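(* Let $A = (a_1\ a_2\ \cdots\ a_n) \in \mathbb{Z}^{d \times n}$ be such that $\operatorname{rank}(A) = d$ and $\mathbb{Z}A = \mathbb{Z}^d$. Let $P_A \subset \mathbb{R}^d$ be the polytope obtained as the convex hull of the lattice points $\{\pm a_1, \ldots, \pm a_n\} \subset \mathbb{Z}^d$. For any $b \in \mathbb{C}^n$, the variety $\mathcal{L}_{A,b} \subseteq \mathbb{C}^n$ is irreducible of dimension $d$. Moreover, for generic $b \in \mathbb{C}^n$ (meaning: for every $b\in\mathbb{C}^n$ such that for each circuit $C$ of $A$ the number $\sum_{j \in C} m^C_j b_j$ is not an even integer), the degree of $\mathcal{L}_{A,b}$ is $$\deg(\mathcal{L}_{A,b}) = 2^{-\mathrm{CL}_A}\, d!\, \operatorname{vol}(P_A),$$ where $\operatorname{vol}(\cdot)$ denotes the Euclidean volume and $\mathrm{CL}_A$ is the number of zero entries of a generic vector in the kernel of $A : \mathbb{R}^n \to \mathbb{R}^d$.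
   Context: For $A \in \mathbb{Q}^{d\times n}$, $\operatorname{Row}(A) \subseteq \mathbb{C}^n$ is the $\mathbb{C}$-linear span of the rows of $A$. For $b \in \mathbb{C}^n$ put $L_{A,b} = \operatorname{Row}(A) - \frac{\pi}{2} b = \{x - \frac{\pi}{2}b : x \in \operatorname{Row}(A)\}$. Let $\cos : \mathbb{C}^n \to \mathbb{C}^n$ be the coordinate-wise cosine. The Lissajous variety is $\mathcal{L}_{A,b} = \cos(L_{A,b}) \subseteq \mathbb{C}^n$ (as a set, without taking closure; part of the assertion is that it is an affine variety). $\mathbb{Z}A \subseteq \mathbb{Z}^d$ is the subgroup generated by the columns $a_1,\dots,a_n$ of $A$. The degree of a $d$-dimensional affine variety in $\mathbb{C}^n$ is the number of its intersection points with a generic affine-linear space of dimension $n-d$. A circuit of $A$ is a subset $C \subseteq \{1,\dots,n\}$ indexing a minimal linearly dependent set of columns of $A$. For each circuit $C$, $m^C \in \mathbb{Z}^n$ is the (unique up to sign) integer vector of minimal length with $A\, m^C = 0$ and support $\{j : m^C_j \neq 0\} = C$. Equivalently, $\mathrm{CL}_A$ is the number of indices $j\in\{1,\dots,n\}$ that belong to no circuit of $A$. *)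

theory Defs
  imports
    "HOL-Analysis.Analysis"
    "HOL-Computational_Algebra.Polynomial"
    "HOL-Computational_Algebra.Group_Closure"
begin

section \<open>Polynomial functions and genericity\<close>

text \<open>
  The polynomial functions in a given set \<open>X\<close> of coordinate functions on a space. Over the infinite
  fields used here they are the same thing as polynomials in these coordinates.
\<close>

inductive_set polyfuns :: "('a \<Rightarrow> 'k::comm_ring_1) set \<Rightarrow> ('a \<Rightarrow> 'k) set"
  for X :: "('a \<Rightarrow> 'k) set" where
  coord: "f \<in> X \<Longrightarrow> f \<in> polyfuns X"
| const: "(\<lambda>_. c) \<in> polyfuns X"
| add: "f \<in> polyfuns X \<Longrightarrow> g \<in> polyfuns X \<Longrightarrow> (\<lambda>x. f x + g x) \<in> polyfuns X"
| mult: "f \<in> polyfuns X \<Longrightarrow> g \<in> polyfuns X \<Longrightarrow> (\<lambda>x. f x * g x) \<in> polyfuns X"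

definition vec_coords :: "('k::comm_ring_1 ^ 'n \<Rightarrow> 'k) set" where
  "vec_coords = range (\<lambda>j x. x $ j)"

text \<open>
  \<open>P\<close> holds on a nonempty Zariski-open subset of \<open>S\<close>. This is the usual meaning of \<^emph>\<open>generic\<close>
  when \<open>S\<close> is irreducible; below, \<open>S\<close> is always a vector space.
\<close>

definition generically ::
    "('a \<Rightarrow> 'k::comm_ring_1) set \<Rightarrow> 'a set \<Rightarrow> ('a \<Rightarrow> bool) \<Rightarrow> bool" where
  "generically X S P \<longleftrightarrow>
     (\<exists>f \<in> polyfuns X. (\<exists>x\<in>S. f x \<noteq> 0) \<and> (\<forall>x\<in>S. f x \<noteq> 0 \<longrightarrow> P x))"

lemma polyfuns_compose_curve:
  assumes "f \<in> polyfuns X" and "\<And>g. g \<in> X \<Longrightarrow> \<exists>p. \<forall>t. g (\<gamma> t) = poly p t"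
  shows "\<exists>p. \<forall>t. f (\<gamma> t) = poly p t"
  using assms(1)
proof induction
  case (coord f)
  then show ?case using assms(2) by blast
next
  case (const c)
  show ?case by (rule exI[of _ "[:c:]"]) simp
next
  case (add f g)
  then obtain p q where "\<forall>t. f (\<gamma> t) = poly p t" "\<forall>t. g (\<gamma> t) = poly q t" by blast
  then show ?case by (intro exI[of _ "p + q"]) simp
next
  case (mult f g)
  then obtain p q where "\<forall>t. f (\<gamma> t) = poly p t" "\<forall>t. g (\<gamma> t) = poly q t" by blast
  then show ?case by (intro exI[of _ "p * q"]) simp
qed

lemma generically_conj:
  fixes X :: "('a \<Rightarrow> 'k::field_char_0) set"
  assumes curve: "\<And>x y. x \<in> S \<Longrightarrow> y \<in> S \<Longrightarrow>
      \<exists>\<gamma>. range \<gamma> \<subseteq> S \<and> \<gamma> 0 = x \<and> \<gamma> 1 = y \<and> (\<forall>g\<in>X. \<exists>p. \<forall>t. g (\<gamma> t) = poly p t)"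
    and "generically X S P" "generically X S Q"
  shows "generically X S (\<lambda>x. P x \<and> Q x)"
proof -
  obtain f x where f: "f \<in> polyfuns X" "x \<in> S" "f x \<noteq> 0" "\<And>x. x\<in>S \<Longrightarrow> f x \<noteq> 0 \<Longrightarrow> P x"
    using assms(2) unfolding generically_def by blast
  obtain g y where g: "g \<in> polyfuns X" "y \<in> S" "g y \<noteq> 0" "\<And>x. x\<in>S \<Longrightarrow> g x \<noteq> 0 \<Longrightarrow> Q x"
    using assms(3) unfolding generically_def by blast
  obtain \<gamma> where \<gamma>: "range \<gamma> \<subseteq> S" "\<gamma> 0 = x" "\<gamma> 1 = y"
      "\<And>g. g\<in>X \<Longrightarrow> \<exists>p. \<forall>t. g (\<gamma> t) = poly p t"
    using curve[OF f(2) g(2)] by blast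
  obtain p q where p: "\<forall>t. f (\<gamma> t) = poly p t" and q: "\<forall>t. g (\<gamma> t) = poly q t"
    using polyfuns_compose_curve[where \<gamma> = \<gamma>, OF f(1) \<gamma>(4)]
      polyfuns_compose_curve[where \<gamma> = \<gamma>, OF g(1) \<gamma>(4)] by blast
  have "p \<noteq> 0" "q \<noteq> 0"
    using f(3) g(3) \<gamma>(2,3) p q by (metis poly_0)+
  then have "finite {t. poly (p * q) t = 0}"
    by (intro poly_roots_finite) simp
  then obtain t where "poly (p * q) t \<noteq> 0"
    using ex_new_if_finite[OF infinite_UNIV_char_0[where 'a='k]] by blast
  then have "f (\<gamma> t) * g (\<gamma> t) \<noteq> 0"
    using p q by simp
  moreover have "\<gamma> t \<in> S" using \<gamma>(1) by blast
  ultimately show ?thesis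
    unfolding generically_def
    using f(4) g(4) by (intro bexI[OF _ polyfuns.mult[OF f(1) g(1)]]) auto
qed

lemma generically_exists: "generically X S P \<Longrightarrow> \<exists>x\<in>S. P x"
  unfolding generically_def by blast


section \<open>Affine varieties in \<open>\<complex>\<^sup>n\<close>\<close>

definition affine_variety :: "(complex ^ 'n) set \<Rightarrow> bool" where
  "affine_variety V \<longleftrightarrow> (\<exists>F \<subseteq> polyfuns vec_coords. V = {x. \<forall>f\<in>F. f x = 0})"

definition irreducible_variety :: "(complex ^ 'n) set \<Rightarrow> bool" where
  "irreducible_variety V \<longleftrightarrow>
     affine_variety V \<and> V \<noteq> {} \<and>
     (\<forall>Y Z. affine_variety Y \<longrightarrow> affine_variety Z \<longrightarrow> V = Y \<union> Z \<longrightarrow> V = Y \<or> V = Z)"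

text \<open>
  Krull dimension: the supremum of the lengths \<open>k\<close> of chains \<open>Z 0 \<subset> \<dots> \<subset> Z k\<close> of irreducible
  subvarieties. (The empty variety gets the value 0 here.)
\<close>

definition variety_dim :: "(complex ^ 'n) set \<Rightarrow> enat" where
  "variety_dim V =
     (SUP k \<in> {k. \<exists>Z. (\<forall>i\<le>k. irreducible_variety (Z i) \<and> Z i \<subseteq> V) \<and> (\<forall>i<k. Z i \<subset> Z (Suc i))}.
        enat k)"

text \<open>
  An affine-linear space of codimension \<open>r\<close> is the solution set of \<open>r\<close> linear equations
  \<open>\<Sum>j. M i $ j * x $ j = c i\<close> (\<open>i < r\<close>) whose coefficient vectors \<open>M i\<close> are linearly independent. It
  is generic if the coefficients \<open>M i $ j\<close> and \<open>c i\<close> are generic.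
\<close>

definition eqn_space :: "nat \<Rightarrow> (nat \<Rightarrow> complex ^ 'n) \<times> (nat \<Rightarrow> complex) \<Rightarrow> (complex ^ 'n) set" where
  "eqn_space r = (\<lambda>(M, c). {x. \<forall>i<r. (\<Sum>j\<in>UNIV. M i $ j * x $ j) = c i})"

definition eqn_coords ::
    "nat \<Rightarrow> ((nat \<Rightarrow> complex ^ 'n) \<times> (nat \<Rightarrow> complex) \<Rightarrow> complex) set" where
  "eqn_coords r = {\<lambda>(M, c). M i $ j | i j. i < r} \<union> {\<lambda>(M, c). c i | i. i < r}"

definition eqn_independent :: "nat \<Rightarrow> (nat \<Rightarrow> complex ^ 'n) \<times> (nat \<Rightarrow> complex) \<Rightarrow> bool" where
  "eqn_independent r = (\<lambda>(M, c). inj_on M {..<r} \<and> vec.independent (M ` {..<r}))"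

text \<open>
  \<open>V\<close> has degree \<open>k\<close>: with \<open>r\<close> the dimension of \<open>V\<close>, a generic affine-linear space of codimension \<open>r\<close>
  meets \<open>V\<close> in exactly \<open>k\<close> points.
\<close>

definition has_degree :: "(complex ^ 'n) set \<Rightarrow> nat \<Rightarrow> bool" where
  "has_degree V k \<longleftrightarrow>
     (\<exists>r. variety_dim V = enat r \<and>
          generically (eqn_coords r) UNIV
            (\<lambda>e. eqn_independent r e \<and>
                 finite (V \<inter> eqn_space r e) \<and> card (V \<inter> eqn_space r e) = k))"

lemma has_degree_unique:
  assumes "has_degree V k" "has_degree V l"
  shows "k = l"
proof -
  obtain r where r: "generically (eqn_coords r) UNIV
      (\<lambda>e. eqn_independent r e \<and> finite (V \<inter> eqn_space r e) \<and> card (V \<inter> eqn_space r e) = k)"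
     "generically (eqn_coords r) UNIV
      (\<lambda>e. eqn_independent r e \<and> finite (V \<inter> eqn_space r e) \<and> card (V \<inter> eqn_space r e) = l)"
    using assms unfolding has_degree_def by auto
  have curve: "\<exists>\<gamma>. range \<gamma> \<subseteq> UNIV \<and> \<gamma> 0 = x \<and> \<gamma> 1 = y \<and>
      (\<forall>g\<in>eqn_coords r. \<exists>p. \<forall>t. g (\<gamma> t) = poly p t)"
    for x y :: "(nat \<Rightarrow> complex ^ 'a) \<times> (nat \<Rightarrow> complex)"
  proof -
    define \<gamma> where "\<gamma> = (\<lambda>t. (\<lambda>i. fst x i + t *s (fst y i - fst x i),
                              \<lambda>i. snd x i + t * (snd y i - snd x i)))"
    have "\<exists>p. \<forall>t. g (\<gamma> t) = poly p t" if "g \<in> eqn_coords r" for g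
      using that unfolding eqn_coords_def
    proof (elim UnE CollectE exE conjE)
      fix i j assume "g = (\<lambda>(M, c). M i $ j)"
      then show ?thesis
        by (intro exI[of _ "[:fst x i $ j, fst y i $ j - fst x i $ j:]"]) (simp add: \<gamma>_def algebra_simps)
    next
      fix i assume "g = (\<lambda>(M, c). c i)"
      then show ?thesis
        by (intro exI[of _ "[:snd x i, snd y i - snd x i:]"]) (simp add: \<gamma>_def)
    qed
    moreover have "\<gamma> 0 = x" "\<gamma> 1 = y"
      by (simp_all add: \<gamma>_def)
    ultimately show ?thesis by blast
  qed
  show ?thesis
    using generically_exists[OF generically_conj[OF curve r]] by auto
qed


section \<open>Lissajous varieties\<close>

definition Row :: "rat ^ 'n ^ 'd \<Rightarrow> (complex ^ 'n) set" where
  "Row A = vec.span (rows (map_matrix of_rat A))"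

definition shifted_row_space :: "rat ^ 'n ^ 'd \<Rightarrow> complex ^ 'n \<Rightarrow> (complex ^ 'n) set" where
  "shifted_row_space A b = {x - complex_of_real (pi / 2) *s b | x. x \<in> Row A}"

definition cos_vec :: "complex ^ 'n \<Rightarrow> complex ^ 'n" where
  "cos_vec x = (\<chi> j. cos (x $ j))"

definition lissajous :: "rat ^ 'n ^ 'd \<Rightarrow> complex ^ 'n \<Rightarrow> (complex ^ 'n) set" where
  "lissajous A b = cos_vec ` shifted_row_space A b"


section \<open>Combinatorial data of an integer matrix\<close>

definition P_polytope :: "int ^ 'n ^ 'd \<Rightarrow> (real ^ 'd) set" where
  "P_polytope A =
     convex hull (columns (map_matrix real_of_int A) \<union> uminus ` columns (map_matrix real_of_int A))"

text \<open>
  Linear dependence is that of the family \<open>(a\<^sub>j)\<close> for \<open>j \<in> C\<close>, not of the set of its values: two indices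
  with equal columns are dependent.
\<close>

definition cols_dependent :: "int ^ 'n ^ 'd \<Rightarrow> 'n set \<Rightarrow> bool" where
  "cols_dependent A C \<longleftrightarrow>
     (\<exists>u :: 'n \<Rightarrow> real. (\<exists>j\<in>C. u j \<noteq> 0) \<and>
        (\<Sum>j\<in>C. u j *\<^sub>R column j (map_matrix real_of_int A)) = 0)"

definition is_circuit :: "int ^ 'n ^ 'd \<Rightarrow> 'n set \<Rightarrow> bool" where
  "is_circuit A C \<longleftrightarrow> cols_dependent A C \<and> (\<forall>C'. C' \<subset> C \<longrightarrow> \<not> cols_dependent A C')"

definition int_relation :: "int ^ 'n ^ 'd \<Rightarrow> 'n set \<Rightarrow> int ^ 'n \<Rightarrow> bool" where
  "int_relation A C m \<longleftrightarrow> A *v m = 0 \<and> {j. m $ j \<noteq> 0} = C"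

text \<open>For a circuit \<open>C\<close> this describes both \<open>m\<^sup>C\<close> and \<open>- m\<^sup>C\<close>.\<close>

definition circuit_vector :: "int ^ 'n ^ 'd \<Rightarrow> 'n set \<Rightarrow> int ^ 'n \<Rightarrow> bool" where
  "circuit_vector A C m \<longleftrightarrow>
     int_relation A C m \<and>
     (\<forall>m'. int_relation A C m' \<longrightarrow>
        norm (\<chi> j. real_of_int (m $ j)) \<le> norm (\<chi> j. real_of_int (m' $ j)))"

definition generic_shift :: "int ^ 'n ^ 'd \<Rightarrow> complex ^ 'n \<Rightarrow> bool" where
  "generic_shift A b \<longleftrightarrow>
     (\<forall>C m. is_circuit A C \<longrightarrow> circuit_vector A C m \<longrightarrow>
        \<not> (\<exists>k::int. even k \<and> (\<Sum>j\<in>C. of_int (m $ j) * b $ j) = of_int k))"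

definition real_kernel :: "int ^ 'n ^ 'd \<Rightarrow> (real ^ 'n) set" where
  "real_kernel A = {v. map_matrix real_of_int A *v v = 0}"

definition CL :: "int ^ 'n ^ 'd \<Rightarrow> nat" where
  "CL A = (THE k. generically vec_coords (real_kernel A) (\<lambda>v. card {j. v $ j = 0} = k))"

lemma generically_kernel_conj:
  assumes "generically vec_coords (real_kernel A) P" "generically vec_coords (real_kernel A) Q"
  shows "generically vec_coords (real_kernel A) (\<lambda>v. P v \<and> Q v)"
proof (rule generically_conj[OF _ assms])
  fix x y assume xy: "x \<in> real_kernel A" "y \<in> real_kernel A"
  define \<gamma> where "\<gamma> = (\<lambda>t. x + t *s (y - x))"
  have "range \<gamma> \<subseteq> real_kernel A"
    using xy unfolding \<gamma>_def real_kernel_def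
    by (auto simp only: mem_Collect_eq matrix_vector_mult_diff_distrib
        matrix_vector_right_distrib vector_scalar_commute vector_smult_rzero diff_self add_0_left)
  moreover have "\<gamma> 0 = x" "\<gamma> 1 = y" by (simp_all add: \<gamma>_def)
  moreover have "\<exists>p. \<forall>t. g (\<gamma> t) = poly p t" if g: "g \<in> vec_coords" for g
  proof -
    obtain j where "g = (\<lambda>x. x $ j)" using g unfolding vec_coords_def by (rule rangeE)
    then show ?thesis
      by (intro exI[of _ "[:x $ j, y $ j - x $ j:]"]) (simp add: \<gamma>_def algebra_simps)
  qed
  ultimately show "\<exists>\<gamma>. range \<gamma> \<subseteq> real_kernel A \<and> \<gamma> 0 = x \<and> \<gamma> 1 = y \<and>
      (\<forall>g\<in>vec_coords. \<exists>p. \<forall>t. g (\<gamma> t) = poly p t)"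
    by blast
qed

lemma generically_CL:
  "generically vec_coords (real_kernel A) (\<lambda>v. card {j. v $ j = 0} = CL A)"
proof -
  let ?K = "real_kernel A"
  define N where "N = {j. \<exists>v\<in>?K. v $ j \<noteq> 0}"
  have triv: "generically vec_coords ?K (\<lambda>v. \<forall>j\<in>{}. v $ j \<noteq> 0)"
    unfolding generically_def
    by (intro bexI[OF _ polyfuns.const[of 1]]) (auto simp: real_kernel_def intro!: exI[of _ 0])
  have "finite F \<Longrightarrow> F \<subseteq> N \<Longrightarrow> generically vec_coords ?K (\<lambda>v. \<forall>j\<in>F. v $ j \<noteq> 0)" for F
  proof (induction F rule: finite_induct)
    case empty
    show ?case by (rule triv)
  next
    case (insert i F)
    have "generically vec_coords ?K (\<lambda>v. v $ i \<noteq> 0)"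
      unfolding generically_def using insert.prems
      by (intro bexI[OF _ polyfuns.coord[of "\<lambda>v. v $ i"]]) (auto simp: N_def vec_coords_def)
    then show ?case
      using generically_kernel_conj[of A "\<lambda>v. v $ i \<noteq> 0" "\<lambda>v. \<forall>j\<in>F. v $ j \<noteq> 0"] insert by simp
  qed
  then have "generically vec_coords ?K (\<lambda>v. \<forall>j\<in>N. v $ j \<noteq> 0)" by simp
  then have ex: "generically vec_coords ?K (\<lambda>v. card {j. v $ j = 0} = card (- N))"
    unfolding generically_def
  proof (elim bexE conjE, intro bexI conjI ballI impI)
    fix f x v assume f: "\<forall>x\<in>?K. f x \<noteq> 0 \<longrightarrow> (\<forall>j\<in>N. x $ j \<noteq> 0)" and v: "v \<in> ?K" "f v \<noteq> 0"
    then have "{j. v $ j = 0} = - N" by (auto simp: N_def)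
    then show "card {j. v $ j = 0} = card (- N)" by simp
  qed auto
  show ?thesis
    unfolding CL_def
  proof (rule theI[of _ "card (- N)"])
    show "generically vec_coords ?K (\<lambda>v. card {j. v $ j = 0} = card (- N))" by (rule ex)
  next
    fix k assume "generically vec_coords ?K (\<lambda>v. card {j. v $ j = 0} = k)"
    from generically_exists[OF generically_kernel_conj[OF this ex]] show "k = card (- N)" by auto
  qed
qed

end

theory Submission
  imports Defs
    "HOL-Library.Function_Algebras"
    "HOL-Computational_Algebra.Fundamental_Theorem_Algebra"
begin

text \<open>
  With \<open>t\<^sub>k = exp (\<i> \<theta>\<^sub>k)\<close> and \<open>\<beta>\<^sub>j = exp (\<i> \<pi> b\<^sub>j / 2)\<close>, the Lissajous variety is the image of the torus under
  \<open>x\<^sub>j = (w\<^sub>j + w\<^sub>j\<^sup>-\<^sup>1) / 2\<close>, \<open>w\<^sub>j = t ^ a\<^sub>j / \<beta>\<^sub>j\<close>. The image is closed because the norm of a Laurent polynomial in \<open>w\<close>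
  over all sign flips \<open>w\<^sub>j \<mapsto> w\<^sub>j\<^sup>-\<^sup>1\<close> is a polynomial in \<open>x\<close>.

  Filter the Laurent polynomials in \<open>t\<close> by the dilates of \<open>P\<^sub>A\<close>, so that level \<open>r\<close> has dimension about
  \<open>vol(P\<^sub>A) r ^ d\<close> and every \<open>x\<^sub>j\<close> has level 1. Then \<open>d\<close> generic linear forms in the \<open>x\<^sub>j\<close> are a Noether normalisation
  compatible with the filtration and have an unramified generic fibre. The functions that are
  idempotents at the points of that fibre form a basis over the polynomials in the forms, generically,
  and comparing the growth \<open>r ^ d / d!\<close> of the latter with \<open>vol(P\<^sub>A) r ^ d\<close> shows that the fibre has
  \<open>d! vol(P\<^sub>A)\<close> points.

  Finally \<open>2 ^ CL\<close> points of the torus lie over a generic point of the variety: the signs of the \<open>w\<^sub>j\<close> can be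
  flipped independently at the indices \<open>j\<close> in no circuit, and nowhere else, as a circuit whose monomial
  relation survived a flip would violate the genericity of \<open>b\<close>.
\<close>

section \<open>Linear systems, characters and Nakayama's lemma\<close>

text \<open>Every algebraic existence statement is obtained by counting: a homogeneous linear system
  with fewer equations than unknowns has a nontrivial solution, and lattice points in the dilates of
  the polytope supply the dimensions. Hence the constant attention to the level in the filtration.
  The obstacle is genericity, which must be given by one polynomial in the coefficients of the
  equations. A statement about all levels, or about all points of a fibre, is not visibly of this
  kind. Each is traded for a certificate of bounded degree: finitely many explicit Laurent
  polynomials span all monomials of one level, and spanning a fixed finite-dimensional space
  survives perturbation. The certificate at one parameter comes from counting again: every nonzero
  Laurent polynomial \<open>H\<close> divides a nonzero polynomial \<open>p\<close> in the forms, so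
  \<open>H\<close> has no zero on a fibre over a point where \<open>p\<close> does not vanish. With
  the Jacobian determinant as a factor of \<open>H\<close> that fibre is unramified.\<close>

lemma underdetermined_system:
  fixes a :: "'i \<Rightarrow> 's \<Rightarrow> 'k::field"
  assumes "finite S" "finite I" "card S < card I"
  shows "\<exists>q. (\<exists>i\<in>I. q i \<noteq> 0) \<and> (\<forall>s\<in>S. (\<Sum>i\<in>I. q i * a i s) = 0)"
  using assms
proof (induction S arbitrary: I a rule: finite_induct)
  case empty
  then have "I \<noteq> {}" by auto
  then show ?case by (intro exI[of _ "\<lambda>_. 1"]) auto
next
  case (insert s S)
  show ?case
  proof (cases "\<forall>i\<in>I. a i s = 0")
    case True
    obtain q where "\<exists>i\<in>I. q i \<noteq> 0" "\<forall>s\<in>S. (\<Sum>i\<in>I. q i * a i s) = 0"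
      using insert.IH[of I a] insert.prems insert.hyps by auto
    then show ?thesis using True by (intro exI[of _ q]) auto
  next
    case False
    then obtain i0 where i0: "i0 \<in> I" "a i0 s \<noteq> 0" by blast
    define a' where "a' i t = a i t - a i s / a i0 s * a i0 t" for i t
    have "card S < card (I - {i0})"
      using insert.prems insert.hyps i0 by (simp add: card_Diff_singleton)
    then obtain q where q: "\<exists>i\<in>I - {i0}. q i \<noteq> 0" "\<forall>t\<in>S. (\<Sum>i\<in>I - {i0}. q i * a' i t) = 0"
      using insert.IH[of "I - {i0}" a'] insert.prems by auto
    define q' where "q' i = (if i = i0 then - (\<Sum>i\<in>I - {i0}. q i * a i s) / a i0 s else q i)" for i
    have split: "(\<Sum>i\<in>I. q' i * a i t) =
        (\<Sum>i\<in>I - {i0}. q i * a i t) - (\<Sum>i\<in>I - {i0}. q i * a i s) / a i0 s * a i0 t" for t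
      using insert.prems(1) i0 by (simp add: sum.remove[of I i0] q'_def)
    have eq: "(\<Sum>i\<in>I - {i0}. q i * a i t) - (\<Sum>i\<in>I - {i0}. q i * a i s) / a i0 s * a i0 t
        = (\<Sum>i\<in>I - {i0}. q i * a' i t)" for t
      by (simp add: a'_def algebra_simps sum_subtractf sum_distrib_left sum_distrib_right
          sum_divide_distrib)
    have "(\<Sum>i\<in>I. q' i * a i t) = 0" if "t \<in> insert s S" for t
    proof (cases "t = s")
      case True
      then show ?thesis using i0 by (simp add: split)
    next
      case False
      then have "t \<in> S" using that by simp
      then show ?thesis unfolding split eq using q(2) by blast
    qed
    moreover have "\<exists>i\<in>I. q' i \<noteq> 0" using q(1) by (auto simp: q'_def)
    ultimately show ?thesis by blast
  qed
qed

lemma linear_relation_exists: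
  fixes g :: "'i \<Rightarrow> 'x \<Rightarrow> 'k::field"
  assumes "finite S" "finite I" "card S < card I"
    and g: "\<And>i. i \<in> I \<Longrightarrow> \<exists>a. \<forall>x. g i x = (\<Sum>s\<in>S. a s * h s x)"
  shows "\<exists>q. (\<exists>i\<in>I. q i \<noteq> 0) \<and> (\<forall>x. (\<Sum>i\<in>I. q i * g i x) = 0)"
proof -
  obtain a where a: "\<And>i x. i \<in> I \<Longrightarrow> g i x = (\<Sum>s\<in>S. a i s * h s x)"
    using g by metis
  obtain q where q: "\<exists>i\<in>I. q i \<noteq> 0" "\<forall>s\<in>S. (\<Sum>i\<in>I. q i * a i s) = 0"
    using underdetermined_system[OF assms(1-3)] by blast
  have "(\<Sum>i\<in>I. q i * g i x) = 0" for x
  proof -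
    have "(\<Sum>i\<in>I. q i * g i x) = (\<Sum>i\<in>I. \<Sum>s\<in>S. q i * a i s * h s x)"
      by (intro sum.cong refl) (simp add: a sum_distrib_left mult.assoc)
    also have "\<dots> = (\<Sum>s\<in>S. (\<Sum>i\<in>I. q i * a i s) * h s x)"
      by (subst sum.swap) (simp add: sum_distrib_right)
    also have "\<dots> = 0" using q(2) by simp
    finally show ?thesis .
  qed
  with q(1) show ?thesis by blast
qed

text \<open>Dedekind's argument: the relation at \<open>m y x\<close> minus
  \<open>\<psi> k y\<close> times the relation at \<open>x\<close> no longer contains
  \<open>k\<close>. As \<open>m\<close> is any operation along which the \<open>\<psi> i\<close> are
  multiplicative, the lemma serves Laurent monomials on the torus as well as ordinary monomials,
  where the points form only a monoid.\<close>

lemma characters_independent: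
  fixes \<psi> :: "'i \<Rightarrow> 'x \<Rightarrow> 'k::field"
  assumes "finite S"
    and mult: "\<And>i x y. i \<in> S \<Longrightarrow> \<psi> i (m x y) = \<psi> i x * \<psi> i y"
    and nz: "\<And>i. i \<in> S \<Longrightarrow> \<exists>x. \<psi> i x \<noteq> 0"
    and inj: "inj_on \<psi> S"
    and "\<And>x. (\<Sum>i\<in>S. q i * \<psi> i x) = 0"
    and "i \<in> S"
  shows "q i = 0"
  using assms
proof (induction S arbitrary: q i rule: finite_induct)
  case empty
  then show ?case by simp
next
  case (insert k S)
  have sum0: "q k * \<psi> k x + (\<Sum>i\<in>S. q i * \<psi> i x) = 0" for x
    using insert.prems(4)[of x] insert.hyps by simp
  have S0: "q i = 0" if "i \<in> S" for i
  proof -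
    have "\<psi> i \<noteq> \<psi> k" using insert.prems(3) insert.hyps that by (auto simp: inj_on_def)
    then obtain y where y: "\<psi> i y \<noteq> \<psi> k y" by auto
    have "(\<Sum>i\<in>S. (q i * (\<psi> i y - \<psi> k y)) * \<psi> i x) = 0" for x
    proof -
      have "(\<Sum>i\<in>S. q i * (\<psi> i y * \<psi> i x)) = - (q k * (\<psi> k y * \<psi> k x))"
        using sum0[of "m y x"] insert.prems(1) by (simp add: add_eq_0_iff2)
      moreover have "(\<Sum>i\<in>S. q i * (\<psi> k y * \<psi> i x)) = \<psi> k y * - (q k * \<psi> k x)"
        using sum0[of x] by (simp add: add_eq_0_iff2 sum_distrib_left mult.left_commute)
      ultimately have "(\<Sum>i\<in>S. q i * (\<psi> i y * \<psi> i x)) - (\<Sum>i\<in>S. q i * (\<psi> k y * \<psi> i x)) = 0"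
        by (simp add: algebra_simps)
      then show ?thesis by (simp add: sum_subtractf[symmetric] algebra_simps)
    qed
    then have "q i * (\<psi> i y - \<psi> k y) = 0"
      using insert.IH[of "\<lambda>i. q i * (\<psi> i y - \<psi> k y)" i] insert.prems that
      by (auto simp: inj_on_insert)
    with y show ?thesis by simp
  qed
  obtain x where "\<psi> k x \<noteq> 0" using insert.prems(2) by blast
  moreover have "q k * \<psi> k x = 0" using sum0[of x] S0 by simp
  ultimately have "q k = 0" by simp
  then show ?case using S0 insert.prems(5) by auto
qed

text \<open>The determinant trick, carried out by eliminating one generator at a time. Since
  \<open>1 - h\<close> need not be invertible in \<open>R\<close>, the conclusion keeps it as a
  factor; it later becomes a function that is 1 at a point of the fibre, and a common denominator
  that is 1 at \<open>c\<close>.\<close>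

lemma nakayama:
  fixes m :: "'i \<Rightarrow> 'a::comm_ring_1"
  assumes "finite K"
    and R: "1 \<in> R" "\<And>a b. a \<in> R \<Longrightarrow> b \<in> R \<Longrightarrow> a - b \<in> R"
    and J: "J \<subseteq> R" "0 \<in> J" "\<And>a b. a \<in> J \<Longrightarrow> b \<in> J \<Longrightarrow> a - b \<in> J"
      "\<And>r a. r \<in> R \<Longrightarrow> a \<in> J \<Longrightarrow> r * a \<in> J"
    and N: "0 \<in> N" "\<And>a b. a \<in> N \<Longrightarrow> b \<in> N \<Longrightarrow> a - b \<in> N" "\<And>r a. r \<in> R \<Longrightarrow> a \<in> N \<Longrightarrow> r * a \<in> N"
    and m: "\<And>i. i \<in> K \<Longrightarrow> \<exists>h. (\<forall>k\<in>K. h k \<in> J) \<and> m i - (\<Sum>k\<in>K. h k * m k) \<in> N"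
  shows "\<exists>h\<in>J. \<forall>i\<in>K. (1 - h) * m i \<in> N"
  using assms(1) m
proof (induction K rule: finite_induct)
  case empty
  then show ?case using J by auto
next
  case (insert k K)
  have addJ: "a + b \<in> J" if "a \<in> J" "b \<in> J" for a b
    using J(3)[OF that(1) J(3)[OF J(2) that(2)]] by simp
  have addN: "a + b \<in> N" if "a \<in> N" "b \<in> N" for a b
    using N(2)[OF that(1) N(2)[OF N(1) that(2)]] by simp
  have sumN: "(\<Sum>x\<in>X. f x) \<in> N" if "\<And>x. x \<in> X \<Longrightarrow> f x \<in> N" for X and f :: "'i \<Rightarrow> 'a"
    using that by (induction X rule: infinite_finite_induct) (auto intro: addN N(1))
  have "\<forall>i\<in>insert k K. \<exists>h. (\<forall>l\<in>insert k K. h l \<in> J) \<and> m i - (\<Sum>l\<in>insert k K. h l * m l) \<in> N"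
    using insert.prems by blast
  from bchoice[OF this] obtain h where h: "\<forall>i\<in>insert k K. (\<forall>l\<in>insert k K. h i l \<in> J) \<and>
      m i - (\<Sum>l\<in>insert k K. h i l * m l) \<in> N" by (rule exE)
  have hJ: "h i l \<in> J" if "i \<in> insert k K" "l \<in> insert k K" for i l
    using bspec[OF conjunct1[OF bspec[OF h that(1)]] that(2)] .
  have hN: "m i - (\<Sum>l\<in>insert k K. h i l * m l) \<in> N" if "i \<in> insert k K" for i
    using bspec[OF h that] by (rule conjunct2)
  define u where "u = 1 - h k k"
  have uR: "u \<in> R" using R(2)[OF R(1)] J(1) hJ unfolding u_def by blast
  have hN': "m i - h i k * m k - (\<Sum>l\<in>K. h i l * m l) \<in> N" if "i \<in> insert k K" for i
    using hN[OF that] insert.hyps by (simp add: algebra_simps)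
  have step: "\<exists>g. (\<forall>l\<in>K. g l \<in> J) \<and> m i - (\<Sum>l\<in>K. g l * m l) \<in> N" if i: "i \<in> K" for i
  proof -
    \<comment> \<open>Coefficients after substituting for \<open>m k\<close>: the relation of
      \<open>i\<close> is multiplied by \<open>u\<close> and the relation of \<open>k\<close> by
      \<open>h i k\<close>. The extra \<open>h k k\<close> at \<open>l = i\<close> restores
      \<open>m i\<close> from \<open>u * m i\<close>.\<close>
    define g where "g l = u * h i l + h i k * h k l + (if l = i then h k k else 0)" for l
    have "g l \<in> J" if "l \<in> K" for l
      unfolding g_def using that i hJ J(1,2,4) uR by (intro addJ) (auto intro!: J(4))
    moreover
    have "m i - (\<Sum>l\<in>K. g l * m l) = u * (m i - h i k * m k - (\<Sum>l\<in>K. h i l * m l))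
        + h i k * (m k - h k k * m k - (\<Sum>l\<in>K. h k l * m l))"
    proof -
      have "(\<Sum>l\<in>K. g l * m l) = u * (\<Sum>l\<in>K. h i l * m l) + h i k * (\<Sum>l\<in>K. h k l * m l)
          + h k k * m i"
        using i insert.hyps(1) unfolding g_def
        by (simp add: distrib_right sum.distrib sum_distrib_left mult.assoc if_distrib[of "\<lambda>x. x * _"]
            cong: if_cong)
      then show ?thesis by (simp add: u_def algebra_simps)
    qed
    moreover have "\<dots> \<in> N"
      using i hN' hJ J(1) uR by (intro addN N(3)) auto
    ultimately show ?thesis by (intro exI[of _ g]) auto
  qed
  obtain h' where h': "h' \<in> J" "\<forall>i\<in>K. (1 - h') * m i \<in> N"
    using insert.IH[OF step] by blast
  have h'R: "1 - h' \<in> R" using R h'(1) J(1) by blast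
  have g1: "1 - (h' + (1 - h') * h k k) = (1 - h') * u" by (simp add: u_def algebra_simps)
  have "(1 - h') * u * m i \<in> N" if "i \<in> insert k K" for i
  proof (cases "i = k")
    case True
    have "(1 - h') * u * m k = (1 - h') * (m k - h k k * m k - (\<Sum>l\<in>K. h k l * m l))
        + (\<Sum>l\<in>K. h k l * ((1 - h') * m l))"
      by (simp add: u_def algebra_simps sum_distrib_left sum_subtractf)
    also have "\<dots> \<in> N"
    proof (rule addN[OF N(3)[OF h'R hN'] sumN])
      fix l assume l: "l \<in> K"
      show "h k l * ((1 - h') * m l) \<in> N"
        using h'(2) l by (auto intro!: N(3)[OF subsetD[OF J(1) hJ]])
    qed simp
    finally show ?thesis using True by simp
  next
    case False
    then have "u * ((1 - h') * m i) \<in> N" using that h'(2) by (auto intro!: N(3)[OF uR])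
    then show ?thesis by (simp add: ac_simps)
  qed
  moreover have "h' + (1 - h') * h k k \<in> J"
    using h' h'R hJ by (intro addJ J(4)) auto
  ultimately show ?case using g1 by metis
qed

text \<open>Both powers have the same leading term, so their difference is of smaller order than
  \<open>N ^ d\<close>. With \<open>\<kappa>\<close> and \<open>\<kappa>'\<close> coming from the
  errors of lattice point counts, this bounds the points between two levels at bounded
  distance.\<close>

lemma power_shell_small:
  fixes v \<kappa> \<kappa>' \<epsilon> :: real
  assumes "\<epsilon> > 0"
  shows "\<exists>N0. \<forall>N\<ge>N0. v * ((real N + \<kappa>) ^ d - (real N - \<kappa>') ^ d) < \<epsilon> * real N ^ d"
proof -
  have "(\<lambda>N. v * ((1 + \<kappa> / real N) ^ d - (1 - \<kappa>' / real N) ^ d)) \<longlonglongrightarrow> v * ((1 + 0) ^ d - (1 - 0) ^ d)"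
    by (intro tendsto_intros lim_const_over_n)
  then have "\<forall>\<^sub>F N in sequentially. v * ((1 + \<kappa> / real N) ^ d - (1 - \<kappa>' / real N) ^ d) < \<epsilon>"
    using assms by (simp add: order_tendsto_iff)
  then have "\<forall>\<^sub>F N in sequentially. v * ((real N + \<kappa>) ^ d - (real N - \<kappa>') ^ d) < \<epsilon> * real N ^ d"
    using eventually_gt_at_top[of 0]
  proof eventually_elim
    case (elim N)
    have "real N + \<kappa> = real N * (1 + \<kappa> / real N)" "real N - \<kappa>' = real N * (1 - \<kappa>' / real N)"
      using elim(2) by (simp_all add: field_simps)
    then have "v * ((real N + \<kappa>) ^ d - (real N - \<kappa>') ^ d) =
       real N ^ d * (v * ((1 + \<kappa> / real N) ^ d - (1 - \<kappa>' / real N) ^ d))"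
      by (simp only: power_mult_distrib) (simp add: algebra_simps)
    also have "\<dots> < real N ^ d * \<epsilon>" using elim by simp
    finally show ?case by (simp add: mult.commute)
  qed
  then show ?thesis by (simp add: eventually_sequentially)
qed

section \<open>The torus and Laurent polynomials\<close>

text \<open>A type of its own makes Laurent polynomials total functions: the ring operations are
  pointwise, and equality of functions is equality of coefficients by
  \<open>ch_independent\<close>.\<close>

typedef ('d::finite) torus = "{t :: complex ^ 'd. \<forall>k. t $ k \<noteq> 0}"
  by (rule exI[of _ "\<chi> k. 1"]) simp

definition tc :: "'d::finite torus \<Rightarrow> 'd \<Rightarrow> complex" where
  "tc \<tau> k = Rep_torus \<tau> $ k"

text \<open>
  \<open>mkt f\<close> is junk when \<open>f\<close> has a zero.
\<close>

definition mkt :: "('d::finite \<Rightarrow> complex) \<Rightarrow> 'd torus" where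
  "mkt f = Abs_torus (\<chi> k. f k)"

lemma tc_nz [simp]: "tc \<tau> k \<noteq> 0"
  using Rep_torus[of \<tau>] by (simp add: tc_def)

lemma tc_mkt: "(\<And>k. f k \<noteq> 0) \<Longrightarrow> tc (mkt f) k = f k"
  by (simp add: tc_def mkt_def Abs_torus_inverse)

lemma torus_eqI: "(\<And>k. tc \<sigma> k = tc \<tau> k) \<Longrightarrow> \<sigma> = \<tau>"
  by (simp add: tc_def Rep_torus_inject[symmetric] vec_eq_iff)

definition tmul :: "'d::finite torus \<Rightarrow> 'd torus \<Rightarrow> 'd torus" where
  "tmul \<sigma> \<tau> = mkt (\<lambda>k. tc \<sigma> k * tc \<tau> k)"

lemma tc_tmul [simp]: "tc (tmul \<sigma> \<tau>) k = tc \<sigma> k * tc \<tau> k"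
  by (simp add: tmul_def tc_mkt)

definition ch :: "int ^ 'd \<Rightarrow> 'd::finite torus \<Rightarrow> complex" where
  "ch u \<tau> = (\<Prod>k\<in>UNIV. tc \<tau> k powi (u $ k))"

lemma ch_0 [simp]: "ch 0 \<tau> = 1"
  by (simp add: ch_def)

lemma ch_nz [simp]: "ch u \<tau> \<noteq> 0"
  by (simp add: ch_def)

lemma ch_add: "ch (u + v) \<tau> = ch u \<tau> * ch v \<tau>"
  by (simp add: ch_def power_int_add prod.distrib)

lemma ch_minus: "ch (- u) \<tau> = inverse (ch u \<tau>)"
  by (simp add: ch_def power_int_minus prod_inversef[symmetric] comp_def)

lemma prod_powi: "(\<Prod>i\<in>X. f i) powi n = (\<Prod>i\<in>X. (f i :: complex) powi n)"
  by (induction X rule: infinite_finite_induct) (auto simp: power_int_mult_distrib)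

lemma ch_scale: "ch (c *s u) \<tau> = ch u \<tau> powi c"
  by (simp add: ch_def prod_powi power_int_mult[symmetric] mult.commute)

lemma ch_sum: "ch (\<Sum>i\<in>X. f i) \<tau> = (\<Prod>i\<in>X. ch (f i) \<tau>)"
  by (induction X rule: infinite_finite_induct) (auto simp: ch_add)

lemma ch_axis [simp]: "ch (axis k c) \<tau> = tc \<tau> k powi c"
proof -
  have "ch (axis k c) \<tau> = (\<Prod>i\<in>UNIV. if i = k then tc \<tau> k powi c else 1)"
    unfolding ch_def by (intro prod.cong) (auto simp: axis_def)
  then show ?thesis by simp
qed

lemma ch_tmul: "ch u (tmul \<sigma> \<tau>) = ch u \<sigma> * ch u \<tau>"
  by (simp add: ch_def power_int_mult_distrib prod.distrib)

lemma ch_inj: "inj ch"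
proof (rule injI)
  fix u v :: "int ^ 'd" assume eq: "ch u = ch v"
  have "u $ k = v $ k" for k
  proof -
    let ?t = "mkt (\<lambda>i. if i = k then 2 else 1)"
    have c: "ch w ?t = 2 powi (w $ k)" for w
    proof -
      have "ch w ?t = (\<Prod>i\<in>UNIV. if i = k then 2 powi (w $ k) else 1)"
        unfolding ch_def by (intro prod.cong) (auto simp: tc_mkt)
      then show ?thesis by simp
    qed
    have "norm ((2::complex) powi (u $ k)) = norm ((2::complex) powi (v $ k))"
      using eq c[of u] c[of v] by simp
    then have "(2::real) powi (u $ k) = 2 powi (v $ k)" by (simp add: norm_power_int)
    then show ?thesis using power_int_strict_increasing[of "u $ k" "v $ k" "2::real"]
        power_int_strict_increasing[of "v $ k" "u $ k" "2::real"] by (cases "u $ k" "v $ k" rule: linorder_cases) auto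
  qed
  then show "u = v" by (simp add: vec_eq_iff)
qed

text \<open>For infinite \<open>S\<close> the sum is 0 by convention, so this is the span of the
  monomials with exponents in \<open>S\<close> only for finite \<open>S\<close>.\<close>

definition LP :: "(int ^ 'd) set \<Rightarrow> ('d::finite torus \<Rightarrow> complex) set" where
  "LP S = {g. \<exists>a. \<forall>\<tau>. g \<tau> = (\<Sum>u\<in>S. a u * ch u \<tau>)}"

abbreviation cst :: "complex \<Rightarrow> 'x \<Rightarrow> complex" where
  "cst c \<equiv> (\<lambda>_. c)"

lemma LP_E: "g \<in> LP S \<Longrightarrow> (\<And>a. g = (\<lambda>\<tau>. \<Sum>u\<in>S. a u * ch u \<tau>) \<Longrightarrow> thesis) \<Longrightarrow> thesis"
  by (auto simp: LP_def fun_eq_iff)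

lemma LP_mono: "S \<subseteq> S' \<Longrightarrow> finite S' \<Longrightarrow> g \<in> LP S \<Longrightarrow> g \<in> LP S'"
proof (elim LP_E)
  fix a assume S: "S \<subseteq> S'" "finite S'" and g: "g = (\<lambda>\<tau>. \<Sum>u\<in>S. a u * ch u \<tau>)"
  have "g \<tau> = (\<Sum>u\<in>S'. (if u \<in> S then a u else 0) * ch u \<tau>)" for \<tau>
    unfolding g using S by (intro sum.mono_neutral_cong_left) auto
  then show "g \<in> LP S'" by (auto simp: LP_def)
qed

lemma LP_zero [simp]: "0 \<in> LP S"
  by (auto simp: LP_def intro!: exI[of _ "\<lambda>_. 0"])

lemma LP_add: "g \<in> LP S \<Longrightarrow> h \<in> LP S \<Longrightarrow> g + h \<in> LP S"
  by (elim LP_E) (auto simp: LP_def sum.distrib distrib_right intro!: exI[of _ "\<lambda>u. _ u + _ u"])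

lemma LP_cmult: "g \<in> LP S \<Longrightarrow> cst c * g \<in> LP S"
  by (elim LP_E) (auto simp: LP_def sum_distrib_left mult.assoc intro!: exI[of _ "\<lambda>u. c * _ u"])

lemma LP_minus: "g \<in> LP S \<Longrightarrow> - g \<in> LP S"
  using LP_cmult[of g S "-1"] by (simp add: times_fun_def fun_Compl_def)

lemma LP_diff: "g \<in> LP S \<Longrightarrow> h \<in> LP S \<Longrightarrow> g - h \<in> LP S"
  using LP_add[OF _ LP_minus, of g S h] by simp

lemma LP_sum: "(\<And>i. i \<in> X \<Longrightarrow> f i \<in> LP S) \<Longrightarrow> (\<Sum>i\<in>X. f i) \<in> LP S"
  by (induction X rule: infinite_finite_induct) (auto intro: LP_add)

lemma LP_ch: "u \<in> S \<Longrightarrow> finite S \<Longrightarrow> ch u \<in> LP S"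
  by (auto simp: LP_def if_distrib[of "\<lambda>x. x * _"] intro!: exI[of _ "\<lambda>v. if v = u then 1 else 0"]
      cong: if_cong)

lemma sum_fun_apply: "(\<Sum>i\<in>X. f i) x = (\<Sum>i\<in>X. f i x)" for f :: "'i \<Rightarrow> 'x \<Rightarrow> 'b::comm_monoid_add"
  by (induction X rule: infinite_finite_induct) auto

lemma prod_fun_apply: "(\<Prod>i\<in>X. f i) x = (\<Prod>i\<in>X. f i x)" for f :: "'i \<Rightarrow> 'x \<Rightarrow> 'b::comm_monoid_mult"
  by (induction X rule: infinite_finite_induct) auto

lemma LP_subset:
  assumes "g \<in> LP S" and zero: "0 \<in> X" and add: "\<And>a b. a \<in> X \<Longrightarrow> b \<in> X \<Longrightarrow> a + b \<in> X"
    and ch: "\<And>c u. u \<in> S \<Longrightarrow> cst c * ch u \<in> X"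
  shows "g \<in> X"
proof -
  obtain a where g: "g = (\<lambda>\<tau>. \<Sum>u\<in>S. a u * ch u \<tau>)" using assms(1) by (rule LP_E)
  have "g = (\<Sum>u\<in>S. cst (a u) * ch u)" unfolding g by (simp add: fun_eq_iff sum_fun_apply)
  also have "\<dots> \<in> X" using ch zero add
    by (induction S rule: infinite_finite_induct) auto
  finally show ?thesis .
qed

lemma LP_mult:
  assumes "g \<in> LP S" "h \<in> LP S'" "finite S''" "\<And>u v. u \<in> S \<Longrightarrow> v \<in> S' \<Longrightarrow> u + v \<in> S''"
  shows "g * h \<in> LP S''"
  using assms(1)
proof (rule LP_subset[where X = "{g. g * h \<in> LP S''}", THEN CollectD], goal_cases)
  case (3 c u)
  have "cst c * ch u * h \<in> LP S''"
    using assms(2)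
  proof (rule LP_subset[where X = "{h. cst c * ch u * h \<in> LP S''}", THEN CollectD], goal_cases)
    case (3 e v)
    have "cst c * ch u * (cst e * ch v) = cst (c * e) * ch (u + v)"
      by (simp add: fun_eq_iff ch_add)
    then show ?case using 3 \<open>u \<in> S\<close> assms(3,4) by (auto intro!: LP_cmult LP_ch)
  qed (auto simp: distrib_left intro: LP_add)
  then show ?case by simp
qed (auto simp: distrib_right intro: LP_add)

lemma ch_independent:
  assumes "finite S" "\<And>\<tau>. (\<Sum>u\<in>S. a u * ch u \<tau>) = 0" "u \<in> S"
  shows "a u = 0"
  using assms by (intro characters_independent[where \<psi> = ch and m = tmul and S = S and q = a and i = u])
    (auto simp: ch_tmul intro!: inj_on_subset[OF ch_inj])

definition Laur :: "('d::finite torus \<Rightarrow> complex) set" where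
  "Laur = {g. \<exists>S. finite S \<and> g \<in> LP S}"

lemma Laur_LP: "finite S \<Longrightarrow> g \<in> LP S \<Longrightarrow> g \<in> Laur"
  by (auto simp: Laur_def)

lemma Laur_add: assumes "g \<in> Laur" "h \<in> Laur" shows "g + h \<in> Laur"
proof -
  obtain S S' where "finite S" "g \<in> LP S" "finite S'" "h \<in> LP S'" using assms by (auto simp: Laur_def)
  then show ?thesis
    by (intro Laur_LP[of "S \<union> S'"] LP_add) (auto intro: LP_mono[of S "S \<union> S'"] LP_mono[of S' "S \<union> S'"])
qed

lemma Laur_mult: assumes "g \<in> Laur" "h \<in> Laur" shows "g * h \<in> Laur"
proof -
  obtain S S' where *: "finite S" "g \<in> LP S" "finite S'" "h \<in> LP S'" using assms by (auto simp: Laur_def)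
  show ?thesis
    by (rule Laur_LP[of "(\<lambda>(u, v). u + v) ` (S \<times> S')"]) (use * in \<open>auto intro!: LP_mult[of g S h S']\<close>)
qed

lemma Laur_ch [simp]: "ch u \<in> Laur"
  by (rule Laur_LP[of "{u}"]) (auto intro: LP_ch)

lemma Laur_cst [simp]: "(cst c :: 'd::finite torus \<Rightarrow> complex) \<in> Laur"
proof -
  have "cst c * ch (0 :: int ^ 'd) \<in> Laur" by (rule Laur_LP[of "{0}"]) (auto intro!: LP_cmult LP_ch)
  moreover have "cst c * ch (0 :: int ^ 'd) = cst c" by (simp add: fun_eq_iff)
  ultimately show ?thesis by (simp only:)
qed

lemma Laur_0 [simp]: "0 \<in> Laur" and Laur_1 [simp]: "1 \<in> Laur"
  using Laur_cst[of 0] Laur_cst[of 1] by (simp_all add: zero_fun_def one_fun_def)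

lemma Laur_minus: "g \<in> Laur \<Longrightarrow> - g \<in> Laur"
  by (auto simp: Laur_def intro: LP_minus)

lemma Laur_diff: "g \<in> Laur \<Longrightarrow> h \<in> Laur \<Longrightarrow> g - h \<in> Laur"
  using Laur_add[OF _ Laur_minus, of g h] by simp

lemma Laur_sum: "(\<And>i. i \<in> X \<Longrightarrow> f i \<in> Laur) \<Longrightarrow> (\<Sum>i\<in>X. f i) \<in> Laur"
  by (induction X rule: infinite_finite_induct) (auto intro: Laur_add)

lemma Laur_prod: "(\<And>i. i \<in> X \<Longrightarrow> f i \<in> Laur) \<Longrightarrow> (\<Prod>i\<in>X. f i) \<in> Laur"
  by (induction X rule: infinite_finite_induct) (auto intro: Laur_mult)

lemma Laur_induct [consumes 1, case_names add ch]:
  assumes "g \<in> Laur" and add: "\<And>a b. P a \<Longrightarrow> P b \<Longrightarrow> P (a + b)" and ch: "\<And>c u. P (cst c * ch u)"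
  shows "P g"
proof -
  obtain S where "finite S" "g \<in> LP S" using assms by (auto simp: Laur_def)
  have "cst 0 * ch (0 :: int ^ 'a) = 0" by (simp add: fun_eq_iff)
  with ch[of 0 0] have "P 0" by (simp only:)
  with \<open>g \<in> LP S\<close> show ?thesis
    by (intro LP_subset[where X = "Collect P", THEN CollectD]) (auto intro: add ch)
qed

text \<open>The whole torus is the case \<open>I = UNIV\<close>. The smaller ones supply the chain
  of subvarieties for the dimension, so irreducibility is set up for all of them at once.\<close>

definition subtorus :: "'d::finite set \<Rightarrow> 'd torus set" where
  "subtorus I = {\<tau>. \<forall>k. k \<notin> I \<longrightarrow> tc \<tau> k = 1}"

text \<open>
  The line through \<open>p\<close> and \<open>q\<close>; it leaves the torus at the roots of \<open>crv_den p q\<close>.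
\<close>

definition crv :: "'d::finite torus \<Rightarrow> 'd torus \<Rightarrow> complex \<Rightarrow> 'd torus" where
  "crv p q s = mkt (\<lambda>k. tc p k + s * (tc q k - tc p k))"

definition crv_den :: "'d::finite torus \<Rightarrow> 'd torus \<Rightarrow> complex poly" where
  "crv_den p q = (\<Prod>k\<in>UNIV. [:tc p k, tc q k - tc p k:])"

text \<open>Restricted to a line, a Laurent polynomial is a rational function with poles only at the
  roots of \<open>crv_den p q\<close>, and a power of that polynomial clears them. Questions of
  vanishing are thereby reduced to polynomials in one variable.\<close>

lemma Laur_crv:
  assumes "g \<in> Laur"
  shows "\<exists>K P. \<forall>s. poly (crv_den p q) s \<noteq> 0 \<longrightarrow> poly P s = g (crv p q s) * poly (crv_den p q) s ^ K"
  using assms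
proof (induction rule: Laur_induct)
  case (add a b)
  then obtain K P L Q where
    "\<forall>s. poly (crv_den p q) s \<noteq> 0 \<longrightarrow> poly P s = a (crv p q s) * poly (crv_den p q) s ^ K"
    "\<forall>s. poly (crv_den p q) s \<noteq> 0 \<longrightarrow> poly Q s = b (crv p q s) * poly (crv_den p q) s ^ L"
    by blast
  then show ?case
    by (intro exI[of _ "K + L"] exI[of _ "P * crv_den p q ^ L + Q * crv_den p q ^ K"])
      (simp add: algebra_simps power_add)
next
  case (ch c u)
  define l where "l k = [:tc p k, tc q k - tc p k:]" for k
  define K where "K = (\<Sum>k\<in>UNIV. nat \<bar>u $ k\<bar>)"
  have K: "0 \<le> u $ k + int K" for k
  proof -
    have "nat \<bar>u $ k\<bar> \<le> K" unfolding K_def by (rule member_le_sum) auto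
    then show ?thesis by linarith
  qed
  show ?case
  proof (intro exI[of _ K] exI[of _ "smult c (\<Prod>k\<in>UNIV. l k ^ nat (u $ k + int K))"] allI impI)
    fix s assume s: "poly (crv_den p q) s \<noteq> 0"
    then have nz: "poly (l k) s \<noteq> 0" for k
      by (auto simp: crv_den_def l_def poly_prod)
    then have tc: "tc (crv p q s) k = poly (l k) s" for k
      by (simp add: crv_def l_def tc_mkt)
    have "poly (l k) s ^ nat (u $ k + int K) = poly (l k) s powi (u $ k) * poly (l k) s ^ K" for k
      using K[of k] nz[of k] by (simp add: power_int_add[symmetric] flip: power_int_of_nat)
    then show "poly (smult c (\<Prod>k\<in>UNIV. l k ^ nat (u $ k + int K))) s =
        (cst c * ch u) (crv p q s) * poly (crv_den p q) s ^ K"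
      by (simp add: poly_prod ch_def tc prod.distrib crv_den_def l_def[symmetric] prod_power_distrib)
  qed
qed

lemma crv_0 [simp]: "crv p q 0 = p" and crv_1 [simp]: "crv p q 1 = q"
  by (auto intro!: torus_eqI simp: crv_def tc_mkt)

lemma crv_den_01 [simp]: "poly (crv_den p q) 0 \<noteq> 0" "poly (crv_den p q) 1 \<noteq> 0"
  by (simp_all add: crv_den_def poly_prod)

lemma crv_subtorus:
  assumes "p \<in> subtorus I" "q \<in> subtorus I" "poly (crv_den p q) s \<noteq> 0" shows "crv p q s \<in> subtorus I"
proof -
  have "tc p k + s * (tc q k - tc p k) \<noteq> 0" for k
    using assms(3) by (auto simp: crv_den_def poly_prod)
  then show ?thesis using assms(1,2) by (simp add: subtorus_def crv_def tc_mkt)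
qed

text \<open>On the line through \<open>p\<close> and \<open>q\<close> both functions are polynomials
  up to denominators, one nonzero at parameter 0 and the other at 1, so all but finitely many
  parameters work.\<close>

lemma Laur_domain:
  assumes "g \<in> Laur" "h \<in> Laur" "p \<in> subtorus I" "q \<in> subtorus I" "g p \<noteq> 0" "h q \<noteq> 0"
  shows "\<exists>\<tau>\<in>subtorus I. g \<tau> * h \<tau> \<noteq> 0"
proof -
  let ?D = "crv_den p q"
  obtain K P where P: "\<And>s. poly ?D s \<noteq> 0 \<Longrightarrow> poly P s = g (crv p q s) * poly ?D s ^ K"
    using Laur_crv[OF assms(1), of p q] by blast
  obtain L Q where Q: "\<And>s. poly ?D s \<noteq> 0 \<Longrightarrow> poly Q s = h (crv p q s) * poly ?D s ^ L"
    using Laur_crv[OF assms(2), of p q] by blast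
  have "P \<noteq> 0" "Q \<noteq> 0" "?D \<noteq> 0"
    using P[of 0] Q[of 1] assms(5,6) crv_den_01 by (metis crv_0 crv_1 mult_eq_0_iff poly_0 power_not_zero)+
  then have "finite {s. poly (P * Q * ?D) s = 0}" by (intro poly_roots_finite) simp
  then obtain s where "poly (P * Q * ?D) s \<noteq> 0"
    using ex_new_if_finite[OF infinite_UNIV_char_0[where 'a=complex]] by blast
  then have "poly ?D s \<noteq> 0" "g (crv p q s) * h (crv p q s) \<noteq> 0" using P[of s] Q[of s] by auto
  then show ?thesis using crv_subtorus[OF assms(3,4)] by blast
qed

lemma subtorus_UNIV [simp]: "subtorus UNIV = UNIV"
  by (simp add: subtorus_def)

lemma Laur_mult_nz: "g \<in> Laur \<Longrightarrow> h \<in> Laur \<Longrightarrow> g \<noteq> 0 \<Longrightarrow> h \<noteq> 0 \<Longrightarrow> g * h \<noteq> 0"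
  using Laur_domain[of g h _ UNIV] by (fastforce simp: fun_eq_iff)

lemma Laur_prod_nz:
  assumes "finite X" "\<And>i. i \<in> X \<Longrightarrow> f i \<in> Laur \<and> f i \<noteq> 0"
  shows "(\<Prod>i\<in>X. f i) \<noteq> 0"
  using assms
proof (induction X rule: finite_induct)
  case (insert i X)
  have "prod f X \<noteq> 0" by (rule insert.IH) (rule insert.prems, blast)
  moreover have "f i \<in> Laur" "f i \<noteq> 0" "prod f X \<in> Laur"
    using insert.prems by (blast intro: Laur_prod)+
  ultimately have "f i * prod f X \<noteq> 0" by (intro Laur_mult_nz)
  then show ?case unfolding prod.insert[OF insert.hyps] .
qed simp

section \<open>Counting lattice points in dilates of the polytope\<close>

definition rv :: "int ^ 'd \<Rightarrow> real ^ 'd" where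
  "rv u = (\<chi> k. real_of_int (u $ k))"

lemma rv_nth [simp]: "rv u $ k = real_of_int (u $ k)"
  by (simp add: rv_def)

lemma rv_simps [simp]: "rv 0 = 0" "rv (u + v) = rv u + rv v" "rv (u - v) = rv u - rv v" "rv (- u) = - rv u"
  by (simp_all add: vec_eq_iff)

lemma rv_sum: "rv (\<Sum>i\<in>X. f i) = (\<Sum>i\<in>X. rv (f i))"
  by (induction X rule: infinite_finite_induct) auto

lemma rv_scale: "rv (c *s u) = real_of_int c *\<^sub>R rv u"
  by (simp add: vec_eq_iff)

text \<open>The image of the ball of radius \<open>r\<close> for the sum norm, which for
  \<open>r > 0\<close> is the dilate of the polytope by \<open>r\<close>. The description by
  coefficients makes sums and multiples of points immediate; for negative \<open>r\<close> the set
  is empty.\<close>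

definition body :: "int ^ 'n ^ 'd \<Rightarrow> real \<Rightarrow> (real ^ 'd) set" where
  "body A r = {x. \<exists>l. (\<Sum>j\<in>UNIV. \<bar>l j\<bar>) \<le> r \<and> x = (\<Sum>j\<in>UNIV. l j *\<^sub>R rv (column j A))}"

lemma bodyI: "(\<Sum>j\<in>UNIV. \<bar>l j\<bar>) \<le> r \<Longrightarrow> (\<Sum>j\<in>UNIV. l j *\<^sub>R rv (column j A)) \<in> body A r"
  by (auto simp: body_def)

lemma bodyE:
  assumes "x \<in> body A r"
  obtains l where "(\<Sum>j\<in>UNIV. \<bar>l j\<bar>) \<le> r" "x = (\<Sum>j\<in>UNIV. l j *\<^sub>R rv (column j A))"
  using assms by (auto simp: body_def)

lemma body_mono: "r \<le> s \<Longrightarrow> x \<in> body A r \<Longrightarrow> x \<in> body A s"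
  by (force simp: body_def)

lemma body_add:
  assumes "x \<in> body A r" "y \<in> body A s" shows "x + y \<in> body A (r + s)"
proof -
  obtain l l' where l: "(\<Sum>j\<in>UNIV. \<bar>l j\<bar>) \<le> r" "x = (\<Sum>j\<in>UNIV. l j *\<^sub>R rv (column j A))"
    and l': "(\<Sum>j\<in>UNIV. \<bar>l' j\<bar>) \<le> s" "y = (\<Sum>j\<in>UNIV. l' j *\<^sub>R rv (column j A))"
    using assms by (auto elim!: bodyE)
  have "(\<Sum>j\<in>UNIV. \<bar>l j + l' j\<bar>) \<le> (\<Sum>j\<in>UNIV. \<bar>l j\<bar> + \<bar>l' j\<bar>)" by (rule sum_mono) linarith
  also have "\<dots> \<le> r + s" using l(1) l'(1) by (simp add: sum.distrib)
  finally have "(\<Sum>j\<in>UNIV. (l j + l' j) *\<^sub>R rv (column j A)) \<in> body A (r + s)" by (rule bodyI)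
  then show ?thesis by (simp add: l l' scaleR_left_distrib sum.distrib)
qed

lemma body_scale:
  assumes "x \<in> body A r" shows "c *\<^sub>R x \<in> body A (\<bar>c\<bar> * r)"
proof -
  obtain l where l: "(\<Sum>j\<in>UNIV. \<bar>l j\<bar>) \<le> r" "x = (\<Sum>j\<in>UNIV. l j *\<^sub>R rv (column j A))"
    using assms by (auto elim!: bodyE)
  have "(\<Sum>j\<in>UNIV. \<bar>c * l j\<bar>) \<le> \<bar>c\<bar> * r"
    using l(1) by (simp add: abs_mult sum_distrib_left[symmetric] mult_left_mono)
  then have "(\<Sum>j\<in>UNIV. (c * l j) *\<^sub>R rv (column j A)) \<in> body A (\<bar>c\<bar> * r)" by (rule bodyI)
  then show ?thesis by (simp add: l scaleR_sum_right)
qed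

lemma body_minus: "x \<in> body A r \<Longrightarrow> - x \<in> body A r"
  using body_scale[of x A r "-1"] by simp

lemma zero_in_body: "0 \<le> r \<Longrightarrow> 0 \<in> body A r"
  using bodyI[of "\<lambda>_. 0" r A] by simp

lemma col_in_body: "rv (column j A) \<in> body A 1"
proof -
  have "(\<Sum>i\<in>UNIV. \<bar>if i = j then 1 else 0 :: real\<bar>) \<le> 1"
    by (simp add: if_distrib[of abs] cong: if_cong)
  from bodyI[OF this, of A] show ?thesis
    by (simp add: if_distrib[of "\<lambda>x. x *\<^sub>R _"] cong: if_cong)
qed

lemma body_nonneg: "x \<in> body A r \<Longrightarrow> 0 \<le> r"
  by (elim bodyE) (meson abs_ge_zero order_trans sum_nonneg)

lemma body_eq_scale: assumes "0 < r" shows "body A r = (\<lambda>x. r *\<^sub>R x) ` body A 1"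
proof (intro equalityI subsetI)
  fix x assume "x \<in> body A r"
  from body_scale[OF this, of "1 / r"] assms show "x \<in> (\<lambda>x. r *\<^sub>R x) ` body A 1"
    by (intro image_eqI[of _ _ "(1 / r) *\<^sub>R x"]) auto
next
  fix x assume "x \<in> (\<lambda>x. r *\<^sub>R x) ` body A 1"
  then show "x \<in> body A r" using body_scale[of _ A 1 r] assms by auto
qed

lemma convex_body: "convex (body A r)"
proof (rule convexI)
  fix x y and u v :: real assume *: "x \<in> body A r" "y \<in> body A r" "0 \<le> u" "0 \<le> v" "u + v = 1"
  have "u *\<^sub>R x + v *\<^sub>R y \<in> body A (\<bar>u\<bar> * r + \<bar>v\<bar> * r)"
    by (intro body_add body_scale *)
  also have "\<bar>u\<bar> * r + \<bar>v\<bar> * r = r" using * by (simp add: distrib_right[symmetric])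
  finally show "u *\<^sub>R x + v *\<^sub>R y \<in> body A r" .
qed

lemma columns_real: "columns (map_matrix real_of_int A) = range (\<lambda>j. rv (column j A))"
  by (auto simp: columns_def column_def map_matrix_def rv_def vec_eq_iff image_def)

lemma P_polytope_eq: "P_polytope A = body A 1"
proof (intro equalityI)
  show "P_polytope A \<subseteq> body A 1"
    unfolding P_polytope_def columns_real
    by (intro hull_minimal convex_body) (auto intro: col_in_body body_minus)
next
  let ?P = "P_polytope A"
  have inP: "rv (column j A) \<in> ?P" "- rv (column j A) \<in> ?P" for j
    unfolding P_polytope_def columns_real by (auto intro!: hull_inc)
  have conv: "convex ?P" by (simp add: P_polytope_def)
  have zero: "0 \<in> ?P"
    using convexD[OF conv inP(1)[of undefined] inP(2)[of undefined], of "1/2" "1/2"] by simp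
  show "body A 1 \<subseteq> ?P"
  proof
    fix x assume "x \<in> body A 1"
    then obtain l where l: "(\<Sum>j\<in>UNIV. \<bar>l j\<bar>) \<le> 1" "x = (\<Sum>j\<in>UNIV. l j *\<^sub>R rv (column j A))"
      by (elim bodyE)
    define s where "s = (\<Sum>j\<in>UNIV. \<bar>l j\<bar>)"
    show "x \<in> ?P"
    proof (cases "s = 0")
      case True
      then have "l j = 0" for j by (simp add: s_def sum_nonneg_eq_0_iff)
      then show ?thesis using zero l by simp
    next
      case False
      then have s: "s > 0" "s \<le> 1" using l(1) by (auto simp: s_def sum_nonneg less_le)
      define y where "y = (\<Sum>j\<in>UNIV. (\<bar>l j\<bar> / s) *\<^sub>R (sgn (l j) *\<^sub>R rv (column j A)))"
      have "y \<in> ?P"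
        unfolding y_def
      proof (rule convex_sum[OF _ conv])
        show "(\<Sum>j\<in>UNIV. \<bar>l j\<bar> / s) = 1" using s by (simp add: sum_divide_distrib[symmetric] s_def)
        show "sgn (l j) *\<^sub>R rv (column j A) \<in> ?P" for j
          using inP[of j] zero by (auto simp: sgn_if)
      qed (use s in auto)
      then have "s *\<^sub>R y + (1 - s) *\<^sub>R 0 \<in> ?P"
        using s by (intro convexD[OF conv _ zero]) auto
      also have "s *\<^sub>R y + (1 - s) *\<^sub>R 0 = x"
      proof -
        have "s * (\<bar>l j\<bar> / s * sgn (l j)) = l j" for j
          using s by (simp add: abs_mult_sgn)
        then show ?thesis by (simp add: y_def l(2) scaleR_sum_right)
      qed
      finally show ?thesis .
    qed
  qed
qed

lemma compact_body: "compact (body A r)"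
proof -
  have *: "compact (body A 1)"
    unfolding P_polytope_eq[symmetric] P_polytope_def columns_real
    by (intro finite_imp_compact_convex_hull) simp
  consider "r > 0" | "r = 0" | "r < 0" by linarith
  then show ?thesis
  proof cases
    case 1
    then show ?thesis using compact_scaling[OF *, of r] body_eq_scale[of r A] by simp
  next
    case 2
    have "x = 0" if x: "x \<in> body A 0" for x
    proof -
      obtain l where l: "(\<Sum>j\<in>UNIV. \<bar>l j\<bar>) \<le> 0" "x = (\<Sum>j\<in>UNIV. l j *\<^sub>R rv (column j A))"
        using x by (elim bodyE)
      then have "(\<Sum>j\<in>UNIV. \<bar>l j\<bar>) = 0" by (intro order_antisym) (simp_all add: sum_nonneg)
      then show ?thesis using l(2) by (simp add: sum_nonneg_eq_0_iff)
    qed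
    then have "body A r \<subseteq> {0}" unfolding 2 by blast
    then have "finite (body A r)" by (rule finite_subset) simp
    then show ?thesis by (rule finite_imp_compact)
  next
    case 3
    then have "x \<notin> body A r" for x using body_nonneg[of x A r] by linarith
    then have "body A r = {}" by blast
    then show ?thesis by simp
  qed
qed

lemma measure_body:
  fixes A :: "int ^ 'n ^ 'd"
  assumes "0 < r" shows "measure lborel (body A r) = r ^ CARD('d) * measure lborel (P_polytope A)"
proof -
  have "measure lebesgue (body A r) = \<bar>r\<bar> ^ DIM(real ^ 'd) * measure lebesgue (body A 1)"
    using measure_lebesgue_affine[of r 0 "body A 1"] body_eq_scale[OF assms, of A] by simp
  then show ?thesis
    using assms borel_compact[OF compact_body, of A] by (simp add: P_polytope_eq)
qed

definition lat :: "int ^ 'n ^ 'd \<Rightarrow> real \<Rightarrow> (int ^ 'd) set" where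
  "lat A r = {u. rv u \<in> body A r}"

lemma lat_mono: "r \<le> s \<Longrightarrow> lat A r \<subseteq> lat A s"
  by (auto simp: lat_def intro: body_mono)

lemma lat_add: "u \<in> lat A r \<Longrightarrow> v \<in> lat A s \<Longrightarrow> u + v \<in> lat A (r + s)"
  by (auto simp: lat_def intro: body_add)

lemma lat_minus: "u \<in> lat A r \<Longrightarrow> - u \<in> lat A r"
  by (auto simp: lat_def intro: body_minus)

lemma zero_in_lat: "0 \<le> r \<Longrightarrow> 0 \<in> lat A r"
  by (auto simp: lat_def intro: zero_in_body)

lemma col_in_lat: "column j A \<in> lat A 1"
  by (auto simp: lat_def intro: col_in_body)

lemma measure_unit_cube:
  "measure lborel (box (rv u) (rv u + 1)) = 1" "measure lborel (cbox (rv u) (rv u + 1)) = 1"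
proof -
  have *: "\<forall>b\<in>Basis. rv u \<bullet> b \<le> (rv u + 1) \<bullet> b"
    by (auto simp: Basis_vec_def inner_axis)
  have "(\<Prod>b\<in>Basis. (rv u + 1 - rv u) \<bullet> b) = (\<Prod>b\<in>(Basis :: (real ^ 'a) set). 1 :: real)"
    by (intro prod.cong) (auto simp: Basis_vec_def inner_axis)
  then show "measure lborel (box (rv u) (rv u + 1)) = 1" "measure lborel (cbox (rv u) (rv u + 1)) = 1"
    using * by (simp_all add: measure_lborel_box_eq measure_lborel_cbox_eq)
qed

locale spanning =
  fixes A :: "int ^ 'n ^ 'd"
  assumes span: "group_closure (columns A) = UNIV"
begin

lemma mult_comb: "A *v m = (\<Sum>j\<in>UNIV. (m $ j) *s column j A)"
  by (simp add: vec_eq_iff matrix_vector_mult_def column_def mult.commute)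

lemma surj: "\<exists>m. A *v m = u"
proof -
  have "u \<in> group_closure (columns A)" using span by simp
  then show ?thesis
  proof induction
    case (base s)
    then consider "s = 0" | j where "s = column j A" by (auto simp: columns_def)
    then show ?case
    proof cases
      case 1
      then show ?thesis by (intro exI[of _ 0]) simp
    next
      case (2 j)
      have "(\<Sum>i\<in>UNIV. A $ k $ i * axis j 1 $ i) = (\<Sum>i\<in>UNIV. if i = j then A $ k $ i else 0)" for k
        by (intro sum.cong) (auto simp: axis_def)
      then show ?thesis
        by (intro exI[of _ "axis j 1"]) (simp add: 2 vec_eq_iff matrix_vector_mult_def column_def)
    qed
  next
    case (diff s t)
    then obtain m m' where "A *v m = s" "A *v m' = t" by blast
    then show ?case by (intro exI[of _ "m - m'"]) (simp add: matrix_vector_mult_diff_distrib)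
  qed
qed

text \<open>A choice of integer preimages under \<open>A\<close>, with no additivity. It turns unit
  vectors into explicit integer combinations of the columns.\<close>

definition sec :: "int ^ 'd \<Rightarrow> int ^ 'n" where
  "sec u = (SOME m. A *v m = u)"

lemma sec [simp]: "A *v sec u = u"
  unfolding sec_def by (rule someI_ex) (rule surj)

text \<open>Each unit vector is an integer combination of columns, hence lies in some dilate. The
  resulting \<open>\<kappa>\<close> bounds the error made when a lattice point is replaced by its
  unit cube.\<close>

lemma cube_in_body: "\<exists>\<kappa>\<ge>0. \<forall>y. (\<forall>k. \<bar>y $ k\<bar> \<le> 1) \<longrightarrow> y \<in> body A \<kappa>"
proof -
  define \<kappa>' where "\<kappa>' k = (\<Sum>j\<in>UNIV. \<bar>real_of_int (sec (axis k 1) $ j)\<bar>)" for k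
  have ax: "axis k 1 \<in> body A (\<kappa>' k)" for k
  proof -
    have "rv (A *v sec (axis k 1)) = axis k 1" by (simp add: vec_eq_iff axis_def)
    moreover have "rv (A *v sec (axis k 1)) = (\<Sum>j\<in>UNIV. real_of_int (sec (axis k 1) $ j) *\<^sub>R rv (column j A))"
      unfolding mult_comb by (simp add: rv_sum rv_scale)
    ultimately show ?thesis using bodyI[of "\<lambda>j. real_of_int (sec (axis k 1) $ j)" "\<kappa>' k" A]
      by (simp add: \<kappa>'_def)
  qed
  have "y \<in> body A (\<Sum>k\<in>UNIV. \<kappa>' k)" if "\<forall>k. \<bar>y $ k\<bar> \<le> 1" for y
  proof -
    have "(\<Sum>k\<in>X. (y $ k) *\<^sub>R axis k 1) \<in> body A (\<Sum>k\<in>X. \<kappa>' k)" if "finite X" for X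
      using that
    proof induction
      case empty
      show ?case by (simp add: zero_in_body)
    next
      case (insert k X)
      have "(y $ k) *\<^sub>R axis k 1 \<in> body A (\<bar>y $ k\<bar> * \<kappa>' k)" by (intro body_scale ax)
      then have "(y $ k) *\<^sub>R axis k 1 \<in> body A (\<kappa>' k)"
        using \<open>\<forall>k. \<bar>y $ k\<bar> \<le> 1\<close> body_nonneg[OF ax[of k]]
        by (intro body_mono[of "\<bar>y $ k\<bar> * \<kappa>' k" "\<kappa>' k"]) (auto intro: mult_left_le_one_le)
      then show ?case using insert body_add by simp
    qed
    from this[of UNIV] show ?thesis by (simp add: basis_expansion scalar_mult_eq_scaleR[symmetric])
  qed
  moreover have "0 \<le> (\<Sum>k\<in>UNIV. \<kappa>' k)" by (simp add: sum_nonneg \<kappa>'_def)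
  ultimately show ?thesis by blast
qed

definition kap :: real where
  "kap = (SOME \<kappa>. 0 \<le> \<kappa> \<and> (\<forall>y. (\<forall>k. \<bar>y $ k\<bar> \<le> 1) \<longrightarrow> y \<in> body A \<kappa>))"

lemma kap: "0 \<le> kap" "(\<And>k. \<bar>y $ k\<bar> \<le> 1) \<Longrightarrow> y \<in> body A kap"
  using someI_ex[OF cube_in_body[unfolded Bex_def]] unfolding kap_def by auto

text \<open>The open unit cubes at lattice points are disjoint and stay inside the body enlarged by
  \<open>kap\<close>. It speaks of finite subsets because the finiteness of \<open>lat A r\<close>
  is drawn from it.\<close>

lemma lat_card_upper_aux:
  assumes "finite F" "F \<subseteq> lat A r" "0 \<le> r"
  shows "real (card F) \<le> measure lborel (body A (r + kap))"
proof -
  have "real (card F) = (\<Sum>u\<in>F. measure lborel (box (rv u) (rv u + 1)))"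
    by (simp add: measure_unit_cube)
  also have "\<dots> = measure lborel (\<Union>u\<in>F. box (rv u) (rv u + 1))"
  proof (rule measure_UNION'[symmetric])
    show "pairwise (\<lambda>u v. disjnt (box (rv u) (rv u + 1)) (box (rv v) (rv v + 1))) F"
    proof (rule pairwiseI)
      fix u v :: "int ^ 'd" assume "u \<noteq> v"
      {
        fix x assume "x \<in> box (rv u) (rv u + 1)" "x \<in> box (rv v) (rv v + 1)"
        then have x: "real_of_int (u $ k) < x $ k" "x $ k < real_of_int (u $ k) + 1"
          "real_of_int (v $ k) < x $ k" "x $ k < real_of_int (v $ k) + 1" for k
          by (auto simp: mem_box_cart)
        have "u $ k = v $ k" for k
        proof -
          have "real_of_int (u $ k) < real_of_int (v $ k + 1)" "real_of_int (v $ k) < real_of_int (u $ k + 1)"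
            using x[of k] by simp_all
          then have "u $ k < v $ k + 1" "v $ k < u $ k + 1" unfolding of_int_less_iff .
          then show ?thesis by linarith
        qed
        then have "u = v" by (simp add: vec_eq_iff)
      }
      with \<open>u \<noteq> v\<close> show "disjnt (box (rv u) (rv u + 1)) (box (rv v) (rv v + 1))"
        by (auto simp: disjnt_def)
    qed
  qed (use assms in \<open>auto intro!: fmeasurableI simp: emeasure_lborel_box_eq\<close>)
  also have "\<dots> \<le> measure lborel (body A (r + kap))"
  proof (rule measure_mono_fmeasurable)
    show "(\<Union>u\<in>F. box (rv u) (rv u + 1)) \<subseteq> body A (r + kap)"
    proof clarify
      fix u x assume "u \<in> F" "x \<in> box (rv u) (rv u + 1)"
      then have "real_of_int (u $ k) < x $ k" "x $ k < real_of_int (u $ k) + 1" for k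
        by (auto simp: mem_box_cart)
      note fl = this
      have "\<bar>(x - rv u) $ k\<bar> \<le> 1" for k using fl[of k] by (simp add: abs_le_iff)
      then have "x - rv u \<in> body A kap" by (rule kap)
      then have "rv u + (x - rv u) \<in> body A (r + kap)"
        using \<open>u \<in> F\<close> assms(2) by (intro body_add) (auto simp: lat_def)
      then show "x \<in> body A (r + kap)" by simp
    qed
  qed (auto intro: fmeasurable_compact compact_body)
  finally show ?thesis .
qed

lemma finite_lat [simp]: "finite (lat A r)"
proof (cases "0 \<le> r")
  case True
  show ?thesis
  proof (rule finite_if_finite_subsets_card_bdd[THEN conjunct1])
    fix G assume "G \<subseteq> lat A r" "finite G"
    then show "card G \<le> nat \<lfloor>measure lborel (body A (r + kap))\<rfloor>"
      using lat_card_upper_aux True by (auto simp: le_nat_floor)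
  qed
next
  case False
  then have "u \<notin> lat A r" for u using body_nonneg[of "rv u" A r] unfolding lat_def by blast
  then have "lat A r = {}" by blast
  then show ?thesis by simp
qed

definition vol :: real where "vol = measure lborel (P_polytope A)"

lemma vol_nonneg [simp]: "0 \<le> vol"
  by (simp add: vol_def)

lemma lat_card_upper:
  assumes "0 < r"
  shows "real (card (lat A r)) \<le> vol * (r + kap) ^ CARD('d)"
  using lat_card_upper_aux[of "lat A r" r] measure_body[of "r + kap" A] assms kap(1)
  by (simp add: vol_def mult.commute)

text \<open>Rounding down moves a point by at most 1 in each coordinate, so the closed unit cubes at
  the points of \<open>lat A r\<close> cover the body shrunk by \<open>kap\<close>.\<close>

lemma lat_card_lower:
  assumes "kap < r"
  shows "vol * (r - kap) ^ CARD('d) \<le> real (card (lat A r))"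
proof -
  have "vol * (r - kap) ^ CARD('d) = measure lborel (body A (r - kap))"
    using measure_body[of "r - kap" A] assms by (simp add: vol_def mult.commute)
  also have "\<dots> \<le> measure lborel (\<Union>u\<in>lat A r. cbox (rv u) (rv u + 1))"
  proof (rule measure_mono_fmeasurable)
    show "body A (r - kap) \<subseteq> (\<Union>u\<in>lat A r. cbox (rv u) (rv u + 1))"
    proof
      fix x assume x: "x \<in> body A (r - kap)"
      define u :: "int ^ 'd" where "u = (\<chi> k. \<lfloor>x $ k\<rfloor>)"
      have fl: "real_of_int (u $ k) \<le> x $ k" "x $ k < real_of_int (u $ k) + 1" for k
        by (simp_all add: u_def)
      have "\<bar>(rv u - x) $ k\<bar> \<le> 1" for k
        using fl[of k] by (simp add: abs_le_iff)
      then have "rv u - x \<in> body A kap" by (rule kap)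
      from body_add[OF x this] have "u \<in> lat A r" by (simp add: lat_def)
      moreover have "x \<in> cbox (rv u) (rv u + 1)"
        by (simp add: mem_box_cart fl(1) less_imp_le[OF fl(2)])
      ultimately show "x \<in> (\<Union>u\<in>lat A r. cbox (rv u) (rv u + 1))" by (rule UN_I)
    qed
    show "body A (r - kap) \<in> sets lborel" using borel_compact[OF compact_body] by simp
    show "(\<Union>u\<in>lat A r. cbox (rv u) (rv u + 1)) \<in> fmeasurable lborel"
      by (rule fmeasurable_compact, rule compact_UN) (rule finite_lat, rule compact_cbox)
  qed
  also have "\<dots> \<le> (\<Sum>u\<in>lat A r. measure lborel (cbox (rv u) (rv u + 1)))"
    by (rule measure_UNION_le[OF finite_lat]) simp
  also have "\<dots> = real (card (lat A r))" by (simp add: measure_unit_cube)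
  finally show ?thesis .
qed

end

section \<open>The filtration and Noether normalisation\<close>

locale liss = spanning A for A :: "int ^ 'n ^ 'd" +
  fixes \<beta> :: "'n \<Rightarrow> complex"
  assumes beta_nz [simp]: "\<beta> j \<noteq> 0"
begin

text \<open>
  With \<open>t\<^sub>k = exp (\<i> \<theta>\<^sub>k)\<close> and \<open>\<beta>\<^sub>j = exp (\<i> \<pi> b\<^sub>j / 2)\<close>, \<open>xf j\<close> is the coordinate \<open>cos (\<theta> \<bullet> a\<^sub>j - \<pi> b\<^sub>j / 2)\<close> of the
  Lissajous variety.
\<close>

definition xf :: "'n \<Rightarrow> 'd torus \<Rightarrow> complex" where
  "xf j \<tau> = (ch (column j A) \<tau> / \<beta> j + \<beta> j * ch (- column j A) \<tau>) / 2"

definition lf :: "complex ^ 'n \<Rightarrow> 'd torus \<Rightarrow> complex" where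
  "lf v \<tau> = (\<Sum>j\<in>UNIV. v $ j * xf j \<tau>)"

abbreviation Bf :: "real \<Rightarrow> ('d torus \<Rightarrow> complex) set" where
  "Bf r \<equiv> LP (lat A r)"

lemma Bf_mono: "r \<le> s \<Longrightarrow> g \<in> Bf r \<Longrightarrow> g \<in> Bf s"
  using LP_mono[OF lat_mono finite_lat] .

lemma Bf_mult: "g \<in> Bf r \<Longrightarrow> h \<in> Bf s \<Longrightarrow> g * h \<in> Bf (r + s)"
  by (rule LP_mult[OF _ _ finite_lat lat_add])

lemma Bf_ch: "u \<in> lat A r \<Longrightarrow> ch u \<in> Bf r"
  by (rule LP_ch[OF _ finite_lat])

lemma Bf_cst: "0 \<le> r \<Longrightarrow> cst c \<in> Bf r"
proof -
  assume "0 \<le> r"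
  then have "cst c * ch (0 :: int ^ 'd) \<in> Bf r" by (intro LP_cmult Bf_ch zero_in_lat)
  moreover have "cst c * ch (0 :: int ^ 'd) = cst c" by (simp add: fun_eq_iff)
  ultimately show ?thesis by (simp only:)
qed

lemma Bf_1: "0 \<le> r \<Longrightarrow> 1 \<in> Bf r"
  using Bf_cst[of r 1] by (simp add: one_fun_def)

lemma Bf_Laur: "g \<in> Bf r \<Longrightarrow> g \<in> Laur"
  by (rule Laur_LP[OF finite_lat])

lemma xf_eq: "xf j = cst (1 / (2 * \<beta> j)) * ch (column j A) + cst (\<beta> j / 2) * ch (- column j A)"
  by (simp add: fun_eq_iff xf_def field_simps)

lemma xf_Bf: "xf j \<in> Bf 1"
  unfolding xf_eq by (intro LP_add LP_cmult Bf_ch lat_minus col_in_lat)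

lemma lf_eq: "lf v = (\<Sum>j\<in>UNIV. cst (v $ j) * xf j)"
  by (simp add: fun_eq_iff lf_def sum_fun_apply)

lemma lf_Bf: "lf v \<in> Bf 1"
  unfolding lf_eq by (intro LP_sum LP_cmult xf_Bf)

lemma lf_axis: "lf (axis j 1) = xf j"
proof -
  have "lf (axis j 1) \<tau> = (\<Sum>i\<in>UNIV. if i = j then xf i \<tau> else 0)" for \<tau>
    unfolding lf_def by (intro sum.cong) (auto simp: axis_def)
  then show ?thesis by (simp add: fun_eq_iff)
qed

lemma lf_diff_scale: "lf (v - c *s w) = lf v - cst c * lf w"
  by (simp add: fun_eq_iff lf_def algebra_simps sum_subtractf sum_distrib_left)

lemma lat_exists: "\<exists>N::nat. u \<in> lat A (real N)"
proof -
  have "rv u = (\<Sum>j\<in>UNIV. real_of_int (sec u $ j) *\<^sub>R rv (column j A))"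
    using sec[of u] unfolding mult_comb by (metis (no_types, lifting) rv_sum rv_scale sum.cong)
  moreover obtain N :: nat where "(\<Sum>j\<in>UNIV. \<bar>real_of_int (sec u $ j)\<bar>) \<le> real N"
    using real_arch_simple by blast
  ultimately have "rv u \<in> body A (real N)" using bodyI by metis
  then show ?thesis by (auto simp: lat_def)
qed

lemma Laur_Bf: assumes "g \<in> Laur" shows "\<exists>N::nat. g \<in> Bf (real N)"
  using assms
proof (induction rule: Laur_induct)
  case (add a b)
  then obtain N N' :: nat where "a \<in> Bf (real N)" "b \<in> Bf (real N')" by blast
  then have "a + b \<in> Bf (real (max N N'))"
    by (intro LP_add) (auto intro: Bf_mono[of "real N" "real (max N N')"] Bf_mono[of "real N'" "real (max N N')"])
  then show ?case ..
next
  case (ch c u)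
  then show ?case using lat_exists[of u] LP_cmult[OF Bf_ch] by blast
qed

text \<open>What one multiplication by the forms of \<open>W\<close> reaches from level
  \<open>r\<close>, together with level \<open>r\<close> itself; the question is whether it exhausts
  level \<open>r + 1\<close>.\<close>

definition U :: "(complex ^ 'n) set \<Rightarrow> real \<Rightarrow> ('d torus \<Rightarrow> complex) set" where
  "U W r = {g. \<exists>b b0. (\<forall>w\<in>W. b w \<in> Bf r) \<and> b0 \<in> Bf r \<and> g = b0 + (\<Sum>w\<in>W. lf w * b w)}"

lemma U_Bf: "g \<in> Bf r \<Longrightarrow> g \<in> U W r"
  unfolding U_def by (rule CollectI, rule exI[of _ "\<lambda>_. 0"], rule exI[of _ g]) simp

lemma U_lf:
  assumes "finite W" "w \<in> W" "b \<in> Bf r" shows "lf w * b \<in> U W r"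
proof -
  have "(\<Sum>v\<in>W. lf v * (if v = w then b else 0)) = (\<Sum>v\<in>W. if v = w then lf w * b else 0)"
    by (intro sum.cong) auto
  also have "\<dots> = lf w * b" using assms by simp
  finally show ?thesis
    unfolding U_def using assms
    by (intro CollectI exI[of _ "\<lambda>v. if v = w then b else 0"] exI[of _ 0]) auto
qed

lemma U_add:
  assumes "g \<in> U W r" "h \<in> U W r" shows "g + h \<in> U W r"
proof -
  obtain b b0 c c0 where *: "\<forall>w\<in>W. b w \<in> Bf r" "b0 \<in> Bf r" "g = b0 + (\<Sum>w\<in>W. lf w * b w)"
    "\<forall>w\<in>W. c w \<in> Bf r" "c0 \<in> Bf r" "h = c0 + (\<Sum>w\<in>W. lf w * c w)"
    using assms unfolding U_def by blast
  then have "g + h = (b0 + c0) + (\<Sum>w\<in>W. lf w * (b w + c w))"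
    by (simp add: distrib_left sum.distrib add_ac)
  then show ?thesis unfolding U_def using *
    by (intro CollectI exI[of _ "\<lambda>w. b w + c w"] exI[of _ "b0 + c0"]) (auto intro: LP_add)
qed

lemma U_mult:
  assumes "g \<in> U W r" "h \<in> Bf s" shows "h * g \<in> U W (s + r)"
proof -
  obtain b b0 where *: "\<forall>w\<in>W. b w \<in> Bf r" "b0 \<in> Bf r" "g = b0 + (\<Sum>w\<in>W. lf w * b w)"
    using assms unfolding U_def by blast
  then have "h * g = h * b0 + (\<Sum>w\<in>W. lf w * (h * b w))"
    by (simp add: distrib_left sum_distrib_left mult.left_commute)
  then show ?thesis unfolding U_def using * assms(2)
    by (intro CollectI exI[of _ "\<lambda>w. h * b w"] exI[of _ "h * b0"]) (auto intro: Bf_mult)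
qed

lemma U_cmult: "g \<in> U W r \<Longrightarrow> cst c * g \<in> U W r"
  using U_mult[of g W r "cst c" 0] by (simp add: Bf_cst)

lemma U_diff: "g \<in> U W r \<Longrightarrow> h \<in> U W r \<Longrightarrow> g - h \<in> U W r"
  using U_add[of g W r "cst (-1) * h"] U_cmult[of h W r "-1"]
  by (simp add: times_fun_def fun_diff_def plus_fun_def)

lemma U_0: "0 \<in> U W r"
  by (simp add: U_Bf)

lemma U_sum: "(\<And>i. i \<in> X \<Longrightarrow> f i \<in> U W r) \<Longrightarrow> (\<Sum>i\<in>X. f i) \<in> U W r"
  by (induction X rule: infinite_finite_induct) (auto intro: U_add U_0)

lemma U_E:
  assumes "g \<in> U W r" "0 \<in> X" "\<And>a b. a \<in> X \<Longrightarrow> b \<in> X \<Longrightarrow> a + b \<in> X"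
    "\<And>b. b \<in> Bf r \<Longrightarrow> b \<in> X" "\<And>w b. w \<in> W \<Longrightarrow> b \<in> Bf r \<Longrightarrow> lf w * b \<in> X"
  shows "g \<in> X"
proof -
  obtain b b0 where *: "\<forall>w\<in>W. b w \<in> Bf r" "b0 \<in> Bf r" "g = b0 + (\<Sum>w\<in>W. lf w * b w)"
    using assms unfolding U_def by blast
  have "(\<Sum>w\<in>W'. lf w * b w) \<in> X" if "W' \<subseteq> W" for W'
    using that by (induction W' rule: infinite_finite_induct) (use assms * in auto)
  then show ?thesis using * assms by auto
qed

lemma U_W_mono: "W \<subseteq> W' \<Longrightarrow> finite W' \<Longrightarrow> g \<in> U W r \<Longrightarrow> g \<in> U W' r"
  by (rule U_E[where W = W and r = r]) (auto intro: U_0 U_add U_Bf U_lf)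

text \<open>
  For \<open>card W = d\<close> the forms of a good set \<open>W\<close> are a Noether normalisation compatible with the
  filtration: multiplication by them eventually generates the next level.
\<close>

definition good :: "(complex ^ 'n) set \<Rightarrow> nat \<Rightarrow> bool" where
  "good W \<nu> \<longleftrightarrow> (\<forall>n\<ge>\<nu>. Bf (real n + 1) \<subseteq> U W (real n))"

lemma good_mono: "good W \<nu> \<Longrightarrow> W \<subseteq> W' \<Longrightarrow> finite W' \<Longrightarrow> good W' \<nu>"
  unfolding good_def by (intro allI impI subsetI) (blast intro: U_W_mono)

text \<open>
  A lattice point deep inside the body has a representation in which one coefficient is at least 2
  in absolute value, so it is reached from a smaller point by multiplication with \<open>xf j\<close>.
\<close>

lemma good_initial: "good (range (\<lambda>j. axis j 1)) (2 * CARD('n))"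
  unfolding good_def
proof (intro allI impI subsetI)
  fix n g assume n: "2 * CARD('n) \<le> n" and g: "g \<in> Bf (real n + 1)"
  let ?W = "range (\<lambda>j. axis j 1) :: (complex ^ 'n) set"
  from g show "g \<in> U ?W (real n)"
  proof (rule LP_subset[OF _ U_0 U_add])
    fix c u assume u: "u \<in> lat A (real n + 1)"
    have "ch u \<in> U ?W (real n)"
    proof (cases "u \<in> lat A (real n)")
      case True
      then show ?thesis by (intro U_Bf Bf_ch)
    next
      case False
      obtain l where l: "(\<Sum>j\<in>UNIV. \<bar>l j\<bar>) \<le> real n + 1" "rv u = (\<Sum>j\<in>UNIV. l j *\<^sub>R rv (column j A))"
        using u by (auto simp: lat_def elim: bodyE)
      have "real n < (\<Sum>j\<in>UNIV. \<bar>l j\<bar>)"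
        using False l(2) bodyI[of l "real n" A] by (force simp: lat_def)
      then have "(\<Sum>j\<in>(UNIV :: 'n set). 2) < (\<Sum>j\<in>UNIV. \<bar>l j\<bar>)" using n by simp
      then obtain j where j: "2 < \<bar>l j\<bar>" by (meson linorder_not_le sum_mono)
      define s :: real where "s = sgn (l j)"
      have s: "\<bar>l j - s\<bar> = \<bar>l j\<bar> - 1" "\<bar>l j - 2 * s\<bar> = \<bar>l j\<bar> - 2" "s = 1 \<or> s = -1"
        using j by (auto simp: s_def sgn_if)
      define si :: int where "si = (if s = 1 then 1 else -1)"
      have si: "real_of_int si = s" using s(3) by (auto simp: si_def)
      \<comment> \<open>Moving the coefficient of column \<open>j\<close> by \<open>e\<close>
        towards 0 lowers the total size by at least 1; this is applied with \<open>e\<close> equal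
        to \<open>si\<close> and to \<open>2 * si\<close>.\<close>
      have shift: "u - e *s column j A \<in> lat A (real n)"
        if e: "\<bar>l j - real_of_int e\<bar> \<le> \<bar>l j\<bar> - 1" for e
      proof -
        have "rv (u - e *s column j A) = (\<Sum>i\<in>UNIV. (l i - (if i = j then real_of_int e else 0)) *\<^sub>R rv (column i A))"
        proof -
          have "(\<Sum>i\<in>UNIV. (if i = j then real_of_int e else 0) *\<^sub>R rv (column i A))
             = (\<Sum>i\<in>UNIV. if i = j then real_of_int e *\<^sub>R rv (column j A) else 0)"
            by (intro sum.cong) auto
          then show ?thesis by (simp add: l(2) scaleR_left_diff_distrib sum_subtractf rv_scale)
        qed
        moreover have "(\<Sum>i\<in>UNIV. \<bar>l i - (if i = j then real_of_int e else 0)\<bar>)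
            \<le> (\<Sum>i\<in>UNIV. \<bar>l i\<bar> - (if i = j then 1 else 0))"
          using e by (intro sum_mono) auto
        then have "(\<Sum>i\<in>UNIV. \<bar>l i - (if i = j then real_of_int e else 0)\<bar>) \<le> real n"
          using l(1) by (simp add: sum_subtractf)
        ultimately show ?thesis unfolding lat_def by (auto intro!: bodyI)
      qed
      have m: "u - si *s column j A \<in> lat A (real n)" "u - (2 * si) *s column j A \<in> lat A (real n)"
        using s by (auto intro!: shift simp: si)
      define c1 c2 where "c1 = (if s = 1 then 1 / (2 * \<beta> j) else \<beta> j / 2)"
        and "c2 = (if s = 1 then \<beta> j / 2 else 1 / (2 * \<beta> j))"
      have c1: "c1 \<noteq> 0" by (simp add: c1_def)
      have xj: "xf j = cst c1 * ch (si *s column j A) + cst c2 * ch (- (si *s column j A))"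
      proof (cases "s = 1")
        case True
        then have "si *s column j A = column j A" by (simp add: si_def)
        with True show ?thesis unfolding xf_eq c1_def c2_def by simp
      next
        case False
        then have "si *s column j A = - column j A" by (simp add: si_def vec_eq_iff)
        with False show ?thesis unfolding xf_eq c1_def c2_def by (simp add: add.commute)
      qed
      \<comment> \<open>With \<open>v = si *s column j A\<close>, the form \<open>xf j\<close> is
        \<open>c1\<close> times the monomial of \<open>v\<close> plus \<open>c2\<close> times that
        of \<open>- v\<close>. Multiplied by the monomial of \<open>u - v\<close> it produces
        \<open>u\<close> and a second term at \<open>u - 2 v\<close>, which is of level
        \<open>n\<close> and is subtracted.\<close>
      have "lf (axis j 1) * (cst (1 / c1) * ch (u - si *s column j A)) -
          cst (c2 / c1) * ch (u - (2 * si) *s column j A) = ch u"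
      proof
        fix \<tau>
        define v where "v = si *s column j A"
        have v: "u = (u - v) + v" "u - (2 * si) *s column j A = (u - v) + - v"
          by (simp_all add: v_def vec_eq_iff algebra_simps)
        have e: "ch u \<tau> = ch (u - v) \<tau> * ch v \<tau>"
          "ch (u - (2 * si) *s column j A) \<tau> = ch (u - v) \<tau> * ch (- v) \<tau>"
          using ch_add[of "u - v" v \<tau>] ch_add[of "u - v" "- v" \<tau>] unfolding v(2) by simp_all
        show "(lf (axis j 1) * (cst (1 / c1) * ch (u - si *s column j A)) -
          cst (c2 / c1) * ch (u - (2 * si) *s column j A)) \<tau> = ch u \<tau>"
          unfolding lf_axis xj v_def[symmetric] fun_diff_def times_fun_def plus_fun_def e
          using c1 by (simp add: field_simps)
      qed
      moreover have "lf (axis j 1) * (cst (1 / c1) * ch (u - si *s column j A)) \<in> U ?W (real n)"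
        using m(1) by (intro U_lf LP_cmult Bf_ch) auto
      moreover have "cst (c2 / c1) * ch (u - (2 * si) *s column j A) \<in> U ?W (real n)"
        using m(2) by (intro U_Bf LP_cmult Bf_ch)
      ultimately show ?thesis using U_diff by metis
    qed
    then show "cst c * ch u \<in> U ?W (real n)" by (rule U_cmult)
  qed
qed

end

section \<open>Noether normalisation by removing one form at a time\<close>

context liss
begin

text \<open>
  Modulo the forms of \<open>W\<close>, the product \<open>P\<close> of \<open>l\<close> forms acts as \<open>c * w0 ^ l\<close>.
\<close>

definition acts_as :: "complex ^ 'n \<Rightarrow> (complex ^ 'n) set \<Rightarrow> ('d torus \<Rightarrow> complex) \<Rightarrow> complex \<Rightarrow> nat \<Rightarrow> bool" where
  "acts_as w0 W P c l \<longleftrightarrow> P \<in> Bf (real l) \<and>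
     (\<forall>r. \<forall>b\<in>Bf r. P * b - cst c * (lf w0 ^ l * b) \<in> U W (r + real l - 1))"

lemma lf_power_Bf: "lf w ^ l \<in> Bf (real l)"
proof (induction l)
  case 0
  show "lf w ^ 0 \<in> Bf (real 0)" by (simp add: Bf_1)
next
  case (Suc l)
  show "lf w ^ Suc l \<in> Bf (real (Suc l))" using Bf_mult[OF lf_Bf[of w] Suc] by (simp add: add.commute)
qed

lemma acts_as_1: "acts_as w0 W 1 1 0"
  by (auto simp: acts_as_def Bf_1 U_0 simp flip: one_fun_def)

lemma acts_as_mult:
  assumes "acts_as w0 W P c l" "acts_as w0 W P' c' l'"
  shows "acts_as w0 W (P * P') (c * c') (l + l')"
  unfolding acts_as_def
proof (intro conjI allI ballI)
  have PB: "P \<in> Bf (real l)" "P' \<in> Bf (real l')" using assms by (auto simp: acts_as_def)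
  then show "P * P' \<in> Bf (real (l + l'))" using Bf_mult by auto
  fix r b assume b: "b \<in> Bf r"
  have "P * (P' * b - cst c' * (lf w0 ^ l' * b)) \<in> U W (real l + (r + real l' - 1))"
    using assms(2) b PB by (intro U_mult) (auto simp: acts_as_def)
  moreover have "lf w0 ^ l' * b \<in> Bf (real l' + r)" using b by (intro Bf_mult lf_power_Bf)
  then have "P * (lf w0 ^ l' * b) - cst c * (lf w0 ^ l * (lf w0 ^ l' * b)) \<in> U W (real l' + r + real l - 1)"
    using assms(1) by (auto simp: acts_as_def)
  ultimately have "P * (P' * b - cst c' * (lf w0 ^ l' * b)) +
      cst c' * (P * (lf w0 ^ l' * b) - cst c * (lf w0 ^ l * (lf w0 ^ l' * b))) \<in> U W (r + real (l + l') - 1)"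
    by (intro U_add U_cmult) (simp_all add: algebra_simps)
  also have "P * (P' * b - cst c' * (lf w0 ^ l' * b)) +
      cst c' * (P * (lf w0 ^ l' * b) - cst c * (lf w0 ^ l * (lf w0 ^ l' * b)))
     = P * P' * b - cst (c * c') * (lf w0 ^ (l + l') * b)"
    by (simp add: fun_eq_iff power_add algebra_simps)
  finally show "P * P' * b - cst (c * c') * (lf w0 ^ (l + l') * b) \<in> U W (r + real (l + l') - 1)" .
qed

lemma acts_as_power: "acts_as w0 W P c l \<Longrightarrow> acts_as w0 W (P ^ n) (c ^ n) (l * n)"
proof (induction n)
  case 0
  show "acts_as w0 W (P ^ 0) (c ^ 0) (l * 0)" by (simp add: acts_as_1)
next
  case (Suc n)
  from acts_as_mult[OF Suc.prems Suc.IH[OF Suc.prems]]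
  show "acts_as w0 W (P ^ Suc n) (c ^ Suc n) (l * Suc n)" by simp
qed

lemma acts_as_prod:
  assumes "finite X" "\<And>i. i \<in> X \<Longrightarrow> acts_as w0 W (P i) (c i) (l i)"
  shows "acts_as w0 W (\<Prod>i\<in>X. P i) (\<Prod>i\<in>X. c i) (\<Sum>i\<in>X. l i)"
  using assms
proof (induction X rule: finite_induct)
  case empty
  show "acts_as w0 W (\<Prod>i\<in>{}. P i) (\<Prod>i\<in>{}. c i) (\<Sum>i\<in>{}. l i)" by (simp add: acts_as_1)
next
  case (insert i X)
  have "acts_as w0 W (\<Prod>i\<in>X. P i) (\<Prod>i\<in>X. c i) (\<Sum>i\<in>X. l i)"
    using insert.IH insert.prems by blast
  from acts_as_mult[OF insert.prems[of i] this] insert.hyps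
  show "acts_as w0 W (\<Prod>i\<in>insert i X. P i) (\<Prod>i\<in>insert i X. c i) (\<Sum>i\<in>insert i X. l i)" by simp
qed

lemma acts_as_lf:
  assumes "finite W" "w - c *s w0 \<in> W" shows "acts_as w0 W (lf w) c 1"
  unfolding acts_as_def
proof (intro conjI allI ballI)
  show "lf w \<in> Bf (real 1)" using lf_Bf by simp
  fix r b assume b: "b \<in> Bf r"
  have "lf w * b - cst c * (lf w0 ^ 1 * b) = lf (w - c *s w0) * b"
    by (simp add: lf_diff_scale algebra_simps)
  then show "lf w * b - cst c * (lf w0 ^ 1 * b) \<in> U W (r + real 1 - 1)"
    using U_lf[OF assms b] by simp
qed

lemma acts_as_self: "acts_as w0 W (lf w0) 1 1"
proof -
  have "lf w0 * b - cst 1 * (lf w0 ^ 1 * b) = 0" for b by (simp add: fun_eq_iff)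
  then show ?thesis using lf_Bf[of w0] U_0 unfolding acts_as_def by simp
qed

text \<open>Monomials are characters of a multiplicative monoid, so a nontrivial combination is not
  identically 0. The nonzero value becomes the leading coefficient after the change of forms in
  \<open>noether_step\<close>.\<close>

lemma monomials_independent:
  fixes X :: "'w set"
  assumes "finite X" and q: "\<exists>\<alpha>\<in>PiE X (\<lambda>_. {..K}). q \<alpha> \<noteq> (0 :: complex)"
  shows "\<exists>\<zeta>. (\<Sum>\<alpha>\<in>PiE X (\<lambda>_. {..K::nat}). q \<alpha> * (\<Prod>w\<in>X. \<zeta> w ^ \<alpha> w)) \<noteq> 0"
proof (rule ccontr)
  assume neg: "\<not> ?thesis"
  let ?S = "PiE X (\<lambda>_. {..K})"
  obtain \<alpha> where \<alpha>: "\<alpha> \<in> ?S" "q \<alpha> \<noteq> 0" using q by blast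
  have "q \<alpha> = 0"
  proof (rule characters_independent[where S = ?S and \<psi> = "\<lambda>\<alpha> \<zeta>. \<Prod>w\<in>X. \<zeta> w ^ \<alpha> w" and m = "\<lambda>x y w. x w * y w"])
    show "inj_on (\<lambda>\<alpha> \<zeta>. \<Prod>w\<in>X. (\<zeta> w :: complex) ^ \<alpha> w) ?S"
    proof (rule inj_onI)
      fix \<alpha> \<gamma> assume S: "\<alpha> \<in> ?S" "\<gamma> \<in> ?S"
        and eq: "(\<lambda>\<zeta>. \<Prod>w\<in>X. (\<zeta> w :: complex) ^ \<alpha> w) = (\<lambda>\<zeta>. \<Prod>w\<in>X. \<zeta> w ^ \<gamma> w)"
      have "\<alpha> w = \<gamma> w" if w: "w \<in> X" for w
      proof -
        have p: "(\<Prod>v\<in>X. (if v = w then 2 else 1 :: complex) ^ \<delta> v) = 2 ^ \<delta> w" for \<delta> :: "'w \<Rightarrow> nat"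
        proof -
          have "(\<Prod>v\<in>X. (if v = w then 2 else 1 :: complex) ^ \<delta> v) = (\<Prod>v\<in>X. if v = w then 2 ^ \<delta> w else 1)"
            by (intro prod.cong) auto
          then show ?thesis using w assms(1) by simp
        qed
        have "(2::complex) ^ \<alpha> w = 2 ^ \<gamma> w"
          using fun_cong[OF eq, of "\<lambda>v. if v = w then 2 else 1"] unfolding p .
        then have "norm ((2::complex) ^ \<alpha> w) = norm ((2::complex) ^ \<gamma> w)" by simp
        then have "(2::real) ^ \<alpha> w = 2 ^ \<gamma> w" by (simp add: norm_power)
        then show ?thesis by simp
      qed
      then show "\<alpha> = \<gamma>" using S by (intro PiE_ext) auto
    qed
    show "\<exists>x. (\<Prod>w\<in>X. (x w :: complex) ^ \<alpha> w) \<noteq> 0" for \<alpha> :: "'w \<Rightarrow> nat"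
      by (intro exI[of _ "\<lambda>_. 1"]) simp
    show "(\<Sum>\<alpha>\<in>?S. q \<alpha> * (\<Prod>w\<in>X. x w ^ \<alpha> w)) = 0" for x
      using neg by blast
  qed (use assms \<alpha> in \<open>auto simp: power_mult_distrib prod.distrib intro: finite_PiE\<close>)
  with \<alpha> show False by simp
qed

lemma shell_card:
  assumes "0 < \<epsilon>"
  shows "\<exists>N0. \<forall>N\<ge>N0. real (card (lat A (real N)) - card (lat A (real N - 1))) < \<epsilon> * real N ^ CARD('d)"
proof -
  obtain N0 where N0: "\<And>N. N0 \<le> N \<Longrightarrow>
      vol * ((real N + kap) ^ CARD('d) - (real N - (kap + 1)) ^ CARD('d)) < \<epsilon> * real N ^ CARD('d)"
    using power_shell_small[OF assms] by blast
  obtain N1 :: nat where N1: "kap + 1 < real N1" using reals_Archimedean2 by blast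
  have "real (card (lat A (real N)) - card (lat A (real N - 1))) < \<epsilon> * real N ^ CARD('d)"
    if N: "max N0 N1 \<le> N" for N
  proof -
    have k: "kap + 1 < real N" "0 < real N" using N N1 kap(1) by auto
    have "card (lat A (real N - 1)) \<le> card (lat A (real N))"
      by (intro card_mono finite_lat lat_mono) simp
    then have "real (card (lat A (real N)) - card (lat A (real N - 1)))
        = real (card (lat A (real N))) - real (card (lat A (real N - 1)))" by simp
    also have "\<dots> \<le> vol * (real N + kap) ^ CARD('d) - vol * (real N - 1 - kap) ^ CARD('d)"
      using k by (intro diff_mono lat_card_upper lat_card_lower) auto
    also have "\<dots> < \<epsilon> * real N ^ CARD('d)"
      using N0[of N] N by (simp add: right_diff_distrib diff_diff_eq add.commute)
    finally show ?thesis .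
  qed
  then show ?thesis by blast
qed

text \<open>
  A relation of degree \<open>D\<close> among more than \<open>d\<close> forms: its coefficients solve a linear system, since a product of
  \<open>D\<close> forms only has to lose its leading part, which lives on a shell of \<open>O(D ^ (d - 1))\<close> lattice points.
\<close>

lemma leading_relation:
  fixes W :: "(complex ^ 'n) set"
  assumes W: "finite W" "w0 \<in> W" "CARD('d) < card W" and \<nu>: "0 < \<nu>"
  defines "X \<equiv> W - {w0}"
  shows "\<exists>K q. 0 < K \<and> (\<exists>\<alpha>\<in>PiE X (\<lambda>_. {..K}). q \<alpha> \<noteq> 0) \<and>
    (\<forall>u\<in>lat A (real \<nu>). (\<Sum>\<alpha>\<in>PiE X (\<lambda>_. {..K}). cst (q \<alpha>) *
        ((\<Prod>w\<in>X. lf w ^ \<alpha> w) * lf w0 ^ (card X * K - (\<Sum>w\<in>X. \<alpha> w)) * ch u))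
      \<in> Bf (real (\<nu> + card X * K) - 1))"
proof -
  define m where "m = card X"
  have X: "finite X" "CARD('d) \<le> m" using W by (auto simp: X_def m_def)
  then have m0: "0 < m" using zero_less_card_finite[where 'a='d] by linarith
  define s where "s = card (lat A (real \<nu>))"
  have s: "0 < s" using zero_in_lat[of "real \<nu>" A] by (auto simp: s_def card_gt_0_iff)
  \<comment> \<open>Chosen so that \<open>s\<close> times a shell of fewer than
    \<open>\<epsilon> * N ^ d\<close> points, with \<open>N \<le> (\<nu> + m) * (K + 1)\<close>,
    stays below the number \<open>(K + 1) ^ m\<close> of exponents.\<close>
  define \<epsilon> where "\<epsilon> = 1 / (real s * real (\<nu> + m) ^ CARD('d))"
  have \<epsilon>: "0 < \<epsilon>" using s m0 by (simp add: \<epsilon>_def)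
  obtain N0 where N0: "\<And>N. N0 \<le> N \<Longrightarrow>
      real (card (lat A (real N)) - card (lat A (real N - 1))) < \<epsilon> * real N ^ CARD('d)"
    using shell_card[OF \<epsilon>] by blast
  define K where "K = Suc N0"
  define D where "D = m * K"
  define N where "N = \<nu> + D"
  have "N0 \<le> K * m" using m0 by (cases m) (auto simp: K_def)
  then have NN0: "N0 \<le> N" by (simp add: N_def D_def mult.commute)
  let ?S = "PiE X (\<lambda>_. {..K})"
  have cardS: "card ?S = (K + 1) ^ m" using X by (simp add: card_PiE m_def)
  define P where "P \<alpha> = (\<Prod>w\<in>X. lf w ^ \<alpha> w) * lf w0 ^ (D - (\<Sum>w\<in>X. \<alpha> w))" for \<alpha> :: "_ \<Rightarrow> nat"
  have PB: "P \<alpha> \<in> Bf (real D)" if "\<alpha> \<in> ?S" for \<alpha>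
  proof -
    have "(\<Sum>w\<in>X. \<alpha> w) \<le> (\<Sum>w\<in>X. K)" using that by (intro sum_mono) (auto simp: PiE_iff)
    then have le: "(\<Sum>w\<in>X. \<alpha> w) \<le> D" by (simp add: D_def m_def)
    have "(\<Prod>w\<in>X'. lf w ^ \<alpha> w) \<in> Bf (real (\<Sum>w\<in>X'. \<alpha> w))" if "finite X'" for X'
      using that
    proof induction
      case empty
      show "(\<Prod>w\<in>{}. lf w ^ \<alpha> w) \<in> Bf (real (\<Sum>w\<in>{}. \<alpha> w))" by (simp add: Bf_1)
    next
      case (insert w X')
      from Bf_mult[OF lf_power_Bf[of w "\<alpha> w"] insert.IH] insert.hyps
      show "(\<Prod>w\<in>insert w X'. lf w ^ \<alpha> w) \<in> Bf (real (\<Sum>w\<in>insert w X'. \<alpha> w))" by simp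
    qed
    then have "P \<alpha> \<in> Bf (real (\<Sum>w\<in>X. \<alpha> w) + real (D - (\<Sum>w\<in>X. \<alpha> w)))"
      unfolding P_def using X(1) by (intro Bf_mult lf_power_Bf)
    then show ?thesis using le by (simp flip: of_nat_add)
  qed
  have ex: "\<exists>a. P \<alpha> * ch u = (\<lambda>\<tau>. \<Sum>v\<in>lat A (real N). a v * ch v \<tau>)"
    if "\<alpha> \<in> ?S" "u \<in> lat A (real \<nu>)" for \<alpha> u
  proof -
    have "P \<alpha> * ch u \<in> Bf (real N)"
      using Bf_mult[OF PB[OF that(1)] Bf_ch[OF that(2)]] by (simp add: N_def add.commute)
    then show ?thesis by (rule LP_E) (rule exI)
  qed
  define a where "a \<alpha> u = (SOME a. P \<alpha> * ch u = (\<lambda>\<tau>. \<Sum>v\<in>lat A (real N). a v * ch v \<tau>))" for \<alpha> u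
  have a: "P \<alpha> * ch u = (\<lambda>\<tau>. \<Sum>v\<in>lat A (real N). a \<alpha> u v * ch v \<tau>)"
    if "\<alpha> \<in> ?S" "u \<in> lat A (real \<nu>)" for \<alpha> u
    unfolding a_def by (rule someI_ex[OF ex[OF that]])
  \<comment> \<open>One equation for each \<open>u\<close> of level \<open>\<nu>\<close> and each
    \<open>v\<close> in the shell: the coefficient at \<open>v\<close> has to cancel. A single
    \<open>q\<close> must serve all \<open>u\<close> at once.\<close>
  define shell where "shell = lat A (real N) - lat A (real N - 1)"
  have sub: "lat A (real N - 1) \<subseteq> lat A (real N)" by (intro lat_mono) simp
  have cardlt: "card (lat A (real \<nu>) \<times> shell) < card ?S"
  proof -
    have "real (card (lat A (real \<nu>) \<times> shell))
        = real s * real (card (lat A (real N)) - card (lat A (real N - 1)))"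
      by (simp add: card_cartesian_product s_def shell_def card_Diff_subset sub)
    also have "\<dots> < real s * (\<epsilon> * real N ^ CARD('d))"
      using N0[OF NN0] s by (intro mult_strict_left_mono) auto
    also have "\<dots> \<le> real s * (\<epsilon> * (real (\<nu> + m) * real (K + 1)) ^ CARD('d))"
    proof -
      have "N \<le> (\<nu> + m) * (K + 1)" by (simp add: N_def D_def algebra_simps)
      then have "real N \<le> real (\<nu> + m) * real (K + 1)" by (metis of_nat_le_iff of_nat_mult)
      then show ?thesis using \<epsilon> by (intro mult_left_mono power_mono) auto
    qed
    also have "\<dots> = real (K + 1) ^ CARD('d)"
      using s \<nu> by (simp add: \<epsilon>_def power_mult_distrib)
    also have "\<dots> \<le> real (K + 1) ^ m" using X(2) by (intro power_increasing) auto
    also have "\<dots> = real (card ?S)" by (simp add: cardS)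
    finally show ?thesis by linarith
  qed
  have fin: "finite ?S" "finite (lat A (real \<nu>) \<times> shell)"
    using X by (auto simp: shell_def intro: finite_PiE)
  obtain q where q: "\<exists>\<alpha>\<in>?S. q \<alpha> \<noteq> 0"
      "\<forall>p\<in>lat A (real \<nu>) \<times> shell. (\<Sum>\<alpha>\<in>?S. q \<alpha> * a \<alpha> (fst p) (snd p)) = 0"
    using underdetermined_system[OF fin(2,1) cardlt, of "\<lambda>\<alpha> p. a \<alpha> (fst p) (snd p)"]
    by (elim exE conjE) (rule that)
  have q2: "(\<Sum>\<alpha>\<in>?S. q \<alpha> * a \<alpha> u v) = 0" if "u \<in> lat A (real \<nu>)" "v \<in> shell" for u v
    using bspec[OF q(2), of "(u, v)"] that by simp
  have B: "(\<Sum>\<alpha>\<in>?S. cst (q \<alpha>) * (P \<alpha> * ch u)) \<in> Bf (real N - 1)" if u: "u \<in> lat A (real \<nu>)" for u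
  proof -
    have "(\<Sum>\<alpha>\<in>?S. cst (q \<alpha>) * (P \<alpha> * ch u)) \<tau> = (\<Sum>v\<in>lat A (real N - 1). (\<Sum>\<alpha>\<in>?S. q \<alpha> * a \<alpha> u v) * ch v \<tau>)" for \<tau>
    proof -
      have "(\<Sum>\<alpha>\<in>?S. cst (q \<alpha>) * (P \<alpha> * ch u)) \<tau> = (\<Sum>\<alpha>\<in>?S. q \<alpha> * (\<Sum>v\<in>lat A (real N). a \<alpha> u v * ch v \<tau>))"
        unfolding sum_fun_apply
      proof (rule sum.cong[OF refl])
        fix \<alpha> assume "\<alpha> \<in> ?S"
        from fun_cong[OF a[OF this u], of \<tau>]
        show "(cst (q \<alpha>) * (P \<alpha> * ch u)) \<tau> = q \<alpha> * (\<Sum>v\<in>lat A (real N). a \<alpha> u v * ch v \<tau>)"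
          by simp
      qed
      also have "\<dots> = (\<Sum>v\<in>lat A (real N). (\<Sum>\<alpha>\<in>?S. q \<alpha> * a \<alpha> u v) * ch v \<tau>)"
        unfolding sum_distrib_left sum_distrib_right by (subst sum.swap) (simp add: mult.assoc)
      also have "\<dots> = (\<Sum>v\<in>lat A (real N - 1). (\<Sum>\<alpha>\<in>?S. q \<alpha> * a \<alpha> u v) * ch v \<tau>)"
        using q2[OF u] sub by (intro sum.mono_neutral_right) (auto simp: shell_def)
      finally show ?thesis .
    qed
    then show ?thesis unfolding LP_def by (intro CollectI exI allI)
  qed
  have "0 < K" by (simp add: K_def)
  with q(1) B show ?thesis
    unfolding P_def N_def D_def m_def by blast
qed

lemma noether_step:
  assumes W: "finite W" "CARD('d) < card W" and g: "good W \<nu>" and \<nu>: "0 < \<nu>"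
  shows "\<exists>W' \<nu>'. finite W' \<and> card W' < card W \<and> good W' \<nu>' \<and> 0 < \<nu>'"
proof -
  have "W \<noteq> {}" using W(2) by auto
  then obtain w0 where w0: "w0 \<in> W" by blast
  define X where "X = W - {w0}"
  have X: "finite X" "W = insert w0 X" "w0 \<notin> X" "card W = Suc (card X)"
    unfolding X_def by (rule finite_Diff[OF W(1)], rule insert_Diff[OF w0, symmetric], blast, rule card.remove[OF W(1) w0])
  from leading_relation[OF W(1) w0 W(2) \<nu>, folded X_def]
  obtain K q where Kq: "0 < K \<and> (\<exists>\<alpha>\<in>PiE X (\<lambda>_. {..K}). q \<alpha> \<noteq> 0) \<and>
    (\<forall>u\<in>lat A (real \<nu>). (\<Sum>\<alpha>\<in>PiE X (\<lambda>_. {..K}). cst (q \<alpha>) *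
        ((\<Prod>w\<in>X. lf w ^ \<alpha> w) * lf w0 ^ (card X * K - (\<Sum>w\<in>X. \<alpha> w)) * ch u))
      \<in> Bf (real (\<nu> + card X * K) - 1))" by (elim exE)
  note K = conjunct1[OF Kq] conjunct1[OF conjunct2[OF Kq]]
  note q = bspec[OF conjunct2[OF conjunct2[OF Kq]]]
  let ?S = "PiE X (\<lambda>_. {..K})"
  define D where "D = card X * K"
  obtain \<zeta> where \<zeta>: "(\<Sum>\<alpha>\<in>?S. q \<alpha> * (\<Prod>w\<in>X. \<zeta> w ^ \<alpha> w)) \<noteq> 0"
    using monomials_independent[OF X(1) K(2)] by (elim exE)
  define z where "z = (\<Sum>\<alpha>\<in>?S. q \<alpha> * (\<Prod>w\<in>X. \<zeta> w ^ \<alpha> w))"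
  define W' where "W' = (\<lambda>w. w - \<zeta> w *s w0) ` X"
  have W': "finite W'" "card W' \<le> card X" using X by (auto simp: W'_def card_image_le)
  define \<mu> where "\<mu> w = (if w = w0 then 1 else \<zeta> w)" for w
  have act: "acts_as w0 W' (lf w) (\<mu> w) 1" if "w \<in> W" for w
    using that X acts_as_self[of w0 W'] acts_as_lf[OF W'(1), of w "\<zeta> w" w0]
    by (auto simp: \<mu>_def W'_def)
  have actP: "acts_as w0 W' ((\<Prod>w\<in>X. lf w ^ \<alpha> w) * lf w0 ^ (D - (\<Sum>w\<in>X. \<alpha> w))) (\<Prod>w\<in>X. \<zeta> w ^ \<alpha> w) D"
    if \<alpha>: "\<alpha> \<in> ?S" for \<alpha>
  proof -
    have "(\<Sum>w\<in>X. \<alpha> w) \<le> (\<Sum>w\<in>X. K)" using \<alpha> by (intro sum_mono) (auto simp: PiE_iff)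
    then have le: "(\<Sum>w\<in>X. \<alpha> w) \<le> D" by (simp add: D_def)
    have "acts_as w0 W' ((\<Prod>w\<in>X. lf w ^ \<alpha> w) * lf w0 ^ (D - (\<Sum>w\<in>X. \<alpha> w)))
        ((\<Prod>w\<in>X. \<zeta> w ^ \<alpha> w) * 1 ^ (D - (\<Sum>w\<in>X. \<alpha> w)))
        ((\<Sum>w\<in>X. 1 * \<alpha> w) + 1 * (D - (\<Sum>w\<in>X. \<alpha> w)))"
      by (intro acts_as_mult acts_as_prod acts_as_power acts_as_self acts_as_lf W'(1) X(1)) (simp add: W'_def)
    then show ?thesis using le by simp
  qed
  have base0: "lf w0 ^ D * ch u \<in> U W' (real \<nu> + real D - 1)" if u: "u \<in> lat A (real \<nu>)" for u
  proof -
    let ?P = "\<lambda>\<alpha>. (\<Prod>w\<in>X. lf w ^ \<alpha> w) * lf w0 ^ (D - (\<Sum>w\<in>X. \<alpha> w))"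
    have "(\<Sum>\<alpha>\<in>?S. cst (q \<alpha>) * (?P \<alpha> * ch u)) \<in> U W' (real \<nu> + real D - 1)"
      using q[OF u] by (intro U_Bf) (simp add: D_def)
    moreover have "(\<Sum>\<alpha>\<in>?S. cst (q \<alpha>) * (?P \<alpha> * ch u - cst (\<Prod>w\<in>X. \<zeta> w ^ \<alpha> w) * (lf w0 ^ D * ch u)))
        \<in> U W' (real \<nu> + real D - 1)"
      using actP Bf_ch[OF u] unfolding acts_as_def by (intro U_sum U_cmult) blast
    ultimately have "(\<Sum>\<alpha>\<in>?S. cst (q \<alpha>) * (?P \<alpha> * ch u)) - (\<Sum>\<alpha>\<in>?S. cst (q \<alpha>) *
        (?P \<alpha> * ch u - cst (\<Prod>w\<in>X. \<zeta> w ^ \<alpha> w) * (lf w0 ^ D * ch u))) \<in> U W' (real \<nu> + real D - 1)"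
      by (rule U_diff)
    also have "(\<Sum>\<alpha>\<in>?S. cst (q \<alpha>) * (?P \<alpha> * ch u)) - (\<Sum>\<alpha>\<in>?S. cst (q \<alpha>) *
        (?P \<alpha> * ch u - cst (\<Prod>w\<in>X. \<zeta> w ^ \<alpha> w) * (lf w0 ^ D * ch u))) = cst z * (lf w0 ^ D * ch u)"
      unfolding z_def sum_subtractf[symmetric]
      by (simp add: fun_eq_iff sum_fun_apply sum_distrib_right right_diff_distrib mult.assoc)
    finally have "cst (1 / z) * (cst z * (lf w0 ^ D * ch u)) \<in> U W' (real \<nu> + real D - 1)"
      by (rule U_cmult)
    moreover have "cst (1 / z) * (cst z * (lf w0 ^ D * ch u)) = lf w0 ^ D * ch u"
      using \<zeta> by (simp add: fun_eq_iff z_def)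
    ultimately show ?thesis by (simp only:)
  qed
  \<comment> \<open>From level \<open>\<nu>\<close> upwards each level is generated by the old forms
    over the previous one, and multiplying by a form raises \<open>U W'\<close> by one
    level.\<close>
  have pow: "lf w0 ^ D * b \<in> U W' (real n + real D - 1)" if "\<nu> \<le> n" "b \<in> Bf (real n)" for n b
    using that
  proof (induction n arbitrary: b rule: dec_induct)
    case base
    from \<open>b \<in> Bf (real \<nu>)\<close> show ?case
    proof (rule LP_subset[where X = "{b. lf w0 ^ D * b \<in> U W' (real \<nu> + real D - 1)}", THEN CollectD])
      fix c u assume "u \<in> lat A (real \<nu>)"
      from U_cmult[OF base0[OF this], of c]
      show "cst c * ch u \<in> {b. lf w0 ^ D * b \<in> U W' (real \<nu> + real D - 1)}"
        by (simp add: mult.left_commute)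
    qed (auto simp: U_0 distrib_left intro: U_add)
  next
    case (step n)
    have IH: "lf w0 ^ D * b \<in> U W' (real n + real D - 1)" if "b \<in> Bf (real n)" for b
      using step.IH[OF that] .
    have "b \<in> Bf (real n + 1)" using step.prems by (simp add: add.commute)
    then have "b \<in> U W (real n)" using g step.hyps(1) by (auto simp: good_def)
    then show ?case
    proof (rule U_E[where X = "{b. lf w0 ^ D * b \<in> U W' (real (Suc n) + real D - 1)}", THEN CollectD])
      fix b assume "b \<in> Bf (real n)"
      from Bf_mult[OF lf_power_Bf this]
      show "b \<in> {b. lf w0 ^ D * b \<in> U W' (real (Suc n) + real D - 1)}"
        by (auto intro!: U_Bf simp: add.commute)
    next
      fix w b assume "w \<in> W" "b \<in> Bf (real n)"
      from U_mult[OF IH[OF this(2)] lf_Bf[of w]]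
      show "lf w * b \<in> {b. lf w0 ^ D * b \<in> U W' (real (Suc n) + real D - 1)}"
        by (simp add: mult.left_commute algebra_simps)
    qed (auto simp: U_0 distrib_left intro: U_add)
  qed
  \<comment> \<open>Powers of \<open>w0\<close> are traded for levels: writing \<open>b\<close>
    through the forms of \<open>W\<close> lowers its level by 1, and each form acts as a multiple of
    \<open>w0\<close>, which restores the lost factor. At \<open>l = D\<close> no factor
    \<open>w0\<close> is left.\<close>
  have down: "lf w0 ^ (D - l) * b \<in> U W' (real n + real D - 1)"
    if "l \<le> D" "\<nu> \<le> n" "b \<in> Bf (real n + real l)" for l n b
    using that
  proof (induction l arbitrary: b)
    case 0
    then show "lf w0 ^ (D - 0) * b \<in> U W' (real n + real D - 1)" using pow[of n b] by simp
  next
    case (Suc l)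
    let ?U = "U W' (real n + real D - 1)"
    have IH: "lf w0 ^ (D - l) * b \<in> ?U" if "b \<in> Bf (real (n + l))" for b
    proof -
      have "l \<le> D" "b \<in> Bf (real n + real l)" using Suc.prems that by simp_all
      from Suc.IH[OF this(1) Suc.prems(2) this(2)] show ?thesis .
    qed
    have "b \<in> Bf (real (n + l) + 1)" using Suc.prems(3) by (simp add: algebra_simps)
    then have "b \<in> U W (real (n + l))" using g Suc.prems(2) unfolding good_def by (meson le_add1 le_trans subsetD)
    then show ?case
    proof (rule U_E[where X = "{b. lf w0 ^ (D - Suc l) * b \<in> ?U}", THEN CollectD])
      fix b assume "b \<in> Bf (real (n + l))"
      from Bf_mult[OF lf_power_Bf[of w0 "D - Suc l"] this]
      show "b \<in> {b. lf w0 ^ (D - Suc l) * b \<in> ?U}" using Suc.prems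
        by (auto intro!: U_Bf simp: of_nat_diff algebra_simps)
    next
      fix w b assume w: "w \<in> W" and b: "b \<in> Bf (real (n + l))"
      from Bf_mult[OF lf_power_Bf[of w0 "D - Suc l"] b]
      have "lf w0 ^ (D - Suc l) * b \<in> Bf (real n + real D - 1)"
        using Suc.prems by (auto simp: of_nat_diff algebra_simps)
      with act[OF w] have "lf w * (lf w0 ^ (D - Suc l) * b) -
          cst (\<mu> w) * (lf w0 ^ 1 * (lf w0 ^ (D - Suc l) * b)) \<in> U W' (real n + real D - 1 + real 1 - 1)"
        unfolding acts_as_def by blast
      moreover have "lf w0 ^ 1 * (lf w0 ^ (D - Suc l) * b) = lf w0 ^ (D - l) * b"
      proof -
        have "D - l = Suc (D - Suc l)" using Suc.prems by simp
        then show ?thesis by (simp add: mult.assoc)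
      qed
      moreover have "lf w0 ^ (D - l) * b \<in> ?U" by (rule IH[OF b])
      ultimately have "lf w * (lf w0 ^ (D - Suc l) * b) - cst (\<mu> w) * (lf w0 ^ (D - l) * b) \<in> ?U"
        "cst (\<mu> w) * (lf w0 ^ (D - l) * b) \<in> ?U" by (auto intro: U_cmult)
      from U_add[OF this] show "lf w * b \<in> {b. lf w0 ^ (D - Suc l) * b \<in> ?U}"
        by (simp add: mult.left_commute)
    qed (auto simp: U_0 distrib_left intro: U_add)
  qed
  have "good W' (\<nu> + D)"
    unfolding good_def
  proof (intro allI impI subsetI)
    fix n b assume n: "\<nu> + D \<le> n" and b: "b \<in> Bf (real n + 1)"
    define r where "r = Suc n - D"
    have r: "real r + real D = real n + 1" "\<nu> \<le> r" using n by (auto simp: r_def of_nat_diff)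
    have "lf w0 ^ (D - D) * b \<in> U W' (real r + real D - 1)"
      using b r by (intro down) auto
    then show "b \<in> U W' (real n)" using r(1) by simp
  qed
  then show ?thesis using W' X(4) \<nu> by (intro exI[of _ W'] exI[of _ "\<nu> + D"]) auto
qed

lemma good_exists: "\<exists>W \<nu>. finite W \<and> card W \<le> CARD('d) \<and> good W \<nu> \<and> 0 < \<nu>"
proof -
  have "\<exists>W' \<nu>'. finite W' \<and> card W' \<le> CARD('d) \<and> good W' \<nu>' \<and> 0 < \<nu>'"
    if "finite W" "good W \<nu>" "0 < \<nu>" for W \<nu>
    using that
  proof (induction "card W" arbitrary: W \<nu> rule: less_induct)
    case less
    show ?case
    proof (cases "card W \<le> CARD('d)")
      case True
      then show ?thesis using less by blast
    next
      case False
      then obtain W' \<nu>' where "finite W'" "card W' < card W" "good W' \<nu>'" "0 < \<nu>'"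
        using noether_step[of W \<nu>] less by (meson not_le)
      then show ?thesis using less.hyps by blast
    qed
  qed
  from this[OF _ good_initial] show ?thesis by simp
qed

end

section \<open>Polynomials filtered by degree\<close>

definition mon :: "('d::finite \<Rightarrow> nat) \<Rightarrow> complex ^ 'd \<Rightarrow> complex" where
  "mon \<alpha> y = (\<Prod>k\<in>UNIV. (y $ k) ^ \<alpha> k)"

definition Smp :: "nat \<Rightarrow> ('d::finite \<Rightarrow> nat) set" where
  "Smp N = {\<alpha>. (\<Sum>k\<in>UNIV. \<alpha> k) \<le> N}"

lemma card_simplex:
  assumes "finite I"
  shows "finite {\<alpha> :: 'd \<Rightarrow> nat. (\<forall>k. k \<notin> I \<longrightarrow> \<alpha> k = 0) \<and> (\<Sum>k\<in>I. \<alpha> k) \<le> N} \<and>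
    card {\<alpha> :: 'd \<Rightarrow> nat. (\<forall>k. k \<notin> I \<longrightarrow> \<alpha> k = 0) \<and> (\<Sum>k\<in>I. \<alpha> k) \<le> N} = (N + card I) choose card I"
  using assms
proof (induction I arbitrary: N rule: finite_induct)
  case empty
  have "{\<alpha> :: 'd \<Rightarrow> nat. \<forall>k. \<alpha> k = 0} = {\<lambda>_. 0}" by auto
  then show ?case by simp
next
  case (insert i I)
  define S where "S I N = {\<alpha> :: 'd \<Rightarrow> nat. (\<forall>k. k \<notin> I \<longrightarrow> \<alpha> k = 0) \<and> (\<Sum>k\<in>I. \<alpha> k) \<le> N}" for I N
  have IH: "finite (S I N)" "card (S I N) = (N + card I) choose card I" for N
    using insert.IH[of N] by (simp_all add: S_def)
  have eq: "S (insert i I) N = (\<Union>a\<in>{..N}. (\<lambda>\<alpha>. \<alpha>(i := a)) ` S I (N - a))"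
  proof (intro equalityI subsetI)
    fix \<alpha> assume \<alpha>: "\<alpha> \<in> S (insert i I) N"
    have "(\<Sum>k\<in>I. (\<alpha>(i := 0)) k) = (\<Sum>k\<in>I. \<alpha> k)" using insert.hyps by (intro sum.cong) auto
    then have "\<alpha>(i := 0) \<in> S I (N - \<alpha> i)" "\<alpha> i \<le> N"
      using \<alpha> insert.hyps by (auto simp: S_def)
    moreover have "\<alpha> = (\<alpha>(i := 0))(i := \<alpha> i)" by simp
    ultimately show "\<alpha> \<in> (\<Union>a\<in>{..N}. (\<lambda>\<alpha>. \<alpha>(i := a)) ` S I (N - a))" by blast
  next
    fix \<alpha> assume "\<alpha> \<in> (\<Union>a\<in>{..N}. (\<lambda>\<alpha>. \<alpha>(i := a)) ` S I (N - a))"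
    then obtain a \<gamma> where a: "a \<le> N" "\<gamma> \<in> S I (N - a)" "\<alpha> = \<gamma>(i := a)" by auto
    have "(\<Sum>k\<in>I. \<alpha> k) = (\<Sum>k\<in>I. \<gamma> k)" using insert.hyps a by (intro sum.cong) auto
    then show "\<alpha> \<in> S (insert i I) N" using a insert.hyps by (auto simp: S_def)
  qed
  have inj: "inj_on (\<lambda>\<alpha>. \<alpha>(i := a)) (S I M)" for a M
  proof (rule inj_onI)
    fix \<alpha> \<gamma> assume *: "\<alpha> \<in> S I M" "\<gamma> \<in> S I M" "\<alpha>(i := a) = \<gamma>(i := a)"
    then have "\<alpha> i = \<gamma> i" using insert.hyps by (simp add: S_def)
    then show "\<alpha> = \<gamma>" using *(3) by (metis fun_upd_triv fun_upd_upd)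
  qed
  have "card (S (insert i I) N) = (\<Sum>a\<le>N. card ((\<lambda>\<alpha>. \<alpha>(i := a)) ` S I (N - a)))"
    unfolding eq
  proof (rule card_UN_disjoint)
    show "\<forall>a\<in>{..N}. \<forall>b\<in>{..N}. a \<noteq> b \<longrightarrow>
        (\<lambda>\<alpha>. \<alpha>(i := a)) ` S I (N - a) \<inter> (\<lambda>\<alpha>. \<alpha>(i := b)) ` S I (N - b) = {}"
      by (auto dest: fun_cong[of _ _ i])
  qed (use IH in auto)
  also have "\<dots> = (\<Sum>a\<le>N. (N - a + card I) choose card I)"
    by (simp add: card_image[OF inj] IH)
  also have "\<dots> = (\<Sum>a\<le>N. (card I + a) choose card I)"
    by (rule sum.reindex_bij_witness[of _ "\<lambda>a. N - a" "\<lambda>a. N - a"]) (auto simp: add.commute)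
  also have "\<dots> = (N + card (insert i I)) choose card (insert i I)"
    unfolding choose_rising_sum(1) using insert.hyps by (simp add: add.commute)
  finally have "card (S (insert i I) N) = (N + card (insert i I)) choose card (insert i I)" .
  moreover have "finite (S (insert i I) N)" unfolding eq using IH(1) by simp
  ultimately show ?case unfolding S_def by blast
qed

lemma finite_Smp [simp]: "finite (Smp N :: ('d::finite \<Rightarrow> nat) set)"
  and card_Smp: "card (Smp N :: ('d::finite \<Rightarrow> nat) set) = (N + CARD('d)) choose CARD('d)"
  using card_simplex[of "UNIV :: 'd set" N] by (simp_all add: Smp_def)

lemma fact_binomial_bounds:
  "N ^ d \<le> fact d * ((N + d) choose d)" "d \<le> D \<Longrightarrow> fact d * ((N + d) choose d) \<le> (N + D) ^ d"
proof -
  have step: "fact (Suc d) * ((N + Suc d) choose Suc d) = (N + Suc d) * (fact d * ((N + d) choose d))" for d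
  proof -
    have "fact (Suc d) * ((N + Suc d) choose Suc d) = fact d * (Suc d * (Suc (N + d) choose Suc d))"
      by (simp only: fact_Suc add_Suc_right of_nat_id mult_ac)
    also have "\<dots> = fact d * (Suc (N + d) * ((N + d) choose d))"
      by (simp only: Suc_times_binomial)
    finally show ?thesis by (simp only: add_Suc_right mult_ac)
  qed
  show "N ^ d \<le> fact d * ((N + d) choose d)"
  proof (induction d)
    case (Suc d)
    have "N ^ Suc d \<le> (N + Suc d) * (fact d * ((N + d) choose d))"
      unfolding power_Suc using Suc by (intro mult_le_mono) auto
    then show ?case unfolding step .
  qed simp
  show "d \<le> D \<Longrightarrow> fact d * ((N + d) choose d) \<le> (N + D) ^ d"
  proof (induction d)
    case (Suc d)
    have "(N + Suc d) * (fact d * ((N + d) choose d)) \<le> (N + D) ^ Suc d"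
      unfolding power_Suc using Suc by (intro mult_le_mono) auto
    then show ?case unfolding step .
  qed simp
qed

lemma card_Smp_lower: "real N ^ CARD('d) \<le> fact CARD('d) * real (card (Smp N :: ('d::finite \<Rightarrow> nat) set))"
proof -
  have "real (N ^ CARD('d)) \<le> real (fact CARD('d) * ((N + CARD('d)) choose CARD('d)))"
    using fact_binomial_bounds(1) by (simp only: of_nat_le_iff)
  then show ?thesis by (simp add: card_Smp)
qed

lemma card_Smp_upper:
  "fact CARD('d) * real (card (Smp N :: ('d::finite \<Rightarrow> nat) set)) \<le> (real N + real CARD('d)) ^ CARD('d)"
proof -
  have "real (fact CARD('d) * ((N + CARD('d)) choose CARD('d))) \<le> real ((N + CARD('d)) ^ CARD('d))"
    using fact_binomial_bounds(2)[OF le_refl] by (simp only: of_nat_le_iff)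
  then show ?thesis by (simp add: card_Smp)
qed

text \<open>Division by \<open>N ^ d\<close> leaves the leading coefficients in the limit, and
  shifts of the argument disappear. This is how inequalities between dimensions become inequalities
  between the number of points of a fibre and the volume.\<close>

lemma power_growth_le:
  fixes a b \<kappa> \<kappa>' :: real
  assumes "\<And>N. N0 \<le> N \<Longrightarrow> a * (real N - \<kappa>) ^ d \<le> b * (real N + \<kappa>') ^ d"
  shows "a \<le> b"
proof (rule LIMSEQ_le)
  show "(\<lambda>N. a * (1 - \<kappa> / real N) ^ d) \<longlonglongrightarrow> a"
    using tendsto_mult[OF tendsto_const tendsto_power[OF tendsto_diff[OF tendsto_const lim_const_over_n]], of a 1 \<kappa> d] by simp
  show "(\<lambda>N. b * (1 + \<kappa>' / real N) ^ d) \<longlonglongrightarrow> b"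
    using tendsto_mult[OF tendsto_const tendsto_power[OF tendsto_add[OF tendsto_const lim_const_over_n]], of b 1 \<kappa>' d] by simp
  show "\<exists>N. \<forall>n\<ge>N. a * (1 - \<kappa> / real n) ^ d \<le> b * (1 + \<kappa>' / real n) ^ d"
  proof (intro exI allI impI)
    fix n assume n: "max 1 N0 \<le> n"
    have "real n * (1 - \<kappa> / real n) = real n - \<kappa>" "real n * (1 + \<kappa>' / real n) = real n + \<kappa>'"
      using n by (simp_all add: field_simps)
    then have "(real n) ^ d * (a * (1 - \<kappa> / real n) ^ d) \<le> (real n) ^ d * (b * (1 + \<kappa>' / real n) ^ d)"
      using assms[of n] n by (simp add: power_mult_distrib[symmetric] mult.left_commute)
    then show "a * (1 - \<kappa> / real n) ^ d \<le> b * (1 + \<kappa>' / real n) ^ d"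
      using n by (simp add: mult_le_cancel_left_pos)
  qed
qed

lemma mon_mult: "mon \<alpha> y * mon \<gamma> y = mon (\<lambda>k. \<alpha> k + \<gamma> k) y"
  by (simp add: mon_def power_add prod.distrib)

lemma mon_independent:
  fixes q :: "('d::finite \<Rightarrow> nat) \<Rightarrow> complex"
  assumes "finite S" "\<And>y. (\<Sum>\<alpha>\<in>S. q \<alpha> * mon \<alpha> y) = 0" "\<alpha> \<in> S"
  shows "q \<alpha> = 0"
proof (rule characters_independent[where S = S and \<psi> = mon and m = "\<lambda>x y. \<chi> k. x $ k * y $ k"])
  have "\<alpha> = \<gamma>" if eq: "mon \<alpha> = mon \<gamma>" for \<alpha> \<gamma> :: "'d \<Rightarrow> nat"
  proof
    fix k :: 'd
    have p: "mon \<delta> (\<chi> i. if i = k then 2 else 1) = 2 ^ \<delta> k" for \<delta>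
    proof -
      have "mon \<delta> (\<chi> i. if i = k then 2 else 1) = (\<Prod>i\<in>UNIV. if i = k then 2 ^ \<delta> k else 1)"
        unfolding mon_def by (intro prod.cong) auto
      then show ?thesis by simp
    qed
    have "(2::complex) ^ \<alpha> k = 2 ^ \<gamma> k"
      using fun_cong[OF eq, of "\<chi> i. if i = k then 2 else 1"] unfolding p .
    then have "norm ((2::complex) ^ \<alpha> k) = norm ((2::complex) ^ \<gamma> k)" by simp
    then have "(2::real) ^ \<alpha> k = 2 ^ \<gamma> k" by (simp add: norm_power)
    then show "\<alpha> k = \<gamma> k" by simp
  qed
  then show "inj_on mon S" by (intro inj_onI)
  show "\<exists>x. mon \<alpha> x \<noteq> 0" for \<alpha> :: "'d \<Rightarrow> nat"
    by (intro exI[of _ "\<chi> k. 1"]) (simp add: mon_def)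
qed (use assms in \<open>auto simp: mon_def power_mult_distrib prod.distrib\<close>)

definition PF :: "nat \<Rightarrow> (complex ^ 'd::finite \<Rightarrow> complex) set" where
  "PF N = {p. \<exists>q. p = (\<lambda>y. \<Sum>\<alpha>\<in>Smp N. q \<alpha> * mon \<alpha> y)}"

lemma PF_E: "p \<in> PF N \<Longrightarrow> (\<And>q. p = (\<lambda>y. \<Sum>\<alpha>\<in>Smp N. q \<alpha> * mon \<alpha> y) \<Longrightarrow> thesis) \<Longrightarrow> thesis"
  unfolding PF_def by (elim CollectE exE) blast

lemma PF_add: "p \<in> PF N \<Longrightarrow> p' \<in> PF N \<Longrightarrow> p + p' \<in> PF N"
proof (elim PF_E)
  fix q q' assume "p = (\<lambda>y. \<Sum>\<alpha>\<in>Smp N. q \<alpha> * mon \<alpha> y)" "p' = (\<lambda>y. \<Sum>\<alpha>\<in>Smp N. q' \<alpha> * mon \<alpha> y)"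
  then show "p + p' \<in> PF N"
    unfolding PF_def by (intro CollectI exI[of _ "\<lambda>\<alpha>. q \<alpha> + q' \<alpha>"]) (simp add: fun_eq_iff distrib_right sum.distrib)
qed

lemma PF_cmult: "p \<in> PF N \<Longrightarrow> cst c * p \<in> PF N"
proof (elim PF_E)
  fix q assume "p = (\<lambda>y. \<Sum>\<alpha>\<in>Smp N. q \<alpha> * mon \<alpha> y)"
  then show "cst c * p \<in> PF N"
    unfolding PF_def by (intro CollectI exI[of _ "\<lambda>\<alpha>. c * q \<alpha>"]) (simp add: fun_eq_iff mult.assoc sum_distrib_left)
qed

lemma PF_mon: "\<alpha> \<in> Smp N \<Longrightarrow> mon \<alpha> \<in> PF N"
proof -
  assume \<alpha>: "\<alpha> \<in> Smp N"
  have "mon \<alpha> y = (\<Sum>\<gamma>\<in>Smp N. (if \<gamma> = \<alpha> then 1 else 0) * mon \<gamma> y)" for y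
  proof -
    have "(\<Sum>\<gamma>\<in>Smp N. (if \<gamma> = \<alpha> then 1 else 0) * mon \<gamma> y) = (\<Sum>\<gamma>\<in>Smp N. if \<gamma> = \<alpha> then mon \<alpha> y else 0)"
      by (intro sum.cong) auto
    then show ?thesis using \<alpha> by simp
  qed
  then show ?thesis unfolding PF_def by (intro CollectI exI ext)
qed

lemma PF_0: "0 \<in> PF N"
  unfolding PF_def by (intro CollectI exI[of _ "\<lambda>_. 0"]) (simp add: fun_eq_iff)

lemma PF_subset:
  assumes "p \<in> PF N" "0 \<in> X" "\<And>a b. a \<in> X \<Longrightarrow> b \<in> X \<Longrightarrow> a + b \<in> X"
    "\<And>c \<alpha>. \<alpha> \<in> Smp N \<Longrightarrow> cst c * mon \<alpha> \<in> X"
  shows "p \<in> X"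
proof -
  obtain q where p: "p = (\<lambda>y. \<Sum>\<alpha>\<in>Smp N. q \<alpha> * mon \<alpha> y)" using assms(1) by (rule PF_E)
  have "p = (\<Sum>\<alpha>\<in>Smp N. cst (q \<alpha>) * mon \<alpha>)" unfolding p by (simp add: fun_eq_iff sum_fun_apply)
  moreover have "(\<Sum>\<alpha>\<in>S. cst (q \<alpha>) * mon \<alpha>) \<in> X" if "S \<subseteq> Smp N" for S
    using that by (induction S rule: infinite_finite_induct) (use assms in auto)
  ultimately show ?thesis by simp
qed

lemma Smp_mono: "N \<le> N' \<Longrightarrow> Smp N \<subseteq> Smp N'"
  by (auto simp: Smp_def)

lemma Smp_add: "\<alpha> \<in> Smp N \<Longrightarrow> \<gamma> \<in> Smp N' \<Longrightarrow> (\<lambda>k. \<alpha> k + \<gamma> k) \<in> Smp (N + N')"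
  by (simp add: Smp_def sum.distrib)

lemma PF_mono: "N \<le> N' \<Longrightarrow> p \<in> PF N \<Longrightarrow> p \<in> PF N'"
  by (rule PF_subset[where N = N]) (auto intro: PF_0 PF_add PF_cmult PF_mon subsetD[OF Smp_mono])

lemma PF_mult:
  assumes "p \<in> PF N" "p' \<in> PF N'" shows "p * p' \<in> PF (N + N')"
  using assms(1)
proof (rule PF_subset[where X = "{p. p * p' \<in> PF (N + N')}", THEN CollectD], goal_cases)
  case (3 c \<alpha>)
  have "cst c * mon \<alpha> * p' \<in> PF (N + N')"
    using assms(2)
  proof (rule PF_subset[where X = "{p'. cst c * mon \<alpha> * p' \<in> PF (N + N')}", THEN CollectD], goal_cases)
    case (3 e \<gamma>)
    have "cst c * mon \<alpha> * (cst e * mon \<gamma>) = cst (c * e) * mon (\<lambda>k. \<alpha> k + \<gamma> k)"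
      by (simp add: fun_eq_iff mon_mult[symmetric])
    then show ?case using 3 \<open>\<alpha> \<in> Smp N\<close> by (auto intro!: PF_cmult PF_mon Smp_add)
  qed (auto simp: distrib_left PF_0 intro: PF_add)
  then show ?case by simp
qed (auto simp: distrib_right PF_0 intro: PF_add)

lemma PF_cst: "(cst c :: complex ^ 'd::finite \<Rightarrow> complex) \<in> PF N"
proof -
  have "cst c * mon (\<lambda>_ :: 'd. 0) \<in> PF N" by (intro PF_cmult PF_mon) (simp add: Smp_def)
  moreover have "cst c * mon (\<lambda>_ :: 'd. 0) = cst c" by (simp add: fun_eq_iff mon_def)
  ultimately show ?thesis by (simp only:)
qed

lemma PF_coord: "(\<lambda>y. y $ k) \<in> PF 1"
proof -
  have "mon (\<lambda>i. if i = k then 1 else 0) y = y $ k" for y :: "complex ^ 'a"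
  proof -
    have "mon (\<lambda>i. if i = k then 1 else 0) y = (\<Prod>i\<in>UNIV. if i = k then y $ k else 1)"
      unfolding mon_def by (intro prod.cong) auto
    then show ?thesis by simp
  qed
  then have "mon (\<lambda>i. if i = k then 1 else 0) = (\<lambda>y. y $ k)" by (rule ext)
  moreover have "mon (\<lambda>i. if i = k then 1 else 0) \<in> PF 1" by (rule PF_mon) (simp add: Smp_def)
  ultimately show ?thesis by (simp only:)
qed

lemma PF_line:
  assumes "p \<in> PF N" shows "\<exists>P. \<forall>s. p (x + s *s v) = poly P s"
  using assms
proof (rule PF_subset[where X = "{p. \<exists>P. \<forall>s. p (x + s *s v) = poly P s}", THEN CollectD], goal_cases)
  case 1
  show ?case by (intro CollectI exI[of _ 0]) simp
next
  case (2 a b)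
  then obtain P Q where "\<forall>s. a (x + s *s v) = poly P s" "\<forall>s. b (x + s *s v) = poly Q s" by blast
  then show ?case by (intro CollectI exI[of _ "P + Q"]) simp
next
  case (3 c \<alpha>)
  show ?case
    by (intro CollectI exI[of _ "smult c (\<Prod>k\<in>UNIV. [:x $ k, v $ k:] ^ \<alpha> k)"])
      (simp add: mon_def poly_prod)
qed

text \<open>On the line from \<open>x\<close> to \<open>y\<close> the function is a polynomial in
  one parameter that vanishes on a real interval next to 0, hence everywhere.\<close>

lemma PF_zero_near:
  assumes p: "p \<in> PF N" and e: "0 < e" and z: "\<And>y. dist y x < e \<Longrightarrow> p y = 0"
  shows "p y = 0"
proof -
  obtain P where P: "\<And>s. p (x + s *s (y - x)) = poly P s" using PF_line[OF p] by blast
  define r where "r = e / (norm (y - x) + 1)"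
  have r: "0 < r" using e by (simp add: r_def add_nonneg_pos)
  have "poly P (complex_of_real s) = 0" if s: "0 < s" "s < r" for s
  proof -
    have "norm (complex_of_real s *s (y - x)) = s * norm (y - x)"
    proof -
      have "complex_of_real s *s (y - x) = s *\<^sub>R (y - x)"
        by (simp add: vec_eq_iff scaleR_conv_of_real[where 'a = complex] right_diff_distrib)
      then show ?thesis using s by simp
    qed
    also have "\<dots> \<le> s * (norm (y - x) + 1)" using s by (intro mult_left_mono) auto
    also have "\<dots> < r * (norm (y - x) + 1)" using s by (intro mult_strict_right_mono) (auto intro: add_nonneg_pos)
    also have "\<dots> = e" by (simp add: r_def add_nonneg_eq_0_iff)
    finally have "dist (x + complex_of_real s *s (y - x)) x < e" by (simp add: dist_norm)
    then show ?thesis using z P by metis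
  qed
  then have "complex_of_real ` {0<..<r} \<subseteq> {s. poly P s = 0}" by auto
  moreover have "infinite (complex_of_real ` {0<..<r})"
    using r by (subst finite_image_iff) (auto intro: inj_onI)
  ultimately have "P = 0" using poly_roots_finite[of P] finite_subset by blast
  then show ?thesis using P[of 1] by simp
qed

section \<open>Fibres of generic linear projections\<close>

definition mx :: "'d::finite torus \<Rightarrow> ('d torus \<Rightarrow> complex) set" where
  "mx \<tau> = {g \<in> Laur. g \<tau> = 0}"

lemma mx_add: "g \<in> mx \<tau> \<Longrightarrow> h \<in> mx \<tau> \<Longrightarrow> g + h \<in> mx \<tau>"
  and mx_diff: "g \<in> mx \<tau> \<Longrightarrow> h \<in> mx \<tau> \<Longrightarrow> g - h \<in> mx \<tau>"
  and mx_0: "0 \<in> mx \<tau>"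
  and mx_mult: "g \<in> Laur \<Longrightarrow> h \<in> mx \<tau> \<Longrightarrow> g * h \<in> mx \<tau>"
  by (auto simp: mx_def intro: Laur_add Laur_mult Laur_diff)

lemma mx_Laur: "g \<in> mx \<tau> \<Longrightarrow> g \<in> Laur" and mx_zero: "g \<in> mx \<tau> \<Longrightarrow> g \<tau> = 0"
  by (auto simp: mx_def)

lemma mx_cst: "g \<in> Laur \<Longrightarrow> g - cst (g \<tau>) \<in> mx \<tau>"
  by (auto simp: mx_def intro: Laur_diff)

lemma mx_sum: "(\<And>i. i \<in> X \<Longrightarrow> f i \<in> mx \<tau>) \<Longrightarrow> (\<Sum>i\<in>X. f i) \<in> mx \<tau>"
  by (induction X rule: infinite_finite_induct) (auto intro: mx_add mx_0)

text \<open>Local coordinates at \<open>\<tau>\<close>, generating the ideal of the point. Dividing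
  by \<open>tc \<tau> k\<close> makes the linear coefficients logarithmic derivatives, which suit
  characters.\<close>

definition zf :: "'d::finite torus \<Rightarrow> 'd \<Rightarrow> 'd torus \<Rightarrow> complex" where
  "zf \<tau> k = cst (1 / tc \<tau> k) * ch (axis k 1) - 1"

lemma zf_apply: "zf \<tau> k \<sigma> = tc \<sigma> k / tc \<tau> k - 1"
  by (simp add: zf_def)

text \<open>
  First-order expansion at \<open>\<tau>\<close> with logarithmic derivatives \<open>g'\<close>.
\<close>

definition tay :: "'d::finite torus \<Rightarrow> ('d torus \<Rightarrow> complex) \<Rightarrow> ('d \<Rightarrow> complex) \<Rightarrow> bool" where
  "tay \<tau> g g' \<longleftrightarrow> (\<exists>h. (\<forall>k. h k \<in> mx \<tau>) \<and> g - cst (g \<tau>) = (\<Sum>k\<in>UNIV. (cst (g' k) + h k) * zf \<tau> k))"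

lemma tayI:
  assumes "\<And>k. h k \<in> mx \<tau>" "\<And>\<sigma>. g \<sigma> - g \<tau> = (\<Sum>k\<in>UNIV. (g' k + h k \<sigma>) * zf \<tau> k \<sigma>)"
  shows "tay \<tau> g g'"
  unfolding tay_def using assms by (intro exI[of _ h]) (simp add: fun_eq_iff sum_fun_apply)

lemma tayD:
  assumes "tay \<tau> g g'"
  shows "\<exists>h. (\<forall>k. h k \<in> mx \<tau>) \<and> (\<forall>\<sigma>. g \<sigma> - g \<tau> = (\<Sum>k\<in>UNIV. (g' k + h k \<sigma>) * zf \<tau> k \<sigma>))"
proof -
  from assms obtain h where h: "\<forall>k. h k \<in> mx \<tau>" "g - cst (g \<tau>) = (\<Sum>k\<in>UNIV. (cst (g' k) + h k) * zf \<tau> k)"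
    unfolding tay_def by (elim exE conjE)
  have "g \<sigma> - g \<tau> = (\<Sum>k\<in>UNIV. (g' k + h k \<sigma>) * zf \<tau> k \<sigma>)" for \<sigma>
    using fun_cong[OF h(2), of \<sigma>] by (simp add: sum_fun_apply)
  with h(1) show ?thesis by (intro exI[of _ h] conjI allI) auto
qed

lemma tay_add: assumes "tay \<tau> g g'" "tay \<tau> h h'" shows "tay \<tau> (g + h) (\<lambda>k. g' k + h' k)"
proof -
  obtain a where "\<forall>k. a k \<in> mx \<tau>" "\<forall>\<sigma>. g \<sigma> - g \<tau> = (\<Sum>k\<in>UNIV. (g' k + a k \<sigma>) * zf \<tau> k \<sigma>)"
    using tayD[OF assms(1)] by (elim exE conjE)
  note a = this[rule_format]
  obtain b where "\<forall>k. b k \<in> mx \<tau>" "\<forall>\<sigma>. h \<sigma> - h \<tau> = (\<Sum>k\<in>UNIV. (h' k + b k \<sigma>) * zf \<tau> k \<sigma>)"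
    using tayD[OF assms(2)] by (elim exE conjE)
  note b = this[rule_format]
  show ?thesis
  proof (rule tayI[where h = "\<lambda>k. a k + b k"])
    show "a k + b k \<in> mx \<tau>" for k using a(1) b(1) by (rule mx_add)
    fix \<sigma>
    have "(g + h) \<sigma> - (g + h) \<tau> = (g \<sigma> - g \<tau>) + (h \<sigma> - h \<tau>)" by simp
    also have "\<dots> = (\<Sum>k\<in>UNIV. (g' k + a k \<sigma>) * zf \<tau> k \<sigma>) + (\<Sum>k\<in>UNIV. (h' k + b k \<sigma>) * zf \<tau> k \<sigma>)"
      by (simp only: a(2) b(2))
    also have "\<dots> = (\<Sum>k\<in>UNIV. (g' k + h' k + (a k + b k) \<sigma>) * zf \<tau> k \<sigma>)"
      unfolding sum.distrib[symmetric] by (rule sum.cong[OF refl]) (simp add: algebra_simps)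
    finally show "(g + h) \<sigma> - (g + h) \<tau> = (\<Sum>k\<in>UNIV. (g' k + h' k + (a k + b k) \<sigma>) * zf \<tau> k \<sigma>)" .
  qed
qed

lemma tay_cmult: assumes "tay \<tau> g g'" shows "tay \<tau> (cst c * g) (\<lambda>k. c * g' k)"
proof -
  obtain a where "\<forall>k. a k \<in> mx \<tau>" "\<forall>\<sigma>. g \<sigma> - g \<tau> = (\<Sum>k\<in>UNIV. (g' k + a k \<sigma>) * zf \<tau> k \<sigma>)"
    using tayD[OF assms(1)] by (elim exE conjE)
  note a = this[rule_format]
  show ?thesis
  proof (rule tayI[where h = "\<lambda>k. cst c * a k"])
    show "cst c * a k \<in> mx \<tau>" for k using a(1) by (rule mx_mult[OF Laur_cst])
    fix \<sigma>
    have "(cst c * g) \<sigma> - (cst c * g) \<tau> = c * (g \<sigma> - g \<tau>)" by (simp add: algebra_simps)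
    also have "\<dots> = c * (\<Sum>k\<in>UNIV. (g' k + a k \<sigma>) * zf \<tau> k \<sigma>)" by (simp only: a(2))
    also have "\<dots> = (\<Sum>k\<in>UNIV. (c * g' k + (cst c * a k) \<sigma>) * zf \<tau> k \<sigma>)"
      unfolding sum_distrib_left by (rule sum.cong[OF refl]) (simp add: algebra_simps)
    finally show "(cst c * g) \<sigma> - (cst c * g) \<tau> = (\<Sum>k\<in>UNIV. (c * g' k + (cst c * a k) \<sigma>) * zf \<tau> k \<sigma>)" .
  qed
qed

lemma tay_0: "tay \<tau> 0 (\<lambda>k. 0)"
  by (rule tayI[where h = "\<lambda>k. 0"]) (simp_all add: mx_0)

lemma tay_sum:
  assumes "finite X" "\<And>i. i \<in> X \<Longrightarrow> tay \<tau> (g i) (g' i)" shows "tay \<tau> (\<Sum>i\<in>X. g i) (\<lambda>k. \<Sum>i\<in>X. g' i k)"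
  using assms
proof (induction X rule: finite_induct)
  case empty
  show "tay \<tau> (\<Sum>i\<in>{}. g i) (\<lambda>k. \<Sum>i\<in>{}. g' i k)" using tay_0 by simp
next
  case (insert i X)
  have "tay \<tau> (\<Sum>i\<in>X. g i) (\<lambda>k. \<Sum>i\<in>X. g' i k)" using insert.IH insert.prems by blast
  from tay_add[OF insert.prems[of i] this] insert.hyps
  show "tay \<tau> (\<Sum>i\<in>insert i X. g i) (\<lambda>k. \<Sum>i\<in>insert i X. g' i k)" by simp
qed

lemma tay_mult:
  assumes "tay \<tau> g g'" "tay \<tau> h h'" "g \<in> Laur"
  shows "tay \<tau> (g * h) (\<lambda>k. g \<tau> * h' k + h \<tau> * g' k)"
proof -
  obtain a where "\<forall>k. a k \<in> mx \<tau>" "\<forall>\<sigma>. g \<sigma> - g \<tau> = (\<Sum>k\<in>UNIV. (g' k + a k \<sigma>) * zf \<tau> k \<sigma>)"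
    using tayD[OF assms(1)] by (elim exE conjE)
  note a = this[rule_format]
  obtain b where "\<forall>k. b k \<in> mx \<tau>" "\<forall>\<sigma>. h \<sigma> - h \<tau> = (\<Sum>k\<in>UNIV. (h' k + b k \<sigma>) * zf \<tau> k \<sigma>)"
    using tayD[OF assms(2)] by (elim exE conjE)
  note b = this[rule_format]
  define e where "e k = (cst (h' k) + b k) * (g - cst (g \<tau>)) + cst (g \<tau>) * b k + cst (h \<tau>) * a k" for k
  show ?thesis
  proof (rule tayI[where h = e])
    show "e k \<in> mx \<tau>" for k unfolding e_def
      using a(1) b(1) mx_cst[OF assms(3)] mx_Laur by (intro mx_add mx_mult Laur_add Laur_cst) blast+
    fix \<sigma>
    have "(g * h) \<sigma> - (g * h) \<tau> = (g \<sigma> - g \<tau>) * (h \<sigma> - h \<tau>) + g \<tau> * (h \<sigma> - h \<tau>) + h \<tau> * (g \<sigma> - g \<tau>)"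
      by (simp add: algebra_simps)
    also have "\<dots> = (g \<sigma> - g \<tau>) * (\<Sum>k\<in>UNIV. (h' k + b k \<sigma>) * zf \<tau> k \<sigma>)
        + g \<tau> * (\<Sum>k\<in>UNIV. (h' k + b k \<sigma>) * zf \<tau> k \<sigma>) + h \<tau> * (\<Sum>k\<in>UNIV. (g' k + a k \<sigma>) * zf \<tau> k \<sigma>)"
      by (simp only: b(2)[of \<sigma>, symmetric] a(2)[of \<sigma>, symmetric])
    also have "\<dots> = (\<Sum>k\<in>UNIV. (g \<tau> * h' k + h \<tau> * g' k + e k \<sigma>) * zf \<tau> k \<sigma>)"
      unfolding sum_distrib_left sum.distrib[symmetric] e_def
      by (rule sum.cong[OF refl]) (simp add: algebra_simps)
    finally show "(g * h) \<sigma> - (g * h) \<tau> = (\<Sum>k\<in>UNIV. (g \<tau> * h' k + h \<tau> * g' k + e k \<sigma>) * zf \<tau> k \<sigma>)" .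
  qed
qed

text \<open>The exponents for which the expansion holds form a subgroup containing the unit
  vectors.\<close>

lemma tay_ch: "tay \<tau> (ch u) (\<lambda>k. of_int (u $ k) * ch u \<tau>)"
proof -
  define T where "T = {u. tay \<tau> (ch u) (\<lambda>k. of_int (u $ k) * ch u \<tau>)}"
  have z: "0 \<in> T"
    unfolding T_def by (rule CollectI, rule tayI[where h = "\<lambda>_. 0"]) (simp_all add: mx_0)
  have add: "u + v \<in> T" if "u \<in> T" "v \<in> T" for u v
  proof -
    have eq: "ch u * ch v = ch (u + v)" by (simp add: fun_eq_iff ch_add)
    from tay_mult[of \<tau> "ch u" _ "ch v"] that
    have "tay \<tau> (ch (u + v)) (\<lambda>k. ch u \<tau> * (of_int (v $ k) * ch v \<tau>) + ch v \<tau> * (of_int (u $ k) * ch u \<tau>))"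
      unfolding T_def eq[symmetric] using Laur_ch by blast
    also have "(\<lambda>k. ch u \<tau> * (of_int (v $ k) * ch v \<tau>) + ch v \<tau> * (of_int (u $ k) * ch u \<tau>))
        = (\<lambda>k. of_int ((u + v) $ k) * ch (u + v) \<tau>)"
      by (simp add: fun_eq_iff ch_add algebra_simps)
    finally show ?thesis by (simp add: T_def)
  qed
  have neg: "- u \<in> T" if uT: "u \<in> T" for u
  proof -
    obtain h where "\<forall>k. h k \<in> mx \<tau>"
      "\<forall>\<sigma>. ch u \<sigma> - ch u \<tau> = (\<Sum>k\<in>UNIV. (of_int (u $ k) * ch u \<tau> + h k \<sigma>) * zf \<tau> k \<sigma>)"
      using tayD[OF CollectD[OF uT[unfolded T_def]]] by (elim exE conjE)
    note h = this[rule_format]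
    define e where "e k = cst (of_int (u $ k)) * (cst (ch (- u) \<tau>) - ch (- u))
        - cst (ch (- u) \<tau>) * (ch (- u) * h k)" for k
    have "tay \<tau> (ch (- u)) (\<lambda>k. of_int ((- u) $ k) * ch (- u) \<tau>)"
    proof (rule tayI[where h = e])
      show "e k \<in> mx \<tau>" for k
      proof -
        have "cst (ch (- u) \<tau>) - ch (- u) \<in> mx \<tau>"
          by (auto simp: mx_def intro: Laur_diff)
        then show ?thesis unfolding e_def
          by (intro mx_diff[OF mx_mult[OF Laur_cst] mx_mult[OF Laur_cst mx_mult[OF Laur_ch h(1)]]])
      qed
      fix \<sigma>
      have "ch (- u) \<sigma> - ch (- u) \<tau> = - (ch (- u) \<tau> * ch (- u) \<sigma> * (ch u \<sigma> - ch u \<tau>))"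
        by (simp add: ch_minus field_simps)
      also have "\<dots> = (\<Sum>k\<in>UNIV. (of_int ((- u) $ k) * ch (- u) \<tau> + e k \<sigma>) * zf \<tau> k \<sigma>)"
        unfolding h(2) sum_distrib_left sum_negf[symmetric]
      proof (rule sum.cong[OF refl])
        fix k
        have "ch (- u) \<tau> * ch u \<tau> = 1" by (simp add: ch_minus)
        then have "- (ch (- u) \<tau> * ch (- u) \<sigma> * (of_int (u $ k) * ch u \<tau> + h k \<sigma>)) = of_int ((- u) $ k) * ch (- u) \<tau> + e k \<sigma>"
          unfolding e_def by (simp add: algebra_simps)
        then show "- (ch (- u) \<tau> * ch (- u) \<sigma> * ((of_int (u $ k) * ch u \<tau> + h k \<sigma>) * zf \<tau> k \<sigma>)) =
            (of_int ((- u) $ k) * ch (- u) \<tau> + e k \<sigma>) * zf \<tau> k \<sigma>"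
          by (metis minus_mult_left mult.assoc)
      qed
      finally show "ch (- u) \<sigma> - ch (- u) \<tau> = (\<Sum>k\<in>UNIV. (of_int ((- u) $ k) * ch (- u) \<tau> + e k \<sigma>) * zf \<tau> k \<sigma>)" .
    qed
    then show ?thesis by (simp add: T_def)
  qed
  have ax: "axis k 1 \<in> T" for k
  proof -
    have "tay \<tau> (ch (axis k 1)) (\<lambda>i. of_int (axis k 1 $ i) * ch (axis k 1) \<tau>)"
    proof (rule tayI[where h = "\<lambda>_. 0"])
      fix \<sigma>
      have "(\<Sum>i\<in>UNIV. (of_int (axis k 1 $ i) * ch (axis k 1) \<tau> + 0 \<sigma>) * zf \<tau> i \<sigma>)
          = (\<Sum>i\<in>UNIV. if i = k then tc \<tau> k * zf \<tau> k \<sigma> else 0)"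
      proof (rule sum.cong[OF refl])
        fix i
        have "i \<noteq> k \<Longrightarrow> axis k 1 $ i = (0 :: int)" by (simp add: axis_def)
        then show "(of_int (axis k 1 $ i) * ch (axis k 1) \<tau> + 0 \<sigma>) * zf \<tau> i \<sigma> = (if i = k then tc \<tau> k * zf \<tau> k \<sigma> else 0)"
          by (cases "i = k") simp_all
      qed
      also have "\<dots> = ch (axis k 1) \<sigma> - ch (axis k 1) \<tau>" by (simp add: zf_apply field_simps)
      finally show "ch (axis k 1) \<sigma> - ch (axis k 1) \<tau> =
          (\<Sum>i\<in>UNIV. (of_int (axis k 1 $ i) * ch (axis k 1) \<tau> + 0 \<sigma>) * zf \<tau> i \<sigma>)" by (rule sym)
    qed (simp add: mx_0)
    then show ?thesis by (simp add: T_def)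
  qed
  have scale: "n *s axis k 1 \<in> T" for n :: int and k
  proof (induction n rule: int_induct[where k = 0])
    case base
    show ?case using z by simp
  next
    case (step1 i)
    then show ?case using add[OF step1(2) ax[of k]] by (simp add: vector_sadd_rdistrib)
  next
    case (step2 i)
    then show ?case using add[OF step2(2) neg[OF ax[of k]]] by (simp add: vector_sub_rdistrib)
  qed
  have "(\<Sum>k\<in>X. (u $ k) *s axis k 1) \<in> T" if "finite X" for X
    using that by induction (auto simp: z intro: add scale)
  from this[of UNIV] have "u \<in> T" by (simp add: basis_expansion)
  then show ?thesis by (simp add: T_def)
qed

lemma Laur_minus_cst_zf:
  assumes "g \<in> Laur"
  shows "\<exists>h. (\<forall>k. h k \<in> Laur) \<and> g - cst (g \<tau>) = (\<Sum>k\<in>UNIV. h k * zf \<tau> k)"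
proof -
  have "\<exists>g'. tay \<tau> g g'"
    using assms
  proof (induction rule: Laur_induct)
    case (add a b)
    then obtain a' b' where "tay \<tau> a a'" "tay \<tau> b b'" by blast
    from tay_add[OF this] show "\<exists>g'. tay \<tau> (a + b) g'" by blast
  next
    case (ch c u)
    from tay_cmult[OF tay_ch] show "\<exists>g'. tay \<tau> (cst c * ch u) g'" by blast
  qed
  then obtain g' h where h: "\<forall>k. h k \<in> mx \<tau>" "g - cst (g \<tau>) = (\<Sum>k\<in>UNIV. (cst (g' k) + h k) * zf \<tau> k)"
    unfolding tay_def by (elim exE conjE)
  have "cst (g' k) + h k \<in> Laur" for k
    by (rule Laur_add[OF Laur_cst mx_Laur[OF spec[OF h(1)]]])
  with h(2) show ?thesis by (intro exI[of _ "\<lambda>k. cst (g' k) + h k"]) simp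
qed

context liss
begin

text \<open>
  \<open>A $ k $ j * yf j\<close> is the derivative of \<open>xf j\<close> with respect to \<open>log t\<^sub>k\<close>.
\<close>

definition yf :: "'n \<Rightarrow> 'd torus \<Rightarrow> complex" where
  "yf j \<tau> = (ch (column j A) \<tau> / \<beta> j - \<beta> j * ch (- column j A) \<tau>) / 2"

definition Jac :: "('d \<Rightarrow> complex ^ 'n) \<Rightarrow> 'd torus \<Rightarrow> complex ^ 'd ^ 'd" where
  "Jac M \<tau> = (\<chi> i k. \<Sum>j\<in>UNIV. M i $ j * (of_int (A $ k $ j) * yf j \<tau>))"

text \<open>A linear projection of the variety to \<open>CARD('d)\<close> coordinates. Its fibres
  are the preimages in the torus of the sections by affine-linear spaces of that
  codimension.\<close>

definition Fm :: "('d \<Rightarrow> complex ^ 'n) \<Rightarrow> 'd torus \<Rightarrow> complex ^ 'd" where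
  "Fm M \<tau> = (\<chi> i. lf (M i) \<tau>)"

lemma tay_lf: "tay \<tau> (lf (M i)) (\<lambda>k. Jac M \<tau> $ i $ k)"
proof -
  have x: "tay \<tau> (xf j) (\<lambda>k. of_int (A $ k $ j) * yf j \<tau>)" for j
  proof -
    have "(\<lambda>k. 1 / (2 * \<beta> j) * (of_int (column j A $ k) * ch (column j A) \<tau>) +
        \<beta> j / 2 * (of_int ((- column j A) $ k) * ch (- column j A) \<tau>)) = (\<lambda>k. of_int (A $ k $ j) * yf j \<tau>)"
      by (simp add: fun_eq_iff yf_def column_def field_simps)
    then show ?thesis
      using tay_add[OF tay_cmult[OF tay_ch, of \<tau> "1 / (2 * \<beta> j)" "column j A"]
          tay_cmult[OF tay_ch, of \<tau> "\<beta> j / 2" "- column j A"]]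
      unfolding xf_eq by simp
  qed
  have "tay \<tau> (\<Sum>j\<in>UNIV. cst (M i $ j) * xf j) (\<lambda>k. \<Sum>j\<in>UNIV. M i $ j * (of_int (A $ k $ j) * yf j \<tau>))"
    by (intro tay_sum tay_cmult x) simp
  then show ?thesis unfolding lf_eq Jac_def vec_lambda_beta .
qed

end

section \<open>Ideals of Laurent polynomials and their common zeros\<close>

lemma Laur_poly: "t \<in> Laur \<Longrightarrow> (\<lambda>\<sigma>. poly q (t \<sigma>)) \<in> Laur"
proof (induction q)
  case 0
  have "(\<lambda>\<sigma>. poly 0 (t \<sigma>)) = cst 0" by simp
  then show "(\<lambda>\<sigma>. poly 0 (t \<sigma>)) \<in> Laur" using Laur_cst by (simp only:)
next
  case (pCons a q)
  have "(\<lambda>\<sigma>. poly (pCons a q) (t \<sigma>)) = cst a + t * (\<lambda>\<sigma>. poly q (t \<sigma>))"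
    by (simp add: fun_eq_iff)
  then show "(\<lambda>\<sigma>. poly (pCons a q) (t \<sigma>)) \<in> Laur"
    using Laur_add[OF Laur_cst Laur_mult[OF pCons.prems pCons.IH[OF pCons.prems]]] by (simp only:)
qed

definition Laur_ideal :: "('d::finite torus \<Rightarrow> complex) set \<Rightarrow> bool" where
  "Laur_ideal E \<longleftrightarrow> E \<subseteq> Laur \<and> 0 \<in> E \<and> (\<forall>a\<in>E. \<forall>b\<in>E. a + b \<in> E) \<and> (\<forall>r\<in>Laur. \<forall>a\<in>E. r * a \<in> E)"

lemma Laur_ideal_add: "Laur_ideal E \<Longrightarrow> a \<in> E \<Longrightarrow> b \<in> E \<Longrightarrow> a + b \<in> E"
  and Laur_ideal_mult: "Laur_ideal E \<Longrightarrow> r \<in> Laur \<Longrightarrow> a \<in> E \<Longrightarrow> r * a \<in> E"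
  and Laur_ideal_0: "Laur_ideal E \<Longrightarrow> 0 \<in> E"
  and Laur_ideal_Laur: "Laur_ideal E \<Longrightarrow> a \<in> E \<Longrightarrow> a \<in> Laur"
  by (auto simp: Laur_ideal_def)

lemma Laur_ideal_diff: assumes "Laur_ideal E" "a \<in> E" "b \<in> E" shows "a - b \<in> E"
proof -
  have "(cst (-1) :: _ torus \<Rightarrow> complex) * b \<in> E"
    by (rule Laur_ideal_mult[OF assms(1) Laur_cst assms(3)])
  from Laur_ideal_add[OF assms(1,2) this]
  show ?thesis by (simp add: fun_diff_def plus_fun_def times_fun_def)
qed

lemma Laur_ideal_sum:
  assumes "Laur_ideal E" "\<And>i. i \<in> X \<Longrightarrow> f i \<in> E" shows "(\<Sum>i\<in>X. f i) \<in> E"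
  using assms(2) by (induction X rule: infinite_finite_induct) (auto intro: Laur_ideal_add[OF assms(1)] Laur_ideal_0[OF assms(1)])

definition ideal_plus :: "('d::finite torus \<Rightarrow> complex) set \<Rightarrow> ('d torus \<Rightarrow> complex) \<Rightarrow> ('d torus \<Rightarrow> complex) set" where
  "ideal_plus E g = {e + g * b | e b. e \<in> E \<and> b \<in> Laur}"

lemma ideal_plus: assumes "Laur_ideal E" "g \<in> Laur"
  shows "Laur_ideal (ideal_plus E g)" "E \<subseteq> ideal_plus E g" "g \<in> ideal_plus E g"
proof -
  have "e + g * b \<in> ideal_plus E g" if "e \<in> E" "b \<in> Laur" for e b
    using that by (auto simp: ideal_plus_def)
  note I = this
  show "E \<subseteq> ideal_plus E g"
  proof
    fix e assume "e \<in> E"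
    from I[OF this Laur_0] show "e \<in> ideal_plus E g" by simp
  qed
  show "g \<in> ideal_plus E g"
    using I[OF Laur_ideal_0[OF assms(1)] Laur_1] by simp
  show "Laur_ideal (ideal_plus E g)"
    unfolding Laur_ideal_def
  proof (intro conjI ballI subsetI)
    fix a assume "a \<in> ideal_plus E g"
    then obtain e b where a: "a = e + g * b" "e \<in> E" "b \<in> Laur" by (auto simp: ideal_plus_def)
    show "a \<in> Laur" unfolding a(1)
      by (rule Laur_add[OF Laur_ideal_Laur[OF assms(1) a(2)] Laur_mult[OF assms(2) a(3)]])
    {
      fix a' assume "a' \<in> ideal_plus E g"
      then obtain e' b' where a': "a' = e' + g * b'" "e' \<in> E" "b' \<in> Laur" by (auto simp: ideal_plus_def)
      have eq: "a + a' = (e + e') + g * (b + b')" unfolding a(1) a'(1) by (simp add: algebra_simps)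
      show "a + a' \<in> ideal_plus E g"
        unfolding eq by (rule I[OF Laur_ideal_add[OF assms(1) a(2) a'(2)] Laur_add[OF a(3) a'(3)]])
    }
    fix r assume r: "r \<in> (Laur :: ('a torus \<Rightarrow> complex) set)"
    have eq: "r * a = r * e + g * (r * b)" unfolding a(1) by (simp add: algebra_simps)
    show "r * a \<in> ideal_plus E g"
      unfolding eq by (rule I[OF Laur_ideal_mult[OF assms(1) r a(2)] Laur_mult[OF r a(3)]])
  next
    show "0 \<in> ideal_plus E g" using I[OF Laur_ideal_0[OF assms(1)] Laur_0] by simp
  qed
qed

text \<open>A Nullstellensatz step by splitting off roots: if 1 lies in the ideal enlarged by
  \<open>t - c\<close> for a root \<open>c\<close> of \<open>q\<close>, then the cofactor
  \<open>q'\<close> evaluated at \<open>t\<close> already lies in \<open>E\<close>, and the degree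
  drops. The descent must stop, since a nonzero constant cannot lie in \<open>E\<close>.\<close>

lemma ideal_plus_root:
  assumes "Laur_ideal E" "1 \<notin> E" "t \<in> Laur" "q \<noteq> 0" "(\<lambda>\<sigma>. poly q (t \<sigma>)) \<in> E"
  shows "\<exists>c. 1 \<notin> ideal_plus E (t - cst c)"
  using assms(4,5)
proof (induction "degree q" arbitrary: q rule: less_induct)
  case less
  show ?case
  proof (cases "degree q = 0")
    case True
    then obtain a where q: "q = [:a:]" by (rule degree_eq_zeroE)
    then have "cst (1 / a) * (\<lambda>\<sigma>. poly q (t \<sigma>)) \<in> E"
      by (intro Laur_ideal_mult[OF assms(1) Laur_cst less.prems(2)])
    moreover have "cst (1 / a) * (\<lambda>\<sigma>. poly q (t \<sigma>)) = 1" using q less.prems(1) by (simp add: fun_eq_iff)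
    ultimately show ?thesis using assms(2) by simp
  next
    case False
    then have "\<not> constant (poly q)" by (simp add: constant_degree)
    from fundamental_theorem_of_algebra[OF this] obtain c where c: "poly q c = 0" ..
    then obtain q' where q': "q = [:- c, 1:] * q'" by (auto simp: poly_eq_0_iff_dvd)
    with less.prems(1) have nz: "q' \<noteq> 0" by auto
    then have deg: "degree q = Suc (degree q')" unfolding q' by (subst degree_mult_eq) auto
    show ?thesis
    proof (rule ccontr)
      assume neg: "\<not> ?thesis"
      then have "1 \<in> ideal_plus E (t - cst c)" by blast
      then obtain e b where e: "1 = e + (t - cst c) * b" "e \<in> E" "b \<in> Laur" by (auto simp: ideal_plus_def)
      let ?q = "\<lambda>\<sigma>. poly q (t \<sigma>)" and ?q' = "\<lambda>\<sigma>. poly q' (t \<sigma>)"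
      have eq: "?q = (t - cst c) * ?q'" unfolding q' by (simp add: fun_eq_iff algebra_simps)
      have "?q' = (e + (t - cst c) * b) * ?q'" unfolding e(1)[symmetric] by simp
      also have "\<dots> = ?q' * e + b * ?q" unfolding eq by (simp add: algebra_simps)
      finally have "?q' = ?q' * e + b * ?q" .
      moreover have "?q' * e + b * ?q \<in> E"
        using e less.prems(2)
        by (intro Laur_ideal_add[OF assms(1)] Laur_ideal_mult[OF assms(1)] Laur_poly assms(3))
      ultimately have "?q' \<in> E" by (simp only:)
      from less.hyps[OF _ nz this] deg neg show False by simp
    qed
  qed
qed

text \<open>Values \<open>l k\<close> for the coordinates are adjoined one at a time, each a root of
  the equation that the coordinate satisfies modulo \<open>E\<close>, while the ideal stays proper.
  They are nonzero because coordinates are units, so they form a point of the torus.\<close>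

lemma ideal_zero:
  assumes E: "Laur_ideal E" "1 \<notin> E"
    and fin: "\<And>k. \<exists>q. q \<noteq> 0 \<and> (\<lambda>\<sigma>. poly q (ch (axis k 1) \<sigma>)) \<in> E"
  shows "\<exists>\<tau>. \<forall>g\<in>E. g \<tau> = 0"
proof -
  define Q where "Q K E' l \<longleftrightarrow> Laur_ideal E' \<and> 1 \<notin> E' \<and> E \<subseteq> E' \<and> (\<forall>k\<in>K. ch (axis k 1) - cst (l k) \<in> E')"
    for K E' and l :: "'a \<Rightarrow> complex"
  have Q: "\<exists>E' l. Q K E' l" if "finite K" for K :: "'a set"
    using that
  proof induction
    case empty
    show ?case by (intro exI[of _ E]) (simp add: Q_def E)
  next
    case (insert k K)
    then obtain E' l where E': "Laur_ideal E'" "1 \<notin> E'" "E \<subseteq> E'" "\<And>i. i\<in>K \<Longrightarrow> ch (axis i 1) - cst (l i) \<in> E'"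
      unfolding Q_def by blast
    obtain q where "q \<noteq> 0" "(\<lambda>\<sigma>. poly q (ch (axis k 1) \<sigma>)) \<in> E'" using fin E'(3) by blast
    then obtain c where c: "1 \<notin> ideal_plus E' (ch (axis k 1) - cst c)"
      using ideal_plus_root[OF E'(1,2) Laur_ch] by blast
    have L: "ch (axis k 1) - cst c \<in> Laur" by (intro Laur_diff) auto
    note ip = ideal_plus[OF E'(1) L]
    have "ch (axis i 1) - cst ((l(k := c)) i) \<in> ideal_plus E' (ch (axis k 1) - cst c)"
      if "i \<in> insert k K" for i
      using that ip(2,3) E'(4) insert.hyps by (cases "i = k") auto
    then have "Q (insert k K) (ideal_plus E' (ch (axis k 1) - cst c)) (l(k := c))"
      unfolding Q_def using ip(1) c subset_trans[OF E'(3) ip(2)] by blast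
    then show ?case by blast
  qed
  obtain E' l where "Q UNIV E' l" using Q[of UNIV] by auto
  then have E': "Laur_ideal E'" "1 \<notin> E'" "E \<subseteq> E'" "\<And>k. ch (axis k 1) - cst (l k) \<in> E'"
    unfolding Q_def by blast+
  have "l k \<noteq> 0" for k
  proof
    assume "l k = 0"
    then have "ch (axis k 1) - 0 \<in> E'" using E'(4)[of k] by (simp only: zero_fun_def)
    then have "ch (- axis k 1) * (ch (axis k 1) - 0) \<in> E'"
      by (rule Laur_ideal_mult[OF E'(1) Laur_ch])
    moreover have "ch (- axis k 1) * (ch (axis k 1) - 0) = 1" by (simp add: fun_eq_iff ch_minus)
    ultimately show False using E'(2) by simp
  qed
  define \<tau> where "\<tau> = mkt l"
  have tc: "tc \<tau> k = l k" for k using \<open>\<And>k. l k \<noteq> 0\<close> by (simp add: \<tau>_def tc_mkt)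
  have zf: "zf \<tau> k \<in> E'" for k
  proof -
    have "zf \<tau> k = cst (1 / l k) * (ch (axis k 1) - cst (l k))"
      using \<open>\<And>k. l k \<noteq> 0\<close> by (simp add: fun_eq_iff zf_def tc field_simps)
    then show ?thesis using Laur_ideal_mult[OF E'(1) Laur_cst E'(4)] by (simp only:)
  qed
  have "g \<tau> = 0" if g: "g \<in> E" for g
  proof (rule ccontr)
    assume nz: "g \<tau> \<noteq> 0"
    obtain h where h: "\<forall>k. h k \<in> Laur" "g - cst (g \<tau>) = (\<Sum>k\<in>UNIV. h k * zf \<tau> k)"
      using Laur_minus_cst_zf[OF Laur_ideal_Laur[OF E(1) g]] by blast
    have "g - cst (g \<tau>) \<in> E'" unfolding h(2)
      using h(1) zf by (intro Laur_ideal_sum[OF E'(1)] Laur_ideal_mult[OF E'(1)]) auto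
    from Laur_ideal_diff[OF E'(1) subsetD[OF E'(3) g] this]
    have "g - (g - cst (g \<tau>)) \<in> E'" .
    then have "cst (1 / g \<tau>) * (g - (g - cst (g \<tau>))) \<in> E'" by (rule Laur_ideal_mult[OF E'(1) Laur_cst])
    moreover have "cst (1 / g \<tau>) * (g - (g - cst (g \<tau>))) = 1" using nz by (simp add: fun_eq_iff)
    ultimately show False using E'(2) by simp
  qed
  then show ?thesis by blast
qed

section \<open>The ideal of a fibre and its idempotents\<close>

context liss
begin

definition Idl :: "('d \<Rightarrow> complex ^ 'n) \<Rightarrow> complex ^ 'd \<Rightarrow> ('d torus \<Rightarrow> complex) set" where
  "Idl M c = {g. \<exists>b. (\<forall>i. b i \<in> Laur) \<and> g = (\<Sum>i\<in>UNIV. (lf (M i) - cst (c $ i)) * b i)}"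

lemma lf_Laur: "lf v \<in> Laur"
  by (rule Bf_Laur[OF lf_Bf])

lemma Idl_ideal: "Laur_ideal (Idl M c)"
  unfolding Laur_ideal_def
proof (intro conjI ballI subsetI)
  fix a assume "a \<in> Idl M c"
  then obtain b where b: "\<forall>i. b i \<in> Laur" "a = (\<Sum>i\<in>UNIV. (lf (M i) - cst (c $ i)) * b i)" by (auto simp: Idl_def)
  then show "a \<in> Laur" by (auto intro!: Laur_sum Laur_mult Laur_diff lf_Laur)
  {
    fix a' assume "a' \<in> Idl M c"
    then obtain b' where b': "\<forall>i. b' i \<in> Laur" "a' = (\<Sum>i\<in>UNIV. (lf (M i) - cst (c $ i)) * b' i)" by (auto simp: Idl_def)
    have "a + a' = (\<Sum>i\<in>UNIV. (lf (M i) - cst (c $ i)) * (b i + b' i))"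
      unfolding b(2) b'(2) by (simp add: distrib_left sum.distrib)
    then show "a + a' \<in> Idl M c" unfolding Idl_def using b(1) b'(1)
      by (intro CollectI exI[of _ "\<lambda>i. b i + b' i"] conjI allI Laur_add) auto
  }
  fix r assume r: "r \<in> (Laur :: ('d torus \<Rightarrow> complex) set)"
  have "r * a = (\<Sum>i\<in>UNIV. (lf (M i) - cst (c $ i)) * (r * b i))"
    unfolding b(2) by (simp add: sum_distrib_left mult.left_commute)
  then show "r * a \<in> Idl M c" unfolding Idl_def using b(1) r
    by (intro CollectI exI[of _ "\<lambda>i. r * b i"] conjI allI Laur_mult) auto
next
  show "0 \<in> Idl M c" unfolding Idl_def by (intro CollectI exI[of _ "\<lambda>_. 0"]) simp
qed

lemma Idl_gen: assumes "b \<in> Laur" shows "(lf (M i) - cst (c $ i)) * b \<in> Idl M c"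
proof -
  have "(\<Sum>j\<in>UNIV. (lf (M j) - cst (c $ j)) * (if j = i then b else 0)) =
      (\<Sum>j\<in>UNIV. if j = i then (lf (M i) - cst (c $ i)) * b else 0)" by (intro sum.cong) auto
  then show ?thesis unfolding Idl_def using assms
    by (intro CollectI exI[of _ "\<lambda>j. if j = i then b else 0"]) auto
qed

end

text \<open>One section of the variety: the forms \<open>M\<close> are a Noether normalisation and
  the fibre over \<open>c\<close> is unramified. \<open>dominant\<close> is a separate assumption
  since \<open>unramified\<close> says nothing about an empty fibre.\<close>

locale fibre = liss +
  fixes M :: "'b \<Rightarrow> complex ^ 'a" and c :: "complex ^ 'b" and \<nu> :: nat
  assumes good: "good (range M) \<nu>" and nu: "0 < \<nu>"
    and unramified: "\<And>\<tau>. Fm M \<tau> = c \<Longrightarrow> det (Jac M \<tau>) \<noteq> 0"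
    and dominant: "\<exists>\<tau>. det (Jac M \<tau>) \<noteq> 0"
begin

definition \<Phi> :: "'b torus set" where "\<Phi> = {\<tau>. Fm M \<tau> = c}"

abbreviation I :: "('b torus \<Rightarrow> complex) set" where "I \<equiv> Idl M c"

lemmas I_def = Idl_def[of M c]
lemmas I_ideal = Idl_ideal[of M c]
lemmas I_gen = Idl_gen[where M = M and c = c]

lemma I_zero: "g \<in> I \<Longrightarrow> \<tau> \<in> \<Phi> \<Longrightarrow> g \<tau> = 0"
  by (auto simp: I_def \<Phi>_def Fm_def sum_fun_apply)

text \<open>Modulo the fibre ideal, multiplication by \<open>lf (M i)\<close> is multiplication by
  the constant \<open>c $ i\<close>, so every level above \<open>\<nu>\<close> collapses to level
  \<open>\<nu>\<close> and the quotient by \<open>I\<close> has finite dimension.\<close>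

lemma Bf_mod_I:
  assumes "\<nu> \<le> n" "g \<in> Bf (real n)" shows "\<exists>h\<in>Bf (real \<nu>). g - h \<in> I"
  using assms
proof (induction n arbitrary: g rule: dec_induct)
  case base
  then show "\<exists>h\<in>Bf (real \<nu>). g - h \<in> I" using Laur_ideal_0[OF I_ideal] by (intro bexI[of _ g]) auto
next
  case (step n)
  let ?X = "{g. \<exists>h\<in>Bf (real \<nu>). g - h \<in> I}"
  have X_add: "a + b \<in> ?X" if "a \<in> ?X" "b \<in> ?X" for a b
  proof -
    obtain h h' where h: "h \<in> Bf (real \<nu>)" "a - h \<in> I" "h' \<in> Bf (real \<nu>)" "b - h' \<in> I" using \<open>a \<in> ?X\<close> \<open>b \<in> ?X\<close> by blast
    have eq: "a + b - (h + h') = (a - h) + (b - h')" by simp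
    have "a + b - (h + h') \<in> I" unfolding eq by (rule Laur_ideal_add[OF I_ideal h(2,4)])
    then show ?thesis using LP_add[OF h(1,3)] by blast
  qed
  have IH: "b \<in> ?X" if "b \<in> Bf (real n)" for b using step.IH[OF that] by blast
  have "g \<in> Bf (real n + 1)" using step.prems by (simp add: add.commute)
  then have "g \<in> U (range M) (real n)" using good step.hyps(1) by (auto simp: good_def)
  then have "g \<in> ?X"
  proof (rule U_E)
    show "0 \<in> ?X" using Laur_ideal_0[OF I_ideal] by (intro CollectI bexI[of _ 0]) auto
    fix w b assume "w \<in> range M" and b: "b \<in> Bf (real n)"
    then obtain i where w: "w = M i" by blast
    obtain h where h: "h \<in> Bf (real \<nu>)" "b - h \<in> I" using IH[OF b] by blast
    have "lf w * b - cst (c $ i) * h = (lf (M i) - cst (c $ i)) * b + cst (c $ i) * (b - h)"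
      unfolding w by (simp add: algebra_simps)
    also have "\<dots> \<in> I"
      using b h by (intro Laur_ideal_add[OF I_ideal] I_gen Laur_ideal_mult[OF I_ideal] Laur_cst Bf_Laur)
    finally show "lf w * b \<in> ?X" using LP_cmult[OF h(1)] by blast
  qed (use X_add IH in auto)
  then show "\<exists>h\<in>Bf (real \<nu>). g - h \<in> I" by blast
qed

lemma Laur_mod_I: assumes "g \<in> Laur" shows "\<exists>h\<in>Bf (real \<nu>). g - h \<in> I"
proof -
  obtain N :: nat where "g \<in> Bf (real N)" using Laur_Bf[OF assms] by blast
  then have "g \<in> Bf (real (max \<nu> N))" by (rule Bf_mono[rotated]) simp
  then show ?thesis by (rule Bf_mod_I[rotated]) simp
qed

text \<open>The powers of \<open>t\<close> have representatives in the finite-dimensional space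
  \<open>Bf (real \<nu>)\<close>, so sufficiently many of them are dependent modulo
  \<open>I\<close>.\<close>

lemma poly_in_I: assumes t: "t \<in> Laur" shows "\<exists>q. q \<noteq> 0 \<and> (\<lambda>\<sigma>. poly q (t \<sigma>)) \<in> I"
proof -
  let ?s = "card (lat A (real \<nu>))"
  have tp: "(\<lambda>\<sigma>. t \<sigma> ^ m) \<in> Laur" for m
    using Laur_poly[OF t, of "monom 1 m"] by (simp add: poly_monom)
  have "\<forall>m. \<exists>h. h \<in> Bf (real \<nu>) \<and> (\<lambda>\<sigma>. t \<sigma> ^ m) - h \<in> I"
    using Laur_mod_I[OF tp] by blast
  from choice[OF this] obtain h where h: "\<forall>m. h m \<in> Bf (real \<nu>) \<and> (\<lambda>\<sigma>. t \<sigma> ^ m) - h m \<in> I" ..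
  have "\<exists>q. (\<exists>m\<in>{..?s}. q m \<noteq> 0) \<and> (\<forall>\<sigma>. (\<Sum>m\<in>{..?s}. q m * h m \<sigma>) = 0)"
    using h by (intro linear_relation_exists[where S = "lat A (real \<nu>)" and h = ch]) (auto simp: LP_def)
  then obtain q where q: "\<exists>m\<in>{..?s}. q m \<noteq> 0" "\<forall>\<sigma>. (\<Sum>m\<in>{..?s}. q m * h m \<sigma>) = 0" by blast
  define Q where "Q = (\<Sum>m\<le>?s. monom (q m) m)"
  have "coeff Q m = q m" if "m \<le> ?s" for m
    using that by (simp add: Q_def coeff_sum)
  then have "Q \<noteq> 0" using q(1) by force
  moreover have "(\<lambda>\<sigma>. poly Q (t \<sigma>)) = (\<Sum>m\<le>?s. cst (q m) * ((\<lambda>\<sigma>. t \<sigma> ^ m) - h m))"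
    using q(2) by (simp add: fun_eq_iff Q_def poly_sum poly_monom sum_fun_apply right_diff_distrib sum_subtractf)
  moreover have "\<dots> \<in> I"
    using h by (intro Laur_ideal_sum[OF I_ideal] Laur_ideal_mult[OF I_ideal] Laur_cst) auto
  ultimately show ?thesis by (intro exI[of _ Q]) simp
qed

lemma ideal_has_zero:
  assumes "Laur_ideal E" "I \<subseteq> E" "1 \<notin> E" shows "\<exists>\<tau>\<in>\<Phi>. \<forall>g\<in>E. g \<tau> = 0"
proof -
  have "\<exists>q. q \<noteq> 0 \<and> (\<lambda>\<sigma>. poly q (ch (axis k 1) \<sigma>)) \<in> E" for k
    using poly_in_I[OF Laur_ch, of "axis k 1"] assms(2) by (elim exE conjE) (rule exI, rule conjI, assumption, rule subsetD)
  from ideal_zero[OF assms(1,3) this] obtain \<tau> where \<tau>: "\<forall>g\<in>E. g \<tau> = 0" ..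
  have "Fm M \<tau> $ i = c $ i" for i
  proof -
    have "(lf (M i) - cst (c $ i)) * 1 \<in> E" using I_gen[OF Laur_1] assms(2) by blast
    then have "((lf (M i) - cst (c $ i)) * 1) \<tau> = 0" using \<tau> by blast
    then show ?thesis by (simp add: Fm_def)
  qed
  then have "\<tau> \<in> \<Phi>" by (simp add: \<Phi>_def vec_eq_iff)
  then show ?thesis using \<tau> by blast
qed

text \<open>The inverse Jacobian, applied to the expansions of the equations at
  \<open>\<tau>\<close>, expresses each \<open>zf \<tau> k\<close> modulo \<open>I\<close> through
  all the \<open>zf \<tau> l\<close> with coefficients vanishing at \<open>\<tau>\<close>.
  Nakayama's lemma then yields one function with value 1 at \<open>\<tau>\<close> that multiplies
  all of them into \<open>I\<close>.\<close>

lemma idempotent_exists: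
  assumes \<tau>: "\<tau> \<in> \<Phi>"
  shows "\<exists>e\<in>Laur. e \<tau> = 1 \<and> (\<forall>k. e * zf \<tau> k \<in> I)"
proof -
  have d: "det (Jac M \<tau>) \<noteq> 0" using unramified \<tau> by (simp add: \<Phi>_def)
  then obtain J' where J': "J' ** Jac M \<tau> = mat 1"
    by (metis invertible_det_nz invertible_def)
  have "\<forall>i. \<exists>h. (\<forall>k. h k \<in> mx \<tau>) \<and> lf (M i) - cst (lf (M i) \<tau>) = (\<Sum>k\<in>UNIV. (cst (Jac M \<tau> $ i $ k) + h k) * zf \<tau> k)"
    using tay_lf unfolding tay_def by blast
  from choice[OF this] obtain h where h: "\<forall>i. (\<forall>k. h i k \<in> mx \<tau>) \<and>
      lf (M i) - cst (lf (M i) \<tau>) = (\<Sum>k\<in>UNIV. (cst (Jac M \<tau> $ i $ k) + h i k) * zf \<tau> k)" ..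
  have fc: "lf (M i) \<tau> = c $ i" for i using \<tau> by (auto simp: \<Phi>_def Fm_def)
  have "\<exists>e\<in>mx \<tau>. \<forall>k\<in>UNIV. (1 - e) * zf \<tau> k \<in> I"
  proof (rule nakayama[OF finite Laur_1 Laur_diff _ mx_0 mx_diff mx_mult Laur_ideal_0[OF I_ideal]
        Laur_ideal_diff[OF I_ideal] Laur_ideal_mult[OF I_ideal]])
    show "mx \<tau> \<subseteq> Laur" using mx_Laur by blast
    fix k :: 'b
    define g where "g l = - (\<Sum>i\<in>UNIV. cst (J' $ k $ i) * h i l)" for l
    have g: "g l \<in> mx \<tau>" for l
      using mx_diff[OF mx_0 mx_sum[of UNIV "\<lambda>i. cst (J' $ k $ i) * h i l"]] h
      by (simp add: g_def mx_mult)
    have "zf \<tau> k - (\<Sum>l\<in>UNIV. g l * zf \<tau> l) = (\<Sum>i\<in>UNIV. cst (J' $ k $ i) * (lf (M i) - cst (c $ i)))"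
    proof
      fix \<sigma>
      have hs: "lf (M i) \<sigma> - c $ i = (\<Sum>l\<in>UNIV. (Jac M \<tau> $ i $ l + h i l \<sigma>) * zf \<tau> l \<sigma>)" for i
        using fun_cong[OF conjunct2[OF spec[OF h, of i]], of \<sigma>] fc by (simp add: sum_fun_apply)
      have m: "(\<Sum>i\<in>UNIV. J' $ k $ i * Jac M \<tau> $ i $ l) = (if k = l then 1 else 0)" for l
        using J' by (simp add: vec_eq_iff matrix_matrix_mult_def mat_def)
      have "(\<Sum>i\<in>UNIV. J' $ k $ i * (lf (M i) \<sigma> - c $ i)) =
          (\<Sum>i\<in>UNIV. \<Sum>l\<in>UNIV. J' $ k $ i * ((Jac M \<tau> $ i $ l + h i l \<sigma>) * zf \<tau> l \<sigma>))"
        unfolding hs sum_distrib_left ..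
      also have "\<dots> = (\<Sum>l\<in>UNIV. \<Sum>i\<in>UNIV. J' $ k $ i * ((Jac M \<tau> $ i $ l + h i l \<sigma>) * zf \<tau> l \<sigma>))"
        by (rule sum.swap)
      also have "\<dots> = (\<Sum>l\<in>UNIV. ((if k = l then 1 else 0) - g l \<sigma>) * zf \<tau> l \<sigma>)"
      proof (rule sum.cong[OF refl])
        fix l
        have "(\<Sum>i\<in>UNIV. J' $ k $ i * ((Jac M \<tau> $ i $ l + h i l \<sigma>) * zf \<tau> l \<sigma>)) =
            (\<Sum>i\<in>UNIV. J' $ k $ i * Jac M \<tau> $ i $ l) * zf \<tau> l \<sigma> + (\<Sum>i\<in>UNIV. J' $ k $ i * h i l \<sigma>) * zf \<tau> l \<sigma>"
          unfolding sum_distrib_right sum.distrib[symmetric]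
          by (rule sum.cong[OF refl]) (simp add: algebra_simps)
        also have "\<dots> = ((if k = l then 1 else 0) - g l \<sigma>) * zf \<tau> l \<sigma>"
          unfolding m by (simp add: g_def sum_fun_apply left_diff_distrib distrib_right)
        finally show "(\<Sum>i\<in>UNIV. J' $ k $ i * ((Jac M \<tau> $ i $ l + h i l \<sigma>) * zf \<tau> l \<sigma>)) =
            ((if k = l then 1 else 0) - g l \<sigma>) * zf \<tau> l \<sigma>" .
      qed
      also have "\<dots> = (\<Sum>l\<in>UNIV. (if k = l then zf \<tau> k \<sigma> else 0)) - (\<Sum>l\<in>UNIV. g l \<sigma> * zf \<tau> l \<sigma>)"
        unfolding sum_subtractf[symmetric] by (rule sum.cong[OF refl]) (simp add: algebra_simps)
      finally show "(zf \<tau> k - (\<Sum>l\<in>UNIV. g l * zf \<tau> l)) \<sigma> =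
          (\<Sum>i\<in>UNIV. cst (J' $ k $ i) * (lf (M i) - cst (c $ i))) \<sigma>"
        by (simp add: sum_fun_apply)
    qed
    also have "\<dots> \<in> I"
    proof (rule Laur_ideal_sum[OF I_ideal])
      fix i
      have "cst (J' $ k $ i) * ((lf (M i) - cst (c $ i)) * 1) \<in> I"
        by (intro Laur_ideal_mult[OF I_ideal] Laur_cst I_gen Laur_1)
      then show "cst (J' $ k $ i) * (lf (M i) - cst (c $ i)) \<in> I" by simp
    qed
    finally show "\<exists>g. (\<forall>l\<in>UNIV. g l \<in> mx \<tau>) \<and> zf \<tau> k - (\<Sum>l\<in>UNIV. g l * zf \<tau> l) \<in> I"
      using g by blast
  qed
  then obtain e where e: "e \<in> mx \<tau>" "\<forall>k. (1 - e) * zf \<tau> k \<in> I" by blast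
  have "1 - e \<in> Laur" using e(1) by (intro Laur_diff Laur_1 mx_Laur)
  with e mx_zero[OF e(1)] show ?thesis by (intro bexI[of _ "1 - e"]) auto
qed

text \<open>
  Since the fibre is unramified, its ideal \<open>I\<close> is near \<open>\<tau>\<close> the full ideal of the point, which gives an
  element that is the idempotent of \<open>\<tau>\<close> modulo \<open>I\<close>.
\<close>

definition id_at :: "'b torus \<Rightarrow> 'b torus \<Rightarrow> complex" where
  "id_at \<tau> = (SOME e. e \<in> Laur \<and> e \<tau> = 1 \<and> (\<forall>k. e * zf \<tau> k \<in> I))"

lemma id_at: assumes "\<tau> \<in> \<Phi>" shows "id_at \<tau> \<in> Laur" "id_at \<tau> \<tau> = 1" "id_at \<tau> * zf \<tau> k \<in> I"
proof -
  have "\<exists>e. e \<in> Laur \<and> e \<tau> = 1 \<and> (\<forall>k. e * zf \<tau> k \<in> I)" using idempotent_exists[OF assms] by blast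
  from someI_ex[OF this] show "id_at \<tau> \<in> Laur" "id_at \<tau> \<tau> = 1" "id_at \<tau> * zf \<tau> k \<in> I"
    unfolding id_at_def by blast+
qed

lemma id_at_other: assumes "\<tau> \<in> \<Phi>" "\<sigma> \<in> \<Phi>" "\<sigma> \<noteq> \<tau>" shows "id_at \<tau> \<sigma> = 0"
proof -
  obtain k where k: "tc \<sigma> k \<noteq> tc \<tau> k" using assms(3) torus_eqI by blast
  have "(id_at \<tau> * zf \<tau> k) \<sigma> = 0" using id_at(3)[OF assms(1)] assms(2) by (rule I_zero)
  then show ?thesis using k by (simp add: zf_apply)
qed

lemma id_at_mult: assumes "\<tau> \<in> \<Phi>" "g \<in> Laur" shows "g * id_at \<tau> - cst (g \<tau>) * id_at \<tau> \<in> I"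
proof -
  obtain h where h: "\<forall>k. h k \<in> Laur" "g - cst (g \<tau>) = (\<Sum>k\<in>UNIV. h k * zf \<tau> k)"
    using Laur_minus_cst_zf[OF assms(2)] by blast
  have "g * id_at \<tau> - cst (g \<tau>) * id_at \<tau> = (g - cst (g \<tau>)) * id_at \<tau>" by (simp add: algebra_simps)
  also have "\<dots> = (\<Sum>k\<in>UNIV. h k * (id_at \<tau> * zf \<tau> k))"
    unfolding h(2) sum_distrib_right by (rule sum.cong[OF refl]) (simp add: ac_simps)
  also have "\<dots> \<in> I"
    by (rule Laur_ideal_sum[OF I_ideal], rule Laur_ideal_mult[OF I_ideal spec[OF h(1)] id_at(3)[OF assms(1)]])
  finally show ?thesis .
qed

text \<open>On the points of the fibre the \<open>id_at\<close> take the values of a unit matrix,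
  and reduction modulo \<open>I\<close> preserves values there. So their representatives in
  \<open>Bf (real \<nu>)\<close> are independent.\<close>

lemma finite_fibre: "finite \<Phi>"
proof (rule finite_if_finite_subsets_card_bdd[THEN conjunct1])
  fix G assume G: "G \<subseteq> \<Phi>" "finite G"
  show "card G \<le> card (lat A (real \<nu>))"
  proof (rule ccontr)
    assume "\<not> ?thesis"
    then have lt: "card (lat A (real \<nu>)) < card G" by simp
    have "\<forall>\<tau>\<in>G. \<exists>h. h \<in> Bf (real \<nu>) \<and> id_at \<tau> - h \<in> I"
      using Laur_mod_I id_at(1) G(1) by blast
    from bchoice[OF this] obtain h where h: "\<forall>\<tau>\<in>G. h \<tau> \<in> Bf (real \<nu>) \<and> id_at \<tau> - h \<tau> \<in> I" ..
    have "\<exists>q. (\<exists>\<tau>\<in>G. q \<tau> \<noteq> 0) \<and> (\<forall>\<sigma>. (\<Sum>\<tau>\<in>G. q \<tau> * h \<tau> \<sigma>) = 0)"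
      using h G(2) lt by (intro linear_relation_exists[where S = "lat A (real \<nu>)" and h = ch]) (auto simp: LP_def)
    then obtain q \<sigma> where q: "\<sigma> \<in> G" "q \<sigma> \<noteq> 0" "\<forall>\<sigma>. (\<Sum>\<tau>\<in>G. q \<tau> * h \<tau> \<sigma>) = 0" by blast
    have "h \<tau> \<sigma> = (if \<tau> = \<sigma> then 1 else 0)" if "\<tau> \<in> G" for \<tau>
    proof -
      have "id_at \<tau> - h \<tau> \<in> I" "\<sigma> \<in> \<Phi>" using h that q(1) G(1) by blast+
      from I_zero[OF this] have "h \<tau> \<sigma> = id_at \<tau> \<sigma>" by simp
      then show ?thesis using id_at(2)[of \<sigma>] id_at_other[of \<tau> \<sigma>] that q(1) G(1) by auto
    qed
    then have "(\<Sum>\<tau>\<in>G. q \<tau> * h \<tau> \<sigma>) = (\<Sum>\<tau>\<in>G. if \<tau> = \<sigma> then q \<sigma> else 0)" by (intro sum.cong) auto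
    then show False using q G(2) by simp
  qed
qed

text \<open>\<open>I\<close> together with the \<open>id_at\<close> generates an ideal without zeros
  on the fibre, hence the unit ideal. The resulting expression of 1 is multiplied by
  \<open>g\<close>, and the coefficient of each \<open>id_at\<close> is replaced by its value at the
  point.\<close>

lemma Laur_decomp:
  assumes "g \<in> Laur" shows "\<exists>a. g - (\<Sum>\<tau>\<in>\<Phi>. cst (a \<tau>) * id_at \<tau>) \<in> I"
proof -
  define E where "E = {g. \<exists>i b. i \<in> I \<and> (\<forall>\<tau>. b \<tau> \<in> Laur) \<and> g = i + (\<Sum>\<tau>\<in>\<Phi>. b \<tau> * id_at \<tau>)}"
  have E: "i + (\<Sum>\<tau>\<in>\<Phi>. b \<tau> * id_at \<tau>) \<in> E" if "i \<in> I" "\<And>\<tau>. b \<tau> \<in> Laur" for i b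
    using that unfolding E_def by blast
  have IE: "I \<subseteq> E"
  proof
    fix i assume "i \<in> I"
    from E[OF this, of "\<lambda>_. 0"] show "i \<in> E" by simp
  qed
  have idE: "id_at \<tau> \<in> E" if "\<tau> \<in> \<Phi>" for \<tau>
  proof -
    have "(\<Sum>\<sigma>\<in>\<Phi>. (if \<sigma> = \<tau> then 1 else 0) * id_at \<sigma>) = (\<Sum>\<sigma>\<in>\<Phi>. if \<sigma> = \<tau> then id_at \<tau> else 0)"
      by (intro sum.cong) auto
    then show ?thesis using E[OF Laur_ideal_0[OF I_ideal], of "\<lambda>\<sigma>. if \<sigma> = \<tau> then 1 else 0"] that finite_fibre by simp
  qed
  have "Laur_ideal E"
    unfolding Laur_ideal_def
  proof (intro conjI ballI subsetI)
    fix a assume "a \<in> E"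
    then obtain i b where a: "i \<in> I" "\<forall>\<tau>. b \<tau> \<in> Laur" "a = i + (\<Sum>\<tau>\<in>\<Phi>. b \<tau> * id_at \<tau>)"
      unfolding E_def by blast
    then show "a \<in> Laur"
      using Laur_ideal_Laur[OF I_ideal] id_at(1) by (auto intro!: Laur_add Laur_sum Laur_mult)
    {
      fix a' assume "a' \<in> E"
      then obtain i' b' where a': "i' \<in> I" "\<forall>\<tau>. b' \<tau> \<in> Laur" "a' = i' + (\<Sum>\<tau>\<in>\<Phi>. b' \<tau> * id_at \<tau>)"
        unfolding E_def by blast
      have "a + a' = (i + i') + (\<Sum>\<tau>\<in>\<Phi>. (b \<tau> + b' \<tau>) * id_at \<tau>)"
        unfolding a(3) a'(3) by (simp add: distrib_right sum.distrib algebra_simps)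
      then show "a + a' \<in> E"
        using E[OF Laur_ideal_add[OF I_ideal a(1) a'(1)], of "\<lambda>\<tau>. b \<tau> + b' \<tau>"] a(2) a'(2)
        by (simp add: Laur_add)
    }
    fix r assume r: "r \<in> (Laur :: ('b torus \<Rightarrow> complex) set)"
    have "r * a = r * i + (\<Sum>\<tau>\<in>\<Phi>. (r * b \<tau>) * id_at \<tau>)"
      unfolding a(3) by (simp add: distrib_left sum_distrib_left mult.assoc)
    then show "r * a \<in> E"
      using E[OF Laur_ideal_mult[OF I_ideal r a(1)], of "\<lambda>\<tau>. r * b \<tau>"] a(2) r by (simp add: Laur_mult)
  qed (use IE Laur_ideal_0[OF I_ideal] in blast)
  moreover have "\<not> (\<exists>\<tau>\<in>\<Phi>. \<forall>g\<in>E. g \<tau> = 0)"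
    using idE id_at(2) by fastforce
  ultimately have "1 \<in> E" using ideal_has_zero[OF _ IE] by blast
  then obtain i b where one: "i \<in> I" "\<forall>\<tau>. b \<tau> \<in> Laur" "1 = i + (\<Sum>\<tau>\<in>\<Phi>. b \<tau> * id_at \<tau>)"
    unfolding E_def by blast
  have "g - (\<Sum>\<tau>\<in>\<Phi>. cst ((g * b \<tau>) \<tau>) * id_at \<tau>) =
      g * i + (\<Sum>\<tau>\<in>\<Phi>. g * b \<tau> * id_at \<tau> - cst ((g * b \<tau>) \<tau>) * id_at \<tau>)"
  proof -
    have "g = g * (i + (\<Sum>\<tau>\<in>\<Phi>. b \<tau> * id_at \<tau>))" unfolding one(3)[symmetric] by simp
    also have "\<dots> = g * i + (\<Sum>\<tau>\<in>\<Phi>. g * b \<tau> * id_at \<tau>)"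
      by (simp add: distrib_left sum_distrib_left mult.assoc)
    finally have "g = g * i + (\<Sum>\<tau>\<in>\<Phi>. g * b \<tau> * id_at \<tau>)" .
    then show ?thesis by (simp add: sum_subtractf)
  qed
  also have "\<dots> \<in> I"
    using assms one
    by (intro Laur_ideal_add[OF I_ideal] Laur_ideal_mult[OF I_ideal] Laur_ideal_sum[OF I_ideal] id_at_mult Laur_mult) auto
  finally show ?thesis by (rule exI[of _ "\<lambda>\<tau>. (g * b \<tau>) \<tau>"])
qed

end

section \<open>Logarithmic coordinates and openness of the projection\<close>

lemma has_derivative_vecI:
  fixes f :: "'a::real_normed_vector \<Rightarrow> complex ^ 'd"
  assumes "\<And>i. ((\<lambda>x. f x $ i) has_derivative (\<lambda>h. f' h $ i)) (at x)"
  shows "(f has_derivative f') (at x)"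
proof (subst has_derivative_componentwise_within, rule ballI)
  fix b :: "complex ^ 'd" assume "b \<in> Basis"
  then obtain i c where b: "b = axis i c" by (auto simp: Basis_vec_def)
  have "((\<lambda>x. f x $ i \<bullet> c) has_derivative (\<lambda>h. f' h $ i \<bullet> c)) (at x)"
    by (rule has_derivative_inner_left[OF assms])
  then show "((\<lambda>x. f x \<bullet> b) has_derivative (\<lambda>h. f' h \<bullet> b)) (at x)"
    unfolding b inner_axis .
qed

definition tex :: "complex ^ 'd \<Rightarrow> 'd::finite torus" where
  "tex \<theta> = mkt (\<lambda>k. exp (\<theta> $ k))"

lemma tc_tex [simp]: "tc (tex \<theta>) k = exp (\<theta> $ k)"
  by (simp add: tex_def tc_mkt)

lemma tex_surj: "\<exists>\<theta>. tex \<theta> = \<tau>"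
  by (intro exI[of _ "\<chi> k. Ln (tc \<tau> k)"] torus_eqI) simp

lemma ch_tex: "ch u (tex \<theta>) = exp (\<Sum>k\<in>UNIV. of_int (u $ k) * \<theta> $ k)"
proof -
  have "exp (of_int n * z) = exp z powi n" for n :: int and z :: complex
    by (simp add: exp_power_int mult.commute)
  then show ?thesis by (simp add: ch_def exp_sum)
qed

lemma ch_has_derivative:
  "((\<lambda>\<theta>. ch u (tex \<theta>)) has_derivative (\<lambda>h. ch u (tex \<theta>) * (\<Sum>k\<in>UNIV. of_int (u $ k) * h $ k))) (at \<theta>)"
proof -
  have l: "((\<lambda>\<theta>. \<Sum>k\<in>UNIV. of_int (u $ k) * \<theta> $ k) has_derivative
      (\<lambda>h. \<Sum>k\<in>UNIV. complex_of_int (u $ k) * h $ k)) (at \<theta>)"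
    by (intro has_derivative_sum has_derivative_mult_right
        bounded_linear.has_derivative[OF bounded_linear_vec_nth] has_derivative_ident)
  from has_derivative_compose[OF l, of exp "(*) (exp (\<Sum>k\<in>UNIV. complex_of_int (u $ k) * \<theta> $ k))"]
  show ?thesis unfolding ch_tex by (simp add: DERIV_exp has_field_derivative_imp_has_derivative)
qed

lemma continuous_Laur_tex: assumes "g \<in> Laur" shows "continuous_on UNIV (\<lambda>\<theta>. g (tex \<theta>))"
  using assms
proof (induction rule: Laur_induct)
  case (add a b)
  then show "continuous_on UNIV (\<lambda>\<theta>. (a + b) (tex \<theta>))" unfolding plus_fun_def by (rule continuous_on_add)
next
  case (ch c u)
  have "continuous_on UNIV (\<lambda>\<theta>. ch u (tex \<theta>))"
    by (rule has_derivative_continuous_on) (rule has_derivative_at_withinI[OF ch_has_derivative])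
  then show "continuous_on UNIV (\<lambda>\<theta>. (cst c * ch u) (tex \<theta>))"
    unfolding times_fun_def by (intro continuous_on_mult continuous_on_const)
qed

context liss
begin

lemma xf_has_derivative:
  "((\<lambda>\<theta>. xf j (tex \<theta>)) has_derivative (\<lambda>h. yf j (tex \<theta>) * (\<Sum>k\<in>UNIV. of_int (A $ k $ j) * h $ k))) (at \<theta>)"
proof -
  have "((\<lambda>\<theta>. 1 / (2 * \<beta> j) * ch (column j A) (tex \<theta>) + \<beta> j / 2 * ch (- column j A) (tex \<theta>)) has_derivative
      (\<lambda>h. 1 / (2 * \<beta> j) * (ch (column j A) (tex \<theta>) * (\<Sum>k\<in>UNIV. of_int (column j A $ k) * h $ k)) +
        \<beta> j / 2 * (ch (- column j A) (tex \<theta>) * (\<Sum>k\<in>UNIV. of_int ((- column j A) $ k) * h $ k)))) (at \<theta>)"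
    by (intro has_derivative_add has_derivative_mult_right ch_has_derivative)
  moreover have "(\<lambda>\<theta>. 1 / (2 * \<beta> j) * ch (column j A) (tex \<theta>) + \<beta> j / 2 * ch (- column j A) (tex \<theta>)) = (\<lambda>\<theta>. xf j (tex \<theta>))"
    by (simp add: xf_eq)
  moreover have "(\<lambda>h. 1 / (2 * \<beta> j) * (ch (column j A) (tex \<theta>) * (\<Sum>k\<in>UNIV. of_int (column j A $ k) * h $ k)) +
        \<beta> j / 2 * (ch (- column j A) (tex \<theta>) * (\<Sum>k\<in>UNIV. of_int ((- column j A) $ k) * h $ k)))
     = (\<lambda>h. yf j (tex \<theta>) * (\<Sum>k\<in>UNIV. of_int (A $ k $ j) * h $ k))"
    by (simp add: fun_eq_iff yf_def column_def sum_negf field_simps)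
  ultimately show ?thesis by (simp only:)
qed

lemma Fm_has_derivative: "((\<lambda>\<theta>. Fm M (tex \<theta>)) has_derivative (\<lambda>h. Jac M (tex \<theta>) *v h)) (at \<theta>)"
proof (rule has_derivative_vecI)
  fix i
  have "((\<lambda>\<theta>. \<Sum>j\<in>UNIV. M i $ j * xf j (tex \<theta>)) has_derivative
      (\<lambda>h. \<Sum>j\<in>UNIV. M i $ j * (yf j (tex \<theta>) * (\<Sum>k\<in>UNIV. of_int (A $ k $ j) * h $ k)))) (at \<theta>)"
    by (intro has_derivative_sum has_derivative_mult_right xf_has_derivative)
  moreover have "(\<lambda>\<theta>. \<Sum>j\<in>UNIV. M i $ j * xf j (tex \<theta>)) = (\<lambda>\<theta>. Fm M (tex \<theta>) $ i)"
    by (simp add: Fm_def lf_def)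
  moreover have "(\<lambda>h. \<Sum>j\<in>UNIV. M i $ j * (yf j (tex \<theta>) * (\<Sum>k\<in>UNIV. of_int (A $ k $ j) * h $ k))) =
      (\<lambda>h. (Jac M (tex \<theta>) *v h) $ i)"
  proof
    fix h :: "complex ^ 'd"
    have "(Jac M (tex \<theta>) *v h) $ i = (\<Sum>k\<in>UNIV. \<Sum>j\<in>UNIV. M i $ j * (of_int (A $ k $ j) * yf j (tex \<theta>)) * h $ k)"
      by (simp add: matrix_vector_mult_def Jac_def sum_distrib_right)
    also have "\<dots> = (\<Sum>j\<in>UNIV. \<Sum>k\<in>UNIV. M i $ j * (of_int (A $ k $ j) * yf j (tex \<theta>)) * h $ k)"
      by (rule sum.swap)
    finally show "(\<Sum>j\<in>UNIV. M i $ j * (yf j (tex \<theta>) * (\<Sum>k\<in>UNIV. of_int (A $ k $ j) * h $ k))) =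
      (Jac M (tex \<theta>) *v h) $ i"
      by (simp add: sum_distrib_left mult_ac)
  qed
  ultimately show "((\<lambda>\<theta>. Fm M (tex \<theta>) $ i) has_derivative (\<lambda>h. (Jac M (tex \<theta>) *v h) $ i)) (at \<theta>)"
    by (simp only:)
qed

text \<open>An open mapping theorem at a point with invertible derivative. The freedom in the
  neighbourhood \<open>S\<close> keeps preimages close to \<open>\<theta>\<close>, as is needed to
  follow the individual points of a fibre.\<close>

lemma Fm_open:
  assumes "det (Jac M (tex \<theta>)) \<noteq> 0" "open S" "\<theta> \<in> S"
  shows "\<exists>e>0. \<forall>y. dist y (Fm M (tex \<theta>)) < e \<longrightarrow> (\<exists>\<theta>'\<in>S. Fm M (tex \<theta>') = y)"
proof -
  obtain J' where J': "Jac M (tex \<theta>) ** J' = mat 1"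
    using assms(1) by (metis invertible_det_nz invertible_def)
  have "Fm M (tex \<theta>) \<in> interior ((\<lambda>\<theta>. Fm M (tex \<theta>)) ` S)"
  proof (rule sussmann_open_mapping[where f' = "\<lambda>h. Jac M (tex \<theta>) *v h" and g' = "\<lambda>h. J' *v h" and S = UNIV])
    show "continuous_on UNIV (\<lambda>\<theta>. Fm M (tex \<theta>))"
      by (rule has_derivative_continuous_on) (rule has_derivative_at_withinI[OF Fm_has_derivative])
    show "bounded_linear ((*v) J')"
    proof (rule linear_conv_bounded_linear[THEN iffD1], rule linearI)
      show "J' *v (r *\<^sub>R x) = r *\<^sub>R (J' *v x)" for r x
        by (simp add: vec_eq_iff matrix_vector_mult_def scaleR_sum_right)
    qed (simp add: matrix_vector_right_distrib)
    show "(*v) (Jac M (tex \<theta>)) \<circ> (*v) J' = id"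
      by (simp add: fun_eq_iff matrix_vector_mul_assoc J')
    show "\<theta> \<in> interior S" using assms(2,3) by (simp add: interior_open)
  qed (auto intro: Fm_has_derivative)
  then obtain e where "e > 0" "ball (Fm M (tex \<theta>)) e \<subseteq> (\<lambda>\<theta>. Fm M (tex \<theta>)) ` S"
    unfolding mem_interior by blast
  then show ?thesis by (intro exI[of _ e]) (fastforce simp: dist_commute subset_eq)
qed

definition pF :: "('d \<Rightarrow> complex ^ 'n) \<Rightarrow> (complex ^ 'd \<Rightarrow> complex) \<Rightarrow> 'd torus \<Rightarrow> complex" where
  "pF M p \<tau> = p (Fm M \<tau>)"

lemma pF_simps: "pF M (p + q) = pF M p + pF M q" "pF M (p * q) = pF M p * pF M q" "pF M (cst e) = cst e"
  "pF M 0 = 0" "pF M 1 = 1" "pF M (p - q) = pF M p - pF M q" "pF M (\<lambda>y. y $ i) = lf (M i)"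
  by (simp_all add: fun_eq_iff pF_def Fm_def)

lemma pF_sum: "pF M (\<Sum>i\<in>X. f i) = (\<Sum>i\<in>X. pF M (f i))"
  by (simp add: fun_eq_iff pF_def sum_fun_apply)

lemma pF_Bf:
  assumes "p \<in> PF N" shows "pF M p \<in> Bf (real N)"
  using assms
proof (rule PF_subset[where X = "{p. pF M p \<in> Bf (real N)}", THEN CollectD], goal_cases)
  case (3 e \<alpha>)
  have "(\<Prod>i\<in>X. lf (M i) ^ \<alpha> i) \<in> Bf (real (\<Sum>i\<in>X. \<alpha> i))" if "finite X" for X
    using that
  proof induction
    case empty
    show "(\<Prod>i\<in>{}. lf (M i) ^ \<alpha> i) \<in> Bf (real (\<Sum>i\<in>{}. \<alpha> i))" by (simp add: Bf_1)
  next
    case (insert i X)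
    from Bf_mult[OF lf_power_Bf[of "M i" "\<alpha> i"] insert.IH] insert.hyps
    show "(\<Prod>i\<in>insert i X. lf (M i) ^ \<alpha> i) \<in> Bf (real (\<Sum>i\<in>insert i X. \<alpha> i))" by simp
  qed
  from this[of UNIV] have "(\<Prod>i\<in>UNIV. lf (M i) ^ \<alpha> i) \<in> Bf (real (\<Sum>i\<in>UNIV. \<alpha> i))" by simp
  moreover have "real (\<Sum>i\<in>UNIV. \<alpha> i) \<le> real N" using 3 by (simp only: of_nat_le_iff) (simp add: Smp_def)
  ultimately have "(\<Prod>i\<in>UNIV. lf (M i) ^ \<alpha> i) \<in> Bf (real N)" by (rule Bf_mono[rotated])
  moreover have "pF M (mon \<alpha>) = (\<Prod>i\<in>UNIV. lf (M i) ^ \<alpha> i)"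
  proof
    fix \<tau>
    have "(f ^ n) \<tau> = f \<tau> ^ n" for f :: "'d torus \<Rightarrow> complex" and n by (induction n) auto
    then show "pF M (mon \<alpha>) \<tau> = (\<Prod>i\<in>UNIV. lf (M i) ^ \<alpha> i) \<tau>"
      by (simp add: pF_def mon_def prod_fun_apply Fm_def)
  qed
  ultimately show ?case by (simp add: pF_simps LP_cmult)
qed (auto simp: pF_simps intro: LP_add)

end

section \<open>Upper bound for the number of points of a fibre\<close>

context fibre
begin

text \<open>The image of the projection contains a ball, and a polynomial vanishing on a ball is
  0.\<close>

lemma pF_eq_0:
  assumes "p \<in> PF N" "pF M p = 0" shows "p y = 0"
proof -
  obtain \<tau> where "det (Jac M \<tau>) \<noteq> 0" using dominant by blast
  then obtain \<theta> where "det (Jac M (tex \<theta>)) \<noteq> 0" using tex_surj by metis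
  then obtain e where e: "e > 0" "\<And>y. dist y (Fm M (tex \<theta>)) < e \<Longrightarrow> \<exists>\<theta>'\<in>UNIV. Fm M (tex \<theta>') = y"
    using Fm_open[of M \<theta> UNIV] by auto
  show ?thesis
  proof (rule PF_zero_near[OF assms(1) e(1)])
    fix y assume "dist y (Fm M (tex \<theta>)) < e"
    then obtain \<theta>' where y: "Fm M (tex \<theta>') = y" using e(2) by blast
    show "p y = 0" using fun_cong[OF assms(2), of "tex \<theta>'"] by (simp add: pF_def y)
  qed
qed

text \<open>
  Distinct unramified points of a fibre give functions that are linearly independent over the polynomials in the forms: near \<open>c\<close> the matrix of
  values of the functions \<open>id_at\<close> at the nearby preimages is diagonally dominant.
\<close>

lemma id_at_independent:
  assumes p: "\<And>\<tau>. \<tau> \<in> \<Phi> \<Longrightarrow> p \<tau> \<in> PF N" and rel: "(\<Sum>\<tau>\<in>\<Phi>. pF M (p \<tau>) * id_at \<tau>) = 0" and \<tau>0: "\<tau>0 \<in> \<Phi>"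
  shows "p \<tau>0 y = 0"
proof -
  define m where "m = real (card \<Phi>)"
  have m: "0 < m" using \<tau>0 finite_fibre by (auto simp: m_def card_gt_0_iff)
  have near: "\<exists>e>0. \<forall>y. dist y c < e \<longrightarrow> (\<exists>\<sigma>. Fm M \<sigma> = y \<and>
      (\<forall>\<rho>\<in>\<Phi>. norm (id_at \<rho> \<sigma> - (if \<rho> = \<tau> then 1 else 0)) < 1 / (2 * m)))" if \<tau>: "\<tau> \<in> \<Phi>" for \<tau>
  proof -
    obtain \<theta> where \<theta>: "tex \<theta> = \<tau>" using tex_surj by blast
    define S where "S = (\<Inter>\<rho>\<in>\<Phi>. {\<theta>. norm (id_at \<rho> (tex \<theta>) - (if \<rho> = \<tau> then 1 else 0)) < 1 / (2 * m)})"
    have "open S"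
      unfolding S_def
      by (intro open_INT finite_fibre ballI open_Collect_less continuous_intros continuous_Laur_tex id_at(1))
    moreover have "\<theta> \<in> S"
      using id_at(2)[OF \<tau>] id_at_other[OF _ \<tau>] m by (auto simp: S_def \<theta>)
    moreover have "det (Jac M (tex \<theta>)) \<noteq> 0" "Fm M (tex \<theta>) = c"
      using unramified \<tau> by (auto simp: \<theta> \<Phi>_def)
    ultimately obtain e where e: "e > 0" "\<forall>y. dist y c < e \<longrightarrow> (\<exists>\<theta>'\<in>S. Fm M (tex \<theta>') = y)"
      using Fm_open[of M \<theta> S] by auto
    show ?thesis
    proof (intro exI[of _ e] conjI e(1) allI impI)
      fix y assume "dist y c < e"
      then obtain \<theta>' where "\<theta>' \<in> S" "Fm M (tex \<theta>') = y" using e(2) by blast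
      then show "\<exists>\<sigma>. Fm M \<sigma> = y \<and> (\<forall>\<rho>\<in>\<Phi>. norm (id_at \<rho> \<sigma> - (if \<rho> = \<tau> then 1 else 0)) < 1 / (2 * m))"
        unfolding S_def by (intro exI[of _ "tex \<theta>'"]) auto
    qed
  qed
  have near': "\<forall>\<tau>\<in>\<Phi>. \<exists>e. e > 0 \<and> (\<forall>y. dist y c < e \<longrightarrow> (\<exists>\<sigma>. Fm M \<sigma> = y \<and>
      (\<forall>\<rho>\<in>\<Phi>. norm (id_at \<rho> \<sigma> - (if \<rho> = \<tau> then 1 else 0)) < 1 / (2 * m))))"
    by (rule ballI, rule near)
  from bchoice[OF near'] obtain e where e: "\<forall>\<tau>\<in>\<Phi>. e \<tau> > 0 \<and> (\<forall>y. dist y c < e \<tau> \<longrightarrow> (\<exists>\<sigma>. Fm M \<sigma> = y \<and>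
      (\<forall>\<rho>\<in>\<Phi>. norm (id_at \<rho> \<sigma> - (if \<rho> = \<tau> then 1 else 0)) < 1 / (2 * m))))" ..
  define e0 where "e0 = Min (e ` \<Phi>)"
  have "e0 \<in> e ` \<Phi>" unfolding e0_def using finite_fibre \<tau>0 by (intro Min_in) auto
  then have e0: "0 < e0" using e by auto
  have e0_le: "e0 \<le> e \<tau>" if "\<tau> \<in> \<Phi>" for \<tau>
    unfolding e0_def using finite_fibre that by (intro Min_le) auto
  have "p \<tau>0 y = 0" if y: "dist y c < e0" for y
  proof -
    \<comment> \<open>For fixed \<open>y\<close> the largest coefficient is singled out, and the
      relation is evaluated at the preimage of \<open>y\<close> near the corresponding
      \<open>\<tau>\<close>. There the deviations from the unit matrix contribute at most half of
      that coefficient.\<close>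
    define mx' where "mx' = Max ((\<lambda>\<tau>. norm (p \<tau> y)) ` \<Phi>)"
    have "mx' \<in> (\<lambda>\<tau>. norm (p \<tau> y)) ` \<Phi>"
      unfolding mx'_def using finite_fibre \<tau>0 by (intro Max_in) auto
    then obtain \<tau> where \<tau>: "\<tau> \<in> \<Phi>" "norm (p \<tau> y) = mx'" by auto
    have le: "norm (p \<rho> y) \<le> mx'" if "\<rho> \<in> \<Phi>" for \<rho>
      unfolding mx'_def using finite_fibre that by (intro Max_ge) auto
    have "dist y c < e \<tau>" using e0_le[OF \<tau>(1)] y by linarith
    then have "\<exists>\<sigma>. Fm M \<sigma> = y \<and>
        (\<forall>\<rho>\<in>\<Phi>. norm (id_at \<rho> \<sigma> - (if \<rho> = \<tau> then 1 else 0)) < 1 / (2 * m))"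
      by (rule mp[OF spec[OF conjunct2[OF bspec[OF e \<tau>(1)]]]])
    then obtain \<sigma> where \<sigma>: "Fm M \<sigma> = y"
      "\<And>\<rho>. \<rho> \<in> \<Phi> \<Longrightarrow> norm (id_at \<rho> \<sigma> - (if \<rho> = \<tau> then 1 else 0)) < 1 / (2 * m)"
      by (elim exE conjE) (rule that, assumption, rule bspec)
    have "0 = (\<Sum>\<rho>\<in>\<Phi>. p \<rho> y * id_at \<rho> \<sigma>)"
      using fun_cong[OF rel, of \<sigma>] by (simp add: sum_fun_apply pF_def \<sigma>(1))
    also have "\<dots> = (\<Sum>\<rho>\<in>\<Phi>. (if \<rho> = \<tau> then p \<tau> y else 0) + p \<rho> y * (id_at \<rho> \<sigma> - (if \<rho> = \<tau> then 1 else 0)))"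
      by (intro sum.cong) (auto simp: algebra_simps)
    also have "\<dots> = p \<tau> y + (\<Sum>\<rho>\<in>\<Phi>. p \<rho> y * (id_at \<rho> \<sigma> - (if \<rho> = \<tau> then 1 else 0)))"
      using \<tau>(1) finite_fibre by (simp add: sum.distrib)
    finally have "p \<tau> y = - (\<Sum>\<rho>\<in>\<Phi>. p \<rho> y * (id_at \<rho> \<sigma> - (if \<rho> = \<tau> then 1 else 0)))"
      by (simp add: eq_neg_iff_add_eq_0)
    then have "mx' = norm (\<Sum>\<rho>\<in>\<Phi>. p \<rho> y * (id_at \<rho> \<sigma> - (if \<rho> = \<tau> then 1 else 0)))"
      using \<tau>(2) by (simp only: norm_minus_cancel)
    also have "\<dots> \<le> (\<Sum>\<rho>\<in>\<Phi>. norm (p \<rho> y * (id_at \<rho> \<sigma> - (if \<rho> = \<tau> then 1 else 0))))"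
      by (rule norm_sum)
    also have "\<dots> \<le> (\<Sum>\<rho>\<in>\<Phi>. mx' * (1 / (2 * m)))"
      unfolding norm_mult
    proof (rule sum_mono)
      fix \<rho> assume \<rho>: "\<rho> \<in> \<Phi>"
      show "norm (p \<rho> y) * norm (id_at \<rho> \<sigma> - (if \<rho> = \<tau> then 1 else 0)) \<le> mx' * (1 / (2 * m))"
        by (rule mult_mono[OF le[OF \<rho>] less_imp_le[OF \<sigma>(2)[OF \<rho>]] order_trans[OF norm_ge_zero le[OF \<rho>]] norm_ge_zero])
    qed
    also have "\<dots> = mx' / 2" using m by (simp add: m_def)
    finally have "mx' \<le> 0" by simp
    then have "norm (p \<tau>0 y) \<le> 0" using le[OF \<tau>0] by linarith
    then show ?thesis by simp
  qed
  then show ?thesis using PF_zero_near[OF p[OF \<tau>0] e0] by blast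
qed

lemma Bf_finite_bound: "\<exists>D::nat. \<forall>\<tau>\<in>\<Phi>. id_at \<tau> \<in> Bf (real D)"
proof -
  have "\<forall>\<tau>\<in>\<Phi>. \<exists>D::nat. id_at \<tau> \<in> Bf (real D)" using Laur_Bf id_at(1) by blast
  from bchoice[OF this] obtain D where D: "\<forall>\<tau>\<in>\<Phi>. id_at \<tau> \<in> Bf (real (D \<tau>))" ..
  have "id_at \<tau> \<in> Bf (real (\<Sum>\<tau>\<in>\<Phi>. D \<tau>))" if "\<tau> \<in> \<Phi>" for \<tau>
  proof -
    have "D \<tau> \<le> (\<Sum>\<tau>\<in>\<Phi>. D \<tau>)" using that finite_fibre by (intro member_le_sum) auto
    then show ?thesis using D that by (intro Bf_mono[of "real (D \<tau>)" "real (\<Sum>\<tau>\<in>\<Phi>. D \<tau>)"]) (auto simp del: of_nat_sum)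
  qed
  then show ?thesis by blast
qed

text \<open>The products of monomials of degree at most \<open>n\<close> in the forms with the
  \<open>id_at\<close> are independent and lie in level \<open>n + D\<close>, with \<open>D\<close>
  fixed. So the number of fibre points times \<open>n ^ d / d!\<close> is asymptotically at most
  \<open>vol * n ^ d\<close>.\<close>

lemma fibre_upper: "real (card \<Phi>) \<le> fact CARD('b) * vol"
proof -
  obtain D :: nat where D: "\<And>\<tau>. \<tau> \<in> \<Phi> \<Longrightarrow> id_at \<tau> \<in> Bf (real D)" using Bf_finite_bound by blast
  have card: "card (Smp n :: ('b \<Rightarrow> nat) set) * card \<Phi> \<le> card (lat A (real (n + D)))" for n
  proof (rule ccontr)
    assume "\<not> ?thesis"
    then have lt: "card (lat A (real (n + D))) < card ((Smp n :: ('b \<Rightarrow> nat) set) \<times> \<Phi>)"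
      by (simp add: card_cartesian_product)
    have fin: "finite ((Smp n :: ('b \<Rightarrow> nat) set) \<times> \<Phi>)" using finite_fibre by simp
    have "\<exists>q. (\<exists>i\<in>Smp n \<times> \<Phi>. q i \<noteq> 0) \<and> (\<forall>x. (\<Sum>i\<in>Smp n \<times> \<Phi>. q i * (pF M (mon (fst i)) * id_at (snd i)) x) = 0)"
    proof (rule linear_relation_exists[OF finite_lat fin lt, where h = ch])
      fix i :: "('b \<Rightarrow> nat) \<times> 'b torus" assume i: "i \<in> Smp n \<times> \<Phi>"
      have "pF M (mon (fst i)) * id_at (snd i) \<in> Bf (real n + real D)"
        using i by (intro Bf_mult pF_Bf PF_mon D) auto
      then show "\<exists>a. \<forall>x. (pF M (mon (fst i)) * id_at (snd i)) x = (\<Sum>s\<in>lat A (real (n + D)). a s * ch s x)"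
        unfolding LP_def by simp
    qed
    then obtain q \<alpha> \<tau> where q: "\<alpha> \<in> Smp n" "\<tau> \<in> \<Phi>" "q (\<alpha>, \<tau>) \<noteq> 0"
      "\<And>x. (\<Sum>i\<in>Smp n \<times> \<Phi>. q i * (pF M (mon (fst i)) * id_at (snd i)) x) = 0" by auto
    define p where "p \<tau> = (\<lambda>y. \<Sum>\<alpha>\<in>Smp n. q (\<alpha>, \<tau>) * mon \<alpha> y)" for \<tau>
    have pP: "p \<tau> \<in> PF n" for \<tau> unfolding p_def PF_def
      by (rule CollectI, rule exI[of _ "\<lambda>\<alpha>. q (\<alpha>, \<tau>)"], rule refl)
    have "(\<Sum>\<tau>\<in>\<Phi>. pF M (p \<tau>) * id_at \<tau>) = 0"
    proof
      fix x
      have "(\<Sum>\<tau>\<in>\<Phi>. pF M (p \<tau>) * id_at \<tau>) x = (\<Sum>\<tau>\<in>\<Phi>. \<Sum>\<alpha>\<in>Smp n. q (\<alpha>, \<tau>) * mon \<alpha> (Fm M x) * id_at \<tau> x)"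
        by (simp add: sum_fun_apply pF_def p_def sum_distrib_right)
      also have "\<dots> = (\<Sum>\<alpha>\<in>Smp n. \<Sum>\<tau>\<in>\<Phi>. q (\<alpha>, \<tau>) * mon \<alpha> (Fm M x) * id_at \<tau> x)" by (rule sum.swap)
      also have "\<dots> = (\<Sum>i\<in>Smp n \<times> \<Phi>. q i * (pF M (mon (fst i)) * id_at (snd i)) x)"
        by (subst sum.cartesian_product) (auto intro!: sum.cong simp: pF_def)
      finally show "(\<Sum>\<tau>\<in>\<Phi>. pF M (p \<tau>) * id_at \<tau>) x = 0 x" using q(4) by simp
    qed
    from id_at_independent[OF pP this q(2)] have "p \<tau> y = 0" for y .
    then have "q (\<alpha>, \<tau>) = 0"
      unfolding p_def by (intro mon_independent[OF finite_Smp _ q(1), of "\<lambda>\<alpha>. q (\<alpha>, \<tau>)"])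
    with q(3) show False by simp
  qed
  show ?thesis
  proof (rule power_growth_le)
    fix n :: nat assume n: "1 \<le> n"
    have "real (card \<Phi>) * real n ^ CARD('b) \<le> real (card \<Phi>) * (fact CARD('b) * real (card (Smp n :: ('b \<Rightarrow> nat) set)))"
      by (intro mult_left_mono card_Smp_lower) auto
    also have "\<dots> = fact CARD('b) * real (card (Smp n :: ('b \<Rightarrow> nat) set) * card \<Phi>)" by simp
    also have "\<dots> \<le> fact CARD('b) * real (card (lat A (real (n + D))))"
      using card[of n] by (intro mult_left_mono) (simp_all only: of_nat_le_iff, simp)
    also have "\<dots> \<le> fact CARD('b) * (vol * (real (n + D) + kap) ^ CARD('b))"
      using n by (intro mult_left_mono lat_card_upper) auto
    finally show "real (card \<Phi>) * (real n - 0) ^ CARD('b) \<le> fact CARD('b) * vol * (real n + (real D + kap)) ^ CARD('b)"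
      by (simp add: add.assoc mult.assoc)
  qed
qed

end

section \<open>Lower bound for the number of points of a fibre\<close>

definition Pol :: "(complex ^ 'd::finite \<Rightarrow> complex) set" where
  "Pol = (\<Union>N. PF N)"

lemma Pol_I: "p \<in> PF N \<Longrightarrow> p \<in> Pol"
  by (auto simp: Pol_def)

lemma Pol_bound2: "p \<in> Pol \<Longrightarrow> q \<in> Pol \<Longrightarrow> \<exists>N. p \<in> PF N \<and> q \<in> PF N"
proof -
  assume "p \<in> Pol" "q \<in> Pol"
  then obtain N N' where "p \<in> PF N" "q \<in> PF N'" by (auto simp: Pol_def)
  then have "p \<in> PF (max N N')" "q \<in> PF (max N N')" by (auto intro: PF_mono[rotated])
  then show ?thesis by blast
qed

lemma Pol_cst: "cst e \<in> Pol" and Pol_0: "0 \<in> Pol" and Pol_coord: "(\<lambda>y. y $ i) \<in> Pol"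
  using Pol_I[OF PF_cst] Pol_I[OF PF_0] Pol_I[OF PF_coord] .

lemma Pol_add: "p \<in> Pol \<Longrightarrow> q \<in> Pol \<Longrightarrow> p + q \<in> Pol"
  by (drule (1) Pol_bound2) (elim exE conjE, rule Pol_I, rule PF_add)

lemma Pol_mult: "p \<in> Pol \<Longrightarrow> q \<in> Pol \<Longrightarrow> p * q \<in> Pol"
  by (drule (1) Pol_bound2) (elim exE conjE, rule Pol_I, rule PF_mult)

lemma Pol_diff: assumes "p \<in> Pol" "q \<in> Pol" shows "p - q \<in> Pol"
proof -
  have "p + cst (-1) * q \<in> Pol" using assms by (intro Pol_add Pol_mult Pol_cst)
  moreover have "p + cst (-1) * q = p - q" by (simp add: fun_eq_iff)
  ultimately show ?thesis by (simp only:)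
qed

lemma Pol_sum: "(\<And>i. i \<in> X \<Longrightarrow> f i \<in> Pol) \<Longrightarrow> (\<Sum>i\<in>X. f i) \<in> Pol"
  by (induction X rule: infinite_finite_induct) (auto intro: Pol_add Pol_0)

lemma Pol_bound:
  assumes "finite X" "\<And>i. i \<in> X \<Longrightarrow> f i \<in> Pol" shows "\<exists>N. \<forall>i\<in>X. f i \<in> PF N"
  using assms
proof (induction X rule: finite_induct)
  case (insert i X)
  then obtain N where N: "\<forall>i\<in>X. f i \<in> PF N" by blast
  obtain N' where N': "f i \<in> PF N'" using insert.prems[of i] by (auto simp: Pol_def)
  have "f j \<in> PF (max N N')" if "j \<in> insert i X" for j
    using that N N' PF_mono[of N "max N N'" "f j"] PF_mono[of N' "max N N'" "f j"] by auto
  then show ?case by blast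
qed simp

context fibre
begin

text \<open>\<open>good\<close> iterated down to level \<open>\<nu>\<close>, each step costing one
  degree in the forms. The degree bound \<open>n\<close> is generous by \<open>\<nu>\<close>, which
  is harmless as only the leading growth counts.\<close>

lemma Bf_gen:
  assumes "\<nu> \<le> n" "g \<in> Bf (real n)"
  shows "\<exists>p. (\<forall>u. p u \<in> PF n) \<and> g = (\<Sum>u\<in>lat A (real \<nu>). pF M (p u) * ch u)"
  using assms
proof (induction n arbitrary: g rule: dec_induct)
  case base
  then obtain a where g: "g = (\<lambda>\<tau>. \<Sum>u\<in>lat A (real \<nu>). a u * ch u \<tau>)" by (rule LP_E)
  have "g = (\<Sum>u\<in>lat A (real \<nu>). pF M (cst (a u)) * ch u)"
    unfolding g pF_simps by (simp add: fun_eq_iff sum_fun_apply)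
  then show "\<exists>p. (\<forall>u. p u \<in> PF \<nu>) \<and> g = (\<Sum>u\<in>lat A (real \<nu>). pF M (p u) * ch u)"
    using PF_cst by (intro exI[of _ "\<lambda>u. cst (a u)"] conjI allI)
next
  case (step n)
  define X where "X = {g. \<exists>p. (\<forall>u. p u \<in> PF (Suc n)) \<and> g = (\<Sum>u\<in>lat A (real \<nu>). pF M (p u) * ch u)}"
  have X: "(\<Sum>u\<in>lat A (real \<nu>). pF M (p u) * ch u) \<in> X" if "\<And>u. p u \<in> PF (Suc n)" for p
    using that unfolding X_def by blast
  have add: "a + b \<in> X" if "a \<in> X" "b \<in> X" for a b
  proof -
    obtain p q where p: "\<forall>u. p u \<in> PF (Suc n)" "a = (\<Sum>u\<in>lat A (real \<nu>). pF M (p u) * ch u)"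
      and q: "\<forall>u. q u \<in> PF (Suc n)" "b = (\<Sum>u\<in>lat A (real \<nu>). pF M (q u) * ch u)"
      using \<open>a \<in> X\<close> \<open>b \<in> X\<close> unfolding X_def by blast
    have eq: "a + b = (\<Sum>u\<in>lat A (real \<nu>). pF M (p u + q u) * ch u)"
      unfolding p(2) q(2) pF_simps distrib_right sum.distrib ..
    show ?thesis unfolding eq by (rule X) (rule PF_add[OF spec[OF p(1)] spec[OF q(1)]])
  qed
  have IH: "\<exists>p. (\<forall>u. p u \<in> PF n) \<and> b = (\<Sum>u\<in>lat A (real \<nu>). pF M (p u) * ch u)"
    if "b \<in> Bf (real n)" for b using step.IH[OF that] .
  have "g \<in> Bf (real n + 1)" using step.prems by (simp add: add.commute)
  then have "g \<in> U (range M) (real n)" using good step.hyps(1) by (auto simp: good_def)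
  then have "g \<in> X"
  proof (rule U_E)
    have "(\<Sum>u\<in>lat A (real \<nu>). pF M 0 * ch u) \<in> X" by (rule X) (rule PF_0)
    then show "0 \<in> X" by (simp add: pF_simps)
  next
    fix b assume "b \<in> Bf (real n)"
    then obtain p where p: "\<forall>u. p u \<in> PF n" "b = (\<Sum>u\<in>lat A (real \<nu>). pF M (p u) * ch u)"
      using IH by blast
    show "b \<in> X" unfolding p(2) using p(1) by (intro X) (auto intro: PF_mono[of n])
  next
    fix w b assume "w \<in> range M" and b: "b \<in> Bf (real n)"
    then obtain i where w: "w = M i" by blast
    obtain p where p: "\<forall>u. p u \<in> PF n" "b = (\<Sum>u\<in>lat A (real \<nu>). pF M (p u) * ch u)"
      using IH[OF b] by blast
    have "lf w * b = (\<Sum>u\<in>lat A (real \<nu>). pF M ((\<lambda>y. y $ i) * p u) * ch u)"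
      unfolding w p(2) pF_simps by (simp add: sum_distrib_left mult.assoc)
    also have "\<dots> \<in> X"
    proof (rule X)
      fix u
      from PF_mult[OF PF_coord spec[OF p(1)]] show "(\<lambda>y. y $ i) * p u \<in> PF (Suc n)" by simp
    qed
    finally show "lf w * b \<in> X" .
  qed (rule add)
  then show "\<exists>p. (\<forall>u. p u \<in> PF (Suc n)) \<and> g = (\<Sum>u\<in>lat A (real \<nu>). pF M (p u) * ch u)"
    unfolding X_def by blast
qed

lemma Laur_gen:
  assumes "g \<in> Laur"
  shows "\<exists>p. (\<forall>u. p u \<in> Pol) \<and> g = (\<Sum>u\<in>lat A (real \<nu>). pF M (p u) * ch u)"
proof -
  obtain N :: nat where "g \<in> Bf (real N)" using Laur_Bf[OF assms] by blast
  then have "g \<in> Bf (real (max \<nu> N))" by (rule Bf_mono[rotated]) simp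
  from Bf_gen[OF _ this] obtain p where p: "\<forall>u. p u \<in> PF (max \<nu> N)"
    "g = (\<Sum>u\<in>lat A (real \<nu>). pF M (p u) * ch u)" by auto
  have "p u \<in> Pol" for u by (rule Pol_I, rule spec[OF p(1)])
  with p(2) show ?thesis by (intro exI[of _ p]) simp
qed

text \<open>
  Modulo the polynomials in the forms that vanish at \<open>c\<close>, the functions \<open>id_at \<tau>\<close> span all Laurent
  polynomials, so by Nakayama they do so after inverting one polynomial \<open>p\<close> with \<open>p c = 1\<close>.
\<close>

definition id_module :: "('b torus \<Rightarrow> complex) set" where
  "id_module = {g. \<exists>p. (\<forall>\<tau>. p \<tau> \<in> Pol) \<and> g = (\<Sum>\<tau>\<in>\<Phi>. pF M (p \<tau>) * id_at \<tau>)}"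

lemma id_module_I: "(\<And>\<tau>. p \<tau> \<in> Pol) \<Longrightarrow> (\<Sum>\<tau>\<in>\<Phi>. pF M (p \<tau>) * id_at \<tau>) \<in> id_module"
  unfolding id_module_def by (intro CollectI exI[of _ p]) simp

definition vanishing_at_c :: "('b torus \<Rightarrow> complex) set" where
  "vanishing_at_c = {pF M p | p. p \<in> Pol \<and> p c = 0}"

lemma vanishing_at_c_I: "p \<in> Pol \<Longrightarrow> p c = 0 \<Longrightarrow> pF M p \<in> vanishing_at_c"
  unfolding vanishing_at_c_def by blast

lemma denominators_exist:
  "\<exists>p\<in>Pol. p c = 1 \<and> (\<forall>u\<in>lat A (real \<nu>). pF M p * ch u \<in> id_module)"
proof -
  have "\<exists>h\<in>vanishing_at_c. \<forall>u\<in>lat A (real \<nu>). (1 - h) * ch u \<in> id_module"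
  proof (rule nakayama[where R = "pF M ` Pol"])
    show "finite (lat A (real \<nu>))" by simp
    show "1 \<in> pF M ` Pol"
      using imageI[OF Pol_cst[of 1], of "pF M"] by (simp add: pF_simps one_fun_def)
    show "a - b \<in> pF M ` Pol" if "a \<in> pF M ` Pol" "b \<in> pF M ` Pol" for a b
    proof -
      obtain p q where "a = pF M p" "p \<in> Pol" "b = pF M q" "q \<in> Pol"
        using \<open>a \<in> pF M ` Pol\<close> \<open>b \<in> pF M ` Pol\<close> by (elim imageE)
      then show ?thesis using imageI[OF Pol_diff[of p q], of "pF M"] by (simp add: pF_simps)
    qed
    show "vanishing_at_c \<subseteq> pF M ` Pol" by (auto simp: vanishing_at_c_def)
    show "0 \<in> vanishing_at_c" using vanishing_at_c_I[OF Pol_0] by (simp add: pF_simps)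
    show "a - b \<in> vanishing_at_c" if "a \<in> vanishing_at_c" "b \<in> vanishing_at_c" for a b
    proof -
      obtain p q where "a = pF M p" "p \<in> Pol" "p c = 0" "b = pF M q" "q \<in> Pol" "q c = 0"
        using \<open>a \<in> vanishing_at_c\<close> \<open>b \<in> vanishing_at_c\<close> unfolding vanishing_at_c_def by blast
      then show ?thesis using vanishing_at_c_I[OF Pol_diff[of p q]] by (simp add: pF_simps)
    qed
    show "r * a \<in> vanishing_at_c" if "r \<in> pF M ` Pol" "a \<in> vanishing_at_c" for r a
    proof -
      obtain p q where "a = pF M p" "p \<in> Pol" "p c = 0" "r = pF M q" "q \<in> Pol"
        using \<open>r \<in> pF M ` Pol\<close> \<open>a \<in> vanishing_at_c\<close> unfolding vanishing_at_c_def by blast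
      then show ?thesis using vanishing_at_c_I[OF Pol_mult[of q p]] by (simp add: pF_simps)
    qed
    have "(\<Sum>\<tau>\<in>\<Phi>. pF M 0 * id_at \<tau>) \<in> id_module" by (rule id_module_I) (rule Pol_0)
    then show "0 \<in> id_module" by (simp add: pF_simps)
    show "a - b \<in> id_module" if "a \<in> id_module" "b \<in> id_module" for a b
    proof -
      obtain p q where p: "\<forall>\<tau>. p \<tau> \<in> Pol" "a = (\<Sum>\<tau>\<in>\<Phi>. pF M (p \<tau>) * id_at \<tau>)"
        and q: "\<forall>\<tau>. q \<tau> \<in> Pol" "b = (\<Sum>\<tau>\<in>\<Phi>. pF M (q \<tau>) * id_at \<tau>)"
        using \<open>a \<in> id_module\<close> \<open>b \<in> id_module\<close> unfolding id_module_def by blast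
      have eq: "a - b = (\<Sum>\<tau>\<in>\<Phi>. pF M (p \<tau> - q \<tau>) * id_at \<tau>)"
        unfolding p(2) q(2) pF_simps left_diff_distrib sum_subtractf ..
      show ?thesis unfolding eq by (rule id_module_I) (rule Pol_diff[OF spec[OF p(1)] spec[OF q(1)]])
    qed
    show "r * a \<in> id_module" if "r \<in> pF M ` Pol" "a \<in> id_module" for r a
    proof -
      obtain p q where p: "\<forall>\<tau>. p \<tau> \<in> Pol" "a = (\<Sum>\<tau>\<in>\<Phi>. pF M (p \<tau>) * id_at \<tau>)"
        and q: "q \<in> Pol" "r = pF M q"
        using \<open>r \<in> pF M ` Pol\<close> \<open>a \<in> id_module\<close> unfolding id_module_def by blast
      have eq: "r * a = (\<Sum>\<tau>\<in>\<Phi>. pF M (q * p \<tau>) * id_at \<tau>)"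
        unfolding p(2) q(2) pF_simps by (simp add: sum_distrib_left mult.assoc)
      show ?thesis unfolding eq by (rule id_module_I) (rule Pol_mult[OF q(1) spec[OF p(1)]])
    qed
    fix u assume "u \<in> lat A (real \<nu>)"
    obtain a where "ch u - (\<Sum>\<tau>\<in>\<Phi>. cst (a \<tau>) * id_at \<tau>) \<in> I" using Laur_decomp[OF Laur_ch] by blast
    then obtain b where b: "\<forall>i. b i \<in> Laur"
      "ch u - (\<Sum>\<tau>\<in>\<Phi>. cst (a \<tau>) * id_at \<tau>) = (\<Sum>i\<in>UNIV. (lf (M i) - cst (c $ i)) * b i)"
      unfolding I_def by blast
    have "\<forall>i. \<exists>p. (\<forall>u. p u \<in> Pol) \<and> b i = (\<Sum>u\<in>lat A (real \<nu>). pF M (p u) * ch u)"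
      using Laur_gen b(1) by blast
    from choice[OF this] obtain p where
      p: "\<forall>i. (\<forall>u. p i u \<in> Pol) \<and> b i = (\<Sum>u\<in>lat A (real \<nu>). pF M (p i u) * ch u)" ..
    define h where "h v = pF M (\<Sum>i\<in>UNIV. ((\<lambda>y. y $ i) - cst (c $ i)) * p i v)" for v
    have hJ: "h v \<in> vanishing_at_c" for v
      unfolding h_def
    proof (rule vanishing_at_c_I)
      show "(\<Sum>i\<in>UNIV. ((\<lambda>y. y $ i) - cst (c $ i)) * p i v) \<in> Pol"
        using p by (intro Pol_sum Pol_mult Pol_diff Pol_coord Pol_cst) blast
    qed (simp add: sum_fun_apply)
    have "ch u - (\<Sum>v\<in>lat A (real \<nu>). h v * ch v) = (\<Sum>\<tau>\<in>\<Phi>. pF M (cst (a \<tau>)) * id_at \<tau>)"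
    proof -
      have "(\<Sum>v\<in>lat A (real \<nu>). h v * ch v) =
          (\<Sum>v\<in>lat A (real \<nu>). \<Sum>i\<in>UNIV. (lf (M i) - cst (c $ i)) * (pF M (p i v) * ch v))"
        by (simp add: h_def pF_sum pF_simps sum_distrib_right mult.assoc)
      also have "\<dots> = (\<Sum>i\<in>UNIV. \<Sum>v\<in>lat A (real \<nu>). (lf (M i) - cst (c $ i)) * (pF M (p i v) * ch v))"
        by (rule sum.swap)
      also have "\<dots> = (\<Sum>i\<in>UNIV. (lf (M i) - cst (c $ i)) * b i)"
        using p by (simp add: sum_distrib_left[symmetric])
      also have "\<dots> = ch u - (\<Sum>\<tau>\<in>\<Phi>. cst (a \<tau>) * id_at \<tau>)" by (rule b(2)[symmetric])
      finally show ?thesis by (simp add: pF_simps)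
    qed
    also have "\<dots> \<in> id_module" by (rule id_module_I) (rule Pol_cst)
    finally show "\<exists>h. (\<forall>v\<in>lat A (real \<nu>). h v \<in> vanishing_at_c) \<and> ch u - (\<Sum>v\<in>lat A (real \<nu>). h v * ch v) \<in> id_module"
      using hJ by blast
  qed
  then obtain q where q: "q \<in> Pol" "q c = 0" "\<forall>u\<in>lat A (real \<nu>). (1 - pF M q) * ch u \<in> id_module"
    unfolding vanishing_at_c_def by blast
  show ?thesis
  proof (intro bexI[of _ "cst 1 - q"] conjI)
    show "cst 1 - q \<in> Pol" using q(1) by (intro Pol_diff Pol_cst)
    have "pF M (cst 1 - q) = 1 - pF M q" by (simp add: pF_simps fun_eq_iff)
    then show "\<forall>u\<in>lat A (real \<nu>). pF M (cst 1 - q) * ch u \<in> id_module" using q(3) by simp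
  qed (simp add: q(2))
qed

text \<open>One fixed factor \<open>pF M p\<close> moves every monomial of level \<open>n\<close>
  into the span of the \<open>id_at\<close> with coefficients of degree at most
  \<open>n + D\<close>. Multiplication by it is injective, Laurent polynomials having no zero
  divisors, so the lattice points of level \<open>n\<close> number at most
  \<open>card (Smp (n + D)) * card \<Phi>\<close>.\<close>

lemma fibre_lower: "fact CARD('b) * vol \<le> real (card \<Phi>)"
proof -
  obtain p where p: "p \<in> Pol" "p c = 1" "\<forall>u\<in>lat A (real \<nu>). pF M p * ch u \<in> id_module"
    using denominators_exist by blast
  have "\<forall>u\<in>lat A (real \<nu>). \<exists>r. (\<forall>\<tau>. r \<tau> \<in> Pol) \<and> pF M p * ch u = (\<Sum>\<tau>\<in>\<Phi>. pF M (r \<tau>) * id_at \<tau>)"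
    using p(3) unfolding id_module_def by blast
  from bchoice[OF this] obtain r where r: "\<forall>u\<in>lat A (real \<nu>). (\<forall>\<tau>. r u \<tau> \<in> Pol) \<and>
      pF M p * ch u = (\<Sum>\<tau>\<in>\<Phi>. pF M (r u \<tau>) * id_at \<tau>)" ..
  have "\<exists>D. \<forall>i\<in>lat A (real \<nu>) \<times> \<Phi>. r (fst i) (snd i) \<in> PF D"
  proof (rule Pol_bound)
    show "r (fst i) (snd i) \<in> Pol" if "i \<in> lat A (real \<nu>) \<times> \<Phi>" for i
      using r that by (auto simp: mem_Times_iff)
  qed (simp add: finite_fibre)
  then obtain D where D': "\<forall>i\<in>lat A (real \<nu>) \<times> \<Phi>. r (fst i) (snd i) \<in> PF D" ..
  have D: "r u \<tau> \<in> PF D" if "u \<in> lat A (real \<nu>)" "\<tau> \<in> \<Phi>" for u \<tau>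
    using bspec[OF D', of "(u, \<tau>)"] that by simp
  have nz: "pF M p \<noteq> 0"
  proof
    assume z: "pF M p = 0"
    obtain N where "p \<in> PF N" using p(1) by (auto simp: Pol_def)
    from pF_eq_0[OF this z, of c] p(2) show False by simp
  qed
  obtain N where pN: "p \<in> PF N" using p(1) by (auto simp: Pol_def)
  have pL: "pF M p \<in> Laur" by (rule Bf_Laur[OF pF_Bf[OF pN]])
  have card: "card (lat A (real n)) \<le> card (Smp (n + D) :: ('b \<Rightarrow> nat) set) * card \<Phi>" if n: "\<nu> \<le> n" for n
  proof (rule ccontr)
    assume "\<not> ?thesis"
    then have lt: "card ((Smp (n + D) :: ('b \<Rightarrow> nat) set) \<times> \<Phi>) < card (lat A (real n))"
      by (simp add: card_cartesian_product)
    have fin: "finite ((Smp (n + D) :: ('b \<Rightarrow> nat) set) \<times> \<Phi>)" using finite_fibre by simp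
    have "\<exists>q. (\<exists>v\<in>lat A (real n). q v \<noteq> 0) \<and> (\<forall>x. (\<Sum>v\<in>lat A (real n). q v * (pF M p * ch v) x) = 0)"
    proof (rule linear_relation_exists[OF fin finite_lat lt, where h = "\<lambda>i x. mon (fst i) (Fm M x) * id_at (snd i) x"])
      fix v assume v: "v \<in> lat A (real n)"
      obtain s where s: "\<forall>u. s u \<in> PF n" "ch v = (\<Sum>u\<in>lat A (real \<nu>). pF M (s u) * ch u)"
        using Bf_gen[OF n Bf_ch[OF v]] by blast
      \<comment> \<open>Coefficients of \<open>pF M p * ch v\<close> with respect to the
        \<open>id_at\<close>: degree \<open>n\<close> from \<open>Bf_gen\<close>, plus
        \<open>D\<close> from \<open>r\<close>, which does not depend on \<open>n\<close>.\<close>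
      define t where "t \<tau> = (\<Sum>u\<in>lat A (real \<nu>). s u * r u \<tau>)" for \<tau>
      have "t \<tau> \<in> PF (n + D)" if \<tau>: "\<tau> \<in> \<Phi>" for \<tau>
      proof -
        have "(\<Sum>u\<in>X. s u * r u \<tau>) \<in> PF (n + D)" if "X \<subseteq> lat A (real \<nu>)" for X
          using that
        proof (induction X rule: infinite_finite_induct)
          case (insert u X)
          have "s u * r u \<tau> \<in> PF (n + D)"
            using insert.prems by (intro PF_mult spec[OF s(1)] D \<tau>) auto
          moreover have "(\<Sum>u\<in>X. s u * r u \<tau>) \<in> PF (n + D)"
            by (rule insert.IH) (use insert.prems in blast)
          ultimately have "s u * r u \<tau> + (\<Sum>u\<in>X. s u * r u \<tau>) \<in> PF (n + D)" by (rule PF_add)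
          then show "(\<Sum>u\<in>insert u X. s u * r u \<tau>) \<in> PF (n + D)"
            unfolding sum.insert[OF insert.hyps] .
        qed (simp_all add: PF_0)
        then show ?thesis unfolding t_def by blast
      qed
      then have "\<forall>\<tau>\<in>\<Phi>. \<exists>a. t \<tau> = (\<lambda>y. \<Sum>\<alpha>\<in>Smp (n + D). a \<alpha> * mon \<alpha> y)"
        unfolding PF_def by blast
      from bchoice[OF this] obtain a where a: "\<forall>\<tau>\<in>\<Phi>. t \<tau> = (\<lambda>y. \<Sum>\<alpha>\<in>Smp (n + D). a \<tau> \<alpha> * mon \<alpha> y)" ..
      have "(pF M p * ch v) x = (\<Sum>i\<in>Smp (n + D) \<times> \<Phi>. a (snd i) (fst i) * (mon (fst i) (Fm M x) * id_at (snd i) x))" for x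
      proof -
        have "pF M p * ch v = (\<Sum>u\<in>lat A (real \<nu>). pF M (s u) * (pF M p * ch u))"
          by (subst s(2)) (simp add: sum_distrib_left mult.left_commute)
        also have "\<dots> = (\<Sum>u\<in>lat A (real \<nu>). \<Sum>\<tau>\<in>\<Phi>. pF M (s u * r u \<tau>) * id_at \<tau>)"
        proof (rule sum.cong[OF refl])
          fix u assume "u \<in> lat A (real \<nu>)"
          then have e: "pF M p * ch u = (\<Sum>\<tau>\<in>\<Phi>. pF M (r u \<tau>) * id_at \<tau>)" using r by blast
          show "pF M (s u) * (pF M p * ch u) = (\<Sum>\<tau>\<in>\<Phi>. pF M (s u * r u \<tau>) * id_at \<tau>)"
            unfolding e by (simp add: sum_distrib_left pF_simps mult.assoc)
        qed
        also have "\<dots> = (\<Sum>\<tau>\<in>\<Phi>. \<Sum>u\<in>lat A (real \<nu>). pF M (s u * r u \<tau>) * id_at \<tau>)" by (rule sum.swap)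
        also have "\<dots> = (\<Sum>\<tau>\<in>\<Phi>. pF M (t \<tau>) * id_at \<tau>)"
          by (simp add: t_def pF_sum sum_distrib_right)
        finally have "(pF M p * ch v) x = (\<Sum>\<tau>\<in>\<Phi>. t \<tau> (Fm M x) * id_at \<tau> x)"
          by (simp add: sum_fun_apply pF_def)
        also have "\<dots> = (\<Sum>\<tau>\<in>\<Phi>. \<Sum>\<alpha>\<in>Smp (n + D). a \<tau> \<alpha> * mon \<alpha> (Fm M x) * id_at \<tau> x)"
          using a by (intro sum.cong refl) (simp add: sum_distrib_right)
        also have "\<dots> = (\<Sum>\<alpha>\<in>Smp (n + D). \<Sum>\<tau>\<in>\<Phi>. a \<tau> \<alpha> * mon \<alpha> (Fm M x) * id_at \<tau> x)" by (rule sum.swap)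
        also have "\<dots> = (\<Sum>i\<in>Smp (n + D) \<times> \<Phi>. a (snd i) (fst i) * (mon (fst i) (Fm M x) * id_at (snd i) x))"
          by (subst sum.cartesian_product) (auto intro!: sum.cong)
        finally show ?thesis .
      qed
      then show "\<exists>a. \<forall>x. (pF M p * ch v) x = (\<Sum>i\<in>Smp (n + D) \<times> \<Phi>. a i * (mon (fst i) (Fm M x) * id_at (snd i) x))"
        by (intro exI[of _ "\<lambda>i. a (snd i) (fst i)"] allI)
    qed
    then obtain q v where q: "v \<in> lat A (real n)" "q v \<noteq> 0"
      "\<And>x. (\<Sum>v\<in>lat A (real n). q v * (pF M p * ch v) x) = 0" by blast
    define g where "g = (\<lambda>x. \<Sum>v\<in>lat A (real n). q v * ch v x)"
    have gL: "g \<in> Laur" unfolding g_def by (rule Laur_LP[OF finite_lat[of "real n"]]) (auto simp: LP_def)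
    have "pF M p * g = 0"
    proof
      fix x
      show "(pF M p * g) x = 0 x" using q(3)[of x] by (simp add: g_def sum_distrib_left mult.left_commute)
    qed
    then have "g = 0" using Laur_mult_nz[OF pL gL nz] by blast
    then have "g x = 0" for x by simp
    then have "(\<Sum>v\<in>lat A (real n). q v * ch v x) = 0" for x unfolding g_def .
    from ch_independent[OF finite_lat this q(1)] q(2) show False by simp
  qed
  obtain N1 :: nat where N1: "kap < real N1" using reals_Archimedean2 by blast
  show ?thesis
  proof (rule power_growth_le)
    fix n :: nat assume n: "max (\<nu> + 1) N1 \<le> n"
    have "fact CARD('b) * (vol * (real n - kap) ^ CARD('b)) \<le> fact CARD('b) * real (card (lat A (real n)))"
      using n N1 by (intro mult_left_mono lat_card_lower) auto
    also have "\<dots> \<le> fact CARD('b) * real (card (Smp (n + D) :: ('b \<Rightarrow> nat) set) * card \<Phi>)"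
      using card[of n] n by (intro mult_left_mono) (simp_all only: of_nat_le_iff, simp_all)
    also have "\<dots> = real (card \<Phi>) * (fact CARD('b) * real (card (Smp (n + D) :: ('b \<Rightarrow> nat) set)))" by simp
    also have "\<dots> \<le> real (card \<Phi>) * (real (n + D) + real CARD('b)) ^ CARD('b)"
      by (intro mult_left_mono card_Smp_upper) auto
    finally show "fact CARD('b) * vol * (real n - kap) ^ CARD('b) \<le> real (card \<Phi>) * (real n + (real D + real CARD('b))) ^ CARD('b)"
      by (simp add: add.assoc mult.assoc)
  qed
qed

theorem fibre_card: "real (card \<Phi>) = fact CARD('b) * vol"
  using fibre_lower fibre_upper by (rule antisym[rotated])

end

section \<open>Genericity\<close>

text \<open>
  Fraction-free elimination: the pivots of \<open>T\<close> are polynomial and equal to 1 at \<open>e0\<close>.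
\<close>

lemma generic_left_inverse:
  fixes T :: "'u \<Rightarrow> 'u \<Rightarrow> 'e \<Rightarrow> complex"
  assumes "finite S" "\<And>u v. u \<in> S \<Longrightarrow> v \<in> S \<Longrightarrow> T u v \<in> polyfuns X"
    "\<And>u v. u \<in> S \<Longrightarrow> v \<in> S \<Longrightarrow> T u v e0 = (if u = v then 1 else 0)"
  shows "\<exists>\<phi>\<in>polyfuns X. \<phi> e0 \<noteq> 0 \<and> (\<forall>e. \<phi> e \<noteq> 0 \<longrightarrow>
    (\<forall>w\<in>S. \<exists>z. \<forall>v\<in>S. (\<Sum>u\<in>S. z u * T u v e) = (if v = w then 1 else 0)))"
  using assms
proof (induction S arbitrary: T rule: finite_induct)
  case empty
  show ?case by (intro bexI[of _ "\<lambda>_. 1"] polyfuns.const) auto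
next
  case (insert x S)
  \<comment> \<open>The Schur complement of the pivot \<open>T x x\<close>, multiplied by the pivot
    so that its entries stay polynomial.\<close>
  define T' where "T' u v = (\<lambda>e. T x x e * T u v e + ((\<lambda>_. - 1) e * T u x e) * T x v e)" for u v
  have pol: "T u v \<in> polyfuns X" if "u \<in> insert x S" "v \<in> insert x S" for u v
    using insert.prems(1) that by blast
  have T'pol: "T' u v \<in> polyfuns X" if "u \<in> S" "v \<in> S" for u v
    unfolding T'_def using that pol
    by (intro polyfuns.add polyfuns.mult[of "\<lambda>e. (\<lambda>_. - 1) e * T u x e"] polyfuns.mult[of "\<lambda>_. - 1"] polyfuns.mult[of "T x x"] polyfuns.const) auto
  have T'0: "T' u v e0 = (if u = v then 1 else 0)" if "u \<in> S" "v \<in> S" for u v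
    using that insert.prems(2) insert.hyps by (auto simp: T'_def)
  obtain \<phi> where \<phi>: "\<phi> \<in> polyfuns X" "\<phi> e0 \<noteq> 0" "\<And>e w. \<phi> e \<noteq> 0 \<Longrightarrow> w \<in> S \<Longrightarrow>
      \<exists>z. \<forall>v\<in>S. (\<Sum>u\<in>S. z u * T' u v e) = (if v = w then 1 else 0)"
    using insert.IH[of T', OF T'pol T'0] by blast
  have key: "\<exists>z. \<forall>v\<in>insert x S. (\<Sum>u\<in>insert x S. z u * T u v e) = (if v = w then 1 else 0)"
    if e: "T x x e * \<phi> e \<noteq> 0" and w: "w \<in> insert x S" for e w
  proof -
    define p where "p = T x x e"
    have p: "p \<noteq> 0" "\<phi> e \<noteq> 0" using e by (auto simp: p_def)
    have S: "\<exists>z. \<forall>v\<in>insert x S. (\<Sum>u\<in>insert x S. z u * T u v e) = (if v = w then 1 else 0)" if w: "w \<in> S" for w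
    proof -
      obtain z' where z': "\<And>v. v \<in> S \<Longrightarrow> (\<Sum>u\<in>S. z' u * T' u v e) = (if v = w then 1 else 0)"
        using \<phi>(3)[OF p(2) w] by blast
      define z where "z u = (if u = x then - (\<Sum>u\<in>S. z' u * T u x e) else p * z' u)" for u
      have eq: "(\<Sum>u\<in>insert x S. z u * T u v e) = (\<Sum>u\<in>S. z' u * (p * T u v e - T u x e * T x v e))" for v
      proof -
        have "(\<Sum>u\<in>S. z u * T u v e) = (\<Sum>u\<in>S. p * z' u * T u v e)"
          using insert.hyps by (intro sum.cong) (auto simp: z_def)
        then show ?thesis using insert.hyps
          by (simp add: z_def right_diff_distrib sum_subtractf sum_distrib_left mult_ac)
      qed
      have "(\<Sum>u\<in>insert x S. z u * T u v e) = (if v = w then 1 else 0)" if "v \<in> insert x S" for v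
      proof (cases "v = x")
        case True
        then show ?thesis using w insert.hyps unfolding eq by (auto simp: p_def mult.commute)
      next
        case False
        then have "v \<in> S" using that by simp
        from z'[OF this] show ?thesis unfolding eq by (simp add: T'_def p_def)
      qed
      then show ?thesis by blast
    qed
    show ?thesis
    proof (cases "w = x")
      case False
      then show ?thesis using w S by blast
    next
      case True
      have "\<forall>w\<in>S. \<exists>z. \<forall>v\<in>insert x S. (\<Sum>u\<in>insert x S. z u * T u v e) = (if v = w then 1 else 0)"
        by (rule ballI, rule S)
      from bchoice[OF this] obtain Z where
        "\<forall>w\<in>S. \<forall>v\<in>insert x S. (\<Sum>u\<in>insert x S. Z w u * T u v e) = (if v = w then 1 else 0)" ..
      note Z = this[rule_format]
      define z where "z u = ((if u = x then 1 else 0) - (\<Sum>w\<in>S. T x w e * Z w u)) / p" for u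
      have "(\<Sum>u\<in>insert x S. z u * T u v e) = (if v = x then 1 else 0)" if v: "v \<in> insert x S" for v
      proof -
        have "(\<Sum>u\<in>insert x S. z u * T u v e) =
            ((\<Sum>u\<in>insert x S. if u = x then T x v e else 0) - (\<Sum>u\<in>insert x S. \<Sum>w\<in>S. T x w e * (Z w u * T u v e))) / p"
          unfolding sum_subtractf[symmetric] sum_divide_distrib z_def
          by (intro sum.cong refl) (simp add: left_diff_distrib sum_distrib_right mult.assoc)
        also have "(\<Sum>u\<in>insert x S. if u = x then T x v e else 0) = T x v e" using insert.hyps by simp
        also have "(\<Sum>u\<in>insert x S. \<Sum>w\<in>S. T x w e * (Z w u * T u v e)) = (\<Sum>w\<in>S. T x w e * (if v = w then 1 else 0))"
          by (subst sum.swap) (use Z v in \<open>simp add: sum_distrib_left[symmetric]\<close>)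
        also have "\<dots> = (if v \<in> S then T x v e else 0)"
          using insert.hyps by (simp add: if_distrib[of "\<lambda>t. _ * t"] cong: if_cong)
        finally show ?thesis using v insert.hyps p by (auto simp: p_def)
      qed
      then show ?thesis unfolding True by blast
    qed
  qed
  have "(\<lambda>e. T x x e * \<phi> e) \<in> polyfuns X" using pol \<phi>(1) by (intro polyfuns.mult) auto
  moreover have "T x x e0 * \<phi> e0 \<noteq> 0" using insert.prems(2)[of x x] \<phi>(2) by simp
  ultimately show ?case using key by (intro bexI[of _ "\<lambda>e. T x x e * \<phi> e"]) auto
qed

section \<open>Families depending polynomially on parameters\<close>

lemma polyfuns_sum: "(\<And>i. i \<in> K \<Longrightarrow> f i \<in> polyfuns X) \<Longrightarrow> (\<lambda>x. \<Sum>i\<in>K. f i x) \<in> polyfuns X"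
proof (induction K rule: infinite_finite_induct)
  case (insert i K)
  then have "(\<lambda>x. f i x + (\<Sum>i\<in>K. f i x)) \<in> polyfuns X" by (intro polyfuns.add[of "f i"]) auto
  then show "(\<lambda>x. \<Sum>i\<in>insert i K. f i x) \<in> polyfuns X" using insert.hyps by simp
qed (simp_all add: polyfuns.const)

text \<open>
  Laurent polynomials supported in \<open>S\<close> whose coefficients are polynomials in the parameter \<open>e\<close>.
\<close>

definition fam :: "('e \<Rightarrow> complex) set \<Rightarrow> (int ^ 'd) set \<Rightarrow> ('e \<Rightarrow> 'd::finite torus \<Rightarrow> complex) \<Rightarrow> bool" where
  "fam X S g \<longleftrightarrow> (\<exists>a. (\<forall>u. a u \<in> polyfuns X) \<and> (\<forall>e \<tau>. g e \<tau> = (\<Sum>u\<in>S. a u e * ch u \<tau>)))"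

lemma fam_I: "(\<And>u. a u \<in> polyfuns X) \<Longrightarrow> (\<And>e \<tau>. g e \<tau> = (\<Sum>u\<in>S. a u e * ch u \<tau>)) \<Longrightarrow> fam X S g"
  unfolding fam_def by blast

lemma fam_const: assumes "g \<in> LP S" shows "fam X S (\<lambda>_. g)"
proof -
  obtain a where "g = (\<lambda>\<tau>. \<Sum>u\<in>S. a u * ch u \<tau>)" using assms by (rule LP_E)
  then show ?thesis by (intro fam_I[where a = "\<lambda>u _. a u"] polyfuns.const) simp
qed

lemma fam_add: assumes "fam X S g" "fam X S h" shows "fam X S (\<lambda>e. g e + h e)"
proof -
  obtain a where "\<forall>u. a u \<in> polyfuns X" "\<forall>e \<tau>. g e \<tau> = (\<Sum>u\<in>S. a u e * ch u \<tau>)"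
    using assms(1) unfolding fam_def by (elim exE conjE)
  note a = this[rule_format]
  obtain b where "\<forall>u. b u \<in> polyfuns X" "\<forall>e \<tau>. h e \<tau> = (\<Sum>u\<in>S. b u e * ch u \<tau>)"
    using assms(2) unfolding fam_def by (elim exE conjE)
  note b = this[rule_format]
  show ?thesis
    by (intro fam_I[where a = "\<lambda>u e. a u e + b u e"] polyfuns.add a(1) b(1)) (simp add: a b distrib_right sum.distrib)
qed

lemma fam_scale: assumes "fam X S g" "p \<in> polyfuns X" shows "fam X S (\<lambda>e \<tau>. p e * g e \<tau>)"
proof -
  obtain a where "\<forall>u. a u \<in> polyfuns X" "\<forall>e \<tau>. g e \<tau> = (\<Sum>u\<in>S. a u e * ch u \<tau>)"
    using assms(1) unfolding fam_def by (elim exE conjE)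
  note a = this[rule_format]
  show ?thesis
    by (intro fam_I[where a = "\<lambda>u e. p e * a u e"] polyfuns.mult assms(2) a(1)) (simp add: a(2) sum_distrib_left mult.assoc)
qed

lemma fam_sum: "finite K \<Longrightarrow> (\<And>i. i \<in> K \<Longrightarrow> fam X S (g i)) \<Longrightarrow> fam X S (\<lambda>e. \<Sum>i\<in>K. g i e)"
proof (induction K rule: finite_induct)
  case empty
  show "fam X S (\<lambda>e. \<Sum>i\<in>{}. g i e)" unfolding sum.empty by (rule fam_const[OF LP_zero])
next
  case (insert i K)
  have "fam X S (\<lambda>e. \<Sum>i\<in>K. g i e)" by (rule insert.IH) (use insert.prems in blast)
  from fam_add[OF insert.prems this]
  show "fam X S (\<lambda>e. \<Sum>i\<in>insert i K. g i e)" unfolding sum.insert[OF insert.hyps] by simp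
qed

lemma fam_mult:
  assumes "fam X S g" "fam X S' h" "finite S" "finite S'" "finite S''" "\<And>u v. u \<in> S \<Longrightarrow> v \<in> S' \<Longrightarrow> u + v \<in> S''"
  shows "fam X S'' (\<lambda>e. g e * h e)"
proof -
  obtain a where "\<forall>u. a u \<in> polyfuns X" "\<forall>e \<tau>. g e \<tau> = (\<Sum>u\<in>S. a u e * ch u \<tau>)"
    using assms(1) unfolding fam_def by (elim exE conjE)
  note a = this[rule_format]
  obtain b where "\<forall>u. b u \<in> polyfuns X" "\<forall>e \<tau>. h e \<tau> = (\<Sum>u\<in>S'. b u e * ch u \<tau>)"
    using assms(2) unfolding fam_def by (elim exE conjE)
  note b = this[rule_format]
  have "fam X S'' (\<lambda>e. \<Sum>u\<in>S. \<Sum>v\<in>S'. (\<lambda>\<tau>. (a u e * b v e) * ch (u + v) \<tau>))"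
    using assms by (intro fam_sum fam_scale fam_const polyfuns.mult a b LP_ch) auto
  moreover have "(\<lambda>e. \<Sum>u\<in>S. \<Sum>v\<in>S'. (\<lambda>\<tau>. (a u e * b v e) * ch (u + v) \<tau>)) = (\<lambda>e. g e * h e)"
    by (simp add: fun_eq_iff sum_fun_apply a(2) b(2) sum_product ch_add mult_ac)
  ultimately show ?thesis by (simp only:)
qed

lemma fam_eval: assumes "fam X S g" "finite S" shows "(\<lambda>e. g e \<tau>) \<in> polyfuns X"
proof -
  obtain a where "\<forall>u. a u \<in> polyfuns X" "\<forall>e \<tau>. g e \<tau> = (\<Sum>u\<in>S. a u e * ch u \<tau>)"
    using assms(1) unfolding fam_def by (elim exE conjE)
  note a = this[rule_format]
  have "(\<lambda>e. \<Sum>u\<in>S. a u e * (\<lambda>_. ch u \<tau>) e) \<in> polyfuns X"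
    by (intro polyfuns_sum polyfuns.mult[of "a u" for u] polyfuns.const a(1))
  then show ?thesis by (simp add: a(2))
qed

text \<open>At \<open>e0\<close> certain combinations of the family reproduce the monomials. For
  other \<open>e\<close> the same combinations have a coefficient matrix \<open>T\<close> that is
  polynomial in \<open>e\<close> and the identity at \<open>e0\<close>; wherever \<open>T\<close>
  has a left inverse the family still spans.\<close>

lemma spanning_open:
  assumes S: "finite S" and K: "finite K" and g: "\<And>i. i \<in> K \<Longrightarrow> fam X S (g i)"
    and e0: "\<And>u. u \<in> S \<Longrightarrow> \<exists>z. ch u = (\<Sum>i\<in>K. cst (z i) * g i e0)"
  shows "\<exists>\<phi>\<in>polyfuns X. \<phi> e0 \<noteq> 0 \<and> (\<forall>e. \<phi> e \<noteq> 0 \<longrightarrow> (\<forall>u\<in>S. \<exists>z. ch u = (\<Sum>i\<in>K. cst (z i) * g i e)))"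
proof -
  have "\<forall>i\<in>K. \<exists>a. (\<forall>u. a u \<in> polyfuns X) \<and> (\<forall>e \<tau>. g i e \<tau> = (\<Sum>u\<in>S. a u e * ch u \<tau>))"
    using g unfolding fam_def by blast
  from bchoice[OF this] obtain a where a: "\<forall>i\<in>K. (\<forall>u. a i u \<in> polyfuns X) \<and> (\<forall>e \<tau>. g i e \<tau> = (\<Sum>u\<in>S. a i u e * ch u \<tau>))" ..
  have "\<forall>u\<in>S. \<exists>z. ch u = (\<Sum>i\<in>K. cst (z i) * g i e0)" using e0 by blast
  from bchoice[OF this] obtain z where z: "\<forall>u\<in>S. ch u = (\<Sum>i\<in>K. cst (z u i) * g i e0)" ..
  define T where "T u v = (\<lambda>e. \<Sum>i\<in>K. (\<lambda>_. z u i) e * a i v e)" for u v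
  have comb: "(\<Sum>i\<in>K. z u i * g i e \<tau>) = (\<Sum>v\<in>S. T u v e * ch v \<tau>)" for u e \<tau>
  proof -
    have "(\<Sum>i\<in>K. z u i * g i e \<tau>) = (\<Sum>i\<in>K. \<Sum>v\<in>S. z u i * a i v e * ch v \<tau>)"
      using a by (intro sum.cong refl) (simp add: sum_distrib_left mult.assoc)
    also have "\<dots> = (\<Sum>v\<in>S. \<Sum>i\<in>K. z u i * a i v e * ch v \<tau>)" by (rule sum.swap)
    finally show ?thesis by (simp add: T_def sum_distrib_right)
  qed
  have Tpol: "T u v \<in> polyfuns X" for u v
    unfolding T_def using a by (intro polyfuns_sum polyfuns.mult[of "\<lambda>_. z u i" for i] polyfuns.const) auto
  have T0: "T u v e0 = (if u = v then 1 else 0)" if "u \<in> S" "v \<in> S" for u v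
  proof -
    have "(\<Sum>w\<in>S. (T u w e0 - (if u = w then 1 else 0)) * ch w \<tau>) = 0" for \<tau>
    proof -
      have "ch u \<tau> = (\<Sum>i\<in>K. z u i * g i e0 \<tau>)"
        using fun_cong[OF bspec[OF z that(1)], of \<tau>] by (simp add: sum_fun_apply)
      then have "ch u \<tau> = (\<Sum>w\<in>S. T u w e0 * ch w \<tau>)" by (simp only: comb)
      moreover have "(\<Sum>w\<in>S. (if u = w then 1 else 0) * ch w \<tau>) = (\<Sum>w\<in>S. if u = w then ch u \<tau> else 0)"
        by (intro sum.cong) auto
      then have "(\<Sum>w\<in>S. (if u = w then 1 else 0) * ch w \<tau>) = ch u \<tau>" using S that(1) by simp
      ultimately show ?thesis by (simp add: left_diff_distrib sum_subtractf)
    qed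
    from ch_independent[OF S this that(2)] show ?thesis by simp
  qed
  obtain \<phi> where \<phi>: "\<phi> \<in> polyfuns X" "\<phi> e0 \<noteq> 0" "\<And>e w. \<phi> e \<noteq> 0 \<Longrightarrow> w \<in> S \<Longrightarrow>
      \<exists>y. \<forall>v\<in>S. (\<Sum>u\<in>S. y u * T u v e) = (if v = w then 1 else 0)"
    using generic_left_inverse[OF S Tpol T0] by blast
  have "\<exists>z. ch w = (\<Sum>i\<in>K. cst (z i) * g i e)" if e: "\<phi> e \<noteq> 0" and w: "w \<in> S" for e w
  proof -
    obtain y where y: "\<And>v. v \<in> S \<Longrightarrow> (\<Sum>u\<in>S. y u * T u v e) = (if v = w then 1 else 0)"
      using \<phi>(3)[OF e w] by blast
    have "ch w \<tau> = (\<Sum>i\<in>K. (\<Sum>u\<in>S. y u * z u i) * g i e \<tau>)" for \<tau>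
    proof -
      have "(\<Sum>i\<in>K. (\<Sum>u\<in>S. y u * z u i) * g i e \<tau>) = (\<Sum>i\<in>K. \<Sum>u\<in>S. y u * (z u i * g i e \<tau>))"
        by (simp add: sum_distrib_right mult.assoc)
      also have "\<dots> = (\<Sum>u\<in>S. \<Sum>i\<in>K. y u * (z u i * g i e \<tau>))" by (rule sum.swap)
      also have "\<dots> = (\<Sum>u\<in>S. y u * (\<Sum>v\<in>S. T u v e * ch v \<tau>))"
        by (simp add: sum_distrib_left[symmetric] comb)
      also have "\<dots> = (\<Sum>u\<in>S. \<Sum>v\<in>S. y u * T u v e * ch v \<tau>)" by (simp add: sum_distrib_left mult.assoc)
      also have "\<dots> = (\<Sum>v\<in>S. \<Sum>u\<in>S. y u * T u v e * ch v \<tau>)" by (rule sum.swap)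
      also have "\<dots> = (\<Sum>v\<in>S. if v = w then ch w \<tau> else 0)"
        unfolding sum_distrib_right[symmetric] by (intro sum.cong refl) (simp add: y)
      also have "\<dots> = ch w \<tau>" using S w by simp
      finally show ?thesis by (rule sym)
    qed
    then show ?thesis
      by (intro exI[of _ "\<lambda>i. \<Sum>u\<in>S. y u * z u i"]) (simp add: fun_eq_iff sum_fun_apply)
  qed
  with \<phi>(1,2) show ?thesis by blast
qed

section \<open>Open conditions on the equations\<close>

context liss
begin

text \<open>The equations of an affine-linear space are numbered from 0, whereas the rows of a
  Jacobian are indexed by the type \<open>'d\<close>.\<close>

definition idx :: "'d \<Rightarrow> nat" where
  "idx = (SOME f. bij_betw f UNIV {..<CARD('d)})"

lemma idx_bij: "bij_betw idx UNIV {..<CARD('d)}"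
proof -
  have "\<exists>f. bij_betw f (UNIV :: 'd set) {..<CARD('d)}"
    using ex_bij_betw_finite_nat[of "UNIV :: 'd set"] by (simp add: atLeast0LessThan)
  then show ?thesis unfolding idx_def by (rule someI_ex)
qed

lemma idx_less: "idx i < CARD('d)"
  using idx_bij by (auto simp: bij_betw_def)

definition Mx :: "(nat \<Rightarrow> complex ^ 'n) \<times> (nat \<Rightarrow> complex) \<Rightarrow> 'd \<Rightarrow> complex ^ 'n" where
  "Mx e i = fst e (idx i)"

definition cx :: "(nat \<Rightarrow> complex ^ 'n) \<times> (nat \<Rightarrow> complex) \<Rightarrow> complex ^ 'd" where
  "cx e = (\<chi> i. snd e (idx i))"

lemma Mx_pol: "(\<lambda>e. Mx e i $ j) \<in> polyfuns (eqn_coords CARD('d))"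
proof (rule polyfuns.coord)
  have "(\<lambda>e. Mx e i $ j) = (\<lambda>(M, c). M (idx i) $ j)" by (auto simp: Mx_def)
  then show "(\<lambda>e. Mx e i $ j) \<in> eqn_coords CARD('d)" unfolding eqn_coords_def using idx_less by blast
qed

lemma cx_pol: "(\<lambda>e. cx e $ i) \<in> polyfuns (eqn_coords CARD('d))"
proof (rule polyfuns.coord)
  have "(\<lambda>e. cx e $ i) = (\<lambda>(M, c). c (idx i))" by (auto simp: cx_def)
  then show "(\<lambda>e. cx e $ i) \<in> eqn_coords CARD('d)" unfolding eqn_coords_def using idx_less by blast
qed

lemma Mx_cx_surj: "\<exists>e. Mx e = M \<and> cx e = c"
proof -
  let ?f = "inv_into UNIV idx"
  have "?f (idx i) = i" for i using idx_bij by (auto simp: bij_betw_def)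
  then show ?thesis
    by (intro exI[of _ "(\<lambda>k. M (?f k), \<lambda>k. c $ ?f k)"]) (simp add: Mx_def cx_def fun_eq_iff vec_eq_iff)
qed

lemma Mx_eq: "fst e = fst e' \<Longrightarrow> Mx e = Mx e'"
  by (simp add: Mx_def fun_eq_iff)

lemma fam_lf: "fam (eqn_coords CARD('d)) (lat A 1) (\<lambda>e. lf (Mx e i))"
proof -
  have "fam (eqn_coords CARD('d)) (lat A 1) (\<lambda>e. \<Sum>j\<in>UNIV. (\<lambda>\<tau>. Mx e i $ j * xf j \<tau>))"
    by (intro fam_sum fam_scale fam_const xf_Bf Mx_pol) simp
  moreover have "(\<lambda>e. \<Sum>j\<in>UNIV. (\<lambda>\<tau>. Mx e i $ j * xf j \<tau>)) = (\<lambda>e. lf (Mx e i))"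
    by (simp add: fun_eq_iff sum_fun_apply lf_def)
  ultimately show ?thesis by (simp only:)
qed

lemma yf_Bf: "yf j \<in> Bf 1"
proof -
  have "yf j = cst (1 / (2 * \<beta> j)) * ch (column j A) - cst (\<beta> j / 2) * ch (- column j A)"
    by (simp add: fun_eq_iff yf_def field_simps)
  then show ?thesis by (simp add: LP_diff LP_cmult Bf_ch lat_minus col_in_lat)
qed

lemma fam_Jac: "fam (eqn_coords CARD('d)) (lat A 1) (\<lambda>e \<tau>. Jac (Mx e) \<tau> $ i $ k)"
proof -
  have "fam (eqn_coords CARD('d)) (lat A 1) (\<lambda>e. \<Sum>j\<in>UNIV. (\<lambda>\<tau>. Mx e i $ j * (cst (of_int (A $ k $ j)) * yf j) \<tau>))"
    by (intro fam_sum fam_scale fam_const LP_cmult yf_Bf Mx_pol) simp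
  moreover have "(\<lambda>e. \<Sum>j\<in>UNIV. (\<lambda>\<tau>. Mx e i $ j * (cst (of_int (A $ k $ j)) * yf j) \<tau>)) = (\<lambda>e \<tau>. Jac (Mx e) \<tau> $ i $ k)"
    by (simp add: fun_eq_iff sum_fun_apply Jac_def)
  ultimately show ?thesis by (simp only:)
qed

lemma fam_det: "fam (eqn_coords CARD('d)) (lat A (real CARD('d))) (\<lambda>e \<tau>. det (Jac (Mx e) \<tau>))"
proof -
  have P: "fam (eqn_coords CARD('d)) (lat A (real (card K))) (\<lambda>e. \<Prod>i\<in>K. (\<lambda>\<tau>. Jac (Mx e) \<tau> $ i $ p i))" if "finite K" for K p
    using that
  proof induction
    case empty
    show "fam (eqn_coords CARD('d)) (lat A (real (card {}))) (\<lambda>e. \<Prod>i\<in>{}. (\<lambda>\<tau>. Jac (Mx e) \<tau> $ i $ p i))"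
      unfolding prod.empty by (rule fam_const) (simp add: Bf_1)
  next
    case (insert i K)
    have "fam (eqn_coords CARD('d)) (lat A (real (card (insert i K)))) (\<lambda>e. (\<lambda>\<tau>. Jac (Mx e) \<tau> $ i $ p i) * (\<Prod>i\<in>K. (\<lambda>\<tau>. Jac (Mx e) \<tau> $ i $ p i)))"
      using lat_add[of _ A 1 _ "real (card K)"] insert.hyps
      by (intro fam_mult[OF fam_Jac insert.IH]) (auto simp: add.commute)
    then show "fam (eqn_coords CARD('d)) (lat A (real (card (insert i K)))) (\<lambda>e. \<Prod>i\<in>insert i K. (\<lambda>\<tau>. Jac (Mx e) \<tau> $ i $ p i))"
      unfolding prod.insert[OF insert.hyps] .
  qed
  have "fam (eqn_coords CARD('d)) (lat A (real CARD('d))) (\<lambda>e. \<Sum>p | p permutes UNIV. (\<lambda>\<tau>. of_int (sign p) * (\<Prod>i\<in>UNIV. (\<lambda>\<tau>. Jac (Mx e) \<tau> $ i $ p i)) \<tau>))"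
    by (intro fam_sum fam_scale polyfuns.const P) (simp_all add: finite_permutations)
  moreover have "(\<lambda>e. \<Sum>p | p permutes UNIV. (\<lambda>\<tau>. of_int (sign p) * (\<Prod>i\<in>UNIV. (\<lambda>\<tau>. Jac (Mx e) \<tau> $ i $ p i)) \<tau>)) = (\<lambda>e \<tau>. det (Jac (Mx e) \<tau>))"
    by (simp add: fun_eq_iff sum_fun_apply prod_fun_apply det_def)
  ultimately show ?thesis by (simp only:)
qed

text \<open>One level \<open>N\<close> suffices: past the bound of \<open>good_initial\<close> every
  level is reached from the previous one by the coordinate forms, and multiplication by a form
  carries \<open>U W\<close> one level up. The condition for all levels is thus equivalent to a
  finite one, for which openness can be shown.\<close>

lemma good_level:
  assumes "2 * CARD('n) \<le> N" "Bf (real N + 1) \<subseteq> U W (real N)" "finite W"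
  shows "good W N"
  unfolding good_def
proof (intro allI impI)
  fix n assume "N \<le> n"
  then show "Bf (real n + 1) \<subseteq> U W (real n)"
  proof (induction n rule: dec_induct)
    case base
    show ?case by (rule assms(2))
  next
    case (step n)
    show ?case
    proof
      fix g assume "g \<in> Bf (real (Suc n) + 1)"
      moreover have "2 * CARD('n) \<le> Suc n" using assms(1) step.hyps by linarith
      ultimately have "g \<in> U (range (\<lambda>j. axis j 1)) (real (Suc n))" using good_initial unfolding good_def by blast
      then show "g \<in> U W (real (Suc n))"
      proof (rule U_E[OF _ U_0 U_add])
        fix b assume "b \<in> Bf (real (Suc n))"
        then show "b \<in> U W (real (Suc n))" by (rule U_Bf)
        fix w :: "complex ^ 'n"
        have "b \<in> U W (real n)" using step.IH \<open>b \<in> Bf (real (Suc n))\<close> by (auto simp: add.commute)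
        from U_mult[OF this lf_Bf[of w]] show "lf w * b \<in> U W (real (Suc n))" by (simp add: add.commute)
      qed
    qed
  qed
qed

lemma U_range:
  assumes "g \<in> U (range M) r"
  shows "\<exists>b b0. (\<forall>i. b i \<in> Bf r) \<and> b0 \<in> Bf r \<and> g = b0 + (\<Sum>i::'d\<in>UNIV. lf (M i) * b i)"
proof -
  let ?X = "{g. \<exists>b b0. (\<forall>i. b i \<in> Bf r) \<and> b0 \<in> Bf r \<and> g = b0 + (\<Sum>i::'d\<in>UNIV. lf (M i) * b i)}"
  have I: "b0 + (\<Sum>i::'d\<in>UNIV. lf (M i) * b i) \<in> ?X" if "\<And>i. b i \<in> Bf r" "b0 \<in> Bf r" for b b0
    using that by blast
  have "g \<in> ?X"
    using assms
  proof (rule U_E)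
    show "0 \<in> ?X" using I[of "\<lambda>_. 0" 0] by simp
  next
    fix a a' assume "a \<in> ?X" "a' \<in> ?X"
    then obtain b b0 b' b0' where *: "\<forall>i. b i \<in> Bf r" "b0 \<in> Bf r" "a = b0 + (\<Sum>i::'d\<in>UNIV. lf (M i) * b i)"
      "\<forall>i. b' i \<in> Bf r" "b0' \<in> Bf r" "a' = b0' + (\<Sum>i::'d\<in>UNIV. lf (M i) * b' i)" by blast
    have eq: "a + a' = (b0 + b0') + (\<Sum>i\<in>UNIV. lf (M i) * (b i + b' i))"
      unfolding *(3,6) by (simp add: distrib_left sum.distrib algebra_simps)
    show "a + a' \<in> ?X" unfolding eq by (rule I) (use * in \<open>auto intro: LP_add\<close>)
  next
    fix b assume "b \<in> Bf r"
    then show "b \<in> ?X" using I[of "\<lambda>_. 0" b] by simp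
  next
    fix w b assume "w \<in> range M" "b \<in> Bf r"
    then obtain i where i: "w = M i" by blast
    have "(\<Sum>j\<in>UNIV. lf (M j) * (if j = i then b else 0)) = (\<Sum>j\<in>UNIV. if j = i then lf (M i) * b else 0)"
      by (intro sum.cong) auto
    then have "lf w * b = 0 + (\<Sum>j\<in>UNIV. lf (M j) * (if j = i then b else 0))" by (simp add: i)
    then show "lf w * b \<in> ?X" using I[of "\<lambda>j. if j = i then b else 0" 0] \<open>b \<in> Bf r\<close> by simp
  qed
  then show ?thesis by blast
qed

text \<open>
  The spanning families are indexed by \<open>'d option\<close> and exponents: \<open>None\<close> stands for the
  distinguished generator \<open>h\<close>, \<open>Some i\<close> for the \<open>i\<close>-th equation.
\<close>

lemma span_family:
  assumes "f0 \<in> LP S0" "\<And>i. f i \<in> LP S1" "finite S0" "finite S1"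
  shows "\<exists>z. h * f0 + (\<Sum>i::'d\<in>UNIV. g i * f i) =
    (\<Sum>k\<in>({None} \<times> S0) \<union> (range Some \<times> S1). cst (z k) * ((case fst k of None \<Rightarrow> h | Some i \<Rightarrow> g i) * ch (snd k)))"
proof -
  obtain a where a: "f0 = (\<lambda>\<tau>. \<Sum>u\<in>S0. a u * ch u \<tau>)" using assms(1) by (rule LP_E)
  have "\<forall>i. \<exists>b. f i = (\<lambda>\<tau>. \<Sum>u\<in>S1. b u * ch u \<tau>)" using assms(2) by (blast elim: LP_E)
  from choice[OF this] obtain b where b: "\<forall>i. f i = (\<lambda>\<tau>. \<Sum>u\<in>S1. b i u * ch u \<tau>)" ..
  define z where "z k = (case fst k of None \<Rightarrow> a (snd k) | Some i \<Rightarrow> b i (snd k))" for k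
  let ?F = "\<lambda>k. cst (z k) * ((case fst k of None \<Rightarrow> h | Some i \<Rightarrow> g i) * ch (snd k))"
  have "(\<Sum>k\<in>({None} \<times> S0) \<union> (range Some \<times> S1). ?F k) = (\<Sum>k\<in>{None} \<times> S0. ?F k) + (\<Sum>k\<in>range Some \<times> S1. ?F k)"
    using assms(3,4) by (intro sum.union_disjoint) auto
  also have "(\<Sum>k\<in>{None} \<times> S0. ?F k) = (\<Sum>u\<in>S0. cst (a u) * (h * ch u))"
    by (rule sum.reindex_bij_witness[of _ "\<lambda>u. (None, u)" snd]) (auto simp: z_def)
  also have "(\<Sum>k\<in>range Some \<times> S1. ?F k) = (\<Sum>k\<in>UNIV \<times> S1. cst (b (fst k) (snd k)) * (g (fst k) * ch (snd k)))"
    by (rule sum.reindex_bij_witness[of _ "\<lambda>k. (Some (fst k), snd k)" "\<lambda>k. (the (fst k), snd k)"]) (auto simp: z_def)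
  also have "\<dots> = (\<Sum>i\<in>UNIV. \<Sum>u\<in>S1. cst (b i u) * (g i * ch u))"
    by (simp add: sum.cartesian_product split_def)
  finally have eq: "(\<Sum>k\<in>({None} \<times> S0) \<union> (range Some \<times> S1). ?F k) =
      (\<Sum>u\<in>S0. cst (a u) * (h * ch u)) + (\<Sum>i\<in>UNIV. \<Sum>u\<in>S1. cst (b i u) * (g i * ch u))" .
  have h0: "h * f0 = (\<Sum>u\<in>S0. cst (a u) * (h * ch u))"
    unfolding a by (simp add: fun_eq_iff sum_fun_apply sum_distrib_left mult.left_commute)
  have hi: "g i * f i = (\<Sum>u\<in>S1. cst (b i u) * (g i * ch u))" for i
    unfolding spec[OF b] by (simp add: fun_eq_iff sum_fun_apply sum_distrib_left mult.left_commute)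
  show ?thesis
    by (rule exI[of _ z]) (simp only: eq h0 hi)
qed

lemma good_open:
  assumes e0: "Bf (real N + 1) \<subseteq> U (range (Mx e0)) (real N)"
  shows "\<exists>\<phi>\<in>polyfuns (eqn_coords CARD('d)). \<phi> e0 \<noteq> 0 \<and> (\<forall>e. \<phi> e \<noteq> 0 \<longrightarrow> Bf (real N + 1) \<subseteq> U (range (Mx e)) (real N))"
proof -
  let ?K = "({None} \<times> lat A (real N)) \<union> (range Some \<times> lat A (real N)) :: ('d option \<times> (int ^ 'd)) set"
  define g where "g k e = (case fst k of None \<Rightarrow> 1 | Some i \<Rightarrow> lf (Mx e i)) * ch (snd k)" for k :: "'d option \<times> (int ^ 'd)" and e
  have fam: "fam (eqn_coords CARD('d)) (lat A (real N + 1)) (g k)" if k: "k \<in> ?K" for k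
  proof (cases "fst k")
    case None
    then have "snd k \<in> lat A (real N + 1)" using k lat_mono[of "real N" "real N + 1" A] by auto
    from fam_const[OF Bf_ch[OF this]]
    have "fam (eqn_coords CARD('d)) (lat A (real N + 1)) (\<lambda>_ :: (nat \<Rightarrow> complex ^ 'n) \<times> (nat \<Rightarrow> complex). ch (snd k))" .
    moreover have "(\<lambda>_. ch (snd k)) = g k" using None by (simp add: fun_eq_iff g_def)
    ultimately show ?thesis by (simp only:)
  next
    case (Some i)
    then have "snd k \<in> lat A (real N)" using k by auto
    moreover have "u + v \<in> lat A (real N + 1)" if "u \<in> lat A 1" "v \<in> lat A (real N)" for u v
      using lat_add[OF that] by (simp add: add.commute)
    ultimately have "fam (eqn_coords CARD('d)) (lat A (real N + 1)) (\<lambda>e. lf (Mx e i) * ch (snd k))"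
      by (intro fam_mult[OF fam_lf fam_const[OF Bf_ch] finite_lat finite_lat finite_lat])
    moreover have "(\<lambda>e. lf (Mx e i) * ch (snd k)) = g k" using Some by (simp add: fun_eq_iff g_def)
    ultimately show ?thesis by (simp only:)
  qed
  have "\<exists>z. ch u = (\<Sum>k\<in>?K. cst (z k) * g k e0)" if u: "u \<in> lat A (real N + 1)" for u
  proof -
    obtain b b0 where b: "\<forall>i. b i \<in> Bf (real N)" "b0 \<in> Bf (real N)" "ch u = b0 + (\<Sum>i\<in>UNIV. lf (Mx e0 i) * b i)"
      using U_range[OF subsetD[OF e0 Bf_ch[OF u]]] by blast
    have "ch u = 1 * b0 + (\<Sum>i\<in>UNIV. lf (Mx e0 i) * b i)" using b(3) by simp
    then show ?thesis
      using span_family[OF b(2) spec[OF b(1)] finite_lat finite_lat, of 1 "\<lambda>i. lf (Mx e0 i)"]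
      unfolding g_def by simp
  qed
  then obtain \<phi> where \<phi>: "\<phi> \<in> polyfuns (eqn_coords CARD('d))" "\<phi> e0 \<noteq> 0" "\<And>e u. \<phi> e \<noteq> 0 \<Longrightarrow> u \<in> lat A (real N + 1) \<Longrightarrow>
      \<exists>z. ch u = (\<Sum>k\<in>?K. cst (z k) * g k e)"
    using spanning_open[of "lat A (real N + 1)" ?K "eqn_coords CARD('d)" g e0] fam by force
  have "Bf (real N + 1) \<subseteq> U (range (Mx e)) (real N)" if e: "\<phi> e \<noteq> 0" for e
  proof
    fix f assume "f \<in> Bf (real N + 1)"
    then show "f \<in> U (range (Mx e)) (real N)"
    proof (rule LP_subset[OF _ U_0 U_add])
      fix c u assume "u \<in> lat A (real N + 1)"
      then obtain z where z: "ch u = (\<Sum>k\<in>?K. cst (z k) * g k e)" using \<phi>(3)[OF e] by blast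
      have "g k e \<in> U (range (Mx e)) (real N)" if k: "k \<in> ?K" for k
      proof (cases "fst k")
        case None
        then show ?thesis using k by (auto simp: g_def intro!: U_Bf Bf_ch)
      next
        case (Some i)
        then show ?thesis using k by (auto simp: g_def intro!: U_lf Bf_ch)
      qed
      then have "ch u \<in> U (range (Mx e)) (real N)" unfolding z by (intro U_sum U_cmult)
      then show "cst c * ch u \<in> U (range (Mx e)) (real N)" by (rule U_cmult)
    qed
  qed
  with \<phi>(1,2) show ?thesis by blast
qed

text \<open>Reduction modulo the fibre ideal with control of levels: the multipliers stay one level
  below the bound for \<open>f\<close>. Such bounds place the certificate of
  \<open>unit_open\<close> in a fixed finite-dimensional space.\<close>

lemma Bf_mod_filtered:
  assumes g: "good (range M) \<nu>" "0 < \<nu>" and n: "\<nu> \<le> n" and f: "f \<in> Bf (real n)"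
  shows "\<exists>h b. h \<in> Bf (real \<nu>) \<and> (\<forall>i. b i \<in> Bf (real n - 1)) \<and> f = h + (\<Sum>i::'d\<in>UNIV. (lf (M i) - cst (c $ i)) * b i)"
  using n f
proof (induction n arbitrary: f rule: dec_induct)
  case base
  then show "\<exists>h b. h \<in> Bf (real \<nu>) \<and> (\<forall>i. b i \<in> Bf (real \<nu> - 1)) \<and> f = h + (\<Sum>i::'d\<in>UNIV. (lf (M i) - cst (c $ i)) * b i)"
    by (intro exI[of _ f] exI[of _ "\<lambda>_. 0"]) simp
next
  case (step n)
  have "f \<in> Bf (real n + 1)" using step.prems by (simp add: add.commute)
  then have "f \<in> U (range M) (real n)" using g(1) step.hyps(1) by (auto simp: good_def)
  from U_range[OF this] obtain b b0 where b: "\<forall>i. b i \<in> Bf (real n)" "b0 \<in> Bf (real n)"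
    "f = b0 + (\<Sum>i::'d\<in>UNIV. lf (M i) * b i)" by blast
  define h0 where "h0 = b0 + (\<Sum>i\<in>UNIV. cst (c $ i) * b i)"
  have "h0 \<in> Bf (real n)" unfolding h0_def using b by (intro LP_add LP_sum LP_cmult) auto
  from step.IH[OF this] obtain h b' where h: "h \<in> Bf (real \<nu>)" "\<forall>i. b' i \<in> Bf (real n - 1)"
    "h0 = h + (\<Sum>i\<in>UNIV. (lf (M i) - cst (c $ i)) * b' i)" by blast
  have "f = h0 + (\<Sum>i\<in>UNIV. (lf (M i) - cst (c $ i)) * b i)"
    unfolding b(3) h0_def by (simp add: left_diff_distrib sum_subtractf)
  also have "\<dots> = h + (\<Sum>i\<in>UNIV. (lf (M i) - cst (c $ i)) * (b' i + b i))"
    unfolding h(3) by (simp add: distrib_left sum.distrib)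
  finally have eq: "f = h + (\<Sum>i\<in>UNIV. (lf (M i) - cst (c $ i)) * (b' i + b i))" .
  have "b' i + b i \<in> Bf (real (Suc n) - 1)" for i
    using Bf_mono[OF _ spec[OF h(2)], of n i] spec[OF b(1), of i] by (auto intro: LP_add)
  with h(1) eq show "\<exists>h b. h \<in> Bf (real \<nu>) \<and> (\<forall>i. b i \<in> Bf (real (Suc n) - 1)) \<and> f = h + (\<Sum>i::'d\<in>UNIV. (lf (M i) - cst (c $ i)) * b i)"
    by (intro exI[of _ h] exI[of _ "\<lambda>i. b' i + b i"]) simp
qed

text \<open>That \<open>h\<close> has no zero on the fibre is certified by an expression of 1
  through \<open>h\<close> and the equations. With bounded levels this makes multiples of
  \<open>h\<close> and of the equations span the monomials of level \<open>L\<close>, which persists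
  wherever a suitable polynomial \<open>\<phi>\<close> is nonzero. The monomial \<open>ch 0\<close>,
  which is 1, then excludes zeros of \<open>h\<close> on the new fibre.\<close>

lemma unit_open:
  fixes h :: "(nat \<Rightarrow> complex ^ 'n) \<times> (nat \<Rightarrow> complex) \<Rightarrow> 'd torus \<Rightarrow> complex"
  assumes g: "good (range (Mx e0)) \<nu>" "0 < \<nu>"
    and h: "fam (eqn_coords CARD('d)) (lat A (real D)) h" "0 < D"
    and one: "1 - h e0 * b \<in> Idl (Mx e0) (cx e0)" "b \<in> Laur"
  shows "\<exists>\<phi>\<in>polyfuns (eqn_coords CARD('d)). \<phi> e0 \<noteq> 0 \<and> (\<forall>e. \<phi> e \<noteq> 0 \<longrightarrow> (\<forall>\<tau>. Fm (Mx e) \<tau> = cx e \<longrightarrow> h e \<tau> \<noteq> 0))"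
proof -
  obtain b1 where b1: "\<forall>i. b1 i \<in> Laur" "1 - h e0 * b = (\<Sum>i\<in>UNIV. (lf (Mx e0 i) - cst (cx e0 $ i)) * b1 i)"
    using one(1) unfolding Idl_def by blast
  obtain n0 :: nat where n0: "b \<in> Bf (real n0)" "\<And>i. b1 i \<in> Bf (real n0)"
  proof -
    obtain m where m: "b \<in> Bf (real m)" using Laur_Bf[OF one(2)] by blast
    have "\<forall>i. \<exists>n::nat. b1 i \<in> Bf (real n)" using Laur_Bf b1(1) by blast
    from choice[OF this] obtain n where n: "\<forall>i. b1 i \<in> Bf (real (n i))" ..
    define n0 where "n0 = m + (\<Sum>i\<in>UNIV. n i)"
    have "n i \<le> n0" for i using member_le_sum[of i UNIV n] by (simp add: n0_def trans_le_add2)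
    then have "b1 i \<in> Bf (real n0)" for i using n by (auto intro: Bf_mono[of "real (n i)"])
    moreover have "b \<in> Bf (real n0)" by (rule Bf_mono[OF _ m]) (simp add: n0_def sum_nonneg)
    ultimately show ?thesis using that by blast
  qed
  \<comment> \<open>\<open>N1\<close> bounds the multipliers that come from the certificate, and
    \<open>L\<close> leaves room for \<open>h\<close> itself; \<open>0 < D\<close> gives
    \<open>N1 \<le> L - 1\<close>, the bound for multipliers of the equations.\<close>
  define N1 where "N1 = n0 + \<nu>"
  define L where "L = N1 + D"
  let ?Zc = "lat A (real L)"
  let ?Za = "lat A (real N1)" and ?Zb = "lat A (real L - 1)"
  let ?K = "({None} \<times> ?Za) \<union> (range Some \<times> ?Zb) :: ('d option \<times> (int ^ 'd)) set"
  define G where "G k e = (case fst k of None \<Rightarrow> h e | Some i \<Rightarrow> lf (Mx e i) - cst (cx e $ i)) * ch (snd k)" for k :: "'d option \<times> (int ^ 'd)" and e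
  have famd: "fam (eqn_coords CARD('d)) (lat A 1) (\<lambda>e. lf (Mx e i) - cst (cx e $ i))" for i
  proof -
    have "fam (eqn_coords CARD('d)) (lat A 1) (\<lambda>e. lf (Mx e i) + (\<lambda>\<tau>. (\<lambda>e. (\<lambda>_. - 1) e * cx e $ i) e * (1 :: 'd torus \<Rightarrow> complex) \<tau>))"
      by (intro fam_add fam_lf fam_scale fam_const Bf_1 polyfuns.mult[of "\<lambda>_. - 1"] polyfuns.const cx_pol) simp
    moreover have "(\<lambda>e. lf (Mx e i) + (\<lambda>\<tau>. (\<lambda>e. (\<lambda>_. - 1) e * cx e $ i) e * (1 :: 'd torus \<Rightarrow> complex) \<tau>)) = (\<lambda>e. lf (Mx e i) - cst (cx e $ i))"
      by (simp add: fun_eq_iff)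
    ultimately show ?thesis by (simp only:)
  qed
  have fam: "fam (eqn_coords CARD('d)) ?Zc (G k)" if k: "k \<in> ?K" for k
  proof (cases "fst k")
    case None
    then have s: "snd k \<in> ?Za" using k by auto
    have "u + v \<in> ?Zc" if "u \<in> lat A (real D)" "v \<in> ?Za" for u v
      using lat_add[OF that] by (simp add: L_def add.commute)
    from fam_mult[OF h(1) fam_const[OF Bf_ch[OF s]] finite_lat finite_lat finite_lat this]
    have "fam (eqn_coords CARD('d)) ?Zc (\<lambda>e. h e * ch (snd k))" .
    moreover have "(\<lambda>e. h e * ch (snd k)) = G k" using None by (simp add: fun_eq_iff G_def)
    ultimately show ?thesis by (simp only:)
  next
    case (Some i)
    then have s: "snd k \<in> ?Zb" using k by auto
    have "u + v \<in> ?Zc" if "u \<in> lat A 1" "v \<in> ?Zb" for u v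
      using lat_add[OF that] by simp
    from fam_mult[OF famd fam_const[OF Bf_ch[OF s]] finite_lat finite_lat finite_lat this]
    have "fam (eqn_coords CARD('d)) ?Zc (\<lambda>e. (lf (Mx e i) - cst (cx e $ i)) * ch (snd k))" .
    moreover have "(\<lambda>e. (lf (Mx e i) - cst (cx e $ i)) * ch (snd k)) = G k" using Some by (simp add: fun_eq_iff G_def)
    ultimately show ?thesis by (simp only:)
  qed
  \<comment> \<open>A monomial is first reduced to \<open>r\<close> of level \<open>\<nu>\<close>,
    and only \<open>r\<close> is multiplied by the certificate for 1; this keeps the products within
    level \<open>N1\<close>.\<close>
  have e0: "\<exists>z. ch u = (\<Sum>k\<in>?K. cst (z k) * G k e0)" if u: "u \<in> ?Zc" for u
  proof -
    have "\<nu> \<le> L" by (simp add: L_def N1_def)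
    from Bf_mod_filtered[OF g this Bf_ch[OF u], of "cx e0"] obtain r b' where r: "r \<in> Bf (real \<nu>)"
      "\<forall>i. b' i \<in> Bf (real L - 1)" "ch u = r + (\<Sum>i\<in>UNIV. (lf (Mx e0 i) - cst (cx e0 $ i)) * b' i)" by blast
    have "r = r * (h e0 * b) + r * (1 - h e0 * b)" by (simp add: algebra_simps)
    also have "\<dots> = h e0 * (b * r) + (\<Sum>i\<in>UNIV. (lf (Mx e0 i) - cst (cx e0 $ i)) * (b1 i * r))"
      unfolding b1(2) by (simp add: sum_distrib_left mult_ac)
    finally have r': "r = h e0 * (b * r) + (\<Sum>i\<in>UNIV. (lf (Mx e0 i) - cst (cx e0 $ i)) * (b1 i * r))" .
    have "ch u = h e0 * (b * r) + (\<Sum>i\<in>UNIV. (lf (Mx e0 i) - cst (cx e0 $ i)) * (b1 i * r))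
        + (\<Sum>i\<in>UNIV. (lf (Mx e0 i) - cst (cx e0 $ i)) * b' i)"
      using r(3) r' by (simp only:)
    also have "\<dots> = h e0 * (b * r) + (\<Sum>i\<in>UNIV. (lf (Mx e0 i) - cst (cx e0 $ i)) * (b1 i * r + b' i))"
      by (simp only: distrib_left sum.distrib add.assoc)
    finally have eq: "ch u = h e0 * (b * r) + (\<Sum>i\<in>UNIV. (lf (Mx e0 i) - cst (cx e0 $ i)) * (b1 i * r + b' i))" .
    have "b * r \<in> Bf (real N1)" using Bf_mult[OF n0(1) r(1)] by (simp add: N1_def)
    moreover have "b1 i * r + b' i \<in> Bf (real L - 1)" for i
    proof (rule LP_add)
      show "b1 i * r \<in> Bf (real L - 1)"
        by (rule Bf_mono[OF _ Bf_mult[OF n0(2) r(1)]]) (use h(2) in \<open>simp add: L_def N1_def\<close>)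
    qed (use r(2) in blast)
    ultimately show ?thesis
      using span_family[of "b * r" ?Za "\<lambda>i. b1 i * r + b' i" ?Zb "h e0" "\<lambda>i. lf (Mx e0 i) - cst (cx e0 $ i)"]
      unfolding G_def eq by simp
  qed
  obtain \<phi> where \<phi>: "\<phi> \<in> polyfuns (eqn_coords CARD('d))" "\<phi> e0 \<noteq> 0" "\<And>e u. \<phi> e \<noteq> 0 \<Longrightarrow> u \<in> ?Zc \<Longrightarrow>
      \<exists>z. ch u = (\<Sum>k\<in>?K. cst (z k) * G k e)"
    using spanning_open[of ?Zc ?K "eqn_coords CARD('d)" G e0] fam e0 by force
  have "h e \<tau> \<noteq> 0" if e: "\<phi> e \<noteq> 0" and \<tau>: "Fm (Mx e) \<tau> = cx e" for e \<tau>
  proof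
    assume z: "h e \<tau> = 0"
    obtain y where "ch 0 = (\<Sum>k\<in>?K. cst (y k) * G k e)" using \<phi>(3)[OF e zero_in_lat] by auto
    from fun_cong[OF this, of \<tau>] have "1 = (\<Sum>k\<in>?K. y k * G k e \<tau>)" by (simp add: sum_fun_apply)
    also have "\<dots> = (\<Sum>k\<in>?K. 0)"
    proof (rule sum.cong[OF refl])
      fix k assume "k \<in> ?K"
      have "lf (Mx e i) \<tau> = cx e $ i" for i
        using arg_cong[OF \<tau>, of "\<lambda>v. v $ i"] by (simp add: Fm_def)
      then show "y k * G k e \<tau> = 0" using z by (cases "fst k") (simp_all add: G_def)
    qed
    finally show False by simp
  qed
  with \<phi>(1,2) show ?thesis by blast
qed

end

lemma eqn_polyfuns_common:
  fixes f g :: "(nat \<Rightarrow> complex ^ 'n) \<times> (nat \<Rightarrow> complex) \<Rightarrow> complex"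
  assumes "f \<in> polyfuns (eqn_coords r)" "g \<in> polyfuns (eqn_coords r)" "f x0 \<noteq> 0" "g y0 \<noteq> 0"
  shows "\<exists>e. f e \<noteq> 0 \<and> g e \<noteq> 0"
proof -
  have curve: "\<exists>\<gamma>. range \<gamma> \<subseteq> UNIV \<and> \<gamma> 0 = x \<and> \<gamma> 1 = y \<and>
      (\<forall>g\<in>eqn_coords r. \<exists>p. \<forall>t. g (\<gamma> t) = poly p t)"
    for x y :: "(nat \<Rightarrow> complex ^ 'n) \<times> (nat \<Rightarrow> complex)"
  proof -
    define \<gamma> where "\<gamma> t = (\<lambda>i. fst x i + t *s (fst y i - fst x i), \<lambda>i. snd x i + t * (snd y i - snd x i))" for t
    have "\<exists>p. \<forall>t. g (\<gamma> t) = poly p t" if "g \<in> eqn_coords r" for g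
      using that unfolding eqn_coords_def
    proof (elim UnE CollectE exE conjE)
      fix i j assume "g = (\<lambda>(M, c). M i $ j)"
      then show ?thesis
        by (intro exI[of _ "[:fst x i $ j, fst y i $ j - fst x i $ j:]"]) (simp add: \<gamma>_def algebra_simps)
    next
      fix i assume "g = (\<lambda>(M, c). c i)"
      then show ?thesis
        by (intro exI[of _ "[:snd x i, snd y i - snd x i:]"]) (simp add: \<gamma>_def)
    qed
    moreover have "\<gamma> 0 = x" "\<gamma> 1 = y" by (simp_all add: \<gamma>_def)
    ultimately show ?thesis by blast
  qed
  have "generically (eqn_coords r) UNIV (\<lambda>e. f e \<noteq> 0)" "generically (eqn_coords r) UNIV (\<lambda>e. g e \<noteq> 0)"
    unfolding generically_def using assms by blast+
  from generically_exists[OF generically_conj[OF curve this]] show ?thesis by blast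
qed

section \<open>Construction of a parameter with unramified fibre\<close>

context liss
begin

lemma good_matrix_exists: "\<exists>M :: 'd \<Rightarrow> complex ^ 'n. \<exists>\<nu>. good (range M) \<nu> \<and> 0 < \<nu>"
proof -
  obtain W \<nu> where W: "finite W" "card W \<le> CARD('d)" "good W \<nu>" "0 < \<nu>" using good_exists by blast
  obtain f :: "complex ^ 'n \<Rightarrow> 'd" where f: "inj_on f W"
    using card_le_inj[OF W(1) finite[of "UNIV :: 'd set"] W(2)] by blast
  define M where "M i = (if i \<in> f ` W then the_inv_into W f i else 0)" for i
  have "W \<subseteq> range M"
  proof
    fix w assume "w \<in> W"
    then have "M (f w) = w" using f by (simp add: M_def the_inv_into_f_f)
    then show "w \<in> range M" by (metis rangeI)
  qed
  then have "good (range M) \<nu>" using good_mono[OF W(3)] by simp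
  with W(4) show ?thesis by blast
qed

lemma yf_nonzero: assumes "column j A \<noteq> 0" shows "yf j \<noteq> 0"
proof
  assume z: "yf j = 0"
  have "column j A \<noteq> - column j A"
  proof
    assume "column j A = - column j A"
    then have "column j A $ k = - column j A $ k" for k by (metis vector_uminus_component)
    then have "column j A $ k = 0" for k by (simp add: equal_neg_zero)
    then show False using assms by (simp add: vec_eq_iff)
  qed
  moreover have "(\<Sum>u\<in>{column j A, - column j A}. (if u = column j A then 1 / \<beta> j else - \<beta> j) * ch u \<tau>) = 0" for \<tau>
    using calculation fun_cong[OF z, of \<tau>] by (simp add: yf_def)
  ultimately have "(if column j A = column j A then 1 / \<beta> j else - \<beta> j) = 0"
    by (intro ch_independent[of "{column j A, - column j A}" "\<lambda>u. if u = column j A then 1 / \<beta> j else - \<beta> j"]) auto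
  then show False by simp
qed

text \<open>At a point where the \<open>yf j\<close> of all nonzero columns are nonzero, integer
  preimages of the unit vectors divided entrywise by these values give forms whose Jacobian is the
  identity.\<close>

lemma dominant_exists: "\<exists>M \<tau>. det (Jac M \<tau>) \<noteq> 0"
proof -
  define J where "J = {j. column j A \<noteq> 0}"
  have "(\<Prod>j\<in>J. yf j) \<noteq> 0"
    by (intro Laur_prod_nz) (auto simp: J_def yf_nonzero intro: Bf_Laur[OF yf_Bf])
  then obtain \<tau> where "(\<Prod>j\<in>J. yf j) \<tau> \<noteq> 0" by (auto simp: fun_eq_iff)
  then have \<tau>: "yf j \<tau> \<noteq> 0" if "j \<in> J" for j
    using that by (simp add: prod_fun_apply)
  define M where "M i = (\<chi> j. if j \<in> J then of_int (sec (axis i 1) $ j) / yf j \<tau> else 0)" for i :: 'd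
  have "Jac M \<tau> $ i $ k = mat 1 $ i $ k" for i k
  proof -
    have "Jac M \<tau> $ i $ k = (\<Sum>j\<in>UNIV. of_int (A $ k $ j * sec (axis i 1) $ j))"
      unfolding Jac_def vec_lambda_beta
    proof (rule sum.cong[OF refl])
      fix j
      have "j \<notin> J \<Longrightarrow> A $ k $ j = 0" by (auto simp: J_def column_def vec_eq_iff)
      then show "M i $ j * (of_int (A $ k $ j) * yf j \<tau>) = of_int (A $ k $ j * sec (axis i 1) $ j)"
        using \<tau>[of j] by (cases "j \<in> J") (simp_all add: M_def)
    qed
    also have "\<dots> = of_int ((A *v sec (axis i 1)) $ k)" by (simp add: matrix_vector_mult_def)
    also have "\<dots> = mat 1 $ i $ k" by (simp add: mat_def axis_def)
    finally show ?thesis .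
  qed
  then have "Jac M \<tau> = mat 1" by (simp add: vec_eq_iff)
  then have "det (Jac M \<tau>) \<noteq> 0" by simp
  then show ?thesis by blast
qed

lemma Idl_closed: "g \<in> Idl M c \<Longrightarrow> h \<in> Idl M c \<Longrightarrow> g + h \<in> Idl M c" "r \<in> Laur \<Longrightarrow> g \<in> Idl M c \<Longrightarrow> r * g \<in> Idl M c"
  "0 \<in> Idl M c"
  using Idl_ideal[of M c] by (auto simp: Laur_ideal_def)

lemma pF_Idl:
  assumes "p \<in> PF N" shows "pF M p - cst (p c) \<in> Idl M c"
proof -
  define X where "X = {p. pF M p \<in> Laur \<and> pF M p - cst (p c) \<in> Idl M c}"
  have cst: "cst z \<in> X" for z
  proof -
    have "pF M (cst z) - cst ((cst z :: complex ^ 'd \<Rightarrow> complex) c) = 0" by (simp add: fun_eq_iff pF_def)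
    then show ?thesis using Idl_closed(3) by (simp add: X_def pF_simps)
  qed
  have add: "p + q \<in> X" if p: "p \<in> X" and q: "q \<in> X" for p q
  proof -
    have "pF M (p + q) - cst ((p + q) c) = (pF M p - cst (p c)) + (pF M q - cst (q c))"
      by (simp add: fun_eq_iff pF_simps)
    also have "\<dots> \<in> Idl M c" using p q by (intro Idl_closed(1)) (auto simp: X_def)
    finally show ?thesis using p q by (simp add: X_def pF_simps Laur_add)
  qed
  have mult: "p * q \<in> X" if p: "p \<in> X" and q: "q \<in> X" for p q
  proof -
    have "pF M (p * q) - cst ((p * q) c) = pF M q * (pF M p - cst (p c)) + cst (p c) * (pF M q - cst (q c))"
      by (simp add: fun_eq_iff pF_simps algebra_simps)
    also have "\<dots> \<in> Idl M c" using p q by (intro Idl_closed(1,2)) (auto simp: X_def)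
    finally show ?thesis using p q by (simp add: X_def pF_simps Laur_mult)
  qed
  have coord: "(\<lambda>y. y $ i) \<in> X" for i
    using Idl_gen[OF Laur_1, of M i c] Bf_Laur[OF lf_Bf[of "M i"]] by (simp add: X_def pF_simps)
  have pow: "(\<lambda>y. y $ i ^ n) \<in> X" for i n
  proof (induction n)
    case 0
    have "(\<lambda>y :: complex ^ 'd. y $ i ^ 0) = cst 1" by simp
    then show "(\<lambda>y. y $ i ^ 0) \<in> X" using cst[of 1] by (simp only:)
  next
    case (Suc n)
    have "(\<lambda>y :: complex ^ 'd. y $ i ^ Suc n) = (\<lambda>y. y $ i) * (\<lambda>y. y $ i ^ n)" by (simp add: fun_eq_iff)
    then show "(\<lambda>y. y $ i ^ Suc n) \<in> X" using mult[OF coord Suc] by (simp only:)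
  qed
  have "(\<lambda>y. \<Prod>i\<in>K. y $ i ^ \<alpha> i) \<in> X" if "finite K" for K and \<alpha> :: "'d \<Rightarrow> nat"
    using that
  proof induction
    case empty
    have "(\<lambda>y :: complex ^ 'd. \<Prod>i\<in>{}. y $ i ^ \<alpha> i) = cst 1" by simp
    then show "(\<lambda>y. \<Prod>i\<in>{}. y $ i ^ \<alpha> i) \<in> X" using cst[of 1] by (simp only:)
  next
    case (insert i K)
    have "(\<lambda>y :: complex ^ 'd. \<Prod>i\<in>insert i K. y $ i ^ \<alpha> i) = (\<lambda>y. y $ i ^ \<alpha> i) * (\<lambda>y. \<Prod>i\<in>K. y $ i ^ \<alpha> i)"
      using insert.hyps by (simp add: fun_eq_iff)
    then show "(\<lambda>y. \<Prod>i\<in>insert i K. y $ i ^ \<alpha> i) \<in> X" using mult[OF pow insert.IH] by (simp only:)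
  qed
  from this[of UNIV] have mon: "mon \<alpha> \<in> X" for \<alpha> by (simp add: mon_def[abs_def])
  have "0 \<in> X" using cst[of 0] by (simp add: zero_fun_def)
  with assms have "p \<in> X" by (rule PF_subset[OF _ _ add mult[OF cst mon]])
  then show ?thesis by (simp add: X_def)
qed

text \<open>Monomials of degree at most \<open>n\<close> in the forms, together with the multiples
  of \<open>H\<close> by monomials of level \<open>n - D\<close>, outnumber the monomials of level
  \<open>n\<close>: the first family has about \<open>n ^ d / d!\<close> members, while levels
  \<open>n\<close> and \<open>n - D\<close> differ by a smaller order. A relation between the
  families gives \<open>p\<close> and \<open>b\<close>; \<open>p\<close> is nonzero because
  \<open>H\<close> is no zero divisor.\<close>

lemma poly_multiple_exists:
  assumes H: "H \<in> Laur" "H \<noteq> 0"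
  shows "\<exists>N. \<exists>p\<in>PF N. \<exists>b\<in>Laur. (\<exists>y. p y \<noteq> 0) \<and> pF M p = H * b"
proof -
  obtain D :: nat where D: "H \<in> Bf (real D)" using Laur_Bf[OF H(1)] by blast
  have "0 < (1 :: real) / fact CARD('d)" by simp
  from power_shell_small[OF this, of vol kap "CARD('d)" "real D + kap"] obtain N0 where
    N0: "\<forall>N\<ge>N0. vol * ((real N + kap) ^ CARD('d) - (real N - (real D + kap)) ^ CARD('d)) < 1 / fact CARD('d) * real N ^ CARD('d)"
    by blast
  obtain N1 :: nat where N1: "kap < real N1" using reals_Archimedean2 by blast
  define n where "n = N0 + N1 + D + 1"
  have kn: "kap < real (n - D)" "D \<le> n" "0 < real n" "N0 \<le> n" using N1 by (auto simp: n_def of_nat_diff)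
  let ?S = "Smp n :: ('d \<Rightarrow> nat) set"
  have lt: "card (lat A (real n)) < card (?S <+> lat A (real (n - D)))"
  proof -
    have "real (card (lat A (real n))) - real (card (lat A (real (n - D))))
        \<le> vol * (real n + kap) ^ CARD('d) - vol * (real (n - D) - kap) ^ CARD('d)"
      using kn by (intro diff_mono lat_card_upper lat_card_lower) auto
    also have "\<dots> = vol * ((real n + kap) ^ CARD('d) - (real n - (real D + kap)) ^ CARD('d))"
      using kn(2) by (simp add: right_diff_distrib of_nat_diff diff_diff_eq)
    also have "\<dots> < 1 / fact CARD('d) * real n ^ CARD('d)" using N0 kn(4) by blast
    also have "\<dots> \<le> real (card ?S)" using card_Smp_lower[of n, where 'd = 'd] by (simp add: field_simps)
    finally have "real (card (lat A (real n))) < real (card ?S + card (lat A (real (n - D))))" by simp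
    then have "card (lat A (real n)) < card ?S + card (lat A (real (n - D)))" by (simp only: of_nat_less_iff)
    then show ?thesis by (simp add: card_Plus)
  qed
  define g where "g i = (case i of Inl \<alpha> \<Rightarrow> pF M (mon \<alpha>) | Inr v \<Rightarrow> H * ch v)" for i :: "('d \<Rightarrow> nat) + (int ^ 'd)"
  have fin: "finite (?S <+> lat A (real (n - D)))" by simp
  have "\<exists>q. (\<exists>i\<in>?S <+> lat A (real (n - D)). q i \<noteq> 0) \<and> (\<forall>x. (\<Sum>i\<in>?S <+> lat A (real (n - D)). q i * g i x) = 0)"
  proof (rule linear_relation_exists[OF finite_lat fin lt, where h = ch])
    fix i assume i: "i \<in> ?S <+> lat A (real (n - D))"
    have "g i \<in> Bf (real n)"
    proof (cases i)
      case (Inl \<alpha>)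
      then show ?thesis using i by (auto simp: g_def intro: pF_Bf PF_mon)
    next
      case (Inr v)
      then have "v \<in> lat A (real (n - D))" using i by auto
      from Bf_mult[OF D Bf_ch[OF this]] show ?thesis using kn(2) Inr by (simp add: g_def of_nat_diff)
    qed
    then show "\<exists>a. \<forall>x. g i x = (\<Sum>s\<in>lat A (real n). a s * ch s x)" unfolding LP_def by simp
  qed
  then obtain q where q: "\<exists>i\<in>?S <+> lat A (real (n - D)). q i \<noteq> 0"
    "\<And>x. (\<Sum>i\<in>?S <+> lat A (real (n - D)). q i * g i x) = 0" by blast
  define p where "p = (\<lambda>y. \<Sum>\<alpha>\<in>?S. q (Inl \<alpha>) * mon \<alpha> y)"
  define b where "b = (\<lambda>x. \<Sum>v\<in>lat A (real (n - D)). q (Inr v) * ch v x)"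
  have pP: "p \<in> PF n" unfolding p_def PF_def by (rule CollectI, rule exI, rule refl)
  have bL: "b \<in> Laur" unfolding b_def by (rule Laur_LP[OF finite_lat[of "real (n - D)"]]) (auto simp: LP_def)
  have rel: "pF M p x + H x * b x = 0" for x
  proof -
    have "pF M p x + H x * b x = (\<Sum>\<alpha>\<in>?S. q (Inl \<alpha>) * g (Inl \<alpha>) x) + (\<Sum>v\<in>lat A (real (n - D)). q (Inr v) * g (Inr v) x)"
      by (simp add: pF_def p_def b_def g_def sum_distrib_left mult.left_commute)
    also have "\<dots> = (\<Sum>i\<in>?S <+> lat A (real (n - D)). q i * g i x)" by (simp add: sum.Plus)
    finally show ?thesis using q(2) by simp
  qed
  have "\<exists>y. p y \<noteq> 0"
  proof (rule ccontr)
    assume "\<not> ?thesis"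
    then have p0: "p y = 0" for y by blast
    then have ql: "q (Inl \<alpha>) = 0" if "\<alpha> \<in> ?S" for \<alpha>
      unfolding p_def by (rule mon_independent[OF finite_Smp _ that, of "\<lambda>\<alpha>. q (Inl \<alpha>)"])
    have "H * b = 0" using rel p0 by (simp add: fun_eq_iff pF_def)
    then have "b = 0" using Laur_mult_nz[OF H(1) bL H(2)] by blast
    then have "b x = 0" for x by simp
    then have qr: "q (Inr v) = 0" if "v \<in> lat A (real (n - D))" for v
      unfolding b_def by (rule ch_independent[OF finite_lat _ that, of "\<lambda>v. q (Inr v)"])
    show False using q(1) ql qr by auto
  qed
  moreover have "pF M p = H * (- b)" using rel by (simp add: fun_eq_iff add_eq_0_iff2)
  ultimately show ?thesis using pP Laur_minus[OF bL] by blast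
qed

text \<open>All conditions are met at one parameter and then spread by openness. With
  \<open>H\<close> the product of the Jacobian determinant and \<open>G\<close>, a polynomial in the
  forms divisible by \<open>H\<close> and nonzero at \<open>y\<close> makes \<open>H\<close> a unit
  modulo the ideal of the fibre over \<open>y\<close>. The factor \<open>G\<close> lets the fibre
  avoid the points where the cosine parametrization has an exceptional number of preimages.\<close>

lemma generic_fibre:
  assumes G: "G \<in> Laur" "G \<noteq> 0"
  shows "\<exists>\<phi>\<in>polyfuns (eqn_coords CARD('d)). (\<exists>e. \<phi> e \<noteq> 0) \<and> (\<forall>e. \<phi> e \<noteq> 0 \<longrightarrow>
    (\<exists>\<nu>. good (range (Mx e)) \<nu> \<and> 0 < \<nu>) \<and> (\<exists>\<tau>. det (Jac (Mx e) \<tau>) \<noteq> 0) \<and>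
    (\<forall>\<tau>. Fm (Mx e) \<tau> = cx e \<longrightarrow> det (Jac (Mx e) \<tau>) \<noteq> 0 \<and> G \<tau> \<noteq> 0))"
proof -
  let ?X = "eqn_coords CARD('d) :: ((nat \<Rightarrow> complex ^ 'n) \<times> (nat \<Rightarrow> complex) \<Rightarrow> complex) set"
  obtain M1 :: "'d \<Rightarrow> complex ^ 'n" and \<nu>1 where M1: "good (range M1) \<nu>1" using good_matrix_exists by blast
  define N where "N = \<nu>1 + 2 * CARD('n)"
  obtain e1 where e1: "Mx e1 = M1" using Mx_cx_surj by blast
  have "Bf (real N + 1) \<subseteq> U (range (Mx e1)) (real N)" using M1 unfolding good_def e1 N_def by (metis le_add1)
  from good_open[OF this] obtain \<phi>1 where \<phi>1: "\<phi>1 \<in> polyfuns ?X" "\<phi>1 e1 \<noteq> 0"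
    "\<And>e. \<phi>1 e \<noteq> 0 \<Longrightarrow> Bf (real N + 1) \<subseteq> U (range (Mx e)) (real N)" by blast
  have good: "good (range (Mx e)) N" if "\<phi>1 e \<noteq> 0" for e
    using \<phi>1(3)[OF that] by (intro good_level) (simp_all add: N_def)
  obtain M2 and \<tau>2 where M2: "det (Jac M2 \<tau>2) \<noteq> 0" using dominant_exists by blast
  obtain e2 where e2: "Mx e2 = M2" using Mx_cx_surj by blast
  define \<phi>3 where "\<phi>3 e = det (Jac (Mx e) \<tau>2)" for e
  have \<phi>3: "\<phi>3 \<in> polyfuns ?X" unfolding \<phi>3_def using fam_eval[OF fam_det finite_lat] by blast
  have "\<phi>3 e2 \<noteq> 0" using M2 by (simp add: \<phi>3_def e2)
  from eqn_polyfuns_common[OF \<phi>1(1) \<phi>3 \<phi>1(2) this] obtain e3 where e3: "\<phi>1 e3 \<noteq> 0" "\<phi>3 e3 \<noteq> 0" by blast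
  define H where "H e = (\<lambda>\<tau>. det (Jac (Mx e) \<tau>)) * G" for e
  obtain DG :: nat where DG: "G \<in> Bf (real DG)" using Laur_Bf[OF G(1)] by blast
  define D where "D = CARD('d) + DG"
  have famH: "fam ?X (lat A (real D)) H"
  proof -
    have "fam ?X (lat A (real D)) (\<lambda>e. (\<lambda>\<tau>. det (Jac (Mx e) \<tau>)) * G)"
      using lat_add[of _ A "real CARD('d)" _ "real DG"]
      by (intro fam_mult[OF fam_det fam_const[OF DG]]) (simp_all add: D_def)
    then show ?thesis by (simp add: H_def[abs_def])
  qed
  have HL: "H e \<in> Laur" for e
  proof -
    obtain a where "\<forall>e \<tau>. H e \<tau> = (\<Sum>u\<in>lat A (real D). a u e * ch u \<tau>)"
      using famH unfolding fam_def by (elim exE conjE)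
    then have "H e \<in> Bf (real D)" unfolding LP_def by (intro CollectI exI[of _ "\<lambda>u. a u e"]) (rule allI, elim allE)
    then show ?thesis by (rule Bf_Laur)
  qed
  have "(\<lambda>\<tau>. det (Jac (Mx e3) \<tau>)) \<noteq> 0" using e3(2) unfolding \<phi>3_def by (metis zero_fun_apply)
  moreover have "(\<lambda>\<tau>. det (Jac (Mx e3) \<tau>)) \<in> Laur"
  proof -
    obtain a where "\<forall>e \<tau>. det (Jac (Mx e) \<tau>) = (\<Sum>u\<in>lat A (real CARD('d)). a u e * ch u \<tau>)"
      using fam_det unfolding fam_def by blast
    then have "(\<lambda>\<tau>. det (Jac (Mx e3) \<tau>)) \<in> Bf (real CARD('d))"
      unfolding LP_def by (intro CollectI exI[of _ "\<lambda>u. a u e3"]) (rule allI, elim allE)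
    then show ?thesis by (rule Bf_Laur)
  qed
  ultimately have Hnz: "H e3 \<noteq> 0" unfolding H_def by (intro Laur_mult_nz G)
  from poly_multiple_exists[OF HL this, of "Mx e3"] obtain N' p b y where
    p: "p \<in> PF N'" "b \<in> Laur" "p y \<noteq> 0" "pF (Mx e3) p = H e3 * b" by blast
  obtain e' where e': "Mx e' = Mx e3" "cx e' = y" using Mx_cx_surj[of "Mx e3" y] by blast
  \<comment> \<open>Only the constants change: goodness and the Jacobian depend on the matrix alone,
    so \<open>e0\<close> inherits both from \<open>e3\<close>.\<close>
  define e0 where "e0 = (fst e3, snd e')"
  have Me0: "Mx e0 = Mx e3" by (rule Mx_eq) (simp add: e0_def)
  have ce0: "cx e0 = y" using e'(2) by (simp add: e0_def cx_def)
  have He0: "H e0 = H e3" by (simp add: H_def Me0)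
  have one: "1 - H e0 * (cst (1 / p y) * b) \<in> Idl (Mx e0) (cx e0)"
  proof -
    have "cst (- 1 / p y) * (pF (Mx e0) p - cst (p (cx e0))) \<in> Idl (Mx e0) (cx e0)"
      by (intro Idl_closed(2) pF_Idl[OF p(1)] Laur_cst)
    moreover have "cst (- 1 / p y) * (pF (Mx e0) p - cst (p (cx e0))) = 1 - H e0 * (cst (1 / p y) * b)"
      unfolding Me0 ce0 p(4) He0 using p(3) by (simp add: fun_eq_iff field_simps)
    ultimately show ?thesis by (simp only:)
  qed
  have good0: "good (range (Mx e0)) N" unfolding Me0 by (rule good[OF e3(1)])
  have N0: "0 < N" by (simp add: N_def)
  obtain \<phi>1' where \<phi>1': "\<phi>1' \<in> polyfuns ?X" "\<phi>1' e0 \<noteq> 0"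
    "\<And>e. \<phi>1' e \<noteq> 0 \<Longrightarrow> Bf (real N + 1) \<subseteq> U (range (Mx e)) (real N)"
    using good_open[of N e0] \<phi>1(3)[OF e3(1)] unfolding Me0 by blast
  have good': "good (range (Mx e)) N" if "\<phi>1' e \<noteq> 0" for e
    using \<phi>1'(3)[OF that] by (intro good_level) (simp_all add: N_def)
  have D0: "0 < D" by (simp add: D_def)
  obtain \<phi>2 where \<phi>2: "\<phi>2 \<in> polyfuns ?X" "\<phi>2 e0 \<noteq> 0"
    "\<And>e \<tau>. \<phi>2 e \<noteq> 0 \<Longrightarrow> Fm (Mx e) \<tau> = cx e \<Longrightarrow> H e \<tau> \<noteq> 0"
    using unit_open[OF good0 N0 famH D0 one] Laur_mult[OF Laur_cst p(2)] by blast
  have \<phi>3e0: "\<phi>3 e0 \<noteq> 0" using e3(2) by (simp add: \<phi>3_def Me0)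
  show ?thesis
  proof (intro bexI[of _ "\<lambda>e. \<phi>1' e * (\<phi>2 e * \<phi>3 e)"] conjI allI impI)
    show "(\<lambda>e. \<phi>1' e * (\<phi>2 e * \<phi>3 e)) \<in> polyfuns ?X"
      by (intro polyfuns.mult[of \<phi>1'] polyfuns.mult[of \<phi>2] \<phi>1'(1) \<phi>2(1) \<phi>3)
    show "\<exists>e. \<phi>1' e * (\<phi>2 e * \<phi>3 e) \<noteq> 0" using \<phi>1'(2) \<phi>2(2) \<phi>3e0 by (intro exI[of _ e0]) simp
  next
    fix e assume "\<phi>1' e * (\<phi>2 e * \<phi>3 e) \<noteq> 0"
    then show "\<exists>\<nu>. good (range (Mx e)) \<nu> \<and> 0 < \<nu>" using good'[of e] N0 by auto
  next
    fix e assume "\<phi>1' e * (\<phi>2 e * \<phi>3 e) \<noteq> 0"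
    then show "\<exists>\<tau>. det (Jac (Mx e) \<tau>) \<noteq> 0" unfolding \<phi>3_def by auto
  next
    fix e \<tau> assume "\<phi>1' e * (\<phi>2 e * \<phi>3 e) \<noteq> 0" "Fm (Mx e) \<tau> = cx e"
    then have "H e \<tau> \<noteq> 0" using \<phi>2(3) by simp
    then show "det (Jac (Mx e) \<tau>) \<noteq> 0" "G \<tau> \<noteq> 0" by (auto simp: H_def)
  qed
qed

end

section \<open>Circuits and the fibres of the cosine parametrization\<close>

lemma common_denominator:
  fixes q :: "'i \<Rightarrow> rat"
  assumes "finite C"
  shows "\<exists>D::int. D \<noteq> 0 \<and> (\<forall>j\<in>C. \<exists>z::int. of_int D * q j = of_int z)"
  using assms
proof induction
  case (insert i C)
  then obtain D :: int where D: "D \<noteq> 0" "\<And>j. j \<in> C \<Longrightarrow> \<exists>z::int. of_int D * q j = of_int z" by blast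
  obtain a b where q: "quotient_of (q i) = (a, b)" by (cases "quotient_of (q i)")
  have ab: "q i = of_int a / of_int b" "b \<noteq> 0"
    using quotient_of_div[OF q] quotient_of_denom_pos[OF q] by simp_all
  have "\<exists>z::int. of_int (D * b) * q j = of_int z" if "j \<in> insert i C" for j
  proof (cases "j = i")
    case True
    then show ?thesis using ab by (intro exI[of _ "D * a"]) simp
  next
    case False
    then have "j \<in> C" using that by simp
    then obtain z :: int where "of_int D * q j = of_int z" using D(2) by blast
    then have "of_int (D * b) * q j = of_int (b * z)" by (simp add: algebra_simps)
    then show ?thesis by blast
  qed
  moreover have "D * b \<noteq> 0" using D(1) ab(2) by simp
  ultimately show ?case by blast
qed (intro exI[of _ 1], simp)

text \<open>A linear map over the rationals from the reals to the rationals with value 1 at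
  \<open>u i\<close>, applied to the coefficients, turns a real relation into a rational one.
  Clearing denominators makes it integral; the entry at \<open>i\<close> stays nonzero.\<close>

lemma int_kernel_vector:
  fixes A :: "int ^ 'n ^ 'd" and u :: "'n \<Rightarrow> real"
  assumes "(\<Sum>j\<in>C. u j *\<^sub>R column j (map_matrix real_of_int A)) = 0" "i \<in> C" "u i \<noteq> 0"
  shows "\<exists>m. A *v m = 0 \<and> m $ i \<noteq> 0 \<and> {j. m $ j \<noteq> 0} \<subseteq> C"
proof -
  interpret Q: vector_space_pair "\<lambda>(q::rat) (x::real). of_rat q * x" "\<lambda>(q::rat) (x::rat). q * x"
    by unfold_locales (simp_all add: of_rat_add of_rat_mult distrib_left distrib_right mult.assoc)
  have "\<not> Q.vs1.dependent {u i}" using assms(3) by (simp add: Q.vs1.dependent_single)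
  from Q.linear_independent_extend[OF this, of "\<lambda>_. 1"] obtain f where
    f: "Vector_Spaces.linear (\<lambda>(q::rat) (x::real). of_rat q * x) (\<lambda>(q::rat) (x::rat). q * x) f" "f (u i) = 1" by auto
  interpret f: Vector_Spaces.linear "\<lambda>(q::rat) (x::real). of_rat q * x" "\<lambda>(q::rat) (x::rat). q * x" f by (rule f(1))
  have fc: "f (u j * of_int c) = f (u j) * of_int c" for j and c :: int
    using f.scale[of "of_int c" "u j"] by (simp add: mult.commute)
  have rel: "(\<Sum>j\<in>C. f (u j) * of_int (A $ k $ j)) = 0" for k
  proof -
    have "(\<Sum>j\<in>C. u j * of_int (A $ k $ j)) = (\<Sum>j\<in>C. u j *\<^sub>R column j (map_matrix real_of_int A)) $ k"
      by (simp add: column_def map_matrix_def)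
    then have "(\<Sum>j\<in>C. u j * of_int (A $ k $ j)) = 0" using assms(1) by simp
    then have "f (\<Sum>j\<in>C. u j * of_int (A $ k $ j)) = 0" by (simp add: f.zero)
    then show ?thesis by (simp add: f.sum fc)
  qed
  obtain D :: int where D: "D \<noteq> 0" "\<And>j. \<exists>z::int. of_int D * f (u j) = of_int z"
    using common_denominator[OF finite[of UNIV], of "\<lambda>j. f (u j)"] by auto
  then obtain z :: "'n \<Rightarrow> int" where z: "\<And>j. of_int D * f (u j) = of_int (z j)" by metis
  define m where "m = (\<chi> j. if j \<in> C then z j else 0)"
  have "(A *v m) $ k = 0" for k
  proof -
    have "rat_of_int ((A *v m) $ k) = (\<Sum>j\<in>UNIV. if j \<in> C then of_int D * (f (u j) * of_int (A $ k $ j)) else 0)"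
      unfolding matrix_vector_mult_def vec_lambda_beta of_int_sum
      by (intro sum.cong refl) (simp add: m_def z[symmetric] mult.assoc[symmetric] mult.commute)
    also have "\<dots> = of_int D * (\<Sum>j\<in>C. f (u j) * of_int (A $ k $ j))"
      by (simp add: sum.If_cases sum_distrib_left)
    finally show ?thesis by (simp add: rel)
  qed
  then have "A *v m = 0" by (simp add: vec_eq_iff)
  moreover have "m $ i \<noteq> 0" using z[of i] D(1) assms(2) f(2) by (auto simp: m_def)
  moreover have "{j. m $ j \<noteq> 0} \<subseteq> C" by (auto simp: m_def split: if_splits)
  ultimately show ?thesis by blast
qed

lemma cols_dependent_int:
  "cols_dependent A C \<longleftrightarrow> (\<exists>m. A *v m = 0 \<and> m \<noteq> 0 \<and> {j. m $ j \<noteq> 0} \<subseteq> C)"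
proof
  assume "cols_dependent A C"
  then obtain u i where u: "i \<in> C" "u i \<noteq> 0" "(\<Sum>j\<in>C. u j *\<^sub>R column j (map_matrix real_of_int A)) = 0"
    unfolding cols_dependent_def by blast
  from int_kernel_vector[OF u(3,1,2)] obtain m where "A *v m = 0" "m $ i \<noteq> 0" "{j. m $ j \<noteq> 0} \<subseteq> C" by blast
  moreover from this have "m \<noteq> 0" by auto
  ultimately show "\<exists>m. A *v m = 0 \<and> m \<noteq> 0 \<and> {j. m $ j \<noteq> 0} \<subseteq> C" by blast
next
  assume "\<exists>m. A *v m = 0 \<and> m \<noteq> 0 \<and> {j. m $ j \<noteq> 0} \<subseteq> C"
  then obtain m where m: "A *v m = 0" "m \<noteq> 0" "{j. m $ j \<noteq> 0} \<subseteq> C" by blast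
  obtain i where "m $ i \<noteq> 0" using m(2) by (auto simp: vec_eq_iff)
  moreover have "(\<Sum>j\<in>C. real_of_int (m $ j) *\<^sub>R column j (map_matrix real_of_int A)) $ k = 0" for k
  proof -
    have "(\<Sum>j\<in>C. real_of_int (m $ j) *\<^sub>R column j (map_matrix real_of_int A)) $ k
        = (\<Sum>j\<in>C. real_of_int (m $ j * A $ k $ j))"
      by (simp add: column_def map_matrix_def)
    also have "\<dots> = (\<Sum>j\<in>UNIV. real_of_int (m $ j * A $ k $ j))"
      using m(3) by (intro sum.mono_neutral_left) auto
    also have "\<dots> = real_of_int ((A *v m) $ k)"
      by (simp add: matrix_vector_mult_def mult.commute)
    finally show ?thesis using m(1) by simp
  qed
  ultimately show "cols_dependent A C" unfolding cols_dependent_def using m(3)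
    by (intro exI[of _ "\<lambda>j. real_of_int (m $ j)"]) (auto simp: vec_eq_iff)
qed

lemma int_mult_scale: "A *v (c *s m) = c *s (A *v m)" for A :: "int ^ 'n ^ 'd"
  by (simp add: vec_eq_iff matrix_vector_mult_def sum_distrib_left algebra_simps)

text \<open>A kernel vector of minimal support among those nonzero at \<open>j\<close> has a circuit
  as its support. The circuit vector is then one of minimal length with this support.\<close>

lemma circuit_vector_exists:
  fixes A :: "int ^ 'n ^ 'd"
  assumes "A *v m = 0" "m $ j \<noteq> 0"
  shows "\<exists>C m'. j \<in> C \<and> is_circuit A C \<and> circuit_vector A C m'"
proof -
  let ?P = "\<lambda>m. A *v m = 0 \<and> m $ j \<noteq> 0"
  obtain m0 where m0: "A *v m0 = 0" "m0 $ j \<noteq> 0"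
    and min: "\<And>m. ?P m \<Longrightarrow> card {i. m0 $ i \<noteq> 0} \<le> card {i. m $ i \<noteq> 0}"
    using ex_has_least_nat[of ?P m "\<lambda>m. card {i. m $ i \<noteq> 0}"] assms by blast
  define C where "C = {i. m0 $ i \<noteq> 0}"
  have "\<not> cols_dependent A C'" if C': "C' \<subset> C" for C'
  proof
    assume "cols_dependent A C'"
    then obtain m' where m': "A *v m' = 0" "m' \<noteq> 0" "{j. m' $ j \<noteq> 0} \<subseteq> C'"
      unfolding cols_dependent_int by blast
    obtain i where i: "m' $ i \<noteq> 0" using m'(2) by (auto simp: vec_eq_iff)
    \<comment> \<open>If \<open>m'\<close> vanishes at \<open>j\<close>, it serves to cancel the
      entry \<open>i\<close> of \<open>m0\<close> without losing the entry \<open>j\<close>;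
      otherwise \<open>m'\<close> itself has smaller support.\<close>
    define m'' where "m'' = (if m' $ j = 0 then m' $ i *s m0 - m0 $ i *s m' else m')"
    have ker: "A *v m'' = 0"
      using m0(1) m'(1) by (simp add: m''_def matrix_vector_mult_diff_distrib int_mult_scale)
    have "m'' $ j \<noteq> 0" using m0(2) i by (simp add: m''_def)
    with ker have le: "card C \<le> card {i. m'' $ i \<noteq> 0}" unfolding C_def by (intro min) simp
    have "{i. m'' $ i \<noteq> 0} \<subseteq> C" using m'(3) C' by (auto simp: m''_def C_def)
    moreover have "{i. m'' $ i \<noteq> 0} \<noteq> C"
    proof (cases "m' $ j = 0")
      case True
      then have "m'' $ i = 0" by (simp add: m''_def)
      moreover have "i \<in> C" using i m'(3) C' by auto
      ultimately show ?thesis by auto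
    next
      case False
      then show ?thesis using m'(3) C' by (auto simp: m''_def)
    qed
    ultimately have "card {i. m'' $ i \<noteq> 0} < card C" by (intro psubset_card_mono) auto
    with le show False by simp
  qed
  moreover have "cols_dependent A C"
    unfolding cols_dependent_int using m0 by (intro exI[of _ m0]) (auto simp: C_def)
  ultimately have circ: "is_circuit A C" by (simp add: is_circuit_def)
  let ?n = "\<lambda>m :: int ^ 'n. nat (\<Sum>i\<in>UNIV. (m $ i)\<^sup>2)"
  have "int_relation A C m0" using m0(1) by (simp add: int_relation_def C_def)
  then obtain m1 where m1: "int_relation A C m1" "\<And>m. int_relation A C m \<Longrightarrow> ?n m1 \<le> ?n m"
    using ex_has_least_nat[of "int_relation A C" m0 ?n] by blast
  have "norm (\<chi> j. real_of_int (m1 $ j)) \<le> norm (\<chi> j. real_of_int (m $ j))" if "int_relation A C m" for m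
  proof -
    have "(\<Sum>i\<in>UNIV. (m1 $ i)\<^sup>2) \<le> (\<Sum>i\<in>UNIV. (m $ i)\<^sup>2)"
      using m1(2)[OF that] by (simp add: nat_le_eq_zle sum_nonneg)
    then have "real_of_int (\<Sum>i\<in>UNIV. (m1 $ i)\<^sup>2) \<le> real_of_int (\<Sum>i\<in>UNIV. (m $ i)\<^sup>2)"
      by (simp only: of_int_le_iff)
    then show ?thesis by (simp add: norm_vec_def L2_set_def)
  qed
  then have "circuit_vector A C m1" using m1(1) by (simp add: circuit_vector_def)
  moreover have "j \<in> C" using m0(2) by (simp add: C_def)
  ultimately show ?thesis using circ by blast
qed

text \<open>The indices contained in no circuit, described through the integer kernel, which is the
  form in which monomial relations enter.\<close>

definition coloops :: "int ^ 'n ^ 'd \<Rightarrow> 'n set" where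
  "coloops A = {j. \<forall>m. A *v m = 0 \<longrightarrow> m $ j = 0}"

lemma real_kernel_coloops: "{j. \<forall>v\<in>real_kernel A. v $ j = 0} = coloops A"
proof (intro equalityI subsetI)
  fix j assume j: "j \<in> {j. \<forall>v\<in>real_kernel A. v $ j = 0}"
  have "m $ j = 0" if m: "A *v m = 0" for m
  proof -
    have "(map_matrix real_of_int A *v (\<chi> i. real_of_int (m $ i))) $ k = real_of_int ((A *v m) $ k)" for k
      by (simp add: matrix_vector_mult_def map_matrix_def)
    then have "(\<chi> i. real_of_int (m $ i)) \<in> real_kernel A" using m by (simp add: real_kernel_def vec_eq_iff)
    then show ?thesis using j by fastforce
  qed
  then show "j \<in> coloops A" by (simp add: coloops_def)
next
  fix j assume j: "j \<in> coloops A"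
  have "v $ j = 0" if v: "v \<in> real_kernel A" for v
  proof (rule ccontr)
    assume nz: "v $ j \<noteq> 0"
    have "(\<Sum>i\<in>UNIV. v $ i *\<^sub>R column i (map_matrix real_of_int A)) = 0"
      using v by (simp add: real_kernel_def matrix_mult_sum scalar_mult_eq_scaleR)
    from int_kernel_vector[OF this UNIV_I nz] show False using j by (auto simp: coloops_def)
  qed
  then show "j \<in> {j. \<forall>v\<in>real_kernel A. v $ j = 0}" by simp
qed

lemma CL_eq: "CL A = card (coloops A)"
proof -
  let ?K = "real_kernel A"
  have "generically vec_coords ?K (\<lambda>v. \<forall>j\<in>F. v $ j \<noteq> 0)" if "F \<subseteq> - coloops A" for F
    using finite[of F] that
  proof (induction F rule: finite_induct)
    case empty
    have "0 \<in> ?K" by (simp add: real_kernel_def)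
    then show ?case unfolding generically_def by (intro bexI[OF _ polyfuns.const[of 1]]) auto
  next
    case (insert i F)
    then have "i \<notin> {j. \<forall>v\<in>?K. v $ j = 0}" unfolding real_kernel_coloops by simp
    then have "generically vec_coords ?K (\<lambda>v. v $ i \<noteq> 0)"
      unfolding generically_def
      by (intro bexI[OF _ polyfuns.coord[of "\<lambda>v. v $ i"]]) (auto simp: vec_coords_def)
    then show ?case
      using generically_kernel_conj[of A "\<lambda>v. v $ i \<noteq> 0" "\<lambda>v. \<forall>j\<in>F. v $ j \<noteq> 0"] insert by simp
  qed
  from generically_exists[OF generically_kernel_conj[OF generically_CL this[OF subset_refl]]]
  obtain v where v: "v \<in> ?K" "card {j. v $ j = 0} = CL A" "\<forall>j\<in>- coloops A. v $ j \<noteq> 0" by blast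
  have "{j. v $ j = 0} = coloops A"
    using v(1,3) unfolding real_kernel_coloops[symmetric] by auto
  then show ?thesis using v(2) by simp
qed

lemma powi_sum: "x \<noteq> 0 \<Longrightarrow> x powi (\<Sum>i\<in>K. f i) = (\<Prod>i\<in>K. x powi f i)" for x :: complex
  by (induction K rule: infinite_finite_induct) (auto simp: power_int_add)

lemma int_mult_sum: "A *v (\<Sum>i\<in>K. f i) = (\<Sum>i\<in>K. A *v f i)" for A :: "int ^ 'n ^ 'd"
  by (induction K rule: infinite_finite_induct) (simp_all add: matrix_vector_right_distrib)

lemma int_mult_axis: "A *v axis i 1 = column i A" for A :: "int ^ 'n ^ 'd"
  by (simp add: vec_eq_iff matrix_vector_mult_def axis_def column_def if_distrib cong: if_cong)

section \<open>Monomial relations and the points of the torus\<close>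

context spanning
begin

lemma ch_comb: "ch (A *v m) \<tau> = (\<Prod>j\<in>UNIV. ch (column j A) \<tau> powi (m $ j))"
  by (simp add: mult_comb ch_sum ch_scale)

lemma tc_comb: "tc \<tau> k = (\<Prod>j\<in>UNIV. ch (column j A) \<tau> powi (sec (axis k 1) $ j))"
  using ch_comb[of "sec (axis k 1)" \<tau>] by simp

lemma torus_point_unique: "(\<And>j. ch (column j A) \<sigma> = ch (column j A) \<tau>) \<Longrightarrow> \<sigma> = \<tau>"
  by (rule torus_eqI) (simp add: tc_comb)

text \<open>The image of a subtorus under the characters is cut out by monomial relations: the
  coordinates of the point are recovered as monomials in \<open>v\<close> through
  \<open>sec\<close>, and the relations show that its character values are the prescribed
  ones.\<close>

lemma torus_point_exists:
  assumes nz: "\<And>j. v j \<noteq> 0"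
    and rel: "\<And>m. \<forall>k\<in>I. (A *v m) $ k = 0 \<Longrightarrow> (\<Prod>j\<in>UNIV. v j powi (m $ j)) = 1"
  shows "\<exists>\<tau>\<in>subtorus I. \<forall>j. ch (column j A) \<tau> = v j"
proof -
  let ?s = "\<lambda>k j. sec (axis k 1) $ j"
  define \<tau> where "\<tau> = mkt (\<lambda>k. \<Prod>j\<in>UNIV. v j powi ?s k j)"
  have tc: "tc \<tau> k = (\<Prod>j\<in>UNIV. v j powi ?s k j)" for k
    unfolding \<tau>_def using nz by (intro tc_mkt) simp
  have "tc \<tau> k = 1" if "k \<notin> I" for k
  proof -
    have "\<forall>l\<in>I. (A *v sec (axis k 1)) $ l = 0" using that by (auto simp: axis_def)
    from rel[OF this] show ?thesis by (simp add: tc)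
  qed
  then have "\<tau> \<in> subtorus I" by (simp add: subtorus_def)
  moreover have "ch (column i A) \<tau> = v i" for i
  proof -
    \<comment> \<open>Both terms have image \<open>column i A\<close>, so \<open>m\<close> is in the
      kernel. Its relation says that rebuilding column \<open>i\<close> from the recovered
      coordinates gives \<open>v i\<close>.\<close>
    define m where "m = (\<Sum>k\<in>UNIV. A $ k $ i *s sec (axis k 1)) - axis i 1"
    have "A *v m = (\<Sum>k\<in>UNIV. A $ k $ i *s axis k 1) - column i A"
      by (simp add: m_def matrix_vector_mult_diff_distrib int_mult_sum int_mult_scale int_mult_axis)
    also have "\<dots> = 0" by (simp add: vec_eq_iff axis_def column_def if_distrib cong: if_cong)
    finally have "(\<Prod>j\<in>UNIV. v j powi (m $ j)) = 1" by (intro rel) simp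
    moreover have "v j powi (m $ j) = (\<Prod>k\<in>UNIV. v j powi (A $ k $ i * ?s k j)) / (if j = i then v i else 1)" for j
      using nz by (auto simp: m_def axis_def powi_sum[symmetric] power_int_diff)
    ultimately have "(\<Prod>j\<in>UNIV. \<Prod>k\<in>UNIV. v j powi (A $ k $ i * ?s k j)) / v i = 1"
      by (simp add: prod_dividef)
    moreover have "ch (column i A) \<tau> = (\<Prod>k\<in>UNIV. \<Prod>j\<in>UNIV. v j powi (A $ k $ i * ?s k j))"
      by (simp add: ch_def tc column_def prod_powi power_int_mult[symmetric] mult.commute)
    ultimately show ?thesis using nz by (simp add: prod.swap[of "\<lambda>k j. v j powi (A $ k $ i * ?s k j)"])
  qed
  ultimately show ?thesis by blast
qed

end

context liss
begin

definition wc :: "'n \<Rightarrow> 'd torus \<Rightarrow> complex" where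
  "wc j \<tau> = ch (column j A) \<tau> / \<beta> j"

lemma wc_nz [simp]: "wc j \<tau> \<noteq> 0"
  by (simp add: wc_def beta_nz)

lemma xf_wc: "xf j \<tau> = (wc j \<tau> + inverse (wc j \<tau>)) / 2"
  by (simp add: xf_def wc_def ch_minus field_simps beta_nz)

lemma xf_eq_iff: "xf j \<sigma> = xf j \<tau> \<longleftrightarrow> wc j \<sigma> = wc j \<tau> \<or> wc j \<sigma> = inverse (wc j \<tau>)"
proof -
  have "(a + inverse a = b + inverse b) = (a = b \<or> a = inverse b)" if "a \<noteq> 0" "b \<noteq> 0" for a b :: complex
  proof -
    have "(a + inverse a = b + inverse b) \<longleftrightarrow> (a - b) * (a * b - 1) = 0"
      using that by (simp add: field_simps)
    also have "\<dots> \<longleftrightarrow> a - b = 0 \<or> a * b - 1 = 0" by simp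
    also have "\<dots> \<longleftrightarrow> a = b \<or> a = inverse b"
      using that by (simp add: field_simps)
    finally show ?thesis .
  qed
  from this[of "wc j \<sigma>" "wc j \<tau>"] show ?thesis by (simp only: xf_wc divide_cancel_right) simp
qed

lemma wc_prod: "(\<Prod>j\<in>UNIV. wc j \<tau> powi (m $ j)) = ch (A *v m) \<tau> / (\<Prod>j\<in>UNIV. \<beta> j powi (m $ j))"
  by (simp add: wc_def power_int_divide_distrib prod_dividef ch_comb)

lemma wc_unique: "(\<And>j. wc j \<sigma> = wc j \<tau>) \<Longrightarrow> \<sigma> = \<tau>"
  by (rule torus_point_unique) (simp add: wc_def beta_nz)

lemma wc_exists:
  assumes nz: "\<And>j. w j \<noteq> 0"
    and rel: "\<And>m. \<forall>k\<in>I. (A *v m) $ k = 0 \<Longrightarrow> (\<Prod>j\<in>UNIV. w j powi (m $ j)) * (\<Prod>j\<in>UNIV. \<beta> j powi (m $ j)) = 1"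
  shows "\<exists>\<tau>\<in>subtorus I. \<forall>j. wc j \<tau> = w j"
proof -
  have "\<exists>\<tau>\<in>subtorus I. \<forall>j. ch (column j A) \<tau> = w j * \<beta> j"
    using nz beta_nz rel by (intro torus_point_exists) (simp_all add: power_int_mult_distrib prod.distrib)
  then show ?thesis by (simp add: wc_def beta_nz nonzero_divide_eq_eq)
qed

definition flip :: "'n set \<Rightarrow> int ^ 'n \<Rightarrow> int ^ 'n" where
  "flip S m = (\<chi> j. if j \<in> S then - (m $ j) else m $ j)"

definition rel_fun :: "int ^ 'n \<Rightarrow> 'd torus \<Rightarrow> complex" where
  "rel_fun m \<tau> = (\<Prod>j\<in>UNIV. wc j \<tau> powi (m $ j))"

lemma rel_fun_Laur: "rel_fun m \<in> Laur"
proof -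
  have "rel_fun m = cst (1 / (\<Prod>j\<in>UNIV. \<beta> j powi (m $ j))) * ch (A *v m)"
    by (simp add: fun_eq_iff rel_fun_def wc_prod)
  then show ?thesis by (simp add: Laur_mult)
qed

text \<open>A character that is constant on the torus has exponent 0, and the value of the monomial
  is read off at the point with all coordinates 1.\<close>

lemma rel_fun_const:
  assumes "\<And>\<tau>. rel_fun m \<tau> = \<kappa>"
  shows "A *v m = 0" "\<kappa> = 1 / (\<Prod>j\<in>UNIV. \<beta> j powi (m $ j))"
proof -
  let ?b = "\<Prod>j\<in>UNIV. \<beta> j powi (m $ j)"
  have b: "?b \<noteq> 0" by (simp add: beta_nz)
  have rf: "ch (A *v m) \<tau> = \<kappa> * ?b" for \<tau>
    using assms[of \<tau>] b by (simp add: rel_fun_def wc_prod field_simps)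
  have "ch (A *v m) (mkt (\<lambda>_. 1)) = 1" by (simp add: ch_def tc_mkt)
  with rf[of "mkt (\<lambda>_. 1)"] have k: "\<kappa> * ?b = 1" by simp
  then show "\<kappa> = 1 / ?b" using b by (simp add: field_simps)
  have "ch (A *v m) = ch 0" using rf k by (simp add: fun_eq_iff)
  then show "A *v m = 0" by (rule injD[OF ch_inj])
qed

text \<open>The function vanishes where \<open>wc j\<close> equals its inverse, so that a flip at
  \<open>j\<close> gives no new point. It is not identically 0 because \<open>axis j 2\<close> is
  not in the kernel of \<open>A\<close>.\<close>

lemma coloop_generic:
  assumes "j \<in> coloops A"
  shows "(\<lambda>\<tau>. wc j \<tau> powi 2 - 1) \<in> Laur" "(\<lambda>\<tau>. wc j \<tau> powi 2 - 1) \<noteq> 0"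
proof -
  have rf: "rel_fun (axis j 2) \<tau> = wc j \<tau> powi 2" for \<tau>
  proof -
    have "rel_fun (axis j 2) \<tau> = (\<Prod>i\<in>UNIV. if i = j then wc j \<tau> powi 2 else 1)"
      unfolding rel_fun_def by (intro prod.cong) (auto simp: axis_def)
    then show ?thesis by simp
  qed
  have "(\<lambda>\<tau>. wc j \<tau> powi 2 - 1) = rel_fun (axis j 2) - 1" by (simp add: fun_eq_iff rf)
  then show "(\<lambda>\<tau>. wc j \<tau> powi 2 - 1) \<in> Laur" by (simp add: Laur_diff rel_fun_Laur)
  show "(\<lambda>\<tau>. wc j \<tau> powi 2 - 1) \<noteq> 0"
  proof
    assume "(\<lambda>\<tau>. wc j \<tau> powi 2 - 1) = 0"
    then have "rel_fun (axis j 2) \<tau> = 1" for \<tau> by (simp add: fun_eq_iff rf)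
    from rel_fun_const(1)[OF this] assms show False by (auto simp: coloops_def axis_def)
  qed
qed

text \<open>
  If the relation of a circuit survives flipping the signs in a set \<open>S\<close> identically, then by
  minimality of the circuit \<open>S\<close> contains all or none of it, and the former would force
  \<open>\<Prod>\<beta>\<^sub>j\<^bsup>2 m\<^sub>j\<^esup> = 1\<close>.
\<close>

lemma flip_circuit:
  assumes circ: "is_circuit A C" "int_relation A C m"
    and gen: "(\<Prod>j\<in>UNIV. \<beta> j powi (2 * m $ j)) \<noteq> 1"
    and const: "\<And>\<tau>. rel_fun (flip S m) \<tau> = 1 / (\<Prod>j\<in>UNIV. \<beta> j powi (m $ j))"
  shows "C \<inter> S = {}"
proof (rule ccontr)
  assume ne: "C \<inter> S \<noteq> {}"
  have m: "A *v m = 0" "{j. m $ j \<noteq> 0} = C" using circ(2) by (simp_all add: int_relation_def)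
  have f: "A *v flip S m = 0"
    "1 / (\<Prod>j\<in>UNIV. \<beta> j powi (m $ j)) = 1 / (\<Prod>j\<in>UNIV. \<beta> j powi (flip S m $ j))"
    by (rule rel_fun_const[OF const])+
  have "C \<subseteq> S"
  proof (rule ccontr)
    assume nsub: "\<not> C \<subseteq> S"
    then obtain i where i: "i \<in> C" "i \<notin> S" by blast
    \<comment> \<open>Adding the two kernel vectors cancels the entries in \<open>S\<close> and
      doubles the others, which leaves a relation supported in a proper subset of the
      circuit.\<close>
    have "A *v (m + flip S m) = 0" using m(1) f(1) by (simp add: matrix_vector_right_distrib)
    moreover have "m $ i \<noteq> 0" using i(1) m(2) by blast
    then have "(m + flip S m) $ i \<noteq> 0" using i(2) by (simp add: flip_def)
    then have "m + flip S m \<noteq> 0" by (metis zero_index)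
    moreover have "{j. (m + flip S m) $ j \<noteq> 0} \<subseteq> C - S" using m(2) by (auto simp: flip_def split: if_splits)
    ultimately have "cols_dependent A (C - S)" unfolding cols_dependent_int by blast
    moreover have "C - S \<subset> C" using ne by blast
    ultimately show False using circ(1) by (simp add: is_circuit_def)
  qed
  have "flip S m $ j = - (m $ j)" for j
    using \<open>C \<subseteq> S\<close> m(2) by (auto simp: flip_def)
  then have "(\<Prod>j\<in>UNIV. \<beta> j powi (m $ j)) = inverse (\<Prod>j\<in>UNIV. \<beta> j powi (m $ j))"
    using f(2) by (simp add: power_int_minus prod_inversef[unfolded comp_def] divide_inverse)
  then have "(\<Prod>j\<in>UNIV. \<beta> j powi (m $ j)) * (\<Prod>j\<in>UNIV. \<beta> j powi (m $ j)) = 1"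
    using beta_nz by (simp add: field_simps)
  moreover have "\<beta> j powi (2 * m $ j) = \<beta> j powi (m $ j) * \<beta> j powi (m $ j)" for j
    using beta_nz[of j] by (simp add: power_int_add[symmetric])
  ultimately show False using gen by (simp add: prod.distrib)
qed

lemma flip_values:
  assumes "\<And>j. xf j \<sigma> = xf j \<tau>"
  shows "rel_fun (flip {j. wc j \<sigma> \<noteq> wc j \<tau>} m) \<tau> = rel_fun m \<sigma>"
proof -
  have "wc j \<tau> powi (flip {j. wc j \<sigma> \<noteq> wc j \<tau>} m $ j) = wc j \<sigma> powi (m $ j)" for j
    using assms[of j] by (auto simp: flip_def xf_eq_iff power_int_minus power_int_inverse)
  then show ?thesis by (simp add: rel_fun_def)
qed

text \<open>Points with the same cosines as \<open>\<tau>\<close> correspond to their sets of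
  flipped indices. Every set of coloops occurs, because kernel vectors vanish there and no relation
  notices the flip. Where \<open>G\<close> is nonzero, any other index is excluded by a circuit
  through it.\<close>

lemma fibres_of_xf:
  assumes gen: "\<And>C m. is_circuit A C \<Longrightarrow> circuit_vector A C m \<Longrightarrow> (\<Prod>j\<in>UNIV. \<beta> j powi (2 * m $ j)) \<noteq> 1"
  shows "\<exists>G\<in>Laur. G \<noteq> 0 \<and> (\<forall>\<tau>. G \<tau> \<noteq> 0 \<longrightarrow> card {\<sigma>. \<forall>j. xf j \<sigma> = xf j \<tau>} = 2 ^ card (coloops A))"
proof -
  have "\<exists>C m. j \<notin> coloops A \<longrightarrow> j \<in> C \<and> is_circuit A C \<and> circuit_vector A C m" for j
    using circuit_vector_exists[of A _ j] by (auto simp: coloops_def)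
  then obtain C m where Cm: "\<And>j. j \<notin> coloops A \<Longrightarrow> j \<in> C j \<and> is_circuit A (C j) \<and> circuit_vector A (C j) (m j)"
    by metis
  define h where "h j S = rel_fun (flip S (m j)) - cst (1 / (\<Prod>i\<in>UNIV. \<beta> i powi (m j $ i)))" for j S
  \<comment> \<open>Only those \<open>h j S\<close> that are not identically 0 enter
    \<open>G\<close>. Where \<open>G\<close> is nonzero, \<open>h j S \<tau> = 0\<close> therefore
    forces \<open>h j S\<close> to vanish identically, as \<open>flip_circuit\<close>
    demands.\<close>
  define K where "K = {p. fst p \<notin> coloops A \<and> h (fst p) (snd p) \<noteq> 0}"
  define G where "G = (\<Prod>p\<in>K. h (fst p) (snd p)) * (\<Prod>j\<in>coloops A. (\<lambda>\<tau>. wc j \<tau> powi 2 - 1))"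
  have h: "h j S \<in> Laur" for j S unfolding h_def by (intro Laur_diff rel_fun_Laur Laur_cst)
  have "G \<in> Laur" unfolding G_def
    by (intro Laur_mult Laur_prod h coloop_generic(1))
  moreover have "G \<noteq> 0" unfolding G_def
  proof (rule Laur_mult_nz)
    show "(\<Prod>p\<in>K. h (fst p) (snd p)) \<noteq> 0" by (rule Laur_prod_nz) (auto simp: K_def h)
    show "(\<Prod>j\<in>coloops A. (\<lambda>\<tau>. wc j \<tau> powi 2 - 1)) \<noteq> 0" by (intro Laur_prod_nz conjI coloop_generic finite)
  qed (intro Laur_prod h coloop_generic(1); assumption)+
  moreover have "card {\<sigma>. \<forall>j. xf j \<sigma> = xf j \<tau>} = 2 ^ card (coloops A)" if G\<tau>: "G \<tau> \<noteq> 0" for \<tau>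
  proof -
    have h\<tau>: "h j S = 0" if "j \<notin> coloops A" "h j S \<tau> = 0" for j S
    proof (rule ccontr)
      assume "h j S \<noteq> 0"
      then have "(j, S) \<in> K" using that(1) by (simp add: K_def)
      moreover have "h (fst p) (snd p) \<tau> \<noteq> 0" if "p \<in> K" for p
        using G\<tau> that by (simp add: G_def prod_fun_apply)
      ultimately show False using that(2) by fastforce
    qed
    have w\<tau>: "wc j \<tau> \<noteq> inverse (wc j \<tau>)" if "j \<in> coloops A" for j
    proof
      assume "wc j \<tau> = inverse (wc j \<tau>)"
      then have "wc j \<tau> powi 2 = 1" by (simp add: power2_eq_square) (metis right_inverse wc_nz)
      moreover have "wc j \<tau> powi 2 - 1 \<noteq> 0"
        using G\<tau> that by (simp add: G_def prod_fun_apply)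
      ultimately show False by simp
    qed
    have sub: "{j. wc j \<sigma> \<noteq> wc j \<tau>} \<subseteq> coloops A" if \<sigma>: "\<forall>j. xf j \<sigma> = xf j \<tau>" for \<sigma>
    proof
      fix j assume j: "j \<in> {j. wc j \<sigma> \<noteq> wc j \<tau>}"
      show "j \<in> coloops A"
      proof (rule ccontr)
        assume nj: "j \<notin> coloops A"
        let ?S = "{j. wc j \<sigma> \<noteq> wc j \<tau>}"
        have c: "j \<in> C j" "is_circuit A (C j)" "circuit_vector A (C j) (m j)" using Cm[OF nj] by auto
        then have ir: "int_relation A (C j) (m j)" by (simp add: circuit_vector_def)
        then have "h j ?S \<tau> = 0" using flip_values[of \<sigma> \<tau> "m j"] \<sigma> by (simp add: h_def int_relation_def rel_fun_def wc_prod)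
        then have "h j ?S = 0" by (rule h\<tau>[OF nj])
        then have "rel_fun (flip ?S (m j)) \<rho> = 1 / (\<Prod>i\<in>UNIV. \<beta> i powi (m j $ i))" for \<rho>
          by (simp add: h_def fun_eq_iff)
        from flip_circuit[OF c(2) ir gen[OF c(2,3)] this] have "C j \<inter> ?S = {}" .
        with c(1) j show False by blast
      qed
    qed
    have "bij_betw (\<lambda>\<sigma>. {j. wc j \<sigma> \<noteq> wc j \<tau>}) {\<sigma>. \<forall>j. xf j \<sigma> = xf j \<tau>} (Pow (coloops A))"
      unfolding bij_betw_def
    proof (intro conjI inj_onI equalityI subsetI)
      fix \<sigma> \<rho> assume a: "\<sigma> \<in> {\<sigma>. \<forall>j. xf j \<sigma> = xf j \<tau>}" "\<rho> \<in> {\<sigma>. \<forall>j. xf j \<sigma> = xf j \<tau>}"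
        "{j. wc j \<sigma> \<noteq> wc j \<tau>} = {j. wc j \<rho> \<noteq> wc j \<tau>}"
      show "\<sigma> = \<rho>"
      proof (rule wc_unique)
        fix j
        have "wc j \<sigma> \<noteq> wc j \<tau> \<longleftrightarrow> wc j \<rho> \<noteq> wc j \<tau>" using a(3) by blast
        moreover have "xf j \<sigma> = xf j \<tau>" "xf j \<rho> = xf j \<tau>" using a(1,2) by blast+
        ultimately show "wc j \<sigma> = wc j \<rho>" unfolding xf_eq_iff by auto
      qed
    next
      fix T assume "T \<in> (\<lambda>\<sigma>. {j. wc j \<sigma> \<noteq> wc j \<tau>}) ` {\<sigma>. \<forall>j. xf j \<sigma> = xf j \<tau>}"
      then show "T \<in> Pow (coloops A)" using sub by blast
    next
      fix T assume T: "T \<in> Pow (coloops A)"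
      define w where "w j = (if j \<in> T then inverse (wc j \<tau>) else wc j \<tau>)" for j
      have "\<exists>\<sigma>\<in>subtorus UNIV. \<forall>j. wc j \<sigma> = w j"
      proof (rule wc_exists)
        show "w j \<noteq> 0" for j by (simp add: w_def)
        fix m assume m: "\<forall>k\<in>UNIV. (A *v m) $ k = 0"
        then have "A *v m = 0" by (simp add: vec_eq_iff)
        moreover from this have "w j powi (m $ j) = wc j \<tau> powi (m $ j)" for j
          using T by (auto simp: w_def coloops_def)
        ultimately show "(\<Prod>j\<in>UNIV. w j powi (m $ j)) * (\<Prod>j\<in>UNIV. \<beta> j powi (m $ j)) = 1"
          by (simp add: wc_prod beta_nz)
      qed
      then obtain \<sigma> where \<sigma>: "\<And>j. wc j \<sigma> = w j" by blast
      have "\<forall>j. xf j \<sigma> = xf j \<tau>" by (simp add: xf_eq_iff \<sigma> w_def)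
      moreover have "{j. wc j \<sigma> \<noteq> wc j \<tau>} = T"
        using T w\<tau> by (auto simp: \<sigma> w_def dest: sym)
      ultimately show "T \<in> (\<lambda>\<sigma>. {j. wc j \<sigma> \<noteq> wc j \<tau>}) ` {\<sigma>. \<forall>j. xf j \<sigma> = xf j \<tau>}" by blast
    qed
    then show ?thesis by (simp add: bij_betw_same_card card_Pow)
  qed
  ultimately show ?thesis by blast
qed

end

section \<open>Polynomial functions of \<open>(w\<^sub>j + w\<^sub>j\<^sup>-\<^sup>1) / 2\<close>\<close>

definition xw :: "'n::finite torus \<Rightarrow> complex ^ 'n" where
  "xw w = (\<chi> j. (tc w j + inverse (tc w j)) / 2)"

definition fl :: "'n set \<Rightarrow> 'n::finite torus \<Rightarrow> 'n torus" where
  "fl S w = mkt (\<lambda>j. if j \<in> S then inverse (tc w j) else tc w j)"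

lemma tc_fl: "tc (fl S w) j = (if j \<in> S then inverse (tc w j) else tc w j)"
  unfolding fl_def by (rule tc_mkt) simp

lemma fl_insert: "i \<notin> S \<Longrightarrow> fl (insert i S) w = fl S (fl {i} w)"
  by (rule torus_eqI) (auto simp: tc_fl)

lemma fl_empty [simp]: "fl {} w = w"
  by (rule torus_eqI) (simp add: tc_fl)

lemma xw_surj: "\<exists>w. xw w = x"
proof -
  have "\<exists>z. z \<noteq> 0 \<and> (z + inverse z) / 2 = x $ j" for j
  proof -
    define y s where "y = x $ j" and "s = csqrt (y\<^sup>2 - 1)"
    have "s\<^sup>2 = y\<^sup>2 - 1" by (simp add: s_def)
    then have p: "(y + s) * (y - s) = 1" by (simp add: power2_eq_square algebra_simps)
    then have "y + s \<noteq> 0" by auto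
    moreover from this p have "inverse (y + s) = y - s" by (simp add: inverse_eq_divide divide_eq_eq mult.commute)
    ultimately show ?thesis by (intro exI[of _ "y + s"]) (simp add: y_def)
  qed
  then obtain z where z: "\<And>j. z j \<noteq> 0" "\<And>j. (z j + inverse (z j)) / 2 = x $ j" by metis
  have "xw (mkt z) = x" by (simp add: xw_def tc_mkt z vec_eq_iff)
  then show ?thesis ..
qed

text \<open>
  For \<open>J = {}\<close> these generate the Laurent polynomials in \<open>w\<close>, for \<open>J = UNIV\<close> the polynomials in \<open>xw w\<close>;
  each new element of \<open>J\<close> is reached by a norm with respect to one sign flip.
\<close>

definition part_coords :: "'n set \<Rightarrow> ('n::finite torus \<Rightarrow> complex) set" where
  "part_coords J = range (\<lambda>j w. xw w $ j) \<union> (\<lambda>j w. tc w j) ` (- J) \<union> (\<lambda>j w. inverse (tc w j)) ` (- J)"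

text \<open>Over the functions generated by \<open>part_coords (insert i J)\<close> the coordinate
  \<open>w_i\<close> is quadratic, \<open>w_i ^ 2 = 2 x_i w_i - 1\<close>, so 1 and
  \<open>w_i\<close> span.\<close>

lemma part_coords_split:
  assumes "g \<in> polyfuns (part_coords J)"
  shows "\<exists>p\<in>polyfuns (part_coords (insert i J)). \<exists>q\<in>polyfuns (part_coords (insert i J)).
    \<forall>w. g w = p w + q w * tc w i"
  using assms
proof induction
  case (coord g)
  note pc = polyfuns.coord[of _ "part_coords (insert i J)"]
  have c: "(\<lambda>w. c) \<in> polyfuns (part_coords (insert i J))" for c by (rule polyfuns.const)
  have x: "(\<lambda>w. xw w $ j) \<in> polyfuns (part_coords (insert i J))" for j
    by (rule pc) (simp add: part_coords_def)
  have t: "(\<lambda>w. tc w j) \<in> polyfuns (part_coords (insert i J))" "(\<lambda>w. inverse (tc w j)) \<in> polyfuns (part_coords (insert i J))"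
    if "j \<notin> J" "j \<noteq> i" for j
    by (rule pc, use that in \<open>simp add: part_coords_def\<close>)+
  have triv: "\<exists>p\<in>polyfuns (part_coords (insert i J)). \<exists>q\<in>polyfuns (part_coords (insert i J)). \<forall>w. h w = p w + q w * tc w i"
    if "h \<in> polyfuns (part_coords (insert i J))" for h
    using that by (intro bexI[of _ h] bexI[OF _ c[of 0]]) simp_all
  from coord consider j where "g = (\<lambda>w. xw w $ j)" | j where "g = (\<lambda>w. tc w j)" "j \<notin> J"
    | j where "g = (\<lambda>w. inverse (tc w j))" "j \<notin> J"
    unfolding part_coords_def by blast
  then show ?case
  proof cases
    case 1
    then show ?thesis by (simp only: triv x)
  next
    case (2 j)
    show ?thesis
    proof (cases "j = i")
      case True
      then show ?thesis using 2 by (intro bexI[OF _ c[of 0]] bexI[OF _ c[of 1]]) simp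
    next
      case False
      show ?thesis unfolding 2(1) by (rule triv[OF t(1)[OF 2(2) False]])
    qed
  next
    case (3 j)
    show ?thesis
    proof (cases "j = i")
      case True
      have m: "(\<lambda>w. 2 * xw w $ i) \<in> polyfuns (part_coords (insert i J))" by (intro polyfuns.mult[OF c x])
      show ?thesis unfolding 3(1) True
        by (rule bexI[OF _ m], rule bexI[OF _ c[of "-1"]]) (simp add: xw_def field_simps)
    next
      case False
      show ?thesis unfolding 3(1) by (rule triv[OF t(2)[OF 3(2) False]])
    qed
  qed
next
  case (const c)
  show ?case by (intro bexI[OF _ polyfuns.const[of 0]] bexI[OF _ polyfuns.const[of c]]) simp
next
  case (add g h)
  from add.IH(1) obtain p q where g: "p \<in> polyfuns (part_coords (insert i J))" "q \<in> polyfuns (part_coords (insert i J))"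
    "\<forall>w. g w = p w + q w * tc w i" by blast
  from add.IH(2) obtain p' q' where h: "p' \<in> polyfuns (part_coords (insert i J))" "q' \<in> polyfuns (part_coords (insert i J))"
    "\<forall>w. h w = p' w + q' w * tc w i" by blast
  show ?case
    by (intro bexI[OF _ polyfuns.add[OF g(1) h(1)]] bexI[OF _ polyfuns.add[OF g(2) h(2)]])
      (simp add: g(3) h(3) algebra_simps)
next
  case (mult g h)
  let ?Q = "polyfuns (part_coords (insert i J))"
  from mult.IH(1) obtain p q where g: "p \<in> ?Q" "q \<in> ?Q" "\<forall>w. g w = p w + q w * tc w i" by blast
  from mult.IH(2) obtain p' q' where h: "p' \<in> ?Q" "q' \<in> ?Q" "\<forall>w. h w = p' w + q' w * tc w i" by blast
  have x: "(\<lambda>w. xw w $ i) \<in> ?Q" by (rule polyfuns.coord) (simp add: part_coords_def)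
  have P: "(\<lambda>w. p w * p' w + (-1) * (q w * q' w)) \<in> ?Q"
    by (intro polyfuns.add[of "\<lambda>w. p w * p' w"] polyfuns.mult[of p] polyfuns.mult[of "\<lambda>_. -1"] polyfuns.mult[of q]
        polyfuns.const g(1,2) h(1,2))
  have Q: "(\<lambda>w. (p w * q' w + q w * p' w) + 2 * (xw w $ i * (q w * q' w))) \<in> ?Q"
    by (intro polyfuns.add[of "\<lambda>w. p w * q' w + q w * p' w"] polyfuns.add[of "\<lambda>w. p w * q' w"] polyfuns.mult[of p]
        polyfuns.mult[of "\<lambda>_. 2"] polyfuns.mult[of q] polyfuns.mult[of "\<lambda>w. xw w $ i"]
        polyfuns.const g(1,2) h(1,2) x)
  have t: "tc w i * tc w i = 2 * (xw w $ i * tc w i) - 1" for w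
    by (simp add: xw_def field_simps)
  have "g w * h w = (p w * p' w + (-1) * (q w * q' w)) + ((p w * q' w + q w * p' w) + 2 * (xw w $ i * (q w * q' w))) * tc w i" for w
  proof -
    have "g w * h w = p w * p' w + (p w * q' w + q w * p' w) * tc w i + q w * q' w * (tc w i * tc w i)"
      by (simp add: g(3) h(3) algebra_simps)
    then show ?thesis unfolding t by (simp add: algebra_simps)
  qed
  then show ?case by (intro bexI[OF _ P] bexI[OF _ Q]) simp
qed

lemma part_coords_flip:
  assumes "p \<in> polyfuns (part_coords J)" "i \<in> J"
  shows "p (fl {i} w) = p w"
  using assms(1)
proof induction
  case (coord p)
  then show ?case using assms(2) by (auto simp: part_coords_def xw_def tc_fl)
qed simp_all

text \<open>The norm of \<open>p + q w_i\<close> is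
  \<open>p ^ 2 + 2 x_i p q + q ^ 2\<close>.\<close>

lemma part_coords_norm:
  assumes "g \<in> polyfuns (part_coords J)"
  shows "(\<lambda>w. g w * g (fl {i} w)) \<in> polyfuns (part_coords (insert i J))"
proof -
  let ?Q = "polyfuns (part_coords (insert i J))"
  obtain p q where g: "p \<in> ?Q" "q \<in> ?Q" "\<forall>w. g w = p w + q w * tc w i"
    using part_coords_split[OF assms] by blast
  have x: "(\<lambda>w. xw w $ i) \<in> ?Q" by (rule polyfuns.coord) (simp add: part_coords_def)
  have "g w * g (fl {i} w) = (p w * p w + 2 * (xw w $ i * (p w * q w))) + q w * q w" for w
  proof -
    have "p (fl {i} w) = p w" "q (fl {i} w) = q w"
      by (rule part_coords_flip[OF g(1)], simp, rule part_coords_flip[OF g(2)], simp)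
    then show ?thesis by (simp add: g(3) xw_def tc_fl algebra_simps)
  qed
  moreover have "(\<lambda>w. (p w * p w + 2 * (xw w $ i * (p w * q w))) + q w * q w) \<in> ?Q"
    by (intro polyfuns.add[of "\<lambda>w. p w * p w + 2 * (xw w $ i * (p w * q w))"] polyfuns.add[of "\<lambda>w. p w * p w"]
        polyfuns.mult[of p] polyfuns.mult[of "\<lambda>_. 2"] polyfuns.mult[of q] polyfuns.mult[of "\<lambda>w. xw w $ i"]
        polyfuns.const g(1,2) x)
  ultimately show ?thesis by simp
qed

lemma part_coords_norm_all:
  assumes "g \<in> polyfuns (part_coords {})"
  shows "(\<lambda>w. \<Prod>S\<in>Pow K. g (fl S w)) \<in> polyfuns (part_coords K)"
  using finite[of K]
proof (induction K rule: finite_induct)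
  case empty
  show "(\<lambda>w. \<Prod>S\<in>Pow {}. g (fl S w)) \<in> polyfuns (part_coords {})" using assms by simp
next
  case (insert i K)
  have "(\<Prod>S\<in>Pow (insert i K). g (fl S w)) = (\<Prod>S\<in>Pow K. g (fl S w)) * (\<Prod>S\<in>Pow K. g (fl S (fl {i} w)))" for w
  proof -
    have inj: "inj_on (insert i) (Pow K)"
    proof (rule inj_onI)
      fix S T assume "S \<in> Pow K" "T \<in> Pow K" "insert i S = insert i T"
      moreover from this have "i \<notin> S" "i \<notin> T" using insert.hyps by auto
      ultimately show "S = T" by (simp add: insert_ident)
    qed
    have "(\<Prod>S\<in>Pow (insert i K). g (fl S w)) = (\<Prod>S\<in>Pow K. g (fl S w)) * (\<Prod>S\<in>insert i ` Pow K. g (fl S w))"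
      unfolding Pow_insert using insert.hyps by (intro prod.union_disjoint) auto
    also have "(\<Prod>S\<in>insert i ` Pow K. g (fl S w)) = (\<Prod>S\<in>Pow K. g (fl (insert i S) w))"
      by (simp only: prod.reindex[OF inj] comp_def)
    also have "\<dots> = (\<Prod>S\<in>Pow K. g (fl S (fl {i} w)))"
      using insert.hyps by (intro prod.cong refl arg_cong[of _ _ g] fl_insert) auto
    finally show ?thesis .
  qed
  then show "(\<lambda>w. \<Prod>S\<in>Pow (insert i K). g (fl S w)) \<in> polyfuns (part_coords (insert i K))"
    using part_coords_norm[OF insert.IH, of i] by simp
qed

lemma part_coords_UNIV:
  assumes "g \<in> polyfuns (part_coords UNIV)"
  shows "\<exists>P\<in>polyfuns vec_coords. \<forall>w. g w = P (xw w)"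
  using assms
proof induction
  case (coord g)
  then obtain j where "g = (\<lambda>w. xw w $ j)" by (auto simp: part_coords_def)
  then show ?case by (intro bexI[of _ "\<lambda>x. x $ j"] polyfuns.coord) (auto simp: vec_coords_def)
next
  case (const c)
  show ?case by (intro bexI[OF _ polyfuns.const[of c]]) simp
next
  case (add g h)
  then obtain P Q where "P \<in> polyfuns vec_coords" "\<forall>w. g w = P (xw w)" "Q \<in> polyfuns vec_coords" "\<forall>w. h w = Q (xw w)" by blast
  then show ?case by (intro bexI[of _ "\<lambda>x. P x + Q x"] polyfuns.add) auto
next
  case (mult g h)
  then obtain P Q where "P \<in> polyfuns vec_coords" "\<forall>w. g w = P (xw w)" "Q \<in> polyfuns vec_coords" "\<forall>w. h w = Q (xw w)" by blast
  then show ?case by (intro bexI[of _ "\<lambda>x. P x * Q x"] polyfuns.mult) auto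
qed

lemma polyfuns_prod:
  "(\<And>i. i \<in> K \<Longrightarrow> f i \<in> polyfuns X) \<Longrightarrow> (\<lambda>x. \<Prod>i\<in>K. f i x) \<in> polyfuns X"
proof (induction K rule: infinite_finite_induct)
  case (insert i K)
  then have "(\<lambda>x. f i x * (\<Prod>i\<in>K. f i x)) \<in> polyfuns X" by (intro polyfuns.mult[of "f i"]) auto
  then show "(\<lambda>x. \<Prod>i\<in>insert i K. f i x) \<in> polyfuns X" using insert.hyps by simp
qed (simp_all add: polyfuns.const)

lemma polyfuns_power: "f \<in> polyfuns X \<Longrightarrow> (\<lambda>x. f x ^ n) \<in> polyfuns X"
  using polyfuns_prod[of "{..<n}" "\<lambda>_. f" X] by simp

lemma ch_part_coords: "ch m \<in> polyfuns (part_coords {})"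
proof -
  have "(\<lambda>w. tc w j powi (m $ j)) \<in> polyfuns (part_coords {})" for j
  proof -
    have "(\<lambda>w. tc w j) \<in> polyfuns (part_coords {})" "(\<lambda>w. inverse (tc w j)) \<in> polyfuns (part_coords {})"
      by (auto intro!: polyfuns.coord simp: part_coords_def)
    from polyfuns_power[OF this(1)] polyfuns_power[OF this(2)] show ?thesis
      by (cases "m $ j \<ge> 0") (simp_all add: power_int_def)
  qed
  then show ?thesis unfolding ch_def[abs_def] by (intro polyfuns_prod)
qed

text \<open>
  The norm \<open>\<Prod>\<^sub>S g (fl S w)\<close> over all sign flips of a Laurent polynomial in \<open>w\<close> is a polynomial in
  \<open>xw w\<close>; it separates \<open>xw ` W\<close> from any point whose preimages can be separated from \<open>W\<close>.
\<close>

lemma separate_image: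
  assumes sep: "\<And>w. w \<notin> W \<Longrightarrow> \<exists>g\<in>polyfuns (part_coords {}). (\<forall>w'\<in>W. g w' = 0) \<and> g w \<noteq> 0"
    and x: "x \<notin> xw ` W"
  shows "\<exists>P\<in>polyfuns vec_coords. (\<forall>y\<in>xw ` W. P y = 0) \<and> P x \<noteq> 0"
proof -
  obtain w where w: "xw w = x" using xw_surj by blast
  \<comment> \<open>One function nonzero at finitely many given points: \<open>t * h\<close> is
    added with \<open>t\<close> outside a finite set of bad values.\<close>
  have "\<exists>g\<in>polyfuns (part_coords {}). (\<forall>w'\<in>W. g w' = 0) \<and> (\<forall>v\<in>Y. g v \<noteq> 0)"
    if "finite Y" "Y \<inter> W = {}" for Y
    using that
  proof (induction Y rule: finite_induct)
    case empty
    show ?case by (intro bexI[OF _ polyfuns.const[of 0]]) simp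
  next
    case (insert v Y)
    then obtain g where g: "g \<in> polyfuns (part_coords {})" "\<forall>w'\<in>W. g w' = 0" "\<forall>v\<in>Y. g v \<noteq> 0" by auto
    obtain h where h: "h \<in> polyfuns (part_coords {})" "\<forall>w'\<in>W. h w' = 0" "h v \<noteq> 0"
      using sep[of v] insert.prems by auto
    have "finite ((\<lambda>u. - g u / h u) ` insert v Y \<union> {0})" using insert.hyps by simp
    then obtain t where t: "t \<notin> (\<lambda>u. - g u / h u) ` insert v Y \<union> {0}"
      using ex_new_if_finite[OF infinite_UNIV_char_0[where 'a=complex]] by blast
    have "g u + t * h u \<noteq> 0" if u: "u \<in> insert v Y" for u
    proof
      assume eq: "g u + t * h u = 0"
      have "h u \<noteq> 0"
      proof
        assume "h u = 0"
        then have "g u = 0" "u \<noteq> v" using eq h(3) by auto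
        then show False using g(3) u by blast
      qed
      moreover have "t * h u = - g u" using eq by (simp only: eq_neg_iff_add_eq_0 add.commute)
      ultimately have "t = - g u / h u" by (rule iffD2[OF nonzero_eq_divide_eq])
      then show False using t u by blast
    qed
    then show ?case using g(2) h(2)
      by (intro bexI[OF _ polyfuns.add[OF g(1) polyfuns.mult[OF polyfuns.const[of t] h(1)]]]) simp
  qed
  note sepY = this
  have "xw (fl S w) = x" for S by (auto simp: w[symmetric] xw_def tc_fl vec_eq_iff)
  then have "fl S w \<notin> W" for S using x imageI[of "fl S w" W xw] by metis
  then have "range (\<lambda>S. fl S w) \<inter> W = {}" by blast
  from sepY[OF finite_imageI[OF finite] this]
  obtain g where g: "g \<in> polyfuns (part_coords {})" "\<forall>w'\<in>W. g w' = 0" "\<forall>v\<in>range (\<lambda>S. fl S w). g v \<noteq> 0"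
    by blast
  obtain P where P: "P \<in> polyfuns vec_coords" "\<forall>w. (\<Prod>S\<in>Pow UNIV. g (fl S w)) = P (xw w)"
    using part_coords_UNIV[OF part_coords_norm_all[OF g(1)]] by blast
  have "P (xw w') = 0" if "w' \<in> W" for w'
  proof -
    have "g (fl {} w') = 0" using g(2) that by simp
    then have "(\<Prod>S\<in>Pow UNIV. g (fl S w')) = 0" by (intro prod_zero bexI[of _ "{}"]) simp_all
    with P(2) show ?thesis by (simp only:)
  qed
  moreover have "P x \<noteq> 0"
    unfolding w[symmetric] P(2)[rule_format, symmetric] using g(3) by simp
  ultimately show ?thesis using P(1) by blast
qed

section \<open>Irreducibility and dimension\<close>

lemma irreducible_prime:
  assumes irr: "irreducible_variety V" and P: "P \<in> polyfuns vec_coords" and Q: "Q \<in> polyfuns vec_coords"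
    and PQ: "\<And>x. x \<in> V \<Longrightarrow> P x * Q x = 0"
  shows "(\<forall>x\<in>V. P x = 0) \<or> (\<forall>x\<in>V. Q x = 0)"
proof -
  obtain F where F: "F \<subseteq> polyfuns vec_coords" "V = {x. \<forall>f\<in>F. f x = 0}"
    using irr unfolding irreducible_variety_def affine_variety_def by blast
  have av: "affine_variety {x\<in>V. R x = 0}" if "R \<in> polyfuns vec_coords" for R
    unfolding affine_variety_def using F that by (intro exI[of _ "insert R F"]) auto
  have "V = {x\<in>V. P x = 0} \<union> {x\<in>V. Q x = 0}" using PQ by auto
  with av[OF P] av[OF Q] have "V = {x\<in>V. P x = 0} \<or> V = {x\<in>V. Q x = 0}"
    using irr unfolding irreducible_variety_def by blast
  then show ?thesis by blast
qed

text \<open>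
  The monomials \<open>\<Prod>i<k. f i ^ e\<^sub>i\<close> with exponents below \<open>B\<close>, enumerated by the number with digits
  \<open>e\<^sub>i\<close> in base \<open>B\<close>.
\<close>

fun digit_mon :: "(nat \<Rightarrow> 'a \<Rightarrow> complex) \<Rightarrow> nat \<Rightarrow> nat \<Rightarrow> nat \<Rightarrow> 'a \<Rightarrow> complex" where
  "digit_mon f B 0 n = (\<lambda>_. 1)"
| "digit_mon f B (Suc k) n = (\<lambda>x. f k x ^ (n div B ^ k) * digit_mon f B k (n mod B ^ k) x)"

lemma digit_mon_polyfuns: "(\<And>i. f i \<in> polyfuns X) \<Longrightarrow> digit_mon f B k n \<in> polyfuns X"
proof (induction k arbitrary: n)
  case 0
  show "digit_mon f B 0 n \<in> polyfuns X" unfolding digit_mon.simps by (rule polyfuns.const)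
next
  case (Suc k)
  show "digit_mon f B (Suc k) n \<in> polyfuns X" unfolding digit_mon.simps
    by (rule polyfuns.mult[OF polyfuns_power[OF Suc.prems] Suc.IH[OF Suc.prems]])
qed

text \<open>
  If \<open>f i\<close> vanishes on \<open>Z i\<close> but not on the irreducible \<open>Z (Suc i)\<close>, then \<open>f 0, \<dots>, f (k - 1)\<close> are
  algebraically independent on \<open>Z k\<close>: the lowest power of \<open>f (k - 1)\<close> in a relation can be cancelled,
  and restricting to \<open>Z (k - 1)\<close> leaves a relation among the others.
\<close>

lemma chain_independent:
  assumes irr: "\<And>i. i \<le> k \<Longrightarrow> irreducible_variety (Z i)"
    and mono: "\<And>i. i < k \<Longrightarrow> Z i \<subseteq> Z (Suc i)"
    and f: "\<And>i. f i \<in> polyfuns vec_coords"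
    and f0: "\<And>i x. i < k \<Longrightarrow> x \<in> Z i \<Longrightarrow> f i x = 0"
    and f1: "\<And>i. i < k \<Longrightarrow> \<exists>x\<in>Z (Suc i). f i x \<noteq> 0"
    and B: "0 < B"
    and rel: "\<And>x. x \<in> Z k \<Longrightarrow> (\<Sum>n<B ^ k. c n * digit_mon f B k n x) = 0"
    and n: "n < B ^ k"
  shows "c n = 0"
  using irr mono f0 f1 rel n
proof (induction k arbitrary: c n)
  case 0
  have "Z 0 \<noteq> {}" using "0.prems"(1)[of 0] by (simp add: irreducible_variety_def)
  then show ?case using "0.prems"(5,6) by auto
next
  case (Suc k)
  define g where "g j x = (\<Sum>n<B ^ k. c (n + j * B ^ k) * digit_mon f B k n x)" for j x
  have gp: "g j \<in> polyfuns vec_coords" for j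
    unfolding g_def[abs_def]
    by (intro polyfuns_sum polyfuns.mult[OF polyfuns.const] digit_mon_polyfuns f)
  have Bk: "0 < B ^ k" using B by simp
  have split: "(\<Sum>n<B ^ Suc k. c n * digit_mon f B (Suc k) n x) = (\<Sum>j<B. f k x ^ j * g j x)" for x
  proof -
    have "(\<Sum>n<B ^ Suc k. c n * digit_mon f B (Suc k) n x)
        = (\<Sum>j<B. \<Sum>n=j * B ^ k..<j * B ^ k + B ^ k. c n * digit_mon f B (Suc k) n x)"
      using sum.nat_group[of "\<lambda>n. c n * digit_mon f B (Suc k) n x" "B ^ k" B] by simp
    also have "\<dots> = (\<Sum>j<B. f k x ^ j * g j x)"
    proof (rule sum.cong[OF refl])
      fix j
      have "(\<Sum>n=j * B ^ k..<j * B ^ k + B ^ k. c n * digit_mon f B (Suc k) n x)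
          = (\<Sum>n<B ^ k. c (n + j * B ^ k) * digit_mon f B (Suc k) (n + j * B ^ k) x)"
        using sum.shift_bounds_nat_ivl[of "\<lambda>n. c n * digit_mon f B (Suc k) n x" 0 "j * B ^ k" "B ^ k"]
        by (simp add: add.commute lessThan_atLeast0)
      also have "\<dots> = f k x ^ j * g j x"
        unfolding g_def sum_distrib_left using Bk by (intro sum.cong refl) simp
      finally show "(\<Sum>n=j * B ^ k..<j * B ^ k + B ^ k. c n * digit_mon f B (Suc k) n x) = f k x ^ j * g j x" .
    qed
    finally show ?thesis .
  qed
  have IH: "c (n + j * B ^ k) = 0" if "\<And>x. x \<in> Z k \<Longrightarrow> g j x = 0" "n < B ^ k" for j n
    using Suc.prems(1,2,3,4) that by (intro Suc.IH[of "\<lambda>n. c (n + j * B ^ k)"]) (auto simp: g_def)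
  have all: "\<forall>n<B ^ k. c (n + j * B ^ k) = 0" if "j < B" for j
    using that
  proof (induction j rule: less_induct)
    case (less j)
    have g0: "g i x = 0" if "i < j" for i x
      using less.IH[of i] that less.prems by (simp add: g_def)
    define h where "h x = (\<Sum>i\<in>{Suc j..<B}. f k x ^ (i - Suc j) * g i x)" for x
    have R: "(\<lambda>x. g j x + f k x * h x) \<in> polyfuns vec_coords"
      unfolding h_def[abs_def]
      by (intro polyfuns.add[of "g j"] polyfuns.mult[of "f k"] polyfuns_sum polyfuns.mult[of "\<lambda>x. f k x ^ _"] polyfuns_power gp f)
    \<comment> \<open>Lower coefficients are 0 already, so \<open>f k ^ j\<close> factors out. As
      \<open>f k\<close> is not identically 0 on the irreducible \<open>Z (Suc k)\<close>, the
      cofactor vanishes there; on \<open>Z k\<close>, where \<open>f k\<close> is 0, only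
      \<open>g j\<close> remains of it.\<close>
    have "f k x ^ j * (g j x + f k x * h x) = 0" if x: "x \<in> Z (Suc k)" for x
    proof -
      have "(\<Sum>i<B. f k x ^ i * g i x) = (\<Sum>i\<in>{j..<B}. f k x ^ i * g i x)"
        using g0 by (intro sum.mono_neutral_right) auto
      also have "\<dots> = f k x ^ j * g j x + (\<Sum>i\<in>{Suc j..<B}. f k x ^ i * g i x)"
        using less.prems by (simp add: sum.atLeast_Suc_lessThan)
      also have "(\<Sum>i\<in>{Suc j..<B}. f k x ^ i * g i x) = f k x ^ j * (f k x * h x)"
        unfolding h_def sum_distrib_left
      proof (rule sum.cong[OF refl])
        fix i assume "i \<in> {Suc j..<B}"
        then have "i = j + Suc (i - Suc j)" by simp
        then have "f k x ^ i = f k x ^ j * (f k x * f k x ^ (i - Suc j))" by (metis power_Suc power_add)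
        then show "f k x ^ i * g i x = f k x ^ j * (f k x * (f k x ^ (i - Suc j) * g i x))" by simp
      qed
      finally have "f k x ^ j * (g j x + f k x * h x) = (\<Sum>i<B. f k x ^ i * g i x)" by (simp add: distrib_left)
      also have "\<dots> = 0" using Suc.prems(5)[OF x] split by simp
      finally show ?thesis .
    qed
    from irreducible_prime[OF Suc.prems(1)[OF le_refl] polyfuns_power[OF f] R this]
    have "\<forall>x\<in>Z (Suc k). g j x + f k x * h x = 0"
      using Suc.prems(4)[OF lessI] by auto
    then have "g j x = 0" if "x \<in> Z k" for x
      using Suc.prems(2)[OF lessI] Suc.prems(3)[OF lessI that] that by fastforce
    then show ?case using IH by blast
  qed
  have "n div B ^ k < B" using Suc.prems(6) Bk by (simp add: div_less_iff_less_mult mult.commute)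
  moreover have "n mod B ^ k < B ^ k" using Bk by simp
  ultimately have "c (n mod B ^ k + n div B ^ k * B ^ k) = 0" using all by blast
  then show ?case by (simp only: mod_div_mult_eq)
qed

lemma Laur_domain_prod:
  assumes "finite K" "\<And>i. i \<in> K \<Longrightarrow> f i \<in> Laur \<and> (\<exists>p\<in>subtorus I. f i p \<noteq> 0)"
  shows "\<exists>\<tau>\<in>subtorus I. (\<Prod>i\<in>K. f i) \<tau> \<noteq> 0"
  using assms
proof (induction K rule: finite_induct)
  case empty
  have "mkt (\<lambda>_. 1) \<in> subtorus I" by (simp add: subtorus_def tc_mkt)
  then show ?case by (intro bexI) simp_all
next
  case (insert i K)
  then obtain q where q: "q \<in> subtorus I" "(\<Prod>i\<in>K. f i) q \<noteq> 0" by blast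
  obtain p where p: "f i \<in> Laur" "p \<in> subtorus I" "f i p \<noteq> 0" using insert.prems by blast
  have "(\<Prod>i\<in>K. f i) \<in> Laur" using insert.prems by (intro Laur_prod) blast
  from Laur_domain[OF p(1) this p(2) q(1) p(3) q(2)] show ?case using insert.hyps by simp
qed

section \<open>Images of subtori under the cosine parametrization\<close>

context liss
begin

definition xv :: "'d torus \<Rightarrow> complex ^ 'n" where
  "xv \<tau> = (\<chi> j. xf j \<tau>)"

definition wt :: "'d torus \<Rightarrow> 'n torus" where
  "wt \<tau> = mkt (\<lambda>j. wc j \<tau>)"

lemma tc_wt: "tc (wt \<tau>) j = wc j \<tau>"
  unfolding wt_def by (rule tc_mkt) simp

lemma xv_wt: "xv \<tau> = xw (wt \<tau>)"
  by (simp add: xv_def xw_def xf_wc tc_wt)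

lemma ch_subtorus: "\<tau> \<in> subtorus I \<Longrightarrow> \<forall>k\<in>I. u $ k = 0 \<Longrightarrow> ch u \<tau> = 1"
  unfolding ch_def
proof (rule prod.neutral, rule ballI)
  fix k assume "\<tau> \<in> subtorus I" "\<forall>k\<in>I. u $ k = 0"
  then show "tc \<tau> k powi (u $ k) = 1" by (cases "k \<in> I") (auto simp: subtorus_def)
qed

lemma separate_wt:
  assumes "w \<notin> wt ` subtorus I"
  shows "\<exists>g\<in>polyfuns (part_coords {}). (\<forall>w'\<in>wt ` subtorus I. g w' = 0) \<and> g w \<noteq> 0"
proof -
  have "\<not> (\<exists>\<tau>\<in>subtorus I. \<forall>j. wc j \<tau> = tc w j)"
  proof
    assume "\<exists>\<tau>\<in>subtorus I. \<forall>j. wc j \<tau> = tc w j"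
    then obtain \<tau> where \<tau>: "\<tau> \<in> subtorus I" "\<forall>j. wc j \<tau> = tc w j" by blast
    have "w = wt \<tau>" by (rule torus_eqI) (simp add: tc_wt \<tau>(2))
    with \<tau>(1) assms show False by blast
  qed
  with wc_exists[of "tc w" I] obtain m where m: "\<forall>k\<in>I. (A *v m) $ k = 0"
    "(\<Prod>j\<in>UNIV. tc w j powi (m $ j)) * (\<Prod>j\<in>UNIV. \<beta> j powi (m $ j)) \<noteq> 1"
    using tc_nz by blast
  let ?b = "\<Prod>j\<in>UNIV. \<beta> j powi (m $ j)"
  define g where "g w = -1 + ?b * ch m w" for w :: "'n torus"
  have gp: "g \<in> polyfuns (part_coords {})" unfolding g_def[abs_def]
    by (intro polyfuns.add[of "\<lambda>_. -1"] polyfuns.mult[of "\<lambda>_. ?b"] polyfuns.const ch_part_coords)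
  have "g (wt \<tau>) = 0" if "\<tau> \<in> subtorus I" for \<tau>
  proof -
    have "ch m (wt \<tau>) = ch (A *v m) \<tau> / ?b" unfolding ch_def[of m] tc_wt wc_prod ..
    then show ?thesis using ch_subtorus[OF that m(1)] beta_nz by (simp add: g_def)
  qed
  moreover have "g w \<noteq> 0" using m(2) by (simp add: g_def ch_def mult.commute)
  ultimately show ?thesis using gp by blast
qed

lemma image_separate:
  assumes "x \<notin> xv ` subtorus I"
  shows "\<exists>P\<in>polyfuns vec_coords. (\<forall>y\<in>xv ` subtorus I. P y = 0) \<and> P x \<noteq> 0"
proof -
  have "xv ` subtorus I = xw ` wt ` subtorus I" by (simp add: image_image xv_wt)
  then show ?thesis using separate_image[OF separate_wt, of I x] assms by simp
qed

lemma affine_image: "affine_variety (xv ` subtorus I)"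
  unfolding affine_variety_def using image_separate[of _ I]
  by (intro exI[of _ "{P\<in>polyfuns vec_coords. \<forall>y\<in>xv ` subtorus I. P y = 0}"]) blast

lemma polyfuns_xv_Laur: "P \<in> polyfuns vec_coords \<Longrightarrow> (\<lambda>\<tau>. P (xv \<tau>)) \<in> Laur"
proof (induction rule: polyfuns.induct)
  case (coord P)
  then obtain j where "P = (\<lambda>x. x $ j)" by (auto simp: vec_coords_def)
  then show ?case using Bf_Laur[OF xf_Bf] by (simp add: xv_def)
next
  case (const c)
  show ?case by (rule Laur_cst)
next
  case (add P Q)
  from Laur_add[OF add.IH] show ?case by (simp add: plus_fun_def)
next
  case (mult P Q)
  from Laur_mult[OF mult.IH] show ?case by (simp add: times_fun_def)
qed

text \<open>Functions vanishing on two proper closed parts that cover the image would have a product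
  vanishing on the whole subtorus, against \<open>Laur_domain\<close>.\<close>

lemma irreducible_image: "irreducible_variety (xv ` subtorus I)"
  unfolding irreducible_variety_def
proof (intro conjI allI impI affine_image)
  have "mkt (\<lambda>_. 1) \<in> subtorus I" by (simp add: subtorus_def tc_mkt)
  then show "xv ` subtorus I \<noteq> {}" by blast
next
  fix Y Z assume av: "affine_variety Y" "affine_variety Z" and eq: "xv ` subtorus I = Y \<union> Z"
  have wit: "\<exists>P\<in>polyfuns vec_coords. (\<forall>y\<in>X. P y = 0) \<and> (\<exists>p\<in>subtorus I. P (xv p) \<noteq> 0)"
    if X: "affine_variety X" "X \<subseteq> xv ` subtorus I" "xv ` subtorus I \<noteq> X" for X
  proof -
    obtain F where F: "F \<subseteq> polyfuns vec_coords" "X = {x. \<forall>f\<in>F. f x = 0}"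
      using X(1) unfolding affine_variety_def by blast
    obtain p where "p \<in> subtorus I" "xv p \<notin> X" using X(2,3) by blast
    then obtain f where "f \<in> F" "f (xv p) \<noteq> 0" using F(2) by blast
    with F \<open>p \<in> subtorus I\<close> show ?thesis by blast
  qed
  show "xv ` subtorus I = Y \<or> xv ` subtorus I = Z"
  proof (rule ccontr)
    assume neq: "\<not> ?thesis"
    obtain P p where P: "P \<in> polyfuns vec_coords" "\<forall>y\<in>Y. P y = 0" "p \<in> subtorus I" "P (xv p) \<noteq> 0"
      using wit[OF av(1)] eq neq by blast
    obtain Q q where Q: "Q \<in> polyfuns vec_coords" "\<forall>y\<in>Z. Q y = 0" "q \<in> subtorus I" "Q (xv q) \<noteq> 0"
      using wit[OF av(2)] eq neq by blast
    from Laur_domain[OF polyfuns_xv_Laur[OF P(1)] polyfuns_xv_Laur[OF Q(1)] P(3) Q(3) P(4) Q(4)]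
    obtain \<tau> where \<tau>: "\<tau> \<in> subtorus I" "P (xv \<tau>) * Q (xv \<tau>) \<noteq> 0" by blast
    have "xv \<tau> \<in> Y \<union> Z" using \<tau>(1) eq by blast
    then show False using P(2) Q(2) \<tau>(2) by auto
  qed
qed

text \<open>
  With \<open>A *v B\<close> the \<open>k\<close>-th unit vector, \<open>\<Prod>\<^sub>j a\<^sub>j\<^bsup>B\<^sub>j\<^esup>\<close> is the \<open>k\<close>-th coordinate. Flipping signs of \<open>B\<close>
  changes the \<open>k\<close>-th entry of \<open>A *v B\<close> by an even number, so it stays odd, in particular nonzero.
\<close>

lemma image_strict:
  assumes k: "k \<notin> I"
  shows "xv ` subtorus I \<subset> xv ` subtorus (insert k I)"
proof -
  define B where "B = sec (axis k 1)"
  let ?\<kappa> = "1 / (\<Prod>j\<in>UNIV. \<beta> j powi (B $ j))"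
  define h where "h S = rel_fun (flip S B) - cst ?\<kappa>" for S
  have hL: "h S \<in> Laur" for S unfolding h_def by (intro Laur_diff rel_fun_Laur Laur_cst)
  have hnz: "\<exists>p\<in>subtorus (insert k I). h S p \<noteq> 0" for S
  proof (rule ccontr)
    assume "\<not> ?thesis"
    then have z: "h S p = 0" if "p \<in> subtorus (insert k I)" for p using that by blast
    \<comment> \<open>A one-parameter subgroup in direction \<open>k\<close>. Along it the flipped
      monomial is a constant times \<open>z powi ?e\<close>, so equal values at 1 and 2 force the
      exponent to be 0.\<close>
    define pt where "pt z = mkt (\<lambda>i. if i = k then z else 1)" for z :: complex
    have pt: "tc (pt z) i = (if i = k then z else 1)" if "z \<noteq> 0" for z i
      unfolding pt_def using that by (intro tc_mkt) simp
    have chpt: "ch u (pt z) = z powi (u $ k)" if "z \<noteq> 0" for u z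
    proof -
      have "ch u (pt z) = (\<Prod>i\<in>UNIV. if i = k then z powi (u $ k) else 1)"
        unfolding ch_def by (intro prod.cong) (auto simp: pt[OF that])
      then show ?thesis by simp
    qed
    let ?e = "(A *v flip S B) $ k"
    have rf: "rel_fun (flip S B) \<tau> = ch (A *v flip S B) \<tau> / (\<Prod>j\<in>UNIV. \<beta> j powi (flip S B $ j))" for \<tau>
      by (simp add: rel_fun_def wc_prod)
    have "rel_fun (flip S B) (pt z) = ?\<kappa>" if "z \<noteq> 0" for z
    proof -
      have "pt z \<in> subtorus (insert k I)" using pt[OF that] by (simp add: subtorus_def)
      then show ?thesis using z[of "pt z"] by (simp add: h_def)
    qed
    from this[of 1] this[of 2] have "(2::complex) powi ?e = 1 powi ?e"
      by (simp add: rf chpt beta_nz divide_cancel_right)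
    then have "(2::real) powi ?e = 1" by (metis norm_numeral norm_one norm_power_int power_int_1_left)
    then have e0: "?e = 0"
      using power_int_strict_increasing[of 0 ?e "2::real"] power_int_strict_increasing[of ?e 0 "2::real"]
      by (cases ?e "0 :: int" rule: linorder_cases) simp_all
    have "?e - (A *v B) $ k = (\<Sum>j\<in>UNIV. A $ k $ j * (flip S B $ j - B $ j))"
      by (simp add: matrix_vector_mult_def sum_subtractf right_diff_distrib)
    moreover have "2 dvd (\<Sum>j\<in>UNIV. A $ k $ j * (flip S B $ j - B $ j))"
      by (intro dvd_sum dvd_mult) (simp add: flip_def)
    ultimately have "2 dvd ?e - (A *v B) $ k" by simp
    then show False using e0 by (simp add: B_def)
  qed
  \<comment> \<open>A point of the larger subtorus where every flip of the monomial differs from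
    \<open>?\<kappa>\<close>. It cannot have the same cosines as a point of the smaller one, where
    the monomial of \<open>B\<close> equals \<open>?\<kappa>\<close>.\<close>
  have "\<exists>\<tau>\<in>subtorus (insert k I). (\<Prod>S\<in>UNIV. h S) \<tau> \<noteq> 0"
    using hL hnz by (intro Laur_domain_prod) auto
  then obtain \<tau> where \<tau>: "\<tau> \<in> subtorus (insert k I)" "\<And>S. h S \<tau> \<noteq> 0"
    by (auto simp: prod_fun_apply)
  have "xv \<tau> \<noteq> xv \<sigma>" if \<sigma>: "\<sigma> \<in> subtorus I" for \<sigma>
  proof
    assume "xv \<tau> = xv \<sigma>"
    then have "xf j \<sigma> = xf j \<tau>" for j by (simp add: xv_def vec_eq_iff)
    from flip_values[OF this, of B] have "h {j. wc j \<sigma> \<noteq> wc j \<tau>} \<tau> = rel_fun B \<sigma> - ?\<kappa>" by (simp add: h_def)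
    also have "\<dots> = 0"
      using \<sigma> k unfolding rel_fun_def wc_prod by (simp add: B_def subtorus_def)
    finally show False using \<tau>(2) by blast
  qed
  then have "xv \<tau> \<notin> xv ` subtorus I" by blast
  moreover have "subtorus I \<subseteq> subtorus (insert k I)" by (auto simp: subtorus_def)
  ultimately show ?thesis using \<tau>(1) by blast
qed

lemma dim_lower: "\<exists>Z. (\<forall>i\<le>CARD('d). irreducible_variety (Z i) \<and> Z i \<subseteq> range xv) \<and> (\<forall>i<CARD('d). Z i \<subset> Z (Suc i))"
proof -
  define I where "I i = {k. idx k < i}" for i
  have "xv ` subtorus (I i) \<subset> xv ` subtorus (I (Suc i))" if i: "i < CARD('d)" for i
  proof -
    obtain k where k: "idx k = i" using idx_bij i unfolding bij_betw_def by (metis imageE lessThan_iff)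
    have "idx l = i \<longleftrightarrow> l = k" for l
      using idx_bij k by (auto simp: bij_betw_def inj_on_def)
    then have "I (Suc i) = insert k (I i)" unfolding I_def less_Suc_eq by blast
    moreover have "k \<notin> I i" using k by (simp add: I_def)
    ultimately show ?thesis using image_strict by simp
  qed
  then show ?thesis using irreducible_image by (intro exI[of _ "\<lambda>i. xv ` subtorus (I i)"]) blast
qed

text \<open>A chain of length \<open>k\<close> gives \<open>k\<close> functions whose
  \<open>B ^ k\<close> monomials are independent by \<open>chain_independent\<close> and lie in
  level \<open>E * B\<close>. That level has at most a constant times \<open>B ^ d\<close> lattice
  points, so \<open>k\<close> cannot exceed \<open>d\<close>.\<close>

lemma dim_upper:
  assumes irr: "\<forall>i\<le>k. irreducible_variety (Z i) \<and> Z i \<subseteq> range xv" and strict: "\<forall>i<k. Z i \<subset> Z (Suc i)"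
  shows "k \<le> CARD('d)"
proof (rule ccontr)
  assume "\<not> ?thesis"
  then have kd: "Suc CARD('d) \<le> k" by simp
  have "\<forall>i. \<exists>P. P \<in> polyfuns vec_coords \<and> (i < k \<longrightarrow> (\<forall>x\<in>Z i. P x = 0) \<and> (\<exists>x\<in>Z (Suc i). P x \<noteq> 0))"
  proof
    fix i
    show "\<exists>P. P \<in> polyfuns vec_coords \<and> (i < k \<longrightarrow> (\<forall>x\<in>Z i. P x = 0) \<and> (\<exists>x\<in>Z (Suc i). P x \<noteq> 0))"
  proof (cases "i < k")
    case True
    with strict have "Z i \<subset> Z (Suc i)" by simp
    then obtain x where x: "x \<in> Z (Suc i)" "x \<notin> Z i" by blast
    from True have "i \<le> k" by (rule less_imp_le)
    with irr have "affine_variety (Z i)" by (simp add: irreducible_variety_def)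
    then obtain F where F: "F \<subseteq> polyfuns vec_coords" "Z i = {x. \<forall>f\<in>F. f x = 0}"
      unfolding affine_variety_def by (elim exE conjE)
    from x(2) obtain f where f: "f \<in> F" "f x \<noteq> 0" unfolding F(2) by blast
    have "\<forall>y\<in>Z i. f y = 0" unfolding F(2) using f(1) by blast
    moreover have "\<exists>y\<in>Z (Suc i). f y \<noteq> 0" using x(1) f(2) by (rule bexI[rotated])
    ultimately show ?thesis using f(1) F(1) by (intro exI[of _ f] conjI impI) (rule subsetD)
  next
    case False
    then show ?thesis by (intro exI[of _ "\<lambda>_. 0"]) (simp add: polyfuns.const)
  qed
  qed
  from choice[OF this] obtain f where f: "\<And>i. f i \<in> polyfuns vec_coords" "\<And>i x. i < k \<Longrightarrow> x \<in> Z i \<Longrightarrow> f i x = 0"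
    "\<And>i. i < k \<Longrightarrow> \<exists>x\<in>Z (Suc i). f i x \<noteq> 0" by blast
  have "\<forall>i. \<exists>D::nat. (\<lambda>\<tau>. f i (xv \<tau>)) \<in> Bf (real D)"
    by (intro allI Laur_Bf polyfuns_xv_Laur f(1))
  from choice[OF this] obtain D :: "nat \<Rightarrow> nat" where D: "\<And>i. (\<lambda>\<tau>. f i (xv \<tau>)) \<in> Bf (real (D i))" by blast
  define E where "E = Suc (\<Sum>i<k. D i)"
  have mono: "(\<lambda>\<tau>. digit_mon f B l n (xv \<tau>)) \<in> Bf (real ((\<Sum>i<l. D i) * B))" if "n < B ^ l" for B l n
    using that
  proof (induction l arbitrary: n)
    case 0
    show ?case using Bf_cst[of 0 1] by simp
  next
    case (Suc l)
    have Bl: "0 < B ^ l" using Suc.prems by (cases "B = 0") auto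
    have pw: "(\<lambda>\<tau>. f l (xv \<tau>) ^ e) \<in> Bf (real (D l * e))" for e
    proof (induction e)
      case 0
      show ?case using Bf_cst[of 0 1] by simp
    next
      case (Suc e)
      from Bf_mult[OF D[of l] Suc.IH] show ?case by (simp add: times_fun_def)
    qed
    have "n div B ^ l \<le> B" using Suc.prems Bl by (simp add: div_less_iff_less_mult mult.commute less_imp_le)
    then have "(\<lambda>\<tau>. f l (xv \<tau>) ^ (n div B ^ l)) \<in> Bf (real (D l * B))"
      by (intro Bf_mono[OF _ pw]) (simp del: of_nat_mult)
    moreover have "(\<lambda>\<tau>. digit_mon f B l (n mod B ^ l) (xv \<tau>)) \<in> Bf (real ((\<Sum>i<l. D i) * B))"
      using Bl by (intro Suc.IH) simp
    ultimately have "(\<lambda>\<tau>. f l (xv \<tau>) ^ (n div B ^ l)) * (\<lambda>\<tau>. digit_mon f B l (n mod B ^ l) (xv \<tau>))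
        \<in> Bf (real (D l * B) + real ((\<Sum>i<l. D i) * B))" by (rule Bf_mult)
    then show ?case by (simp add: times_fun_def algebra_simps)
  qed
  have bound: "B ^ k \<le> card (lat A (real (E * B)))" if B: "0 < B" for B
  proof (rule ccontr)
    assume lt: "\<not> ?thesis"
    have "\<exists>q. (\<exists>n\<in>{..<B ^ k}. q n \<noteq> 0) \<and> (\<forall>\<tau>. (\<Sum>n\<in>{..<B ^ k}. q n * digit_mon f B k n (xv \<tau>)) = 0)"
    proof (rule linear_relation_exists[where h = ch and S = "lat A (real (E * B))"])
      fix n assume "n \<in> {..<B ^ k}"
      then have "(\<lambda>\<tau>. digit_mon f B k n (xv \<tau>)) \<in> Bf (real (E * B))" by (intro Bf_mono[OF _ mono]) (simp_all add: E_def)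
      then obtain a where "(\<lambda>\<tau>. digit_mon f B k n (xv \<tau>)) = (\<lambda>\<tau>. \<Sum>u\<in>lat A (real (E * B)). a u * ch u \<tau>)"
        by (rule LP_E)
      then show "\<exists>a. \<forall>\<tau>. digit_mon f B k n (xv \<tau>) = (\<Sum>s\<in>lat A (real (E * B)). a s * ch s \<tau>)"
        by (intro exI[of _ a] allI) (rule fun_cong)
    qed (use lt in auto)
    then obtain q n where q: "n < B ^ k" "q n \<noteq> 0" "\<And>\<tau>. (\<Sum>n<B ^ k. q n * digit_mon f B k n (xv \<tau>)) = 0"
      by auto
    have "q n = 0"
    proof (rule chain_independent[where Z = Z and f = f and k = k and B = B and c = q])
      fix x assume "x \<in> Z k"
      then obtain \<tau> where "x = xv \<tau>" using irr by blast
      then show "(\<Sum>n<B ^ k. q n * digit_mon f B k n x) = 0" using q(3) by simp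
    next
      show "irreducible_variety (Z i)" if "i \<le> k" for i using irr that by blast
      show "Z i \<subseteq> Z (Suc i)" if "i < k" for i using strict that by blast
    qed (fact f B q(1))+
    with q(2) show False by simp
  qed
  define K where "K = vol * (real E + kap) ^ CARD('d)"
  have "real B \<le> K" if B: "0 < B" for B
  proof -
    have "real (B ^ Suc CARD('d)) \<le> real (B ^ k)"
      using kd B by (simp only: of_nat_le_iff power_increasing)
    also have "\<dots> \<le> real (card (lat A (real (E * B))))" using bound[OF B] by simp
    also have "\<dots> \<le> vol * (real (E * B) + kap) ^ CARD('d)" using B by (intro lat_card_upper) (simp add: E_def add_pos_nonneg sum_nonneg)
    also have "\<dots> \<le> vol * ((real E + kap) * real B) ^ CARD('d)"
    proof -
      have "kap * 1 \<le> kap * real B" using B kap(1) by (intro mult_left_mono) auto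
      then show ?thesis using kap(1) by (intro mult_left_mono power_mono) (auto simp: algebra_simps)
    qed
    also have "\<dots> = K * real B ^ CARD('d)" by (simp add: K_def power_mult_distrib)
    finally have "real B * real B ^ CARD('d) \<le> K * real B ^ CARD('d)" by simp
    then show ?thesis using B by (simp add: mult_le_cancel_right)
  qed
  note le = this
  obtain B :: nat where "K < real B" using reals_Archimedean2 by blast
  with le[of "Suc B"] show False by simp
qed

lemma variety_dim_range: "variety_dim (range xv) = enat CARD('d)"
  unfolding variety_dim_def
proof (intro antisym SUP_least SUP_upper)
  fix k assume "k \<in> {k. \<exists>Z. (\<forall>i\<le>k. irreducible_variety (Z i) \<and> Z i \<subseteq> range xv) \<and> (\<forall>i<k. Z i \<subset> Z (Suc i))}"
  then show "enat k \<le> enat CARD('d)" using dim_upper by auto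
qed (use dim_lower in blast)

end

section \<open>The degree\<close>

context liss
begin

text \<open>The Jacobian is the matrix of the forms times another matrix, so a linear relation
  between the forms would be a left kernel vector of it.\<close>

lemma Mx_independent:
  assumes "det (Jac (Mx e) \<tau>) \<noteq> 0"
  shows "eqn_independent CARD('d) e"
proof -
  have zero: "a = 0" if a: "(\<Sum>i\<in>UNIV. a $ i *s Mx e i) = 0" for a :: "complex ^ 'd"
  proof -
    have "(a v* Jac (Mx e) \<tau>) $ k = (\<Sum>j\<in>UNIV. (\<Sum>i\<in>UNIV. a $ i *s Mx e i) $ j * (of_int (A $ k $ j) * yf j \<tau>))" for k
    proof -
      have "(a v* Jac (Mx e) \<tau>) $ k = (\<Sum>i\<in>UNIV. \<Sum>j\<in>UNIV. a $ i * Mx e i $ j * (of_int (A $ k $ j) * yf j \<tau>))"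
        by (simp add: vector_matrix_mult_def Jac_def sum_distrib_left sum_distrib_right mult.commute mult.left_commute)
      also have "\<dots> = (\<Sum>j\<in>UNIV. (\<Sum>i\<in>UNIV. a $ i * Mx e i $ j) * (of_int (A $ k $ j) * yf j \<tau>))"
        by (subst sum.swap) (simp add: sum_distrib_right)
      finally show ?thesis by simp
    qed
    then have "transpose (Jac (Mx e) \<tau>) *v a = 0" using a by (simp add: vec_eq_iff)
    moreover have "invertible (transpose (Jac (Mx e) \<tau>))" using assms by (simp add: invertible_det_nz det_transpose)
    ultimately show ?thesis using matrix_left_invertible_ker[of "transpose (Jac (Mx e) \<tau>)"]
      by (auto simp: invertible_def)
  qed
  have inj: "inj (Mx e)"
  proof (rule injI, rule ccontr)
    fix i i' assume eq: "Mx e i = Mx e i'" and ne: "i \<noteq> i'"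
    define a :: "complex ^ 'd" where "a = axis i 1 - axis i' 1"
    have "(\<Sum>l\<in>UNIV. a $ l *s Mx e l) = (\<Sum>l\<in>UNIV. (if l = i then Mx e i else 0) - (if l = i' then Mx e i' else 0))"
      by (intro sum.cong refl) (auto simp: a_def axis_def ne)
    also have "\<dots> = 0" using eq by (simp add: sum_subtractf)
    finally have "a $ i = 0" using zero[of a] by simp
    then show False using ne by (simp add: a_def axis_def)
  qed
  have idx_image: "{..<CARD('d)} = range idx" using idx_bij by (simp add: bij_betw_def)
  have M: "fst e ` {..<CARD('d)} = range (Mx e)" unfolding idx_image by (simp add: image_image Mx_def)
  have "inj_on (fst e) {..<CARD('d)}"
    unfolding idx_image
  proof (rule inj_onI)
    fix x y assume "x \<in> range idx" "y \<in> range idx" "fst e x = fst e y"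
    then obtain i i' where "x = idx i" "y = idx i'" "Mx e i = Mx e i'" by (auto simp: Mx_def)
    then show "x = y" using injD[OF inj] by metis
  qed
  moreover have "vec.independent (range (Mx e))"
  proof (rule vec.independent_if_scalars_zero)
    fix f x assume f: "(\<Sum>x\<in>range (Mx e). f x *s x) = 0" and x: "x \<in> range (Mx e)"
    have "(\<Sum>i\<in>UNIV. f (Mx e i) *s Mx e i) = 0" using f by (simp add: sum.reindex[OF inj] comp_def)
    then have "(\<chi> i. f (Mx e i)) = (0 :: complex ^ 'd)" by (intro zero) simp
    then have "f (Mx e i) = 0" for i by (simp add: vec_eq_iff)
    then show "f x = 0" using x by blast
  qed simp
  ultimately show ?thesis by (simp add: eqn_independent_def M split: prod.split) (metis M fst_conv)
qed

lemma eqn_space_image: "range xv \<inter> eqn_space CARD('d) e = xv ` {\<tau>. Fm (Mx e) \<tau> = cx e}"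
proof -
  have "xv \<tau> \<in> eqn_space CARD('d) e \<longleftrightarrow> Fm (Mx e) \<tau> = cx e" for \<tau>
  proof -
    have "xv \<tau> \<in> eqn_space CARD('d) e \<longleftrightarrow> (\<forall>i\<in>{..<CARD('d)}. (\<Sum>j\<in>UNIV. fst e i $ j * xv \<tau> $ j) = snd e i)"
      by (cases e) (auto simp: eqn_space_def)
    also have "{..<CARD('d)} = range idx" using idx_bij by (simp add: bij_betw_def)
    finally show ?thesis by (simp add: Fm_def cx_def Mx_def lf_def xv_def vec_eq_iff)
  qed
  then show ?thesis by blast
qed

text \<open>A fibre of the projection in the torus is a union of fibres of the cosine
  parametrization. Each of these has \<open>2 ^ CL A\<close> points as \<open>G\<close> is nonzero
  there, so the section of the variety has the number of fibre points divided by that power.\<close>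

lemma degree_range:
  assumes gen: "\<And>C m. is_circuit A C \<Longrightarrow> circuit_vector A C m \<Longrightarrow> (\<Prod>j\<in>UNIV. \<beta> j powi (2 * m $ j)) \<noteq> 1"
  shows "\<exists>k. has_degree (range xv) k \<and> 2 ^ CL A * real k = fact CARD('d) * vol"
proof -
  have "\<exists>G\<in>Laur. G \<noteq> 0 \<and> (\<forall>\<tau>. G \<tau> \<noteq> 0 \<longrightarrow> card {\<sigma>. \<forall>j. xf j \<sigma> = xf j \<tau>} = 2 ^ CL A)"
    unfolding CL_eq by (rule fibres_of_xf) (rule gen)
  then obtain G where G: "G \<in> Laur" "G \<noteq> 0"
    "\<And>\<tau>. G \<tau> \<noteq> 0 \<Longrightarrow> card {\<sigma>. \<forall>j. xf j \<sigma> = xf j \<tau>} = 2 ^ CL A"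
    by blast
  obtain \<phi> e0 where \<phi>: "\<phi> \<in> polyfuns (eqn_coords CARD('d))" "\<phi> e0 \<noteq> 0"
    "\<And>e. \<phi> e \<noteq> 0 \<Longrightarrow> \<exists>\<nu>. good (range (Mx e)) \<nu> \<and> 0 < \<nu>"
    "\<And>e. \<phi> e \<noteq> 0 \<Longrightarrow> \<exists>\<tau>. det (Jac (Mx e) \<tau>) \<noteq> 0"
    "\<And>e \<tau>. \<phi> e \<noteq> 0 \<Longrightarrow> Fm (Mx e) \<tau> = cx e \<Longrightarrow> det (Jac (Mx e) \<tau>) \<noteq> 0 \<and> G \<tau> \<noteq> 0"
    using generic_fibre[OF G(1,2)] by blast
  let ?V = "\<lambda>e. range xv \<inter> eqn_space CARD('d) e"
  have V: "finite (?V e) \<and> 2 ^ CL A * real (card (?V e)) = fact CARD('d) * vol" if e: "\<phi> e \<noteq> 0" for e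
  proof -
    obtain \<nu> where \<nu>: "good (range (Mx e)) \<nu>" "0 < \<nu>" using \<phi>(3)[OF e] by blast
    interpret F: fibre A \<beta> "Mx e" "cx e" \<nu>
      using \<nu> \<phi>(4)[OF e] \<phi>(5)[OF e] by unfold_locales auto
    have sat: "{\<tau>\<in>F.\<Phi>. xv \<tau> = xv \<rho>} = {\<sigma>. \<forall>j. xf j \<sigma> = xf j \<rho>}" if "\<rho> \<in> F.\<Phi>" for \<rho>
      using that by (auto simp: F.\<Phi>_def xv_def vec_eq_iff Fm_def lf_def)
    have "card F.\<Phi> = (\<Sum>y\<in>xv ` F.\<Phi>. card {\<tau>\<in>F.\<Phi>. xv \<tau> = y})"
      using sum.image_gen[OF F.finite_fibre, of "\<lambda>_. 1 :: nat" xv] by simp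
    also have "\<dots> = (\<Sum>y\<in>xv ` F.\<Phi>. 2 ^ CL A)"
    proof (rule sum.cong[OF refl])
      fix y assume "y \<in> xv ` F.\<Phi>"
      then obtain \<rho> where \<rho>: "\<rho> \<in> F.\<Phi>" "y = xv \<rho>" by blast
      then have "G \<rho> \<noteq> 0" using \<phi>(5)[OF e] by (simp add: F.\<Phi>_def)
      then show "card {\<tau>\<in>F.\<Phi>. xv \<tau> = y} = 2 ^ CL A" unfolding \<rho>(2) sat[OF \<rho>(1)] by (rule G(3))
    qed
    finally have "card F.\<Phi> = card (?V e) * 2 ^ CL A" by (simp add: eqn_space_image F.\<Phi>_def)
    then have "real (card F.\<Phi>) = real (card (?V e) * 2 ^ CL A)" by simp
    then have "2 ^ CL A * real (card (?V e)) = fact CARD('d) * vol" unfolding F.fibre_card by (simp add: mult.commute)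
    moreover have "finite (?V e)" using F.finite_fibre by (simp add: eqn_space_image F.\<Phi>_def)
    ultimately show ?thesis by blast
  qed
  define k where "k = card (?V e0)"
  have "card (?V e) = k" if "\<phi> e \<noteq> 0" for e
  proof -
    have "2 ^ CL A * real (card (?V e)) = 2 ^ CL A * real k" using V[OF that] V[OF \<phi>(2)] by (simp add: k_def)
    then show ?thesis by simp
  qed
  moreover have "eqn_independent CARD('d) e" if "\<phi> e \<noteq> 0" for e using \<phi>(4)[OF that] Mx_independent by blast
  ultimately have "generically (eqn_coords CARD('d)) UNIV (\<lambda>e. eqn_independent CARD('d) e \<and> finite (?V e) \<and> card (?V e) = k)"
    unfolding generically_def using V \<phi>(1,2) by (intro bexI[OF _ \<phi>(1)] conjI ballI impI bexI[of _ e0]) auto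
  then have "has_degree (range xv) k" unfolding has_degree_def using variety_dim_range by blast
  moreover have "2 ^ CL A * real k = fact CARD('d) * vol" using V[OF \<phi>(2)] by (simp add: k_def)
  ultimately show ?thesis by blast
qed

end

section \<open>Lissajous varieties as images of the torus\<close>

lemma Row_eq: "Row (map_matrix rat_of_int A) = range (\<lambda>\<theta>. \<theta> v* map_matrix complex_of_int A)"
proof -
  let ?M = "map_matrix complex_of_int A"
  have M: "map_matrix of_rat (map_matrix rat_of_int A) = ?M" by (simp add: map_matrix_def vec_eq_iff)
  show ?thesis unfolding Row_def M
  proof (intro equalityI subsetI)
    fix x assume "x \<in> vec.span (rows ?M)"
    then show "x \<in> range (\<lambda>\<theta>. \<theta> v* ?M)"
    proof (induction rule: vec.span_induct_alt)
      case base
      show ?case by (rule range_eqI[of _ _ 0]) (simp add: vector_matrix_mult_def vec_eq_iff)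
    next
      case (step c x y)
      then obtain \<theta> where \<theta>: "y = \<theta> v* ?M" by blast
      obtain i where i: "x = row i ?M" using step by (auto simp: rows_def)
      have "c *s x + y = (axis i c + \<theta>) v* ?M"
        by (simp add: \<theta> i vector_matrix_mult_def vec_eq_iff row_def axis_def distrib_left distrib_right sum.distrib
            mult_delta_left mult_delta_right mult.commute)
      then show ?case by blast
    qed
  next
    fix x assume "x \<in> range (\<lambda>\<theta>. \<theta> v* ?M)"
    then obtain \<theta> where "x = \<theta> v* ?M" by blast
    then have "x = (\<Sum>i\<in>UNIV. \<theta> $ i *s row i ?M)"
      by (simp add: vec_eq_iff vector_matrix_mult_def row_def mult.commute)
    moreover have "row i ?M \<in> rows ?M" for i by (auto simp: rows_def)
    ultimately show "x \<in> vec.span (rows ?M)"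
      by (auto intro!: vec.span_sum vec.span_scale intro: vec.span_base)
  qed
qed

definition shift_factor :: "complex ^ 'n \<Rightarrow> 'n \<Rightarrow> complex" where
  "shift_factor b j = exp (\<i> * (pi / 2 * b $ j))"

text \<open>Euler's formula turns the cosine of a linear form in \<open>\<theta>\<close> into
  \<open>xf\<close>, the translation by \<open>b\<close> becoming the factor
  \<open>shift_factor b\<close>. The whole torus is reached because every nonzero complex number is
  an exponential.\<close>

lemma lissajous_eq:
  fixes A :: "int ^ 'n ^ 'd"
  assumes "group_closure (columns A) = UNIV"
  shows "lissajous (map_matrix rat_of_int A) b = range (liss.xv A (shift_factor b))"
proof -
  interpret liss A "shift_factor b" using assms by unfold_locales (simp_all add: shift_factor_def)
  define T where "T \<theta> = mkt (\<lambda>k. exp (\<i> * \<theta> $ k))" for \<theta> :: "complex ^ 'd"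
  have tcT: "tc (T \<theta>) k = exp (\<i> * \<theta> $ k)" for \<theta> k unfolding T_def by (intro tc_mkt) simp
  have "\<exists>\<theta>. \<tau> = T \<theta>" for \<tau>
    by (rule exI[of _ "\<chi> k. - \<i> * Ln (tc \<tau> k)"], rule torus_eqI) (simp add: tcT)
  then have surj: "range T = UNIV" by (metis surjI)
  have "cos_vec (\<theta> v* map_matrix complex_of_int A - complex_of_real (pi / 2) *s b) = xv (T \<theta>)" for \<theta>
  proof -
    have "cos (y - pi / 2 * b $ j) = xf j (T \<theta>)" if y: "y = (\<Sum>k\<in>UNIV. \<theta> $ k * of_int (A $ k $ j))" for j y
    proof -
      have ch: "ch (column j A) (T \<theta>) = exp (\<i> * y)"
        by (simp add: ch_def tcT column_def y exp_power_int sum_distrib_left exp_sum mult_ac)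
      have "cos (y - pi / 2 * b $ j) = (exp (\<i> * (y - pi / 2 * b $ j)) + exp (- (\<i> * (y - pi / 2 * b $ j)))) / 2"
        by (rule cos_exp_eq)
      also have "exp (\<i> * (y - pi / 2 * b $ j)) = ch (column j A) (T \<theta>) / shift_factor b j"
        by (simp add: ch shift_factor_def exp_diff[symmetric] right_diff_distrib)
      also have "exp (- (\<i> * (y - pi / 2 * b $ j))) = shift_factor b j * ch (- column j A) (T \<theta>)"
        by (simp add: ch_minus ch shift_factor_def exp_minus[symmetric] exp_add[symmetric] algebra_simps)
      finally show ?thesis by (simp add: xf_def)
    qed
    then show ?thesis by (simp add: cos_vec_def xv_def vec_eq_iff vector_matrix_mult_def map_matrix_def)
  qed
  then have "lissajous (map_matrix rat_of_int A) b = range (\<lambda>\<theta>. xv (T \<theta>))"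
    unfolding lissajous_def shifted_row_space_def Row_eq by (simp only: setcompr_eq_image image_image Collect_mem_eq)
  also have "\<dots> = xv ` range T" by (simp add: image_image)
  finally show ?thesis by (simp add: surj)
qed

text \<open>The product is \<open>exp (\<i> * pi * s)\<close> with \<open>s\<close> the sum over the
  circuit, which is 1 exactly when \<open>s\<close> is an even integer.\<close>

lemma generic_shift_factor:
  assumes "generic_shift A b" "is_circuit A C" "circuit_vector A C m"
  shows "(\<Prod>j\<in>UNIV. shift_factor b j powi (2 * m $ j)) \<noteq> 1"
proof
  assume eq: "(\<Prod>j\<in>UNIV. shift_factor b j powi (2 * m $ j)) = 1"
  define s where "s = (\<Sum>j\<in>C. of_int (m $ j) * b $ j)"
  have C: "C = {j. m $ j \<noteq> 0}" using assms(3) by (simp add: circuit_vector_def int_relation_def)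
  have s: "s = (\<Sum>j\<in>UNIV. of_int (m $ j) * b $ j)"
    unfolding s_def by (intro sum.mono_neutral_left) (auto simp: C)
  have "shift_factor b j powi (2 * m $ j) = exp (\<i> * pi * (of_int (m $ j) * b $ j))" for j
    unfolding shift_factor_def exp_power_int by (intro arg_cong[of _ _ exp]) simp
  then have "exp (\<i> * pi * s) = 1" using eq by (simp add: s exp_sum sum_distrib_left)
  then obtain n :: int where n: "Re (\<i> * pi * s) = 0" "Im (\<i> * pi * s) = of_int (2 * n) * pi"
    unfolding exp_eq_1 by blast
  then have "s = of_int (2 * n)" by (simp add: complex_eq_iff)
  then show False using assms unfolding generic_shift_def s_def by (metis dvd_triv_left)
qed

theorem theorem1p4:
  fixes A :: "int ^ 'n ^ 'd"
  assumes "rank (map_matrix rat_of_int A) = CARD('d)"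
    and "group_closure (columns A) = UNIV"
  shows "(\<forall>b :: complex ^ 'n.
            irreducible_variety (lissajous (map_matrix rat_of_int A) b) \<and>
            variety_dim (lissajous (map_matrix rat_of_int A) b) = enat CARD('d)) \<and>
         (\<forall>b :: complex ^ 'n. generic_shift A b \<longrightarrow>
            (\<exists>k. has_degree (lissajous (map_matrix rat_of_int A) b) k \<and>
                 real k = 2 powi (- int (CL A)) * fact CARD('d) * measure lborel (P_polytope A)))"
  proof (intro conjI allI impI)
  fix b :: "complex ^ 'n"
  interpret liss A "shift_factor b" using assms(2) by unfold_locales (simp_all add: shift_factor_def)
  show "irreducible_variety (lissajous (map_matrix rat_of_int A) b)"
    unfolding lissajous_eq[OF assms(2)] using irreducible_image[of UNIV] by simp
  show "variety_dim (lissajous (map_matrix rat_of_int A) b) = enat CARD('d)"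
    unfolding lissajous_eq[OF assms(2)] by (rule variety_dim_range)
next
  fix b :: "complex ^ 'n" assume b: "generic_shift A b"
  interpret liss A "shift_factor b" using assms(2) by unfold_locales (simp_all add: shift_factor_def)
  have "\<exists>k. has_degree (range xv) k \<and> 2 ^ CL A * real k = fact CARD('d) * vol"
    by (rule degree_range) (rule generic_shift_factor[OF b])
  then obtain k where k: "has_degree (range xv) k" "2 ^ CL A * real k = fact CARD('d) * vol" by blast
  have "real k = 2 powi (- int (CL A)) * fact CARD('d) * measure lborel (P_polytope A)"
    using k(2) by (simp add: power_int_minus field_simps vol_def)
  with k(1) show "\<exists>k. has_degree (lissajous (map_matrix rat_of_int A) b) k \<and>
      real k = 2 powi (- int (CL A)) * fact CARD('d) * measure lborel (P_polytope A)"
    unfolding lissajous_eq[OF assms(2)] by blast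
qed

end
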